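(* Let $X$ be a tree and let $G$ be a countable group acting on $X$ by automorphisms. Assume that (a) either $G$ is not amenable (as a discrete group) and the stabilizer in $G$ of every vertex of $X$ is finite, or (b) $X$ is locally finite and the closure of the image of $G$ in $\mathrm{Aut}(X)$ is not amenable. Then there exists an uncountable family $(\pi_t)_t$ of irreducible unitary representations of $G$ with the following properties: each $\pi_t$ is infinite dimensional, each $\pi_t$ is traceable, and $\pi_t$ is not weakly equivalent to $\pi_{t'}$ whenever $t' \neq t$.
   Context: Unitary representations of $G$ are homomorphisms $\pi: G \to U(\mathcal H)$ into the unitary group of a complex separable Hilbert space $\mathcal H$. The maximal $C^*$-algebra $C^*(G)$ is the completion of the group algebra $\mathbf C[G]$ for the norm $f \mapsto \sup_\pi \|\pi(f)\|$, the supremum being over all unitary representations $\pi$ of $G$ on separable Hilbert spaces; every unitary representation $\pi$ of $G$ extends uniquely to a $*$-representation $\pi : C^*(G) \to \mathcal B(\mathcal H)$. An irreducible unitary representation $(\pi, \mathcal H)$ of $G$ is traceable if $\pi(C^*(G))$ (equivalently, the $C^*$-subalgebra of $\mathcal B(\mathcal H)$ generated by $\pi(G)$) contains the algebra of compact operators on $\mathcal H$. Two unitary representations $\pi, \rho$ of $G$ are weakly equivalent if $\|\pi(a)\| = \|\rho(a)\|$ for all $a \in C^*(G)$, that is, if their extensions to $C^*(G)$ have the same kernel. A graph is locally finite if every vertex has only finitely many neighbours. When $X$ is locally finite, $\mathrm{Aut}(X)$ denotes its group of automorphisms with the topology of pointwise convergence; it is a locally compact group in which the vertex stabilizers are compact.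 A topological group $\mathbf G$ is amenable if there exists a $\mathbf G$-invariant mean on the Banach space of left uniformly continuous bounded functions on $\mathbf G$. *)

theory Defs
  imports
    "HOL-Analysis.Analysis"
    "HOL-Algebra.Group_Action"
    "HOL-Algebra.Module"
    "HOL-Algebra.Algebraic_Closure_Type"
begin

section \<open>Trees and their automorphism groups\<close>

text \<open>A simple graph is a vertex set with a symmetric irreflexive adjacency relation; an undirected
  edge therefore occurs in both orientations, and cycles have at least three vertices.\<close>

definition simple_graph :: "'v set \<Rightarrow> ('v \<times> 'v) set \<Rightarrow> bool" where
  "simple_graph V E \<longleftrightarrow> E \<subseteq> V \<times> V \<and> sym E \<and> irrefl E"

definition graph_connected :: "'v set \<Rightarrow> ('v \<times> 'v) set \<Rightarrow> bool" where
  "graph_connected V E \<longleftrightarrow> V \<noteq> {} \<and> (\<forall>u\<in>V. \<forall>v\<in>V. (u, v) \<in> E\<^sup>*)"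

definition graph_cycle :: "('v \<times> 'v) set \<Rightarrow> 'v list \<Rightarrow> bool" where
  "graph_cycle E vs \<longleftrightarrow> 3 \<le> length vs \<and> distinct vs
     \<and> successively (\<lambda>u v. (u, v) \<in> E) vs \<and> (last vs, hd vs) \<in> E"

definition tree_graph :: "'v set \<Rightarrow> ('v \<times> 'v) set \<Rightarrow> bool" where
  "tree_graph V E \<longleftrightarrow> simple_graph V E \<and> graph_connected V E \<and> (\<nexists>vs. graph_cycle E vs)"

definition locally_finite_graph :: "'v set \<Rightarrow> ('v \<times> 'v) set \<Rightarrow> bool" where
  "locally_finite_graph V E \<longleftrightarrow> (\<forall>v\<in>V. finite {w. (v, w) \<in> E})"

definition graph_aut :: "'v set \<Rightarrow> ('v \<times> 'v) set \<Rightarrow> ('v \<Rightarrow> 'v) monoid" where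
  "graph_aut V E = BijGroup V
     \<lparr>carrier := {f \<in> Bij V. \<forall>u\<in>V. \<forall>v\<in>V. (f u, f v) \<in> E \<longleftrightarrow> (u, v) \<in> E}\<rparr>"

definition graph_aut_topology :: "'v set \<Rightarrow> ('v \<times> 'v) set \<Rightarrow> ('v \<Rightarrow> 'v) topology" where
  "graph_aut_topology V E =
     subtopology (product_topology (\<lambda>_. discrete_topology V) V) (carrier (graph_aut V E))"


section \<open>Amenability\<close>

text \<open>In the following two definitions \<open>T\<close> is a group topology on \<open>carrier G\<close>. Left uniform
  continuity means that left translation \<open>u \<mapsto> f(u \<cdot>)\<close> is norm continuous, which by translation
  is a condition at the identity only. If \<open>T\<close> is discrete, every bounded function qualifies.\<close>

definition left_unif_cont_bounded :: "('g, 'm) monoid_scheme \<Rightarrow> 'g topology \<Rightarrow> ('g \<Rightarrow> complex) set" where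
  "left_unif_cont_bounded G T = {f \<in> extensional (carrier G).
     bounded (f ` carrier G) \<and>
     (\<forall>\<epsilon>>0. \<exists>U. openin T U \<and> \<one>\<^bsub>G\<^esub> \<in> U \<and>
        (\<forall>u\<in>U. \<forall>x\<in>carrier G. cmod (f (u \<otimes>\<^bsub>G\<^esub> x) - f x) < \<epsilon>))}"

definition amenable :: "('g, 'm) monoid_scheme \<Rightarrow> 'g topology \<Rightarrow> bool" where
  "amenable G T \<longleftrightarrow> (\<exists>m :: ('g \<Rightarrow> complex) \<Rightarrow> complex.
     (\<forall>f\<in>left_unif_cont_bounded G T. \<forall>h\<in>left_unif_cont_bounded G T.
        m (\<lambda>x\<in>carrier G. f x + h x) = m f + m h) \<and>
     (\<forall>c. \<forall>f\<in>left_unif_cont_bounded G T. m (\<lambda>x\<in>carrier G. c * f x) = c * m f) \<and>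
     m (\<lambda>x\<in>carrier G. 1) = 1 \<and>
     (\<forall>f\<in>left_unif_cont_bounded G T. (\<forall>x\<in>carrier G. f x \<in> \<real>\<^sub>\<ge>\<^sub>0) \<longrightarrow> m f \<in> \<real>\<^sub>\<ge>\<^sub>0) \<and>
     (\<forall>g\<in>carrier G. \<forall>f\<in>left_unif_cont_bounded G T.
        m (\<lambda>x\<in>carrier G. f (g \<otimes>\<^bsub>G\<^esub> x)) = m f))"


section \<open>Complex Hilbert spaces and operators\<close>

abbreviation complex_ring :: "complex ring" where
  "complex_ring \<equiv> ring_of_type_algebra"

text \<open>The fields \<open>mult\<close> and \<open>one\<close> inherited from the ring record carry no meaning here, as usual for
  modules in HOL-Algebra.\<close>

record 'h inner_module = "(complex, 'h) module" +
  cinner :: "'h \<Rightarrow> 'h \<Rightarrow> complex"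

definition hnorm :: "('h, 'm) inner_module_scheme \<Rightarrow> 'h \<Rightarrow> real" where
  "hnorm H x = sqrt (Re (cinner H x x))"

definition hdist :: "('h, 'm) inner_module_scheme \<Rightarrow> 'h \<Rightarrow> 'h \<Rightarrow> real" where
  "hdist H x y = hnorm H (x \<ominus>\<^bsub>H\<^esub> y)"

definition htopology :: "('h, 'm) inner_module_scheme \<Rightarrow> 'h topology" where
  "htopology H = Metric_space.mtopology (carrier H) (hdist H)"

locale complex_hilbert = Module.module complex_ring H
  for H :: "('h, 'm) inner_module_scheme" (structure) +
  assumes cinner_add_left:
      "\<lbrakk>x \<in> carrier H; y \<in> carrier H; z \<in> carrier H\<rbrakk>
        \<Longrightarrow> cinner H (x \<oplus> y) z = cinner H x z + cinner H y z"
    and cinner_smult_left: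
      "\<lbrakk>x \<in> carrier H; y \<in> carrier H\<rbrakk> \<Longrightarrow> cinner H (c \<odot> x) y = c * cinner H x y"
    and cinner_commute:
      "\<lbrakk>x \<in> carrier H; y \<in> carrier H\<rbrakk> \<Longrightarrow> cinner H y x = cnj (cinner H x y)"
    and cinner_self_nonneg: "x \<in> carrier H \<Longrightarrow> cinner H x x \<in> \<real>\<^sub>\<ge>\<^sub>0"
    and cinner_self_eq_0: "\<lbrakk>x \<in> carrier H; cinner H x x = 0\<rbrakk> \<Longrightarrow> x = \<zero>"
    and complete: "Metric_space.mcomplete (carrier H) (hdist H)"

locale separable_hilbert = complex_hilbert +
  assumes separable: "separable_space (htopology H)"

definition finite_dimensional :: "('h, 'm) inner_module_scheme \<Rightarrow> bool" where
  "finite_dimensional H \<longleftrightarrow> (\<exists>B. finite B \<and> B \<subseteq> carrier H \<and>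
     (\<forall>x\<in>carrier H. \<exists>c. x = finsum H (\<lambda>b. c b \<odot>\<^bsub>H\<^esub> b) B))"

text \<open>Operators are extensional, so that equality of operators is equality on \<open>carrier H\<close>.\<close>

definition bounded_ops :: "('h, 'm) inner_module_scheme \<Rightarrow> ('h \<Rightarrow> 'h) set" where
  "bounded_ops H = {A \<in> carrier H \<rightarrow>\<^sub>E carrier H.
     (\<forall>x\<in>carrier H. \<forall>y\<in>carrier H. A (x \<oplus>\<^bsub>H\<^esub> y) = A x \<oplus>\<^bsub>H\<^esub> A y) \<and>
     (\<forall>c. \<forall>x\<in>carrier H. A (c \<odot>\<^bsub>H\<^esub> x) = c \<odot>\<^bsub>H\<^esub> A x) \<and>
     (\<exists>C. \<forall>x\<in>carrier H. hnorm H (A x) \<le> C * hnorm H x)}"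

definition opnorm :: "('h, 'm) inner_module_scheme \<Rightarrow> ('h \<Rightarrow> 'h) \<Rightarrow> real" where
  "opnorm H A = Sup {hnorm H (A x) | x. x \<in> carrier H \<and> hnorm H x \<le> 1}"

definition op_diff :: "('h, 'm) inner_module_scheme \<Rightarrow> ('h \<Rightarrow> 'h) \<Rightarrow> ('h \<Rightarrow> 'h) \<Rightarrow> 'h \<Rightarrow> 'h" where
  "op_diff H A B = (\<lambda>x\<in>carrier H. A x \<ominus>\<^bsub>H\<^esub> B x)"

definition compact_ops :: "('h, 'm) inner_module_scheme \<Rightarrow> ('h \<Rightarrow> 'h) set" where
  "compact_ops H = {A \<in> bounded_ops H.
     compactin (htopology H) (htopology H closure_of (A ` {x \<in> carrier H. hnorm H x \<le> 1}))}"

definition unitary_group :: "('h, 'm) inner_module_scheme \<Rightarrow> ('h \<Rightarrow> 'h) monoid" where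
  "unitary_group H = BijGroup (carrier H)
     \<lparr>carrier := {U \<in> bounded_ops H. bij_betw U (carrier H) (carrier H) \<and>
        (\<forall>x\<in>carrier H. \<forall>y\<in>carrier H. cinner H (U x) (U y) = cinner H x y)}\<rparr>"


section \<open>Unitary representations and the maximal group C*-algebra\<close>

definition unitary_rep ::
  "('g, 'n) monoid_scheme \<Rightarrow> ('h, 'm) inner_module_scheme \<Rightarrow> ('g \<Rightarrow> 'h \<Rightarrow> 'h) \<Rightarrow> bool" where
  "unitary_rep G H \<pi> \<longleftrightarrow> separable_hilbert H \<and> \<pi> \<in> hom G (unitary_group H)"

definition irreducible_rep ::
  "('g, 'n) monoid_scheme \<Rightarrow> ('h, 'm) inner_module_scheme \<Rightarrow> ('g \<Rightarrow> 'h \<Rightarrow> 'h) \<Rightarrow> bool" where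
  "irreducible_rep G H \<pi> \<longleftrightarrow> unitary_rep G H \<pi> \<and> carrier H \<noteq> {\<zero>\<^bsub>H\<^esub>} \<and>
     (\<forall>W. submodule W complex_ring H \<and> closedin (htopology H) W \<and> (\<forall>g\<in>carrier G. \<pi> g ` W \<subseteq> W)
        \<longrightarrow> W = {\<zero>\<^bsub>H\<^esub>} \<or> W = carrier H)"

definition group_algebra :: "('g, 'n) monoid_scheme \<Rightarrow> ('g \<Rightarrow> complex) set" where
  "group_algebra G = {f. finite {g. f g \<noteq> 0} \<and> {g. f g \<noteq> 0} \<subseteq> carrier G}"

definition group_algebra_rep ::
  "('h, 'm) inner_module_scheme \<Rightarrow> ('g \<Rightarrow> 'h \<Rightarrow> 'h) \<Rightarrow> ('g \<Rightarrow> complex) \<Rightarrow> 'h \<Rightarrow> 'h" where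
  "group_algebra_rep H \<pi> f =
     (\<lambda>x\<in>carrier H. finsum H (\<lambda>g. f g \<odot>\<^bsub>H\<^esub> \<pi> g x) {g. f g \<noteq> 0})"

text \<open>A separable Hilbert space has at most the cardinality of the continuum, so up to unitary
  equivalence all of them have their carrier inside the type \<open>nat \<Rightarrow> complex\<close>.\<close>

type_synonym hilbert_univ = "(nat \<Rightarrow> complex) inner_module"

definition cstar_norm :: "('g, 'n) monoid_scheme \<Rightarrow> ('g \<Rightarrow> complex) \<Rightarrow> real" where
  "cstar_norm G f =
     Sup {opnorm H (group_algebra_rep H \<pi> f) | (H :: hilbert_univ) \<pi>. unitary_rep G H \<pi>}"

text \<open>The completion of the group algebra, as Cauchy sequences modulo null sequences.\<close>

definition cstar_cauchy :: "('g, 'n) monoid_scheme \<Rightarrow> (nat \<Rightarrow> 'g \<Rightarrow> complex) set" where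
  "cstar_cauchy G = {F. (\<forall>n. F n \<in> group_algebra G) \<and>
     (\<forall>\<epsilon>>0. \<exists>N. \<forall>m\<ge>N. \<forall>n\<ge>N. cstar_norm G (F m - F n) < \<epsilon>)}"

definition cstar_rel ::
  "('g, 'n) monoid_scheme \<Rightarrow> ((nat \<Rightarrow> 'g \<Rightarrow> complex) \<times> (nat \<Rightarrow> 'g \<Rightarrow> complex)) set" where
  "cstar_rel G = {(F, F'). F \<in> cstar_cauchy G \<and> F' \<in> cstar_cauchy G \<and>
     (\<lambda>n. cstar_norm G (F n - F' n)) \<longlonglongrightarrow> 0}"

definition max_cstar_algebra :: "('g, 'n) monoid_scheme \<Rightarrow> (nat \<Rightarrow> 'g \<Rightarrow> complex) set set" where
  "max_cstar_algebra G = cstar_cauchy G // cstar_rel G"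

text \<open>The extension of a unitary representation to the completion, by continuity.\<close>

definition cstar_rep ::
  "('h, 'm) inner_module_scheme \<Rightarrow> ('g \<Rightarrow> 'h \<Rightarrow> 'h) \<Rightarrow> (nat \<Rightarrow> 'g \<Rightarrow> complex) set \<Rightarrow> 'h \<Rightarrow> 'h" where
  "cstar_rep H \<pi> a = (THE A. A \<in> bounded_ops H \<and>
     (\<forall>F\<in>a. (\<lambda>n. opnorm H (op_diff H (group_algebra_rep H \<pi> (F n)) A)) \<longlonglongrightarrow> 0))"

definition traceable_rep ::
  "('g, 'n) monoid_scheme \<Rightarrow> ('h, 'm) inner_module_scheme \<Rightarrow> ('g \<Rightarrow> 'h \<Rightarrow> 'h) \<Rightarrow> bool" where
  "traceable_rep G H \<pi> \<longleftrightarrow> irreducible_rep G H \<pi> \<and>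
     compact_ops H \<subseteq> cstar_rep H \<pi> ` max_cstar_algebra G"

definition weakly_equivalent ::
  "('g, 'n) monoid_scheme \<Rightarrow> ('h, 'm) inner_module_scheme \<Rightarrow> ('g \<Rightarrow> 'h \<Rightarrow> 'h)
     \<Rightarrow> ('k, 'l) inner_module_scheme \<Rightarrow> ('g \<Rightarrow> 'k \<Rightarrow> 'k) \<Rightarrow> bool" where
  "weakly_equivalent G H \<pi> K \<rho> \<longleftrightarrow>
     (\<forall>a\<in>max_cstar_algebra G. opnorm H (cstar_rep H \<pi> a) = opnorm K (cstar_rep K \<rho> a))"

end

theory Submission
  imports Defs
begin

text \<open>
  The representations are found inside deformations of the permutation representation of \<open>G\<close> on the
  vertices of the tree. On a tree the kernel \<open>q\<^bsup>d(x,y)\<^esup>\<close> is positive definite for \<open>0 \<le> q < 1\<close>, so there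
  are vectors \<open>e\<^sub>x\<close> with \<open>\<langle>e\<^sub>x, e\<^sub>y\<rangle> = q\<^bsup>d(x,y)\<^esup>\<close> and a unitary representation \<open>\<rho>\<^sub>q\<close> with
  \<open>\<rho>\<^sub>q(g) e\<^sub>x = e\<^bsub>gx\<^esub>\<close>. On a countable invariant subtree all of them are realized on the same space
  \<open>\<ell>\<^sup>2(V)\<close>, with \<open>\<rho>\<^sub>0\<close> the permutation representation (\<open>tree_rep\<close>). An element \<open>g\<close> moves the parent
  relation of the rooted tree only at finitely many vertices; therefore \<open>\<rho>\<^sub>q(g) - \<rho>\<^sub>0(g)\<close> has finite
  rank and is norm continuous in \<open>q\<close>.

  Let \<open>T\<^sub>q\<close> be the operator of a lazy symmetric random walk on \<open>G\<close> in \<open>\<rho>\<^sub>q\<close>, and \<open>top q\<close> the top of its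
  spectrum. Non-amenability enters only through \<open>top 0 < 1\<close>: otherwise there are almost invariant
  vectors in \<open>\<ell>\<^sup>2(V)\<close>, hence an invariant mean on \<open>V\<close> (\<open>invariant_mean\<close>), which integrated over the
  finite or compact vertex stabilizers becomes an invariant mean on \<open>G\<close> or on the closure of its image
  (\<open>group_mean\<close>, \<open>amenable_closure\<close>). As \<open>q\<close> tends to \<open>1\<close> the vector \<open>e\<^sub>x\<close> becomes almost invariant and
  \<open>top q\<close> tends to \<open>1\<close>. By continuity every \<open>t < 1\<close> near \<open>1\<close> is some \<open>top q\<close> (\<open>top_attains\<close>).

  As \<open>T\<^sub>q\<close> is a finite-rank perturbation of \<open>T\<^sub>0\<close>, whose spectrum lies below \<open>t\<close>, this \<open>t\<close> is an isolated
  eigenvalue of finite multiplicity, and its eigenprojection is the norm limit of the powers of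
  \<open>T\<^sub>q / t\<close> (\<open>top_eigenprojection\<close>). Below it there is a minimal projection in the norm closure of
  \<open>\<rho>\<^sub>q(\<complex>[G])\<close>. On the cyclic subspace of a vector in its range it acts as the projection onto a line,
  so this subspace is irreducible and the closure acts on it by an algebra that contains all operators
  of rank one, hence all compact ones (\<open>traceable_subrepresentation\<close>). That the limits are images of
  elements of \<open>C\<^sup>*(G)\<close> is the closedness of the image of the maximal C*-algebra, which rests on
  \<open>lift_with_norm_control\<close>.

  The walk has norm \<open>t\<close> in the representation so obtained, and \<open>t\<close> is thus an invariant of its weak
  equivalence class. The representation is infinite dimensional: since \<open>t < 1\<close> the orbits of \<open>G\<close> are
  unbounded, and the coefficients of \<open>\<rho>\<^sub>q\<close> tend to zero along a suitable sequence
  (\<open>mixing_sequence\<close>), which no finite-dimensional unitary representation allows.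
\<close>

section \<open>Inner product calculus\<close>

lemma complex_ring_simps [simp]:
 "carrier complex_ring = UNIV" "x \<oplus>\<^bsub>complex_ring\<^esub> y = x + y" "x \<otimes>\<^bsub>complex_ring\<^esub> y = x * y"
 "\<zero>\<^bsub>complex_ring\<^esub> = 0" "\<one>\<^bsub>complex_ring\<^esub> = 1"
 by (simp_all add: ring_of_type_algebra_def)

context complex_hilbert
begin

abbreviation ip :: "'h => 'h => complex" where "ip x y \<equiv> cinner H x y"
abbreviation space :: "'h set" ("\<H>") where "\<H> \<equiv> carrier H"
abbreviation nm :: "'h => real" where "nm x \<equiv> hnorm H x"

lemma scale_closed [simp, intro]: "x \<in> \<H> ==> c \<odot> x \<in> \<H>"
 using smult_closed by simp

lemma scale_one [simp]: "x \<in> \<H> ==> 1 \<odot> x = x"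
 using smult_one by simp

lemma ip_smult_right [simp]:
 "[|x \<in> \<H>; y \<in> \<H>|] ==> ip x (c \<odot> y) = cnj c * ip x y"
 by (metis cinner_commute cinner_smult_left complex_cnj_mult scale_closed)

lemma ip_add_right [simp]:
 "[|x \<in> \<H>; y \<in> \<H>; z \<in> \<H>|] ==> ip x (y \<oplus> z) = ip x y + ip x z"
 by (metis cinner_commute cinner_add_left complex_cnj_add M.a_closed)

declare cinner_add_left [simp] cinner_smult_left [simp]

lemma ip_zero_left [simp]: "y \<in> \<H> ==> ip \<zero> y = 0"
 using cinner_add_left[of \<zero> \<zero> y] by simp

lemma ip_zero_right [simp]: "y \<in> \<H> ==> ip y \<zero> = 0"
 using ip_add_right[of y \<zero> \<zero>] by simp

lemma ip_uminus_left [simp]: "[|x \<in> \<H>; y \<in> \<H>|] ==> ip (\<ominus> x) y = - ip x y"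
 using cinner_add_left[of x "\<ominus> x" y] by (simp add: M.r_neg add_eq_0_iff)

lemma ip_uminus_right [simp]: "[|x \<in> \<H>; y \<in> \<H>|] ==> ip x (\<ominus> y) = - ip x y"
 using ip_add_right[of x y "\<ominus> y"] by (simp add: M.r_neg add_eq_0_iff)

lemma diff_closed [simp, intro]: "[|x \<in> \<H>; y \<in> \<H>|] ==> x \<ominus> y \<in> \<H>"
 by (simp add: M.minus_closed)

lemma ip_diff_left [simp]:
 "[|x \<in> \<H>; y \<in> \<H>; z \<in> \<H>|] ==> ip (x \<ominus> y) z = ip x z - ip y z"
 by (simp add: a_minus_def)

lemma ip_diff_right [simp]:
 "[|x \<in> \<H>; y \<in> \<H>; z \<in> \<H>|] ==> ip x (y \<ominus> z) = ip x y - ip x z"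
 by (simp add: a_minus_def)

lemma hsum_closed [simp, intro]:
 "(!!i. i \<in> I ==> f i \<in> \<H>) ==> finsum H f I \<in> \<H>"
 by (rule M.finsum_closed) auto

lemma ip_sum_left:
 assumes "finite I" "!!i. i \<in> I ==> f i \<in> \<H>" "y \<in> \<H>"
 shows "ip (finsum H f I) y = (\<Sum>i\<in>I. ip (f i) y)"
 using assms by (induction I) (auto simp: M.finsum_insert Pi_def)

lemma ip_sum_right:
 assumes "finite I" "!!i. i \<in> I ==> f i \<in> \<H>" "y \<in> \<H>"
 shows "ip y (finsum H f I) = (\<Sum>i\<in>I. ip y (f i))"
 using assms by (induction I) (auto simp: M.finsum_insert Pi_def)

text \<open>Vector identities reduce to identities between complex numbers, where algebraic
 simplification is available: this replaces calculation in the module.\<close>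

lemma vec_eqI:
 assumes "x \<in> \<H>" "y \<in> \<H>" "!!z. z \<in> \<H> ==> ip x z = ip y z"
 shows "x = y"
proof -
 have "ip (x \<ominus> y) (x \<ominus> y) = 0" using assms by simp
 hence "x \<ominus> y = \<zero>" using assms cinner_self_eq_0 by blast
 thus ?thesis using assms(1,2) by (metis M.add.inv_solve_right M.l_zero a_minus_def M.zero_closed)
qed

lemma ip_self: assumes "x \<in> \<H>" shows "ip x x = of_real ((nm x)\<^sup>2)"
proof -
 have "ip x x \<in> \<real>\<^sub>\<ge>\<^sub>0" by (rule cinner_self_nonneg[OF assms])
 then obtain r where "r \<ge> 0" "ip x x = of_real r" by (auto elim: nonneg_Reals_cases)
 thus ?thesis by (simp add: hnorm_def)
qed

lemma nm_ge0 [simp]: "x \<in> \<H> ==> 0 <= nm x"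
 using cinner_self_nonneg[of x] unfolding hnorm_def by (auto simp: complex_nonneg_Reals_iff)

lemma nm_sq: "x \<in> \<H> ==> (nm x)\<^sup>2 = Re (ip x x)"
 by (simp add: ip_self)

lemma nm_eq0 [simp]: "x \<in> \<H> ==> nm x = 0 \<longleftrightarrow> x = \<zero>"
 using ip_self[of x] cinner_self_eq_0[of x] by (auto simp: hnorm_def)

lemma nm_zero [simp]: "nm \<zero> = 0" by simp

lemma nm_leI: assumes "x \<in> \<H>" "Re (ip x x) <= c\<^sup>2" "0 <= c" shows "nm x <= c"
 using assms nm_sq[of x] by (metis power2_le_imp_le)

lemma nm_scale [simp]: assumes "x \<in> \<H>" shows "nm (c \<odot> x) = cmod c * nm x"
proof -
 have "ip (c \<odot> x) (c \<odot> x) = of_real ((cmod c)\<^sup>2) * ip x x"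
  using assms by (simp only: cinner_smult_left ip_smult_right scale_closed complex_norm_square mult_ac)
 hence "(nm (c \<odot> x))\<^sup>2 = Re (of_real ((cmod c)\<^sup>2) * ip x x)"
  using assms nm_sq[of "c \<odot> x"] by (simp only: scale_closed)
 also have "\<dots> = (cmod c)\<^sup>2 * Re (ip x x)" by simp
 finally have "(nm (c \<odot> x))\<^sup>2 = (cmod c * nm x)\<^sup>2"
  using assms by (simp only: nm_sq power_mult_distrib)
 thus ?thesis using assms
  by (metis mult_nonneg_nonneg nm_ge0 norm_ge_zero power2_eq_imp_eq scale_closed)
qed

lemma nm_uminus [simp]: "x \<in> \<H> ==> nm (\<ominus> x) = nm x"
 by (simp add: hnorm_def)

lemma nm_minus_commute: "[|x \<in> \<H>; y \<in> \<H>|] ==> nm (x \<ominus> y) = nm (y \<ominus> x)"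
 by (simp add: hnorm_def)

lemma cauchy_schwarz:
 assumes x: "x \<in> \<H>" and y: "y \<in> \<H>"
 shows "cmod (ip x y) <= nm x * nm y"
proof (cases "y = \<zero>")
 case True thus ?thesis using x by simp
next
 case False
 have ny: "nm y > 0" using False y nm_ge0[of y] nm_eq0[of y] by linarith
 define c where "c = ip x y / of_real ((nm y)\<^sup>2)"
 define z where "z = x \<ominus> c \<odot> y"
 have zc: "z \<in> \<H>" using x y by (simp add: z_def)
 have "ip z y = 0" using x y ny by (simp add: z_def c_def ip_self)
 hence yz: "ip y z = 0" using cinner_commute[OF zc y] by simp
 have zx: "ip z z = ip x x - c * ip y x" 
 proof -
  have "ip z z = ip x z - c * ip y z" using x y zc unfolding z_def[symmetric] 
   by (metis z_def cinner_smult_left ip_diff_left scale_closed)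
  also have "ip x z = ip x x - cnj c * ip x y" using x y by (simp add: z_def)
  finally have "ip z z = ip x x - cnj c * ip x y" using yz by simp
  moreover have "cnj c * ip x y = c * ip y x"
   using cinner_commute[OF x y] by (simp add: c_def)
  ultimately show ?thesis by simp
 qed
 have "c * ip y x = of_real ((cmod (ip x y))\<^sup>2 / (nm y)\<^sup>2)"
  using cinner_commute[OF x y] complex_norm_square[of "ip x y"] by (simp add: c_def)
 hence "(nm z)\<^sup>2 = (nm x)\<^sup>2 - (cmod (ip x y))\<^sup>2 / (nm y)\<^sup>2"
  using zx x zc by (simp add: nm_sq)
 hence "(cmod (ip x y))\<^sup>2 / (nm y)\<^sup>2 <= (nm x)\<^sup>2" by (smt (verit) zero_le_power2)
 hence "(cmod (ip x y))\<^sup>2 <= (nm x * nm y)\<^sup>2" using ny by (simp add: field_simps power_mult_distrib)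
 thus ?thesis using x y by (meson mult_nonneg_nonneg nm_ge0 power2_le_imp_le)
qed

lemma nm_add_sq:
 assumes x: "x \<in> \<H>" and y: "y \<in> \<H>"
 shows "(nm (x \<oplus> y))\<^sup>2 = (nm x)\<^sup>2 + 2 * Re (ip x y) + (nm y)\<^sup>2"
proof -
 have "Re (ip y x) = Re (ip x y)" using cinner_commute[OF x y] by simp
 thus ?thesis using x y by (simp add: nm_sq)
qed

lemma nm_diff_sq:
 assumes x: "x \<in> \<H>" and y: "y \<in> \<H>"
 shows "(nm (x \<ominus> y))\<^sup>2 = (nm x)\<^sup>2 - 2 * Re (ip x y) + (nm y)\<^sup>2"
proof -
 have "Re (ip y x) = Re (ip x y)" using cinner_commute[OF x y] by simp
 thus ?thesis using x y by (simp add: nm_sq)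
qed

lemma nm_triangle:
 assumes x: "x \<in> \<H>" and y: "y \<in> \<H>"
 shows "nm (x \<oplus> y) <= nm x + nm y"
proof (rule nm_leI)
 have "Re (ip x y) <= nm x * nm y" "Re (ip y x) <= nm x * nm y"
  using cauchy_schwarz[OF x y] cauchy_schwarz[OF y x] complex_Re_le_cmod[of "ip x y"] complex_Re_le_cmod[of "ip y x"]
  by (auto simp: mult.commute)
 thus "Re (ip (x \<oplus> y) (x \<oplus> y)) <= (nm x + nm y)\<^sup>2"
  using x y nm_sq[OF x] nm_sq[OF y] by (simp add: power2_sum)
qed (use x y in auto)

lemma nm_triangle_diff:
 assumes x: "x \<in> \<H>" and y: "y \<in> \<H>" and z: "z \<in> \<H>"
 shows "nm (x \<ominus> z) <= nm (x \<ominus> y) + nm (y \<ominus> z)"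
proof -
 have "x \<ominus> z = (x \<ominus> y) \<oplus> (y \<ominus> z)" by (rule vec_eqI) (use assms in auto)
 thus ?thesis using nm_triangle[of "x \<ominus> y" "y \<ominus> z"] assms by simp
qed

lemma nm_diff_le: "[|x \<in> \<H>; y \<in> \<H>|] ==> nm (x \<ominus> y) <= nm x + nm y"
 using nm_triangle[of x "\<ominus> y"] by (simp add: a_minus_def)

lemma nm_le_diff:
 assumes "x \<in> \<H>" "y \<in> \<H>" shows "nm x <= nm y + nm (x \<ominus> y)"
proof -
 have "x = y \<oplus> (x \<ominus> y)" by (rule vec_eqI) (use assms in auto)
 thus ?thesis using nm_triangle[of y "x \<ominus> y"] assms by simp
qed

lemma nm_sum_le:
 assumes "finite I" "!!i. i \<in> I ==> f i \<in> \<H>"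
 shows "nm (finsum H f I) <= (\<Sum>i\<in>I. nm (f i))"
 using assms
proof (induction I)
 case (insert i I)
 have "nm (finsum H f (insert i I)) <= nm (f i) + nm (finsum H f I)"
  using insert nm_triangle[of "f i" "finsum H f I"] by (auto simp: M.finsum_insert Pi_def)
 thus ?case using insert by force
qed auto

end

text \<open>The library's metric notions presuppose a distance that is symmetric and nonnegative on the
 whole type, also off the carrier; this is what the additional assumption records.\<close>

locale hspace = complex_hilbert H for H :: "('h, 'm) inner_module_scheme" (structure) +
 assumes metric: "Metric_space (carrier H) (hdist H)"

sublocale hspace \<subseteq> MS: Metric_space "carrier H" "hdist H"
 by (rule metric)

context hspace
begin

lemma hdist_nm: "hdist H x y = nm (x \<ominus> y)" by (simp add: hdist_def)

definition tends :: "(nat => 'h) => 'h => bool" where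
 "tends x l \<longleftrightarrow> (\<forall>n. x n \<in> \<H>) \<and> l \<in> \<H> \<and> (\<lambda>n. nm (x n \<ominus> l)) \<longlonglongrightarrow> 0"

lemma tendsD: "tends x l ==> l \<in> \<H>" "tends x l ==> x n \<in> \<H>"
 "tends x l ==> (\<lambda>n. nm (x n \<ominus> l)) \<longlonglongrightarrow> 0"
 by (auto simp: tends_def)

lemma limitin_iff_tends:
 assumes "!!n. x n \<in> \<H>"
 shows "limitin MS.mtopology x l sequentially \<longleftrightarrow> tends x l"
proof -
 have "(\<forall>\<epsilon>>0. \<exists>N. \<forall>n\<ge>N. hdist H (x n) l < \<epsilon>) \<longleftrightarrow> (\<lambda>n. nm (x n \<ominus> l)) \<longlonglongrightarrow> 0" if "l \<in> \<H>"
  using that assms by (simp add: LIMSEQ_iff hdist_nm)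
 thus ?thesis using assms unfolding MS.limit_metric_sequentially tends_def by auto
qed

lemma hcomplete:
 assumes "!!n. x n \<in> \<H>" "!!\<epsilon>. \<epsilon> > 0 ==> \<exists>N. \<forall>m\<ge>N. \<forall>n\<ge>N. nm (x m \<ominus> x n) < \<epsilon>"
 shows "\<exists>l. tends x l"
proof -
 have "MS.MCauchy x" using assms unfolding MS.MCauchy_def by (auto simp: hdist_nm)
 then obtain l where "limitin MS.mtopology x l sequentially"
  using complete unfolding MS.mcomplete_def by blast
 thus ?thesis using limitin_iff_tends assms(1) by blast
qed

lemma closedin_seq:
 "closedin (htopology H) W \<longleftrightarrow> W \<subseteq> \<H> \<and> (\<forall>x l. (\<forall>n. x n \<in> W) \<and> tends x l --> l \<in> W)"
proof -
 have "closedin MS.mtopology W \<longleftrightarrow> W \<subseteq> \<H> \<and>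
   (\<forall>x l. (\<forall>n. x n \<in> W) \<and> limitin MS.mtopology x l sequentially --> l \<in> W)"
  unfolding MS.metric_closedin_iff_sequentially_closed by (auto simp: image_subset_iff)
 also have "\<dots> \<longleftrightarrow> W \<subseteq> \<H> \<and> (\<forall>x l. (\<forall>n. x n \<in> W) \<and> tends x l --> l \<in> W)"
  using limitin_iff_tends by blast
 finally show ?thesis by (simp add: htopology_def)
qed

definition csub :: "'h set => bool" where
 "csub W \<longleftrightarrow> submodule W complex_ring H \<and> closedin (htopology H) W"

lemma csubI:
 assumes "W \<subseteq> \<H>" "\<zero> \<in> W" "!!x y. x \<in> W ==> y \<in> W ==> x \<oplus> y \<in> W"
  "!!c x. x \<in> W ==> c \<odot> x \<in> W" "!!x l. (!!n. x n \<in> W) ==> tends x l ==> l \<in> W"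
 shows "csub W"
proof -
 have m: "\<ominus> x = (-1) \<odot> x" if "x \<in> \<H>" for x
  by (rule vec_eqI) (use that in auto)
 have "submodule W complex_ring H"
  by (rule submoduleI) (use assms m in auto)
 moreover have "closedin (htopology H) W" unfolding closedin_seq using assms(1,5) by blast
 ultimately show ?thesis unfolding csub_def by simp
qed

lemma csubD:
 assumes "csub W"
 shows "W \<subseteq> \<H>" "\<zero> \<in> W" "!!x y. x \<in> W ==> y \<in> W ==> x \<oplus> y \<in> W"
  "!!c x. x \<in> W ==> c \<odot> x \<in> W" "!!x l. (!!n. x n \<in> W) ==> tends x l ==> l \<in> W"
  "!!x y. x \<in> W ==> y \<in> W ==> x \<ominus> y \<in> W"
proof -
 have s: "submodule W complex_ring H" and c: "closedin (htopology H) W"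
  using assms by (auto simp: csub_def)
 note e = submoduleE[OF s]
 show "W \<subseteq> \<H>" by (rule e(1))
 show "!!x y. x \<in> W ==> y \<in> W ==> x \<oplus> y \<in> W" using e(5) by simp
 show cs: "!!c x. x \<in> W ==> c \<odot> x \<in> W" using e(4) by simp
 obtain x where "x \<in> W" using e(2) by auto
 thus "\<zero> \<in> W" using cs[of x 0] e(1) smult_l_null by auto
 show "!!x y. x \<in> W ==> y \<in> W ==> x \<ominus> y \<in> W" using e(5) e(3) by (simp add: a_minus_def)
 show "!!x l. (!!n. x n \<in> W) ==> tends x l ==> l \<in> W" using c unfolding closedin_seq by blast
qed

lemma csub_mem: "csub W ==> x \<in> W ==> x \<in> \<H>" using csubD(1) by blast

lemma csub_sum: assumes "csub W" "finite I" "!!i. i \<in> I ==> f i \<in> W" shows "finsum H f I \<in> W"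
 using assms(2,3)
proof (induction I)
 case empty thus ?case using csubD(2)[OF assms(1)] by simp
next
 case (insert i I)
 have "f \<in> insert i I \<rightarrow> \<H>" using insert.prems csub_mem[OF assms(1)] by auto
 thus ?case using insert csubD(3)[OF assms(1)] by (auto simp: M.finsum_insert)
qed

lemma csub_carrier: "csub (\<H>)" by (rule csubI) (auto dest: tendsD)

lemma csub_Int: assumes V: "csub V" and W: "csub W" shows "csub (V \<inter> W)"
proof (rule csubI)
 fix x l assume "!!n. x n \<in> V \<inter> W" "tends x l"
 thus "l \<in> V \<inter> W" using csubD(5)[OF V, of x l] csubD(5)[OF W, of x l] by simp
qed (use csubD(1-4)[OF V] csubD(1-4)[OF W] in \<open>simp_all add: le_infI1\<close>)

subsection \<open>Limits\<close>

lemma tends_ip: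
 assumes "tends x l" "y \<in> \<H>" shows "(\<lambda>n. ip (x n) y) \<longlonglongrightarrow> ip l y"
proof -
 have "(\<lambda>n. ip (x n) y - ip l y) \<longlonglongrightarrow> 0"
 proof (rule Lim_null_comparison)
  show "\<forall>\<^sub>F n in sequentially. norm (ip (x n) y - ip l y) <= nm (x n \<ominus> l) * nm y"
   using cauchy_schwarz[of "x _ \<ominus> l" y] tendsD[OF assms(1)] assms(2) by (intro always_eventually) simp
  show "(\<lambda>n. nm (x n \<ominus> l) * nm y) \<longlonglongrightarrow> 0" using tendsD(3)[OF assms(1)] by (rule tendsto_mult_left_zero)
 qed
 thus ?thesis by (simp add: LIM_zero_iff)
qed

lemma tends_nm: assumes "tends x l" shows "(\<lambda>n. nm (x n)) \<longlonglongrightarrow> nm l"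
proof -
 have "(\<lambda>n. nm (x n) - nm l) \<longlonglongrightarrow> 0"
 proof (rule Lim_null_comparison)
  have "\<bar>nm (x n) - nm l\<bar> <= nm (x n \<ominus> l)" for n
   using nm_le_diff[of "x n" l] nm_le_diff[of l "x n"] nm_minus_commute[of l "x n"] tendsD[OF assms] by auto
  thus "\<forall>\<^sub>F n in sequentially. norm (nm (x n) - nm l) <= nm (x n \<ominus> l)" by simp
 qed (rule tendsD(3)[OF assms])
 thus ?thesis by (simp add: LIM_zero_iff)
qed

lemma tends_unique: assumes "tends x l" "tends x m" shows "l = m"
proof (rule vec_eqI)
 fix z assume "z \<in> \<H>"
 thus "ip l z = ip m z" using tends_ip[OF assms(1)] tends_ip[OF assms(2)] LIMSEQ_unique by blast
qed (use assms tendsD in auto)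

lemma tends_lip:
 assumes "tends x l" "!!u. u \<in> \<H> ==> A u \<in> \<H>"
  "!!u v. [|u \<in> \<H>; v \<in> \<H>|] ==> nm (A u \<ominus> A v) <= C * nm (u \<ominus> v)"
 shows "tends (\<lambda>n. A (x n)) (A l)"
 unfolding tends_def
proof (intro conjI allI)
 show "(\<lambda>n. nm (A (x n) \<ominus> A l)) \<longlonglongrightarrow> 0"
 proof (rule Lim_null_comparison)
  show "\<forall>\<^sub>F n in sequentially. norm (nm (A (x n) \<ominus> A l)) <= C * nm (x n \<ominus> l)"
   using assms(2) assms(3)[OF tendsD(2,1)[OF assms(1)]] tendsD(1,2)[OF assms(1)]
   by (intro always_eventually allI) simp
  show "(\<lambda>n. C * nm (x n \<ominus> l)) \<longlonglongrightarrow> 0" using tendsD(3)[OF assms(1)] tendsto_mult_right_zero by blast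
 qed
qed (use assms tendsD[OF assms(1)] in auto)

subsection \<open>The Riesz representation theorem on closed subspaces\<close>

text \<open>The representing vector minimizes \<open>\<parallel>x\<parallel>\<^sup>2 - 2 Re f(x)\<close>; a minimizing sequence is Cauchy by the
 parallelogram law. Taking \<open>f = \<langle>\<cdot>, v\<rangle>\<close> gives the orthogonal projection of \<open>v\<close>.\<close>

lemma quad_zero:
 fixes a b :: real assumes "!!t. 0 <= 2 * t * a + t\<^sup>2 * b" "b \<ge> 0" shows "a = 0"
proof (rule ccontr)
 assume "a ~= 0"
 define s where "s = b + 1"
 have s: "s > 0" "b = s - 1" using assms(2) by (auto simp: s_def)
 have "2 * (- a / s) * a + (- a / s)\<^sup>2 * b = - (a\<^sup>2 * (s + 1) / s\<^sup>2)"
  using s(1) unfolding s(2) by (simp add: field_simps power2_eq_square)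
 moreover have "a\<^sup>2 * (s + 1) / s\<^sup>2 > 0" using \<open>a ~= 0\<close> s(1) by simp
 ultimately show False using assms(1)[of "- a / s"] by linarith
qed

lemma riesz:
 assumes W: "csub W"
  and add: "!!x y. [|x \<in> W; y \<in> W|] ==> f (x \<oplus> y) = f x + f y"
  and sc: "!!c x. x \<in> W ==> f (c \<odot> x) = c * f x"
  and bd: "!!x. x \<in> W ==> cmod (f x) <= C * nm x"
 shows "\<exists>w\<in>W. \<forall>x\<in>W. f x = ip x w"
proof -
 note D = csubD[OF W]
 have WH[simp]: "x \<in> W ==> x \<in> \<H>" for x using D(1) by auto
 define J where "J x = (nm x)\<^sup>2 - 2 * Re (f x)" for x
 have low: "J x \<ge> - (C\<^sup>2)" if "x \<in> W" for x
 proof -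
  have "Re (f x) <= C * nm x" using bd[OF that] complex_Re_le_cmod[of "f x"] by linarith
  moreover have "0 <= (nm x - C)\<^sup>2" by simp
  ultimately show ?thesis unfolding J_def by (simp add: power2_diff algebra_simps)
 qed
 define m where "m = Inf (J ` W)"
 have bb: "bdd_below (J ` W)" using low by (rule bdd_belowI2)
 have ne: "J ` W ~= {}" using D(2) by auto
 have mle: "m <= J x" if "x \<in> W" for x unfolding m_def using that bb by (simp add: cInf_lower)
 have "\<exists>x\<in>W. J x < m + 1 / (real n + 1)" for n
 proof -
  have "Inf (J ` W) < m + 1 / (real n + 1)" unfolding m_def by (simp add: add_pos_nonneg)
  thus ?thesis using cInf_lessD[OF ne] by blast
 qed
 then obtain x where xW: "!!n. x n \<in> W" and xJ: "!!n. J (x n) < m + 1 / (real n + 1)" by metis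
 have par: "(nm (a \<ominus> b))\<^sup>2 = 2 * J a + 2 * J b - 4 * J ((1/2) \<odot> (a \<oplus> b))" if "a \<in> W" "b \<in> W" for a b
 proof -
  have "f ((1/2) \<odot> (a \<oplus> b)) = (f a + f b) / 2" using that D by (simp add: sc add)
  hence "Re (f ((1/2) \<odot> (a \<oplus> b))) = (Re (f a) + Re (f b)) / 2"
   by (simp only: plus_complex.sel Re_divide_numeral)
  thus ?thesis using that D(3,4,6) unfolding J_def by (simp add: nm_sq field_simps del: nm_scale)
 qed
 have cau: "(nm (x i \<ominus> x j))\<^sup>2 <= 2 / (real i + 1) + 2 / (real j + 1)" for i j
  using par[OF xW[of i] xW[of j]] xJ[of i] xJ[of j] mle[of "(1/2) \<odot> (x i \<oplus> x j)"] xW D by fastforce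
 have "\<exists>l. tends x l"
 proof (rule hcomplete)
  fix \<epsilon> :: real assume e: "\<epsilon> > 0"
  obtain N where N: "4 / \<epsilon>\<^sup>2 < real N" using reals_Archimedean2 by blast
  hence N': "4 / (real N + 1) < \<epsilon>\<^sup>2"
  proof -
   have "4 < real N * \<epsilon>\<^sup>2" using N e by (simp add: field_simps)
   also have "\<dots> <= (real N + 1) * \<epsilon>\<^sup>2" by (simp add: algebra_simps)
   finally show ?thesis by (simp add: field_simps)
  qed
  have "nm (x i \<ominus> x j) < \<epsilon>" if "i \<ge> N" "j \<ge> N" for i j
  proof -
   have "2 / (real i + 1) <= 2 / (real N + 1)" "2 / (real j + 1) <= 2 / (real N + 1)"
    using that by (auto intro!: divide_left_mono)
   hence "(nm (x i \<ominus> x j))\<^sup>2 < \<epsilon>\<^sup>2"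
    using cau[of i j] N' add_divide_distrib[of 2 2 "real N + 1"] by simp
   thus ?thesis using e by (meson less_imp_le power2_less_imp_less)
  qed
  thus "\<exists>N. \<forall>m\<ge>N. \<forall>n\<ge>N. nm (x m \<ominus> x n) < \<epsilon>" by blast
 qed (use xW in auto)
 then obtain w where w: "tends x w" by blast
 have wW: "w \<in> W" using D(5) xW w by blast
 have fx: "(\<lambda>n. f (x n)) \<longlonglongrightarrow> f w"
 proof -
  have fd: "f (x n) - f w = f (x n \<ominus> w)" for n
  proof -
   have "x n \<ominus> w = x n \<oplus> (-1) \<odot> w" by (rule vec_eqI) (use xW wW in auto)
   thus ?thesis using add[of "x n" "(-1) \<odot> w"] sc[of w "-1"] xW wW D by simp
  qed
  have "(\<lambda>n. f (x n) - f w) \<longlonglongrightarrow> 0"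
  proof (rule Lim_null_comparison)
   show "\<forall>\<^sub>F n in sequentially. norm (f (x n) - f w) <= C * nm (x n \<ominus> w)"
    unfolding fd using bd D(6)[OF xW wW] by simp
   show "(\<lambda>n. C * nm (x n \<ominus> w)) \<longlonglongrightarrow> 0" using tendsD(3)[OF w] tendsto_mult_right_zero by blast
  qed
  thus ?thesis by (simp add: LIM_zero_iff)
 qed
 have "(\<lambda>n. J (x n)) \<longlonglongrightarrow> J w" unfolding J_def
  by (intro tendsto_intros tends_nm[OF w] fx)
 moreover have "(\<lambda>n. m + 1 / (real n + 1)) \<longlonglongrightarrow> m + 0"
  using LIMSEQ_Suc[OF lim_const_over_n[of "1::real"]] by (intro tendsto_intros) (simp add: add.commute)
 ultimately have Jw: "J w <= m" using xJ LIMSEQ_le[of "\<lambda>n. J (x n)" "J w" "\<lambda>n. m + 1 / (real n + 1)" "m + 0"]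
  by (metis add.right_neutral less_imp_le)
 have key: "Re (ip y w) = Re (f y)" if y: "y \<in> W" for y
 proof -
  have "Re (ip w y) - Re (f y) = 0"
  proof (rule quad_zero)
   fix t :: real
   have "J w <= J (w \<oplus> of_real t \<odot> y)" using Jw mle[of "w \<oplus> of_real t \<odot> y"] y wW D by force
   moreover have "J (w \<oplus> of_real t \<odot> y) = J w + 2 * t * (Re (ip w y) - Re (f y)) + t\<^sup>2 * (nm y)\<^sup>2"
   proof -
    have "f (w \<oplus> of_real t \<odot> y) = f w + of_real t * f y" using y wW D by (simp add: add sc)
    thus ?thesis unfolding J_def using y wW nm_add_sq[of w "of_real t \<odot> y"]
     by (simp add: algebra_simps power_mult_distrib)
   qed
   ultimately show "0 <= 2 * t * (Re (ip w y) - Re (f y)) + t\<^sup>2 * (nm y)\<^sup>2" by linarith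
  qed simp
  thus ?thesis using cinner_commute[of w y] y wW by simp
 qed
 have "f y = ip y w" if y: "y \<in> W" for y
 proof (rule complex_eqI)
  show "Re (f y) = Re (ip y w)" using key[OF y] by simp
  have "Re (ip (\<i> \<odot> y) w) = Re (f (\<i> \<odot> y))" using key y D by blast
  thus "Im (f y) = Im (ip y w)" using y wW sc by simp
 qed
 thus ?thesis using wW by blast
qed

lemma projection:
 assumes W: "csub W" and v: "v \<in> \<H>"
 shows "\<exists>w\<in>W. \<forall>x\<in>W. ip (v \<ominus> w) x = 0"
proof -
 have WH[simp]: "x \<in> W ==> x \<in> \<H>" for x using csubD(1)[OF W] by auto
 have "\<exists>w\<in>W. \<forall>x\<in>W. ip x v = ip x w"
  by (rule riesz[OF W, where C="nm v"]) (use v cauchy_schwarz[of _ v] in \<open>auto simp: mult.commute\<close>)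
 then obtain w where w: "w \<in> W" "\<forall>x\<in>W. ip x v = ip x w" by blast
 have "ip (v \<ominus> w) x = 0" if "x \<in> W" for x
 proof -
  have "ip x (v \<ominus> w) = 0" using w that v by simp
  thus ?thesis using cinner_commute[of x "v \<ominus> w"] w that v by simp
 qed
 thus ?thesis using w by blast
qed

end

section \<open>Orthonormal families and positive operators\<close>

lemma common_convergent_subsequence:
 fixes c :: "'i => nat => complex"
 assumes "finite I" "!!i. i \<in> I ==> bounded (range (c i))"
 shows "\<exists>\<phi>. strict_mono \<phi> \<and> (\<forall>i\<in>I. convergent (c i \<circ> \<phi>))"
 using assms
proof (induction I)
 case empty
 show ?case by (rule exI[of _ id]) (auto simp: strict_mono_def)
next
 case (insert i I)
 then obtain \<phi> where \<phi>: "strict_mono \<phi>" "\<forall>j\<in>I. convergent (c j \<circ> \<phi>)" by blast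
 have "bounded (range (c i \<circ> \<phi>))"
  using insert.prems[of i] by (auto intro: bounded_subset)
 then obtain l \<psi> where \<psi>: "strict_mono \<psi>" "((c i \<circ> \<phi>) \<circ> \<psi>) \<longlonglongrightarrow> l"
  using bounded_imp_convergent_subsequence by blast
 have "convergent (c j \<circ> (\<phi> \<circ> \<psi>))" if "j \<in> insert i I" for j
 proof (cases "j = i")
  case True thus ?thesis using \<psi>(2) by (auto simp: convergent_def o_assoc)
 next
  case False
  hence "convergent (c j \<circ> \<phi>)" using that \<phi> by auto
  thus ?thesis using convergent_subseq_convergent[OF _ \<psi>(1)] by (simp add: o_assoc)
 qed
 thus ?case using strict_mono_o[OF \<phi>(1) \<psi>(1)] by blast
qed

context complex_hilbert
begin

definition orthonormal :: "'h set => bool" where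
 "orthonormal U \<longleftrightarrow> U \<subseteq> \<H> \<and> (\<forall>u\<in>U. \<forall>v\<in>U. ip u v = (if u = v then 1 else 0))"

definition fproj :: "'h set => 'h => 'h" where
 "fproj U x = finsum H (\<lambda>u. ip x u \<odot> u) U"

lemma orthonormal_mem: "orthonormal U ==> u \<in> U ==> u \<in> \<H>"
 by (auto simp: orthonormal_def)

lemma orthonormal_nm: "orthonormal U ==> u \<in> U ==> nm u = 1"
 by (auto simp: orthonormal_def hnorm_def)

lemma fproj_closed [simp]:
 "[|orthonormal U; x \<in> \<H>|] ==> fproj U x \<in> \<H>"
 unfolding fproj_def using orthonormal_mem by auto

lemma ip_fproj:
 assumes "orthonormal U" "finite U" "x \<in> \<H>" "y \<in> \<H>"
 shows "ip (fproj U x) y = (\<Sum>u\<in>U. ip x u * ip u y)"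
 using assms orthonormal_mem[OF assms(1)] by (simp add: fproj_def ip_sum_left)

lemma ip_fproj_mem:
 assumes "orthonormal U" "finite U" "x \<in> \<H>" "u \<in> U"
 shows "ip (fproj U x) u = ip x u"
proof -
 have "ip (fproj U x) u = (\<Sum>v\<in>U. ip x v * ip v u)"
  using assms orthonormal_mem[OF assms(1)] ip_fproj by blast
 also have "\<dots> = (\<Sum>v\<in>U. if v = u then ip x v else 0)"
  using assms by (intro sum.cong) (auto simp: orthonormal_def)
 finally show ?thesis using assms by simp
qed

lemma fproj_selfadj:
 assumes "orthonormal U" "finite U" "x \<in> \<H>" "y \<in> \<H>"
 shows "ip (fproj U x) y = ip x (fproj U y)"
proof -
 have "ip x (fproj U y) = cnj (ip (fproj U y) x)" using assms by (intro cinner_commute) auto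
 also have "\<dots> = (\<Sum>u\<in>U. cnj (ip y u) * cnj (ip u x))" using assms by (simp add: ip_fproj)
 also have "\<dots> = (\<Sum>u\<in>U. ip x u * ip u y)"
 proof (rule sum.cong)
  fix u assume "u \<in> U"
  hence u: "u \<in> \<H>" using assms(1) orthonormal_mem by blast
  have "cnj (ip y u) = ip u y" "cnj (ip u x) = ip x u"
   using cinner_commute[OF assms(4) u] cinner_commute[OF u assms(3)] by simp_all
  thus "cnj (ip y u) * cnj (ip u x) = ip x u * ip u y" by simp
 qed simp
 finally show ?thesis using assms by (simp add: ip_fproj)
qed

lemma fproj_nm_sq:
 assumes "orthonormal U" "finite U" "x \<in> \<H>"
 shows "(nm (fproj U x))\<^sup>2 = (\<Sum>u\<in>U. (cmod (ip x u))\<^sup>2)" "Re (ip x (fproj U x)) = (nm (fproj U x))\<^sup>2"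
proof -
 have a: "ip (fproj U x) x = of_real (\<Sum>u\<in>U. (cmod (ip x u))\<^sup>2)"
 proof -
  have "ip x u * ip u x = of_real ((cmod (ip x u))\<^sup>2)" if "u \<in> U" for u
   using cinner_commute[OF assms(3) orthonormal_mem[OF assms(1) that]] complex_norm_square[of "ip x u"] by simp
  thus ?thesis using assms by (simp add: ip_fproj)
 qed
 have b: "ip (fproj U x) (fproj U x) = ip (fproj U x) x"
 proof -
  have "ip u (fproj U x) = ip u x" if "u \<in> U" for u
   using ip_fproj_mem[OF assms that] cinner_commute[of x u] cinner_commute[of "fproj U x" u]
    assms orthonormal_mem[OF assms(1) that] by simp
  thus ?thesis using assms by (simp add: ip_fproj)
 qed
 show "(nm (fproj U x))\<^sup>2 = (\<Sum>u\<in>U. (cmod (ip x u))\<^sup>2)"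
  using a b assms by (simp add: nm_sq)
 show "Re (ip x (fproj U x)) = (nm (fproj U x))\<^sup>2"
  using b assms fproj_selfadj[OF assms assms(3)] by (simp add: nm_sq)
qed

lemma fproj_le:
 assumes "orthonormal U" "finite U" "x \<in> \<H>"
 shows "nm (fproj U x) <= nm x" "nm (x \<ominus> fproj U x) <= nm x"
proof -
 have e: "(nm (x \<ominus> fproj U x))\<^sup>2 = (nm x)\<^sup>2 - (nm (fproj U x))\<^sup>2"
  using nm_diff_sq[of x "fproj U x"] fproj_nm_sq(2)[OF assms] assms by simp
 show "nm (x \<ominus> fproj U x) <= nm x"
  by (rule power2_le_imp_le) (use e assms in auto)
 have "0 <= (nm (x \<ominus> fproj U x))\<^sup>2" by simp
 thus "nm (fproj U x) <= nm x" by - (rule power2_le_imp_le, use e assms in auto)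
qed

lemma bessel:
 assumes "orthonormal U" "finite U" "x \<in> \<H>"
 shows "(\<Sum>u\<in>U. (cmod (ip x u))\<^sup>2) <= (nm x)\<^sup>2"
 using fproj_nm_sq(1)[OF assms] fproj_le(1)[OF assms] assms by (metis fproj_closed nm_ge0 power_mono)

lemma orthonormal_insert:
 assumes "orthonormal U" "v \<in> \<H>" "nm v = 1" "!!u. u \<in> U ==> ip v u = 0"
 shows "orthonormal (insert v U)" "v \<notin> U"
proof -
 have s: "ip v v = 1" using ip_self[OF assms(2)] assms(3) by simp
 have "ip u v = 0" if "u \<in> U" for u
  using cinner_commute[of v u] assms that orthonormal_mem by simp
 thus "orthonormal (insert v U)" "v \<notin> U" using assms s unfolding orthonormal_def by auto
qed

lemma trace_bound:
 assumes U: "orthonormal U" "finite U" and I: "finite I"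
  and ab: "!!i. i \<in> I ==> a i \<in> \<H>" "!!i. i \<in> I ==> b i \<in> \<H>"
  and low: "!!u. u \<in> U ==> c <= Re (ip (finsum H (\<lambda>i. ip u (a i) \<odot> b i) I) u)"
 shows "real (card U) * c <= (\<Sum>i\<in>I. (nm (a i))\<^sup>2 + (nm (b i))\<^sup>2)"
proof -
 have "real (card U) * c = (\<Sum>u\<in>U. c)" by simp
 also have "\<dots> <= (\<Sum>u\<in>U. \<Sum>i\<in>I. (cmod (ip (a i) u))\<^sup>2 + (cmod (ip (b i) u))\<^sup>2)"
 proof (rule sum_mono)
  fix u assume u: "u \<in> U"
  hence uc: "u \<in> \<H>" using U orthonormal_mem by blast
  have "c <= Re (\<Sum>i\<in>I. ip u (a i) * ip (b i) u)"
   using low[OF u] ab uc I by (simp add: ip_sum_left)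
  also have "\<dots> = (\<Sum>i\<in>I. Re (ip u (a i) * ip (b i) u))" by (rule Re_sum)
  also have "\<dots> <= (\<Sum>i\<in>I. (cmod (ip (a i) u))\<^sup>2 + (cmod (ip (b i) u))\<^sup>2)"
  proof (rule sum_mono)
   fix i assume i: "i \<in> I"
   have "cmod (ip u (a i)) = cmod (ip (a i) u)"
    using cinner_commute[OF ab(1)[OF i] uc] by simp
   hence "Re (ip u (a i) * ip (b i) u) <= cmod (ip (a i) u) * cmod (ip (b i) u)"
    by (metis complex_Re_le_cmod norm_mult)
   also have "\<dots> <= (cmod (ip (a i) u))\<^sup>2 + (cmod (ip (b i) u))\<^sup>2"
    using sum_squares_bound[of "cmod (ip (a i) u)" "cmod (ip (b i) u)"]
     mult_nonneg_nonneg[OF norm_ge_zero[of "ip (a i) u"] norm_ge_zero[of "ip (b i) u"]] by linarith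
   finally show "Re (ip u (a i) * ip (b i) u) <= (cmod (ip (a i) u))\<^sup>2 + (cmod (ip (b i) u))\<^sup>2" .
  qed
  finally show "c <= (\<Sum>i\<in>I. (cmod (ip (a i) u))\<^sup>2 + (cmod (ip (b i) u))\<^sup>2)" .
 qed
 also have "\<dots> = (\<Sum>i\<in>I. (\<Sum>u\<in>U. (cmod (ip (a i) u))\<^sup>2) + (\<Sum>u\<in>U. (cmod (ip (b i) u))\<^sup>2))"
  by (subst sum.swap) (simp add: sum.distrib)
 also have "\<dots> <= (\<Sum>i\<in>I. (nm (a i))\<^sup>2 + (nm (b i))\<^sup>2)"
  using bessel[OF U] ab by (intro sum_mono add_mono) auto
 finally show ?thesis .
qed

definition linear_op :: "('h => 'h) => bool" where
 "linear_op A \<longleftrightarrow> (\<forall>x\<in>\<H>. A x \<in> \<H>) \<and>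
   (\<forall>x\<in>\<H>. \<forall>y\<in>\<H>. A (x \<oplus> y) = A x \<oplus> A y) \<and> (\<forall>c. \<forall>x\<in>\<H>. A (c \<odot> x) = c \<odot> A x)"

definition selfadj :: "('h => 'h) => bool" where
 "selfadj A \<longleftrightarrow> (\<forall>x\<in>\<H>. \<forall>y\<in>\<H>. ip (A x) y = ip x (A y))"

lemma linear_opD:
 assumes "linear_op A"
 shows "x \<in> \<H> ==> A x \<in> \<H>"
  "[|x \<in> \<H>; y \<in> \<H>|] ==> A (x \<oplus> y) = A x \<oplus> A y"
  "x \<in> \<H> ==> A (c \<odot> x) = c \<odot> A x"
  "[|x \<in> \<H>; y \<in> \<H>|] ==> A (x \<ominus> y) = A x \<ominus> A y"
  "A \<zero> = \<zero>"
proof -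
 show c: "x \<in> \<H> ==> A x \<in> \<H>" for x using assms by (auto simp: linear_op_def)
 show a: "[|x \<in> \<H>; y \<in> \<H>|] ==> A (x \<oplus> y) = A x \<oplus> A y" for x y
  using assms by (auto simp: linear_op_def)
 show s: "x \<in> \<H> ==> A (c \<odot> x) = c \<odot> A x" for x c using assms by (auto simp: linear_op_def)
 have d: "u \<ominus> v = u \<oplus> (-1) \<odot> v" if "u \<in> \<H>" "v \<in> \<H>" for u v
  by (rule vec_eqI) (use that in auto)
 show "[|x \<in> \<H>; y \<in> \<H>|] ==> A (x \<ominus> y) = A x \<ominus> A y"
  using a s c d by simp
 show "A \<zero> = \<zero>" using s[of \<zero> 0] c[of \<zero>] smult_l_null by simp
qed

lemma linear_op_funpow: "linear_op A ==> linear_op (A ^^ n)"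
 by (induction n) (auto simp: linear_op_def)

text \<open>The form \<open>\<langle>A x, x\<rangle>\<close> of a positive operator controls \<open>\<parallel>A x\<parallel>\<close>: expand
 \<open>\<langle>A z, z\<rangle> \<ge> 0\<close> at \<open>z = x - C\<inverse> A x\<close>.\<close>

lemma positive_form_bound:
 assumes A: "linear_op A" "selfadj A" and x: "x \<in> \<H>"
  and pos: "!!z. z \<in> \<H> ==> 0 <= Re (ip (A z) z)"
  and C: "C > 0" "Re (ip (A (A x)) (A x)) <= C * (nm (A x))\<^sup>2"
 shows "(nm (A x))\<^sup>2 <= C * Re (ip (A x) x)"
proof -
 note l = linear_opD[OF A(1)]
 define z where "z = x \<ominus> of_real (1/C) \<odot> A x"
 have sa: "ip (A (A x)) x = ip (A x) (A x)" using A(2) x l(1) unfolding selfadj_def by blast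
 have zH: "z \<in> \<H>" using x l by (simp add: z_def)
 have "0 <= Re (ip (A z) z)" by (rule pos[OF zH])
 also have "\<dots> = Re (ip (A x) x) - 2 / C * (nm (A x))\<^sup>2 + (1 / C)\<^sup>2 * Re (ip (A (A x)) (A x))"
  using x l sa by (simp add: z_def nm_sq power2_eq_square[of C] power_divide algebra_simps)
 also have "\<dots> <= Re (ip (A x) x) - 2 / C * (nm (A x))\<^sup>2 + (1 / C)\<^sup>2 * (C * (nm (A x))\<^sup>2)"
  using C by (intro add_left_mono mult_left_mono) auto
 also have "\<dots> = Re (ip (A x) x) - (nm (A x))\<^sup>2 / C"
  using C(1) by (simp add: power2_eq_square field_simps)
 finally show ?thesis using C(1) by (simp add: field_simps)
qed

end

context hspace
begin

lemma gram_schmidt: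
 assumes "finite Y" "csub W" "Y \<subseteq> W"
 shows "\<exists>U. finite U \<and> orthonormal U \<and> U \<subseteq> W \<and> (\<forall>y\<in>Y. fproj U y = y)"
 using assms(1,3)
proof (induction Y)
 case empty
 have "orthonormal {}" by (simp add: orthonormal_def)
 thus ?case by blast
next
 case (insert y Y)
 then obtain U where U: "finite U" "orthonormal U" "U \<subseteq> W" "\<forall>y\<in>Y. fproj U y = y" by auto
 note WH = csub_mem[OF assms(2)]
 have yW: "y \<in> W" and yH: "y \<in> \<H>" using insert.prems WH by auto
 define z where "z = y \<ominus> fproj U y"
 have fW: "fproj U y \<in> W" unfolding fproj_def
  using U csubD(4)[OF assms(2)] by (intro csub_sum[OF assms(2)]) auto
 hence zW: "z \<in> W" using yW csubD(6)[OF assms(2)] by (simp add: z_def)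
 have zU: "ip z u = 0" if "u \<in> U" for u
  using ip_fproj_mem[OF U(2,1) yH that] U that yH orthonormal_mem by (simp add: z_def)
 show ?case
 proof (cases "z = \<zero>")
  case True
  have "fproj U y = y"
  proof (rule vec_eqI)
   fix w assume "w \<in> \<H>"
   thus "ip (fproj U y) w = ip y w"
    using True U yH ip_diff_left[of y "fproj U y" w] by (simp add: z_def)
  qed (use U yH in auto)
  thus ?thesis using U by blast
 next
  case False
  have zH: "z \<in> \<H>" using zW WH by blast
  have nz: "nm z > 0" using False zH nm_ge0[OF zH] nm_eq0[OF zH] by linarith
  define v where "v = of_real (1 / nm z) \<odot> z"
  have v: "v \<in> \<H>" "v \<in> W" "nm v = 1" "!!u. u \<in> U ==> ip v u = 0"
   using zH zW nz zU csubD(4)[OF assms(2)] U orthonormal_mem by (auto simp: v_def norm_divide)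
  note V = orthonormal_insert[OF U(2) v(1,3,4)]
  have vx: "fproj (insert v U) x = ip x v \<odot> v \<oplus> fproj U x" if "x \<in> \<H>" for x
   unfolding fproj_def using U(1) V(2) v(1) orthonormal_mem[OF U(2)] that by (auto simp: M.finsum_insert)
  have "fproj (insert v U) x = x" if "x \<in> Y" for x
  proof -
   have xW: "x \<in> W" and xH: "x \<in> \<H>" using insert.prems that WH by auto
   have "ip x v = cnj (ip v (fproj U x))" using U(4) that cinner_commute[OF v(1) xH] by simp
   also have "ip v (fproj U x) = 0" using v U(1) xH orthonormal_mem[OF U(2)] unfolding fproj_def by (simp add: ip_sum_right)
   finally have "ip x v = 0" by simp
   thus ?thesis using vx[OF xH] U(4) that xH v(1) smult_l_null by simp
  qed
  moreover have "fproj (insert v U) y = y"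
  proof -
   have "ip y z = of_real ((nm z)\<^sup>2)"
   proof -
    have "ip (fproj U y) z = 0"
    proof -
     have "ip u z = 0" if "u \<in> U" for u using zU[OF that] cinner_commute[of z u] zH orthonormal_mem[OF U(2) that] by simp
     thus ?thesis using U zH yH by (simp add: ip_fproj)
    qed
    moreover have "ip z z = ip y z - ip (fproj U y) z" using yH zH U unfolding z_def by simp
    ultimately show ?thesis using ip_self[OF zH] by simp
   qed
   hence "ip y v \<odot> v = z"
    using zH yH nz by (intro vec_eqI) (auto simp: v_def power2_eq_square)
   hence "fproj (insert v U) y = z \<oplus> fproj U y" using vx[OF yH] by simp
   also have "\<dots> = y" by (rule vec_eqI) (use yH U zH in \<open>auto simp: z_def\<close>)
   finally show ?thesis .
  qed
  moreover have "insert v U \<subseteq> W" using U v by auto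
  ultimately show ?thesis using V(1) U(1) by blast
 qed
qed

subsection \<open>Orthogonal projections\<close>

definition oproj :: "'h set => 'h => 'h" where
 "oproj W x = (SOME w. w \<in> W \<and> (\<forall>y\<in>W. ip (x \<ominus> w) y = 0))"

lemma oproj:
 assumes W: "csub W" and x: "x \<in> \<H>"
 shows "oproj W x \<in> W" "!!y. y \<in> W ==> ip (x \<ominus> oproj W x) y = 0" "oproj W x \<in> \<H>"
proof -
 have "oproj W x \<in> W \<and> (\<forall>y\<in>W. ip (x \<ominus> oproj W x) y = 0)"
  unfolding oproj_def by (rule someI_ex) (use projection[OF W x] in blast)
 thus "oproj W x \<in> W" "!!y. y \<in> W ==> ip (x \<ominus> oproj W x) y = 0" by auto
 thus "oproj W x \<in> \<H>" using csub_mem[OF W] by blast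
qed

lemma oproj_unique:
 assumes W: "csub W" and x: "x \<in> \<H>" and w: "w \<in> W" "!!y. y \<in> W ==> ip (x \<ominus> w) y = 0"
 shows "oproj W x = w"
proof -
 note o = oproj[OF W x]
 have wH: "w \<in> \<H>" using w(1) csub_mem[OF W] by blast
 define d where "d = w \<ominus> oproj W x"
 have d: "d \<in> W" using o w csubD(6)[OF W] by (simp add: d_def)
 have "ip (w \<ominus> oproj W x) d = 0"
  using o(2)[OF d] w(2)[OF d] x o(3) wH csub_mem[OF W d] by simp
 hence "ip (w \<ominus> oproj W x) (w \<ominus> oproj W x) = 0" by (simp only: d_def)
 hence "w \<ominus> oproj W x = \<zero>" using cinner_self_eq_0 wH o(3) by blast
 show ?thesis
 proof (rule vec_eqI)
  fix z assume "z \<in> \<H>"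
  thus "ip (oproj W x) z = ip w z" using \<open>w \<ominus> oproj W x = \<zero>\<close> ip_diff_left[of w "oproj W x" z] wH o(3) by simp
 qed (use wH o(3) in auto)
qed

lemma oproj_linear: assumes W: "csub W" shows "linear_op (oproj W)"
 unfolding linear_op_def
proof (intro conjI ballI allI)
 fix x y c assume x: "x \<in> \<H>" and y: "y \<in> \<H>"
 note ox = oproj[OF W x] and oy = oproj[OF W y] and D = csubD[OF W] csub_mem[OF W]
 show "oproj W (x \<oplus> y) = oproj W x \<oplus> oproj W y"
 proof (rule oproj_unique[OF W])
  fix z assume z: "z \<in> W"
  have zH: "z \<in> \<H>" using D(7)[OF z] .
  show "ip (x \<oplus> y \<ominus> (oproj W x \<oplus> oproj W y)) z = 0"
   using ox(2)[OF z] oy(2)[OF z] ox(3) oy(3) x y zH by (simp add: algebra_simps)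
 qed (use x y ox(1) oy(1) D(3) in auto)
 show "oproj W (c \<odot> x) = c \<odot> oproj W x"
 proof (rule oproj_unique[OF W])
  fix y assume y: "y \<in> W"
  have "ip x y = ip (oproj W x) y" using ox(2)[OF y] ox(3) x D(7)[OF y] by simp
  thus "ip (c \<odot> x \<ominus> c \<odot> oproj W x) y = 0" using x ox(3) D(7)[OF y] by simp
 qed (use x ox D in auto)
qed (use oproj(3)[OF W] in auto)

lemma oproj_ip:
 assumes W: "csub W" and x: "x \<in> \<H>" "y \<in> W" shows "ip (oproj W x) y = ip x y"
 using oproj(3)[OF W x(1)] oproj(2)[OF W x] x csub_mem[OF W x(2)] by simp

lemma oproj_selfadj: assumes W: "csub W" shows "selfadj (oproj W)"
 unfolding selfadj_def
proof (intro ballI)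
 fix x y assume x: "x \<in> \<H>" and y: "y \<in> \<H>"
 note ox = oproj[OF W x] and oy = oproj[OF W y]
 have "ip (oproj W x) (y \<ominus> oproj W y) = cnj (ip (y \<ominus> oproj W y) (oproj W x))"
  using cinner_commute[of "y \<ominus> oproj W y" "oproj W x"] ox oy y by auto
 hence "ip (oproj W x) (y \<ominus> oproj W y) = 0" using oy(2)[OF ox(1)] by simp
 hence "ip (oproj W x) y = ip (oproj W x) (oproj W y)" using ox oy y by simp
 thus "ip (oproj W x) y = ip x (oproj W y)" using ox(2)[OF oy(1)] x ox(3) oy(3) by simp
qed

lemma oproj_id: assumes W: "csub W" and x: "x \<in> W" shows "oproj W x = x"
 by (rule oproj_unique[OF W]) (use x csub_mem[OF W] in auto)

lemma oproj_pythagoras: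
 assumes W: "csub W" and x: "x \<in> \<H>"
 shows "(nm x)\<^sup>2 = (nm (oproj W x))\<^sup>2 + (nm (x \<ominus> oproj W x))\<^sup>2"
proof -
 note o = oproj[OF W x]
 have "ip x (oproj W x) = ip (oproj W x) (oproj W x)" using o(2)[OF o(1)] o(3) x by simp
 thus ?thesis using nm_diff_sq[OF x o(3)] nm_sq[OF o(3)] by simp
qed

lemma oproj_le:
 assumes W: "csub W" and x: "x \<in> \<H>"
 shows "nm (oproj W x) <= nm x" "nm (x \<ominus> oproj W x) <= nm x"
 by (rule power2_le_imp_le, use oproj_pythagoras[OF W x] x oproj(3)[OF W x] in auto)+

lemma orthogonal_csub: assumes "W \<subseteq> \<H>"
 shows "csub {x \<in> \<H>. \<forall>w\<in>W. ip x w = 0}" (is "csub ?O")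
proof (rule csubI)
 fix x l assume x: "!!n. x n \<in> ?O" and t: "tends x l"
 have "ip l w = 0" if w: "w \<in> W" for w
 proof -
  have "(\<lambda>n. ip (x n) w) \<longlonglongrightarrow> ip l w" using tends_ip[OF t] w assms by blast
  moreover have "(\<lambda>n. ip (x n) w) = (\<lambda>n. 0)" using x w by auto
  ultimately show ?thesis using LIMSEQ_unique tendsto_const by metis
 qed
 thus "l \<in> ?O" using tendsD[OF t] by simp
qed (use assms in auto)

subsection \<open>The top eigenvalue of a positive operator\<close>

text \<open>Here \<open>F\<close>, given by \<open>F x = \<Sum>i\<in>I. \<langle>x, a i\<rangle> b i\<close>, has finite rank, and the last assumption says
 \<open>T <= r + F\<close>. A value \<open>s > r\<close> that is the supremum of the form of \<open>T\<close> on \<open>M\<close> is then attained: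
 along a maximizing sequence \<open>v\<close> the vectors \<open>(s - T) v\<close> tend to \<open>0\<close>, the vectors \<open>F v\<close> converge
 on a subsequence, and \<open>s - T + F \<ge> s - r > 0\<close> makes \<open>v\<close> itself Cauchy.\<close>

lemma top_eigenvector:
 assumes T: "linear_op T" "selfadj T" and bT: "!!x. x \<in> \<H> ==> nm (T x) <= B * nm x"
  and s: "r < s" "0 < s" "!!x. x \<in> \<H> ==> Re (ip (T x) x) <= s * (nm x)\<^sup>2"
  and I: "finite I" "!!i. i \<in> I ==> a i \<in> \<H>" "!!i. i \<in> I ==> b i \<in> \<H>"
  and gap: "!!x. x \<in> \<H> ==>
    Re (ip (T x) x) <= r * (nm x)\<^sup>2 + Re (ip (finsum H (\<lambda>i. ip x (a i) \<odot> b i) I) x)"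
  and M: "csub M"
  and top: "!!s'. s' < s ==> \<exists>x\<in>M. Re (ip (T x) x) > s' * (nm x)\<^sup>2"
 shows "\<exists>v\<in>M. nm v = 1 \<and> T v = of_real s \<odot> v"
proof -
 note l = linear_opD[OF T(1)] and MH = csub_mem[OF M]
 define F where "F x = finsum H (\<lambda>i. ip x (a i) \<odot> b i) I" for x
 have FH[simp]: "x \<in> \<H> ==> F x \<in> \<H>" for x unfolding F_def using I by auto
 define A where "A x = of_real s \<odot> x \<ominus> T x" for x
 have A: "linear_op A" unfolding linear_op_def
 proof (intro conjI ballI allI)
  fix x y c assume x: "x \<in> \<H>" and y: "y \<in> \<H>"
  show "A (x \<oplus> y) = A x \<oplus> A y" by (rule vec_eqI) (use x y l in \<open>auto simp: A_def algebra_simps\<close>)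
  show "A (c \<odot> x) = c \<odot> A x" by (rule vec_eqI) (use x l in \<open>auto simp: A_def algebra_simps\<close>)
 qed (use l in \<open>auto simp: A_def\<close>)
 have As: "selfadj A" using T(2) l unfolding selfadj_def A_def by simp
 note Al = linear_opD[OF A]
 have Ap: "0 <= Re (ip (A x) x)" if "x \<in> \<H>" for x
  using s(3)[OF that] l that by (simp add: A_def nm_sq)
 define C where "C = s + \<bar>B\<bar>"
 have C: "C > 0" using s(2) by (simp add: C_def)
 have bA: "Re (ip (A y) y) <= C * (nm y)\<^sup>2" if y: "y \<in> \<H>" for y
 proof -
  have "- Re (ip (T y) y) <= nm (T y) * nm y"
   using cauchy_schwarz[OF l(1)[OF y] y] abs_Re_le_cmod[of "ip (T y) y"] by linarith
  also have "\<dots> <= (\<bar>B\<bar> * nm y) * nm y"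
   using order_trans[OF bT[OF y] mult_right_mono[OF abs_ge_self nm_ge0[OF y]]] y
   by (intro mult_right_mono) auto
  finally show ?thesis using y l by (simp add: A_def C_def nm_sq[symmetric] power2_eq_square algebra_simps)
 qed
 have small: "(nm (A x))\<^sup>2 <= C * Re (ip (A x) x)" if "x \<in> \<H>" for x
  by (rule positive_form_bound[OF A As that Ap C bA]) (use that Al in auto)
 have "\<exists>v\<in>M. nm v = 1 \<and> Re (ip (A v) v) < 1 / (real n + 1)" for n
 proof -
  have "s - 1 / (real n + 1) < s" by simp
  then obtain x where x: "x \<in> M" "Re (ip (T x) x) > (s - 1 / (real n + 1)) * (nm x)\<^sup>2"
   using top by blast
  have xH: "x \<in> \<H>" using x MH by blast
  have "x ~= \<zero>" using x(2) l(5) by auto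
  hence nx: "nm x > 0" using nm_ge0[OF xH] nm_eq0[OF xH] by linarith
  define v where "v = of_real (1 / nm x) \<odot> x"
  have v: "v \<in> M" "nm v = 1" using x nx xH csubD(4)[OF M] by (auto simp: v_def norm_divide)
  have "Re (ip (A x) x) < 1 / (real n + 1) * (nm x)\<^sup>2"
   using x(2) xH l by (simp add: A_def nm_sq algebra_simps)
  moreover have "Re (ip (A v) v) = Re (ip (A x) x) / (nm x)\<^sup>2"
   using xH Al nx by (simp add: v_def power2_eq_square)
  ultimately have "Re (ip (A v) v) < 1 / (real n + 1)" using nx by (simp add: divide_less_eq)
  thus ?thesis using v by blast
 qed
 then obtain v where v: "!!n. v n \<in> M" "!!n. nm (v n) = 1" "!!n. Re (ip (A (v n)) (v n)) < 1 / (real n + 1)"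
  by metis
 have vH: "v n \<in> \<H>" for n using v MH by blast
 have "(\<lambda>n. nm (A (v n))) \<longlonglongrightarrow> 0"
 proof -
  have "(\<lambda>n. (nm (A (v n)))\<^sup>2) \<longlonglongrightarrow> 0"
  proof (rule Lim_null_comparison)
   have "(nm (A (v n)))\<^sup>2 <= C * (1 / (real n + 1))" for n
    using small[OF vH[of n]] v(3)[of n] C by (meson less_imp_le mult_left_mono order_trans)
   thus "\<forall>\<^sub>F n in sequentially. norm ((nm (A (v n)))\<^sup>2) <= C * (1 / (real n + 1))" by simp
   have "(\<lambda>n. 1 / (real n + 1)) \<longlonglongrightarrow> 0"
    using LIMSEQ_Suc[OF lim_const_over_n[of "1::real"]] by (simp add: add.commute)
   thus "(\<lambda>n. C * (1 / (real n + 1))) \<longlonglongrightarrow> 0" by (rule tendsto_mult_right_zero)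
  qed
  hence "(\<lambda>n. sqrt ((nm (A (v n)))\<^sup>2)) \<longlonglongrightarrow> sqrt 0" by (rule tendsto_real_sqrt)
  thus ?thesis using vH Al by simp
 qed
 moreover have bnd: "bounded (range (\<lambda>n. ip (v n) (a i)))" if "i \<in> I" for i
  unfolding bounded_iff using cauchy_schwarz[OF vH I(2)[OF that]] v(2) by (intro exI[of _ "nm (a i)"]) auto
 obtain \<phi> where \<phi>: "strict_mono \<phi>" "\<forall>i\<in>I. convergent ((\<lambda>n. ip (v n) (a i)) \<circ> \<phi>)"
  using common_convergent_subsequence[OF I(1), of "\<lambda>i n. ip (v n) (a i)"] bnd by blast
 define w where "w n = v (\<phi> n)" for n
 have wH: "w n \<in> \<H>" "w n \<in> M" "nm (w n) = 1" for n using vH v by (auto simp: w_def)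
 have Aw: "(\<lambda>n. nm (A (w n))) \<longlonglongrightarrow> 0"
  using LIMSEQ_subseq_LIMSEQ[OF calculation \<phi>(1)] by (simp add: w_def o_def)
 have est: "(s - r) * nm x <= nm (A x) + (\<Sum>i\<in>I. cmod (ip x (a i)) * nm (b i))" if x: "x \<in> \<H>" for x
 proof (cases "nm x = 0")
  case True thus ?thesis using x Al I by (auto intro!: add_nonneg_nonneg sum_nonneg)
 next
  case False
  hence nx: "nm x > 0" using nm_ge0[OF x] by linarith
  have F: "nm (F x) <= (\<Sum>i\<in>I. cmod (ip x (a i)) * nm (b i))"
   unfolding F_def using nm_sum_le[OF I(1), of "\<lambda>i. ip x (a i) \<odot> b i"] I x by simp
  have "(s - r) * (nm x)\<^sup>2 <= Re (ip (A x) x) + Re (ip (F x) x)"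
   using gap[OF x] x l by (simp add: A_def F_def[symmetric] nm_sq algebra_simps)
  also have "\<dots> <= nm (A x) * nm x + nm (F x) * nm x"
   using cauchy_schwarz[of "A x" x] cauchy_schwarz[of "F x" x] x Al
    complex_Re_le_cmod[of "ip (A x) x"] complex_Re_le_cmod[of "ip (F x) x"] FH by fastforce
  also have "\<dots> <= (nm (A x) + (\<Sum>i\<in>I. cmod (ip x (a i)) * nm (b i))) * nm x"
   using F nx by (simp add: algebra_simps)
  finally have "((s - r) * nm x) * nm x <= (nm (A x) + (\<Sum>i\<in>I. cmod (ip x (a i)) * nm (b i))) * nm x"
   by (simp add: power2_eq_square mult.assoc)
  thus ?thesis using nx by simp
 qed
 have "\<exists>u. tends w u"
 proof (rule hcomplete)
  fix \<epsilon> :: real assume e: "\<epsilon> > 0"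
  define K where "K = 1 + (\<Sum>i\<in>I. nm (b i))"
  have K: "K > 0" using I by (auto simp: K_def intro!: add_pos_nonneg sum_nonneg)
  define \<delta> where "\<delta> = (s - r) * \<epsilon> / (3 * K)"
  have d: "\<delta> > 0" using s e K by (simp add: \<delta>_def)
  have e1: "\<forall>\<^sub>F n in sequentially. nm (A (w n)) < \<delta>" using order_tendstoD(2)[OF Aw d] .
  have "\<exists>N. \<forall>m\<ge>N. \<forall>n\<ge>N. cmod (ip (w m) (a i) - ip (w n) (a i)) < \<delta>" if "i \<in> I" for i
  proof -
   have "Cauchy (\<lambda>n. ip (w n) (a i))"
    using \<phi>(2) that by (intro convergent_Cauchy) (auto simp: w_def o_def)
   thus ?thesis using d unfolding Cauchy_def dist_norm by blast
  qed
  then obtain N where N: "!!i m n. i \<in> I ==> m \<ge> N i ==> n \<ge> N i ==> cmod (ip (w m) (a i) - ip (w n) (a i)) < \<delta>"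
   by metis
  obtain N0 where N0: "!!n. n \<ge> N0 ==> nm (A (w n)) < \<delta>" using e1 unfolding eventually_sequentially by blast
  define N' where "N' = Max (insert N0 (N ` I))"
  have N': "N' \<ge> N0" "!!i. i \<in> I ==> N' \<ge> N i" using I(1) by (auto simp: N'_def)
  have "nm (w m \<ominus> w n) < \<epsilon>" if mn: "m \<ge> N'" "n \<ge> N'" for m n
  proof -
   have 1: "nm (A (w m \<ominus> w n)) < 2 * \<delta>"
    using N0[of m] N0[of n] mn N' Al wH nm_diff_le[of "A (w m)" "A (w n)"] by fastforce
   have "(\<Sum>i\<in>I. cmod (ip (w m \<ominus> w n) (a i)) * nm (b i)) <= (\<Sum>i\<in>I. \<delta> * nm (b i))"
   proof (intro sum_mono mult_right_mono)
    fix i assume i: "i \<in> I"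
    show "cmod (ip (w m \<ominus> w n) (a i)) <= \<delta>"
     using N[OF i, of m n] N'(2)[OF i] mn wH I(2)[OF i] by simp
   qed (use I in auto)
   also have "\<dots> = \<delta> * (K - 1)" by (simp add: K_def sum_distrib_left)
   finally have "(s - r) * nm (w m \<ominus> w n) < 2 * \<delta> + \<delta> * (K - 1)"
    using est[of "w m \<ominus> w n"] 1 wH by simp
   also have "\<dots> <= \<delta> * (3 * K)"
   proof -
    have "1 <= K" using I by (auto simp: K_def intro!: sum_nonneg)
    hence "\<delta> * (1 + K) <= \<delta> * (3 * K)" using d by (intro mult_left_mono) auto
    thus ?thesis by (simp add: algebra_simps)
   qed
   also have "\<dots> = (s - r) * \<epsilon>" using K by (simp add: \<delta>_def)
   finally show ?thesis using s(1) by simp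
  qed
  thus "\<exists>N. \<forall>m\<ge>N. \<forall>n\<ge>N. nm (w m \<ominus> w n) < \<epsilon>" by blast
 qed (rule wH)
 then obtain u where u: "tends w u" by blast
 note uH = tendsD(1)[OF u]
 have uM: "u \<in> M" using csubD(5)[OF M] wH u by blast
 have nu: "nm u = 1" using tends_nm[OF u] LIMSEQ_unique[OF _ tendsto_const] by (simp add: wH(3))
 have "tends (\<lambda>n. A (w n)) (A u)"
 proof (rule tends_lip[OF u])
  show "nm (A x \<ominus> A y) <= C * nm (x \<ominus> y)" if "x \<in> \<H>" "y \<in> \<H>" for x y
  proof -
   have z: "x \<ominus> y \<in> \<H>" using that by simp
   have "(nm (A (x \<ominus> y)))\<^sup>2 <= C * Re (ip (A (x \<ominus> y)) (x \<ominus> y))" by (rule small[OF z])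
   also have "\<dots> <= C * (C * (nm (x \<ominus> y))\<^sup>2)" using bA[OF z] C by simp
   finally have "(nm (A (x \<ominus> y)))\<^sup>2 <= (C * nm (x \<ominus> y))\<^sup>2" by (simp add: power2_eq_square mult_ac)
   thus ?thesis using C z Al that by (metis less_imp_le mult_nonneg_nonneg nm_ge0 power2_le_imp_le)
  qed
 qed (rule Al(1))
 hence "(\<lambda>n. nm (A (w n))) \<longlonglongrightarrow> nm (A u)" by (rule tends_nm)
 hence "nm (A u) = 0" using Aw LIMSEQ_unique by blast
 hence "A u = \<zero>" using Al(1)[OF uH] by simp
 have "T u = of_real s \<odot> u"
 proof (rule vec_eqI)
  fix z assume "z \<in> \<H>"
  thus "ip (T u) z = ip (of_real s \<odot> u) z"
   using \<open>A u = \<zero>\<close> uH l ip_diff_left[of "of_real s \<odot> u" "T u" z] unfolding A_def by simp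
 qed (use uH l in auto)
 thus ?thesis using uM nu by blast
qed

definition eigenspace :: "('h => 'h) => real => 'h set" where
 "eigenspace T s = {x \<in> \<H>. T x = of_real s \<odot> x}"

lemma eigenspace_csub:
 assumes T: "linear_op T" and bT: "!!x. x \<in> \<H> ==> nm (T x) <= B * nm x"
 shows "csub (eigenspace T s)"
proof (rule csubI)
 note l = linear_opD[OF T]
 show "\<zero> \<in> eigenspace T s" using l(5) smult_r_null by (simp add: eigenspace_def)
 show "x \<oplus> y \<in> eigenspace T s" if "x \<in> eigenspace T s" "y \<in> eigenspace T s" for x y
  using that l(2) by (auto simp: eigenspace_def intro!: vec_eqI simp: algebra_simps)
 show "c \<odot> x \<in> eigenspace T s" if "x \<in> eigenspace T s" for c x
  using that l(3) by (auto simp: eigenspace_def intro!: vec_eqI simp: algebra_simps)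
 fix x y assume x: "!!n. x n \<in> eigenspace T s" and t: "tends x y"
 have "tends (\<lambda>n. T (x n)) (T y)"
  by (rule tends_lip[OF t, where C=B]) (use l bT in \<open>auto simp flip: l(4)\<close>)
 moreover have "tends (\<lambda>n. of_real s \<odot> x n) (of_real s \<odot> y)"
 proof (rule tends_lip[OF t, where C="\<bar>s\<bar>"])
  fix u v assume "u \<in> \<H>" "v \<in> \<H>"
  hence "of_real s \<odot> u \<ominus> of_real s \<odot> v = of_real s \<odot> (u \<ominus> v)"
   by (intro vec_eqI) (auto simp: algebra_simps)
  thus "nm (of_real s \<odot> u \<ominus> of_real s \<odot> v) <= \<bar>s\<bar> * nm (u \<ominus> v)" using \<open>u \<in> \<H>\<close> \<open>v \<in> \<H>\<close> by simp
 qed auto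
 moreover have "(\<lambda>n. T (x n)) = (\<lambda>n. of_real s \<odot> x n)" using x by (auto simp: eigenspace_def)
 ultimately have "T y = of_real s \<odot> y" using tends_unique by metis
 thus "y \<in> eigenspace T s" using tendsD(1)[OF t] by (simp add: eigenspace_def)
qed (auto simp: eigenspace_def)

text \<open>On the orthogonal complement of the top eigenspace the form is bounded by some \<open>s' < s\<close>, so
 there \<open>\<parallel>T\<parallel> <= s'\<close>: the powers of \<open>T / s\<close> converge geometrically to the spectral projection. This
 replaces functional calculus.\<close>

lemma powers_to_projection:
 assumes T: "linear_op T" "selfadj T" and bT: "!!x. x \<in> \<H> ==> nm (T x) <= B * nm x"
  and pos: "!!x. x \<in> \<H> ==> 0 <= Re (ip (T x) x)" and s: "0 < s" "s' < s"
  and sm: "!!x. [|x \<in> \<H>; !!w. w \<in> eigenspace T s ==> ip x w = 0|] ==> Re (ip (T x) x) <= s' * (nm x)\<^sup>2"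
 shows "\<exists>\<delta>\<ge>0. \<delta> < 1 \<and> (\<forall>n. \<forall>x\<in>\<H>.
  nm (of_real (1 / s ^ n) \<odot> (T ^^ n) x \<ominus> oproj (eigenspace T s) x) <= \<delta> ^ n * nm x)"
proof -
 define E where "E = eigenspace T s"
 note l = linear_opD[OF T(1)]
 have Ec: "csub E" unfolding E_def by (rule eigenspace_csub[OF T(1) bT])
 note EH = csub_mem[OF Ec]
 define Q where "Q = {x \<in> \<H>. \<forall>w\<in>E. ip x w = 0}"
 define s2 where "s2 = max s' (s/2)"
 have s2: "0 < s2" "s2 < s" "s' <= s2" using s by (auto simp: s2_def)
 have TO: "T x \<in> Q" if x: "x \<in> Q" for x
 proof -
  have xH: "x \<in> \<H>" using x by (simp add: Q_def)
  have "ip (T x) w = 0" if w: "w \<in> E" for w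
  proof -
   have "ip (T x) w = ip x (T w)" using T(2) xH EH[OF w] unfolding selfadj_def by blast
   also have "T w = of_real s \<odot> w" using w by (simp add: E_def eigenspace_def)
   also have "ip x (of_real s \<odot> w) = 0" using x w xH EH[OF w] by (simp add: Q_def)
   finally show ?thesis .
  qed
  thus ?thesis using l(1)[OF xH] by (simp add: Q_def)
 qed
 have form: "Re (ip (T x) x) <= s2 * (nm x)\<^sup>2" if "x \<in> Q" for x
  using sm[of x] that s2(3) mult_right_mono[OF s2(3), of "(nm x)\<^sup>2"] unfolding Q_def E_def by fastforce
 have nT: "nm (T x) <= s2 * nm x" if x: "x \<in> Q" for x
 proof -
  have xH: "x \<in> \<H>" using x by (simp add: Q_def)
  have "(nm (T x))\<^sup>2 <= s2 * Re (ip (T x) x)"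
   by (rule positive_form_bound[OF T xH pos s2(1) form[OF TO[OF x]]])
  also have "\<dots> <= s2 * (s2 * (nm x)\<^sup>2)" using form[OF x] s2(1) by simp
  finally have "(nm (T x))\<^sup>2 <= (s2 * nm x)\<^sup>2" by (simp add: power2_eq_square mult_ac)
  thus ?thesis by (rule power2_le_imp_le) (use s2 xH in auto)
 qed
 have pO: "(T ^^ n) x \<in> Q \<and> nm ((T ^^ n) x) <= s2 ^ n * nm x" if x: "x \<in> Q" for n x
 proof (induction n)
  case (Suc n)
  have "nm (T ((T ^^ n) x)) <= s2 * nm ((T ^^ n) x)" using nT Suc by blast
  also have "\<dots> <= s2 * (s2 ^ n * nm x)" using Suc s2 by simp
  finally show ?case using TO Suc by simp
 qed (use x in simp)
 have pE: "(T ^^ n) x = of_real (s ^ n) \<odot> x" if x: "x \<in> E" for n x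
 proof (induction n)
  case 0 thus ?case using EH[OF x] by simp
 next
  case (Suc n)
  have "(T ^^ Suc n) x = of_real (s ^ n) \<odot> T x" using Suc l(3) EH[OF x] by simp
  also have "T x = of_real s \<odot> x" using x by (simp add: E_def eigenspace_def)
  also have "of_real (s ^ n) \<odot> (of_real s \<odot> x) = of_real (s ^ Suc n) \<odot> x"
   by (rule vec_eqI) (use EH[OF x] in auto)
  finally show ?case .
 qed
 have "nm (of_real (1 / s ^ n) \<odot> (T ^^ n) x \<ominus> oproj E x) <= (s2 / s) ^ n * nm x" if x: "x \<in> \<H>" for n x
 proof -
  note o = oproj[OF Ec x] and ln = linear_opD[OF linear_op_funpow[OF T(1), of n]]
  define y where "y = x \<ominus> oproj E x"
  have yO: "y \<in> Q" and yH: "y \<in> \<H>" using o x by (auto simp: Q_def y_def)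
  have xe: "x = oproj E x \<oplus> y" by (rule vec_eqI) (use x o in \<open>auto simp: y_def\<close>)
  have "(T ^^ n) x = of_real (s ^ n) \<odot> oproj E x \<oplus> (T ^^ n) y"
   using ln(2)[OF o(3) yH] pE[OF o(1)] xe by metis
  hence "of_real (1 / s ^ n) \<odot> (T ^^ n) x \<ominus> oproj E x = of_real (1 / s ^ n) \<odot> (T ^^ n) y"
   using s(1) o(3) yH ln(1) by (intro vec_eqI) (auto simp: algebra_simps)
  hence "nm (of_real (1 / s ^ n) \<odot> (T ^^ n) x \<ominus> oproj E x) = 1 / s ^ n * nm ((T ^^ n) y)"
   using ln(1)[OF yH] s(1) by (simp add: norm_divide norm_power)
  also have "\<dots> <= 1 / s ^ n * (s2 ^ n * nm y)" using pO[OF yO] s by (intro mult_left_mono) auto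
  also have "\<dots> = (s2 / s) ^ n * nm y" by (simp add: power_divide)
  also have "\<dots> <= (s2 / s) ^ n * nm x" using oproj_le(2)[OF Ec x] s2 s by (intro mult_left_mono) (auto simp: y_def)
  finally show ?thesis .
 qed
 moreover have "0 <= s2 / s" "s2 / s < 1" using s2 s by auto
 ultimately show ?thesis unfolding E_def by blast
qed

lemma top_spectral_projection:
 assumes T: "linear_op T" "selfadj T" and bT: "!!x. x \<in> \<H> ==> nm (T x) <= B * nm x"
  and pos: "!!x. x \<in> \<H> ==> 0 <= Re (ip (T x) x)"
  and s: "r < s" "0 < s" "!!x. x \<in> \<H> ==> Re (ip (T x) x) <= s * (nm x)\<^sup>2"
  and I: "finite I" "!!i. i \<in> I ==> a i \<in> \<H>" "!!i. i \<in> I ==> b i \<in> \<H>"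
  and gap: "!!x. x \<in> \<H> ==>
    Re (ip (T x) x) <= r * (nm x)\<^sup>2 + Re (ip (finsum H (\<lambda>i. ip x (a i) \<odot> b i) I) x)"
  and top: "!!s'. s' < s ==> \<exists>x\<in>\<H>. Re (ip (T x) x) > s' * (nm x)\<^sup>2"
 shows "\<exists>v\<in>eigenspace T s. nm v = 1"
  and "\<exists>\<delta>\<ge>0. \<delta> < 1 \<and> (\<forall>n. \<forall>x\<in>\<H>.
   nm (of_real (1 / s ^ n) \<odot> (T ^^ n) x \<ominus> oproj (eigenspace T s) x) <= \<delta> ^ n * nm x)"
  and "\<exists>N. \<forall>U. finite U \<and> orthonormal U \<and> U \<subseteq> eigenspace T s --> card U <= N"
proof -
 define E where "E = eigenspace T s"
 have Ec: "csub E" unfolding E_def by (rule eigenspace_csub[OF T(1) bT])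
 have EH: "E \<subseteq> \<H>" using csubD(1)[OF Ec] .
 show "\<exists>v\<in>eigenspace T s. nm v = 1"
  using top_eigenvector[OF T bT s I gap csub_carrier top] unfolding eigenspace_def by blast
 define Q where "Q = {x \<in> \<H>. \<forall>w\<in>E. ip x w = 0}"
 have Oc: "csub Q" unfolding Q_def by (rule orthogonal_csub[OF EH])
 have "\<exists>s'<s. \<forall>x\<in>Q. Re (ip (T x) x) <= s' * (nm x)\<^sup>2"
 proof (rule ccontr)
  assume "\<not> ?thesis"
  hence t: "\<exists>x\<in>Q. Re (ip (T x) x) > s' * (nm x)\<^sup>2" if "s' < s" for s' using that by force
  have "\<exists>v\<in>Q. nm v = 1 \<and> T v = of_real s \<odot> v"
   by (rule top_eigenvector[OF T bT s I gap Oc t])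
  then obtain v where v: "v \<in> Q" "nm v = 1" "T v = of_real s \<odot> v" by blast
  hence "v \<in> E" "v \<in> \<H>" by (auto simp: Q_def E_def eigenspace_def)
  hence "ip v v = 0" using v by (simp add: Q_def)
  thus False using ip_self[OF \<open>v \<in> \<H>\<close>] v(2) by simp
 qed
 then obtain s' where s': "s' < s" "!!x. x \<in> Q ==> Re (ip (T x) x) <= s' * (nm x)\<^sup>2" by blast
 show "\<exists>\<delta>\<ge>0. \<delta> < 1 \<and> (\<forall>n. \<forall>x\<in>\<H>.
   nm (of_real (1 / s ^ n) \<odot> (T ^^ n) x \<ominus> oproj (eigenspace T s) x) <= \<delta> ^ n * nm x)"
  by (rule powers_to_projection[OF T bT pos s(2) s'(1) s'(2)]) (auto simp: Q_def E_def)
 define K where "K = (\<Sum>i\<in>I. (nm (a i))\<^sup>2 + (nm (b i))\<^sup>2)"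
 have "card U <= nat \<lceil>K / (s - r)\<rceil>" if U: "finite U" "orthonormal U" "U \<subseteq> E" for U
 proof -
  have "real (card U) * (s - r) <= K" unfolding K_def
  proof (rule trace_bound[OF U(2,1) I])
   fix u assume u: "u \<in> U"
   hence uH: "u \<in> \<H>" "nm u = 1" "T u = of_real s \<odot> u"
    using U orthonormal_mem orthonormal_nm by (auto simp: E_def eigenspace_def)
   thus "s - r <= Re (ip (finsum H (\<lambda>i. ip u (a i) \<odot> b i) I) u)"
    using gap[OF uH(1)] by (simp add: ip_self)
  qed auto
  hence "real (card U) <= K / (s - r)" using s(1) by (simp add: field_simps)
  thus ?thesis by linarith
 qed
 thus "\<exists>N. \<forall>U. finite U \<and> orthonormal U \<and> U \<subseteq> eigenspace T s --> card U <= N"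
  unfolding E_def by blast
qed

end

section \<open>Operator norms\<close>

context complex_hilbert
begin

lemma bounded_opsI:
 assumes "linear_op A" "A \<in> extensional (\<H>)" "!!x. x \<in> \<H> ==> nm (A x) <= C * nm x"
 shows "A \<in> bounded_ops H"
 using assms unfolding bounded_ops_def linear_op_def PiE_def by blast

lemma bounded_opsD:
 assumes "A \<in> bounded_ops H"
 shows "linear_op A" "A \<in> extensional (\<H>)" "\<exists>C. \<forall>x\<in>\<H>. nm (A x) <= C * nm x"
 using assms unfolding bounded_ops_def linear_op_def PiE_def by auto

lemma vec_diff_self [simp]: "x \<in> \<H> ==> x \<ominus> x = \<zero>"
 by (simp add: a_minus_def M.r_neg)

lemma nm_pos: "x \<in> \<H> ==> x ~= \<zero> ==> nm x > 0"
 using nm_ge0[of x] nm_eq0[of x] by linarith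

lemma opnorm_le:
 assumes "!!x. x \<in> \<H> ==> nm (A x) <= C * nm x" "0 <= C"
 shows "opnorm H A <= C"
 unfolding opnorm_def
proof (rule cSup_least)
 show "{nm (A x) |x. x \<in> \<H> \<and> nm x <= 1} ~= {}" using nm_zero M.zero_closed by fastforce
 fix y assume "y \<in> {nm (A x) |x. x \<in> \<H> \<and> nm x <= 1}"
 then obtain x where x: "y = nm (A x)" "x \<in> \<H>" "nm x <= 1" by blast
 thus "y <= C" using assms(1)[OF x(2)] mult_left_le[OF x(3) assms(2)] by linarith
qed

lemma opnorm_upper:
 assumes A: "A \<in> bounded_ops H" and x: "x \<in> \<H>" "nm x <= 1"
 shows "nm (A x) <= opnorm H A"
 unfolding opnorm_def
proof (rule cSup_upper)
 obtain C where C: "\<forall>x\<in>\<H>. nm (A x) <= C * nm x" using bounded_opsD(3)[OF A] by blast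
 show "bdd_above {nm (A x) |x. x \<in> \<H> \<and> nm x <= 1}"
 proof (rule bdd_aboveI[of _ "\<bar>C\<bar>"])
  fix y assume "y \<in> {nm (A x) |x. x \<in> \<H> \<and> nm x <= 1}"
  then obtain x where x: "y = nm (A x)" "x \<in> \<H>" "nm x <= 1" by blast
  have "nm (A x) <= \<bar>C\<bar> * nm x" using C x(2) mult_right_mono[OF abs_ge_self[of C] nm_ge0[OF x(2)]] by fastforce
  also have "\<dots> <= \<bar>C\<bar> * 1" using x(3) by (intro mult_left_mono) auto
  finally show "y <= \<bar>C\<bar>" using x(1) by simp
 qed
qed (use x in blast)

lemma opnorm_ge0: "A \<in> bounded_ops H ==> 0 <= opnorm H A"
 using opnorm_upper[of A \<zero>] linear_opD(5)[OF bounded_opsD(1), of A] by simp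

lemma opnorm_bound:
 assumes A: "A \<in> bounded_ops H" and x: "x \<in> \<H>"
 shows "nm (A x) <= opnorm H A * nm x"
proof (cases "x = \<zero>")
 case True
 thus ?thesis using linear_opD(5)[OF bounded_opsD(1)[OF A]] by simp
next
 case False
 note l = linear_opD[OF bounded_opsD(1)[OF A]]
 have n: "nm x > 0" using nm_pos[OF x False] .
 have "nm (A (of_real (1 / nm x) \<odot> x)) <= opnorm H A"
  by (rule opnorm_upper[OF A]) (use x n in \<open>auto simp: norm_divide\<close>)
 thus ?thesis using l(1,3)[OF x] n by (simp add: norm_divide field_simps)
qed

lemma op_diff_bounded:
 assumes C: "C \<in> bounded_ops H" and D: "D \<in> bounded_ops H" shows "op_diff H C D \<in> bounded_ops H"
proof -
 note c = linear_opD[OF bounded_opsD(1)[OF C]] and d = linear_opD[OF bounded_opsD(1)[OF D]]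
 obtain a where a: "\<forall>z\<in>\<H>. nm (C z) <= a * nm z" using bounded_opsD(3)[OF C] by blast
 obtain b where b: "\<forall>z\<in>\<H>. nm (D z) <= b * nm z" using bounded_opsD(3)[OF D] by blast
 show ?thesis
 proof (rule bounded_opsI[where C = "a + b"])
  show "linear_op (op_diff H C D)" unfolding linear_op_def op_diff_def
   using c(1-3) d(1-3) by (auto intro!: vec_eqI simp: algebra_simps)
  fix z assume z: "z \<in> \<H>"
  have "nm (C z \<ominus> D z) <= nm (C z) + nm (D z)" using c(1)[OF z] d(1)[OF z] by (rule nm_diff_le)
  also have "\<dots> <= a * nm z + b * nm z" using a b z by (intro add_mono) auto
  finally show "nm (op_diff H C D z) <= (a + b) * nm z" using z by (simp add: op_diff_def algebra_simps)
 qed (simp add: op_diff_def)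
qed

lemma opnorm_eqI:
 assumes "A \<in> bounded_ops H" "!!x. x \<in> \<H> ==> nm (A x) <= s * nm x" "0 <= s"
  and v: "v \<in> \<H>" "nm v = 1" "nm (A v) = s"
 shows "opnorm H A = s"
 using opnorm_le[OF assms(2,3)] opnorm_upper[OF assms(1) v(1)] v by simp

text \<open>For \<open>0 <= K <= 1\<close> the sequence \<open>\<langle>K\<^sup>k x, x\<rangle>\<close> is decreasing and convex, hence its decrement
 at \<open>k = 2 n\<close> is at most the average decrement before it.\<close>

lemma contraction_decrement:
 assumes K: "linear_op K" "selfadj K"
  and pos: "!!x. x \<in> \<H> ==> 0 <= Re (ip (K x) x)"
  and x: "x \<in> \<H>"
 shows "(2 * real n + 1) * ((nm ((K ^^ n) x))\<^sup>2 - Re (ip (K ((K ^^ n) x)) ((K ^^ n) x))) <= (nm x)\<^sup>2"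
proof -
 note l = linear_opD[OF K(1)]
 have pc[simp]: "(K ^^ k) x \<in> \<H>" for k using linear_opD(1)[OF linear_op_funpow[OF K(1)] x] .
 define d where "d k = Re (ip ((K ^^ k) x) x)" for k
 have sa: "ip (K u) v = ip u (K v)" if "u \<in> \<H>" "v \<in> \<H>" for u v
  using K(2) that unfolding selfadj_def by blast
 have mv: "ip ((K ^^ (i + j)) x) x = ip ((K ^^ i) x) ((K ^^ j) x)" for i j
 proof (induction j arbitrary: i)
  case (Suc j)
  have "ip ((K ^^ (i + Suc j)) x) x = ip (K ((K ^^ i) x)) ((K ^^ j) x)" using Suc[of "Suc i"] by simp
  also have "\<dots> = ip ((K ^^ i) x) (K ((K ^^ j) x))" by (rule sa) auto
  finally show ?case by simp
 qed simp
 have de: "d (i + j) = Re (ip ((K ^^ i) x) ((K ^^ j) x))" for i j using mv by (simp add: d_def)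
 have d0: "0 <= d k" for k
 proof (cases "even k")
  case True
  then obtain j where "k = 2 * j" by (elim evenE)
  hence "k = j + j" by simp
  thus ?thesis using de[of j j] nm_sq[OF pc[of j]] by (metis zero_le_power2)
 next
  case False
  then obtain j where "k = 2 * j + 1" by (elim oddE)
  hence "k = Suc j + j" by simp
  thus ?thesis using de[of "Suc j" j] pos[OF pc[of j]] by simp
 qed
 have conv: "d k - d (Suc k) \<ge> d (Suc k) - d (Suc (Suc k))" for k
 proof (cases "even k")
  case True
  then obtain j where "k = 2 * j" by (elim evenE)
  hence j: "k = j + j" by simp
  define y where "y = (K ^^ j) x \<ominus> (K ^^ Suc j) x"
  have yc: "y \<in> \<H>" by (simp add: y_def del: funpow.simps)
  have "Re (ip y y) = d (j + j) - d (j + Suc j) - d (Suc j + j) + d (Suc j + Suc j)"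
   by (simp add: y_def de del: funpow.simps add_Suc add_Suc_right)
  hence "Re (ip y y) = d k - 2 * d (Suc k) + d (Suc (Suc k))" by (simp add: j)
  moreover have "Re (ip y y) \<ge> 0" using nm_sq[OF yc] by (metis zero_le_power2)
  ultimately show ?thesis by linarith
 next
  case False
  then obtain j where "k = 2 * j + 1" by (elim oddE)
  hence j: "k = Suc j + j" by simp
  define y where "y = (K ^^ j) x \<ominus> (K ^^ Suc j) x"
  have yc: "y \<in> \<H>" by (simp add: y_def del: funpow.simps)
  have "K y = (K ^^ Suc j) x \<ominus> (K ^^ Suc (Suc j)) x"
   using l(4)[OF pc pc, of j "Suc j"] by (simp add: y_def)
  hence "Re (ip (K y) y) = d (Suc j + j) - d (Suc j + Suc j) - d (Suc (Suc j) + j) + d (Suc (Suc j) + Suc j)"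
   by (simp add: y_def de del: funpow.simps add_Suc add_Suc_right)
  hence "Re (ip (K y) y) = d k - 2 * d (Suc k) + d (Suc (Suc k))" by (simp add: j)
  thus ?thesis using pos[OF yc] by linarith
 qed
 have mono: "d (2 * n) - d (Suc (2 * n)) <= d k - d (Suc k)" if "k <= 2 * n" for k
  using that by (induction rule: inc_induct) (use conv in \<open>auto intro: order_trans\<close>)
 have "(2 * real n + 1) * (d (2 * n) - d (Suc (2 * n))) = (\<Sum>k\<le>2 * n. d (2 * n) - d (Suc (2 * n)))" by simp
 also have "\<dots> <= (\<Sum>k\<le>2 * n. d k - d (Suc k))" using mono by (intro sum_mono) simp
 also have "\<dots> = d 0 - d (Suc (2 * n))" by (simp add: sum_telescope)
 also have "\<dots> <= d 0" using d0 by simp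
 also have "\<dots> = (nm x)\<^sup>2" using x by (simp add: d_def nm_sq)
 finally have "(2 * real n + 1) * (d (n + n) - d (Suc n + n)) <= (nm x)\<^sup>2"
  by (simp only: mult_2 add_Suc)
 thus ?thesis unfolding de by (simp only: nm_sq[OF pc] funpow.simps o_apply)
qed

end

section \<open>The group algebra and its representations\<close>

definition l1norm :: "('g => complex) => real" where
 "l1norm f = (\<Sum>g | f g ~= 0. cmod (f g))"

definition ga_single :: "'g => 'g => complex" where
 "ga_single g = (\<lambda>h. if h = g then 1 else 0)"

definition ga_star :: "('g, 'n) monoid_scheme => ('g => complex) => 'g => complex" where
 "ga_star G f = (\<lambda>g. if g \<in> carrier G then cnj (f (inv\<^bsub>G\<^esub> g)) else 0)"

definition ga_conv :: "('g, 'n) monoid_scheme => ('g => complex) => ('g => complex) => 'g => complex" where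
 "ga_conv G f h = (\<lambda>x. if x \<in> carrier G then \<Sum>y | f y ~= 0. f y * h (inv\<^bsub>G\<^esub> y \<otimes>\<^bsub>G\<^esub> x) else 0)"

lemma group_algebraI: "[|finite S; S \<subseteq> carrier G; !!g. g \<notin> S ==> f g = 0|] ==> f \<in> group_algebra G"
 unfolding group_algebra_def by (auto intro: finite_subset[of _ S])

lemma group_algebraD:
 "f \<in> group_algebra G ==> finite {g. f g ~= 0}" "f \<in> group_algebra G ==> {g. f g ~= 0} \<subseteq> carrier G"
 "f \<in> group_algebra G ==> f g ~= 0 ==> g \<in> carrier G"
 unfolding group_algebra_def by auto

lemma group_algebra_add:
 "f \<in> group_algebra G ==> h \<in> group_algebra G ==> (\<lambda>g. f g + h g) \<in> group_algebra G"
 by (rule group_algebraI[of "{g. f g ~= 0} \<union> {g. h g ~= 0}"]) (auto dest: group_algebraD)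

lemma group_algebra_diff:
 "f \<in> group_algebra G ==> h \<in> group_algebra G ==> f - h \<in> group_algebra G"
 by (rule group_algebraI[of "{g. f g ~= 0} \<union> {g. h g ~= 0}"]) (auto dest: group_algebraD)

lemma group_algebra_scale: "f \<in> group_algebra G ==> (\<lambda>g. c * f g) \<in> group_algebra G"
 by (rule group_algebraI[of "{g. f g ~= 0}"]) (auto dest: group_algebraD)

lemma group_algebra_single: "g \<in> carrier G ==> ga_single g \<in> group_algebra G"
 by (rule group_algebraI[of "{g}"]) (auto simp: ga_single_def)

context group
begin

lemma group_algebra_star: assumes "f \<in> group_algebra G" shows "ga_star G f \<in> group_algebra G"
proof (rule group_algebraI[of "m_inv G ` {g. f g ~= 0}"])
 fix g assume g: "g \<notin> m_inv G ` {g. f g ~= 0}"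
 show "ga_star G f g = 0"
 proof (cases "g \<in> carrier G")
  case True
  hence "g = inv (inv g)" by simp
  hence "f (inv g) = 0" using g by blast
  thus ?thesis by (simp add: ga_star_def)
 qed (simp add: ga_star_def)
qed (use group_algebraD[OF assms] in auto)

lemma group_algebra_conv:
 assumes f: "f \<in> group_algebra G" and h: "h \<in> group_algebra G" shows "ga_conv G f h \<in> group_algebra G"
proof (rule group_algebraI[of "(\<lambda>(y, z). y \<otimes> z) ` ({g. f g ~= 0} \<times> {g. h g ~= 0})"])
 fix x assume x: "x \<notin> (\<lambda>(y, z). y \<otimes> z) ` ({g. f g ~= 0} \<times> {g. h g ~= 0})"
 show "ga_conv G f h x = 0"
 proof (cases "x \<in> carrier G")
  case True
  have "f y * h (inv y \<otimes> x) = 0" if "f y ~= 0" for y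
  proof -
   have "y \<in> carrier G" using group_algebraD(3)[OF f that] .
   hence "x = y \<otimes> (inv y \<otimes> x)" using True by (simp add: m_assoc[symmetric])
   hence "h (inv y \<otimes> x) = 0" using x that by force
   thus ?thesis by simp
  qed
  thus ?thesis by (simp add: ga_conv_def)
 qed (simp add: ga_conv_def)
qed (use group_algebraD[OF f] group_algebraD[OF h] in auto)

lemma ga_conv_sum:
 assumes f: "f \<in> group_algebra G" and h: "h \<in> group_algebra G"
 shows "(\<Sum>x | ga_conv G f h x ~= 0. ga_conv G f h x * c x)
  = (\<Sum>y | f y ~= 0. \<Sum>z | h z ~= 0. f y * h z * c (y \<otimes> z))"
proof -
 define F where "F = {g. f g ~= 0}"
 define K where "K = {g. h g ~= 0}"
 have FK: "finite F" "finite K" "F \<subseteq> carrier G" "K \<subseteq> carrier G"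
  using group_algebraD[OF f] group_algebraD[OF h] by (auto simp: F_def K_def)
 define S where "S = (\<lambda>(y, z). y \<otimes> z) ` (F \<times> K)"
 have S: "finite S" "S \<subseteq> carrier G" using FK by (auto simp: S_def)
 have 0: "ga_conv G f h x = 0" if "x \<notin> S" for x
 proof (cases "x \<in> carrier G")
  case True
  have "f y * h (inv y \<otimes> x) = 0" if "f y ~= 0" for y
  proof -
   have y: "y \<in> carrier G" using group_algebraD(3)[OF f that] .
   hence "x = y \<otimes> (inv y \<otimes> x)" using True by (simp add: m_assoc[symmetric])
   hence "h (inv y \<otimes> x) = 0" using \<open>x \<notin> S\<close> that unfolding S_def F_def K_def by force
   thus ?thesis by simp
  qed
  thus ?thesis by (simp add: ga_conv_def)
 qed (simp add: ga_conv_def)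
 have "(\<Sum>x | ga_conv G f h x ~= 0. ga_conv G f h x * c x) = (\<Sum>x\<in>S. ga_conv G f h x * c x)"
  using 0 S(1) by (intro sum.mono_neutral_left) auto
 also have "\<dots> = (\<Sum>x\<in>S. \<Sum>y\<in>F. f y * h (inv y \<otimes> x) * c x)"
  using S(2) by (intro sum.cong) (auto simp: ga_conv_def F_def sum_distrib_right)
 also have "\<dots> = (\<Sum>y\<in>F. \<Sum>x\<in>S. f y * h (inv y \<otimes> x) * c x)" by (rule sum.swap)
 also have "\<dots> = (\<Sum>y\<in>F. \<Sum>z\<in>K. f y * h z * c (y \<otimes> z))"
 proof (rule sum.cong)
  fix y assume y: "y \<in> F"
  hence yc: "y \<in> carrier G" using FK by auto
  have inj: "inj_on (\<lambda>z. y \<otimes> z) K" using yc FK(4) l_cancel by (meson inj_onI subsetD)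
  have "(\<Sum>z\<in>K. f y * h z * c (y \<otimes> z)) = (\<Sum>x\<in>(\<lambda>z. y \<otimes> z) ` K. f y * h (inv y \<otimes> x) * c x)"
   unfolding sum.reindex[OF inj] using yc FK(4) by (intro sum.cong) (auto simp: m_assoc[symmetric])
  also have "\<dots> = (\<Sum>x\<in>S. f y * h (inv y \<otimes> x) * c x)"
  proof (rule sum.mono_neutral_left)
   show "\<forall>x\<in>S - (\<lambda>z. y \<otimes> z) ` K. f y * h (inv y \<otimes> x) * c x = 0"
   proof
    fix x assume x: "x \<in> S - (\<lambda>z. y \<otimes> z) ` K"
    hence "x = y \<otimes> (inv y \<otimes> x)" using S yc by (auto simp: m_assoc[symmetric])
    hence "inv y \<otimes> x \<notin> K" using x by blast
    thus "f y * h (inv y \<otimes> x) * c x = 0" by (simp add: K_def)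
   qed
  qed (use S y in \<open>auto simp: S_def\<close>)
  finally show "(\<Sum>x\<in>S. f y * h (inv y \<otimes> x) * c x) = (\<Sum>z\<in>K. f y * h z * c (y \<otimes> z))" by simp
 qed simp
 finally show ?thesis by (simp add: F_def K_def)
qed

lemma ga_star_sum:
 assumes f: "f \<in> group_algebra G"
 shows "(\<Sum>x | ga_star G f x ~= 0. ga_star G f x * c x) = (\<Sum>y | f y ~= 0. cnj (f y) * c (inv y))"
proof -
 have inj: "inj_on (m_inv G) {y. f y ~= 0}"
  using group_algebraD(2)[OF f] by (auto intro!: inj_onI dest: inv_inj[THEN inj_onD])
 have "{x. ga_star G f x ~= 0} = m_inv G ` {y. f y ~= 0}"
  using group_algebraD(3)[OF f] by (force simp: ga_star_def image_iff)
 hence "(\<Sum>x | ga_star G f x ~= 0. ga_star G f x * c x) = (\<Sum>y | f y ~= 0. ga_star G f (inv y) * c (inv y))"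
  by (simp add: sum.reindex[OF inj])
 also have "\<dots> = (\<Sum>y | f y ~= 0. cnj (f y) * c (inv y))"
  using group_algebraD(3)[OF f] by (intro sum.cong) (auto simp: ga_star_def)
 finally show ?thesis .
qed

end

locale unitary_action = complex_hilbert H + G: group G
 for H :: "('h, 'm) inner_module_scheme" (structure) and G :: "('g, 'n) monoid_scheme" +
 fixes \<pi> :: "'g => 'h => 'h"
 assumes rep: "\<pi> \<in> hom G (unitary_group H)"
begin

lemma rep_mem: assumes "g \<in> carrier G"
 shows "\<pi> g \<in> bounded_ops H" "bij_betw (\<pi> g) (\<H>) (\<H>)"
  "[|x \<in> \<H>; y \<in> \<H>|] ==> ip (\<pi> g x) (\<pi> g y) = ip x y"
 using rep assms by (auto simp: hom_def unitary_group_def)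

lemma act_linear: "g \<in> carrier G ==> linear_op (\<pi> g)"
 using bounded_opsD(1) rep_mem(1) by blast

lemma act_closed [simp]: "[|g \<in> carrier G; x \<in> \<H>|] ==> \<pi> g x \<in> \<H>"
 using linear_opD(1)[OF act_linear] by blast

lemma act_nm [simp]: "[|g \<in> carrier G; x \<in> \<H>|] ==> nm (\<pi> g x) = nm x"
 by (simp add: hnorm_def rep_mem(3))

lemma rep_Bij: assumes "g \<in> carrier G" shows "\<pi> g \<in> Bij (\<H>)"
 using rep_mem[OF assms] bounded_opsD(2) by (auto simp: Bij_def)

lemma act_mult:
 assumes "g \<in> carrier G" "h \<in> carrier G" "x \<in> \<H>"
 shows "\<pi> (g \<otimes>\<^bsub>G\<^esub> h) x = \<pi> g (\<pi> h x)"
proof -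
 have "\<pi> (g \<otimes>\<^bsub>G\<^esub> h) = \<pi> g \<otimes>\<^bsub>unitary_group H\<^esub> \<pi> h" using rep assms by (auto simp: hom_def)
 thus ?thesis using assms rep_Bij by (simp add: unitary_group_def BijGroup_def compose_def)
qed

lemma act_one [simp]: assumes "x \<in> \<H>" shows "\<pi> \<one>\<^bsub>G\<^esub> x = x"
proof -
 have "\<pi> \<one>\<^bsub>G\<^esub> (\<pi> \<one>\<^bsub>G\<^esub> x) = \<pi> \<one>\<^bsub>G\<^esub> x" using act_mult[of "\<one>\<^bsub>G\<^esub>" "\<one>\<^bsub>G\<^esub>" x] assms by simp
 thus ?thesis using rep_mem(2)[of "\<one>\<^bsub>G\<^esub>"] assms by (auto simp: bij_betw_def inj_on_def)
qed

lemma act_adj: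
 assumes "g \<in> carrier G" "x \<in> \<H>" "y \<in> \<H>"
 shows "ip (\<pi> g x) y = ip x (\<pi> (inv\<^bsub>G\<^esub> g) y)"
proof -
 have "\<pi> g (\<pi> (inv\<^bsub>G\<^esub> g) y) = y" using act_mult[of g "inv\<^bsub>G\<^esub> g" y] assms by simp
 thus ?thesis using rep_mem(3)[of g x "\<pi> (inv\<^bsub>G\<^esub> g) y"] assms by simp
qed

abbreviation rho :: "('g => complex) => 'h => 'h" where "rho \<equiv> group_algebra_rep H \<pi>"

lemma rho_closed [simp]: "[|f \<in> group_algebra G; x \<in> \<H>|] ==> rho f x \<in> \<H>"
 using group_algebraD(3)[of f G] by (auto simp: group_algebra_rep_def)

lemma ip_rho:
 assumes "f \<in> group_algebra G" "x \<in> \<H>" "y \<in> \<H>"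
 shows "ip (rho f x) y = (\<Sum>g | f g ~= 0. f g * ip (\<pi> g x) y)"
proof -
 note D = group_algebraD[OF assms(1)]
 have "ip (rho f x) y = (\<Sum>g | f g ~= 0. ip (f g \<odot> \<pi> g x) y)"
  using assms(2,3) D ip_sum_left[OF D(1), of "\<lambda>g. f g \<odot> \<pi> g x" y] by (simp add: group_algebra_rep_def)
 also have "\<dots> = (\<Sum>g | f g ~= 0. f g * ip (\<pi> g x) y)"
  using assms(2,3) D(3) by (intro sum.cong) auto
 finally show ?thesis .
qed

lemma ip_rho_sum:
 assumes "f \<in> group_algebra G" "x \<in> \<H>" "y \<in> \<H>" "finite S" "!!g. f g ~= 0 ==> g \<in> S"
 shows "ip (rho f x) y = (\<Sum>g\<in>S. f g * ip (\<pi> g x) y)"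
 unfolding ip_rho[OF assms(1-3)] using assms(4,5) by (intro sum.mono_neutral_left) auto

lemma rho_linear: assumes f: "f \<in> group_algebra G" shows "linear_op (rho f)"
 unfolding linear_op_def
proof (intro conjI ballI allI)
 fix x y c assume x: "x \<in> \<H>" and y: "y \<in> \<H>"
 note a = linear_opD[OF act_linear] and fG = group_algebraD(3)[OF f]
 show "rho f (x \<oplus> y) = rho f x \<oplus> rho f y"
 proof (rule vec_eqI)
  fix z assume z: "z \<in> \<H>"
  show "ip (rho f (x \<oplus> y)) z = ip (rho f x \<oplus> rho f y) z"
   using x y z f fG a by (simp add: ip_rho sum.distrib[symmetric] distrib_left cong: sum.cong_simp)
 qed (use x y f in auto)
 show "rho f (c \<odot> x) = c \<odot> rho f x"
 proof (rule vec_eqI)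
  fix z assume z: "z \<in> \<H>"
  show "ip (rho f (c \<odot> x)) z = ip (c \<odot> rho f x) z"
   using x y z f fG a by (simp add: ip_rho sum_distrib_left mult_ac cong: sum.cong_simp)
 qed (use x f in auto)
qed (use f in auto)

lemma rho_bound: assumes f: "f \<in> group_algebra G" and x: "x \<in> \<H>"
 shows "nm (rho f x) <= l1norm f * nm x"
proof -
 have "nm (rho f x) <= (\<Sum>g | f g ~= 0. nm (f g \<odot> \<pi> g x))"
  using x group_algebraD[OF f] nm_sum_le[OF group_algebraD(1)[OF f], of "\<lambda>g. f g \<odot> \<pi> g x"]
  by (simp add: group_algebra_rep_def)
 also have "\<dots> = (\<Sum>g | f g ~= 0. cmod (f g) * nm x)"
  using x group_algebraD[OF f] by (intro sum.cong) auto
 finally show ?thesis by (simp add: l1norm_def sum_distrib_right)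
qed

lemma rho_bounded_op: "f \<in> group_algebra G ==> rho f \<in> bounded_ops H"
 using rho_bound rho_linear by (intro bounded_opsI[where C="l1norm f"]) (auto simp: group_algebra_rep_def)

lemma rho_add:
 assumes f: "f \<in> group_algebra G" and h: "h \<in> group_algebra G" and x: "x \<in> \<H>"
 shows "rho (\<lambda>g. f g + h g) x = rho f x \<oplus> rho h x"
proof (rule vec_eqI)
 fix z assume z: "z \<in> \<H>"
 let ?S = "{g. f g ~= 0} \<union> {g. h g ~= 0}"
 have S: "finite ?S" using group_algebraD f h by auto
 have "ip (rho (\<lambda>g. f g + h g) x) z = (\<Sum>g\<in>?S. (f g + h g) * ip (\<pi> g x) z)"
  by (rule ip_rho_sum[OF group_algebra_add[OF f h] x z S]) auto
 also have "\<dots> = (\<Sum>g\<in>?S. f g * ip (\<pi> g x) z) + (\<Sum>g\<in>?S. h g * ip (\<pi> g x) z)"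
  by (simp add: distrib_right sum.distrib)
 also have "\<dots> = ip (rho f x \<oplus> rho h x) z"
  using ip_rho_sum[OF f x z S] ip_rho_sum[OF h x z S] f h x z by simp
 finally show "ip (rho (\<lambda>g. f g + h g) x) z = ip (rho f x \<oplus> rho h x) z" .
qed (use assms group_algebra_add[OF f h] in auto)

lemma rho_scale:
 assumes f: "f \<in> group_algebra G" and x: "x \<in> \<H>"
 shows "rho (\<lambda>g. c * f g) x = c \<odot> rho f x"
proof (rule vec_eqI)
 fix z assume z: "z \<in> \<H>"
 show "ip (rho (\<lambda>g. c * f g) x) z = ip (c \<odot> rho f x) z"
  using ip_rho_sum[OF group_algebra_scale[OF f, of c] x z group_algebraD(1)[OF f]] ip_rho[OF f x z] f x z
  by (simp add: sum_distrib_left mult.assoc)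
qed (use assms group_algebra_scale[OF f] in auto)

lemma rho_diff:
 assumes f: "f \<in> group_algebra G" and h: "h \<in> group_algebra G" and x: "x \<in> \<H>"
 shows "rho (f - h) x = rho f x \<ominus> rho h x"
proof -
 have "f - h = (\<lambda>g. f g + (-1) * h g)" by (auto simp: fun_eq_iff)
 hence "rho (f - h) x = rho f x \<oplus> (-1) \<odot> rho h x"
  using rho_add[OF f group_algebra_scale[OF h, of "-1"] x] rho_scale[OF h x, of "-1"] by simp
 also have "\<dots> = rho f x \<ominus> rho h x" by (rule vec_eqI) (use assms in auto)
 finally show ?thesis .
qed

lemma rho_single:
 assumes "g \<in> carrier G" "x \<in> \<H>" shows "rho (ga_single g) x = \<pi> g x"
proof (rule vec_eqI)
 fix z assume z: "z \<in> \<H>"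
 have "ip (rho (ga_single g) x) z = (\<Sum>h\<in>{g}. ga_single g h * ip (\<pi> h x) z)"
  by (rule ip_rho_sum[OF group_algebra_single[OF assms(1)] assms(2) z])
   (auto simp: ga_single_def split: if_splits)
 thus "ip (rho (ga_single g) x) z = ip (\<pi> g x) z" by (simp add: ga_single_def)
qed (use assms group_algebra_single[of g G] in auto)

lemma rho_conv:
 assumes f: "f \<in> group_algebra G" and h: "h \<in> group_algebra G" and x: "x \<in> \<H>"
 shows "rho (ga_conv G f h) x = rho f (rho h x)"
proof (rule vec_eqI)
 fix z assume z: "z \<in> \<H>"
 have "ip (rho (ga_conv G f h) x) z = (\<Sum>y | f y ~= 0. \<Sum>w | h w ~= 0. f y * h w * ip (\<pi> (y \<otimes>\<^bsub>G\<^esub> w) x) z)"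
  unfolding ip_rho[OF G.group_algebra_conv[OF f h] x z] by (rule G.ga_conv_sum[OF f h])
 also have "\<dots> = (\<Sum>y | f y ~= 0. f y * ip (\<pi> y (rho h x)) z)"
 proof (rule sum.cong)
  fix y assume "y \<in> {y. f y ~= 0}"
  hence y: "y \<in> carrier G" using group_algebraD(3)[OF f] by simp
  have "ip (\<pi> y (rho h x)) z = ip (rho h x) (\<pi> (inv\<^bsub>G\<^esub> y) z)" using y h x z by (simp add: act_adj)
  also have "\<dots> = (\<Sum>w | h w ~= 0. h w * ip (\<pi> w x) (\<pi> (inv\<^bsub>G\<^esub> y) z))" using y z by (intro ip_rho[OF h x]) simp
  also have "\<dots> = (\<Sum>w | h w ~= 0. h w * ip (\<pi> (y \<otimes>\<^bsub>G\<^esub> w) x) z)"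
   using group_algebraD(3)[OF h] x y z by (intro sum.cong) (auto simp: act_mult act_adj[of y])
  finally show "(\<Sum>w | h w ~= 0. f y * h w * ip (\<pi> (y \<otimes>\<^bsub>G\<^esub> w) x) z) = f y * ip (\<pi> y (rho h x)) z"
   by (simp add: sum_distrib_left mult.assoc)
 qed simp
 also have "\<dots> = ip (rho f (rho h x)) z" using f h x z by (simp add: ip_rho)
 finally show "ip (rho (ga_conv G f h) x) z = ip (rho f (rho h x)) z" .
qed (use assms G.group_algebra_conv[OF f h] in auto)

lemma rho_star:
 assumes f: "f \<in> group_algebra G" and x: "x \<in> \<H>" and y: "y \<in> \<H>"
 shows "ip (rho f x) y = ip x (rho (ga_star G f) y)"
proof -
 have "ip x (rho (ga_star G f) y) = cnj (ip (rho (ga_star G f) y) x)"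
  using x y G.group_algebra_star[OF f] by (intro cinner_commute) auto
 also have "ip (rho (ga_star G f) y) x = (\<Sum>g | f g ~= 0. cnj (f g) * ip (\<pi> (inv\<^bsub>G\<^esub> g) y) x)"
  unfolding ip_rho[OF G.group_algebra_star[OF f] y x] by (rule G.ga_star_sum[OF f])
 also have "cnj \<dots> = (\<Sum>g | f g ~= 0. f g * ip (\<pi> g x) y)"
 proof -
  have "cnj (ip (\<pi> (inv\<^bsub>G\<^esub> g) y) x) = ip (\<pi> g x) y" if "f g ~= 0" for g
   using group_algebraD(3)[OF f that] x y cinner_commute[of "\<pi> (inv\<^bsub>G\<^esub> g) y" x] by (simp add: act_adj)
  thus ?thesis by (simp cong: sum.cong_simp)
 qed
 also have "\<dots> = ip (rho f x) y" using f x y by (simp add: ip_rho)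
 finally show ?thesis by simp
qed

end

lemma unitary_rep_action: "unitary_rep G H \<pi> ==> group G ==> unitary_action H G \<pi>"
 unfolding unitary_rep_def separable_hilbert_def
 by (intro unitary_action.intro unitary_action_axioms.intro) auto

section \<open>The image of the maximal C*-algebra is closed\<close>

text \<open>An element \<open>1 - f\<^sup>* f / L\<close> with \<open>L \<ge> \<parallel>f\<parallel>\<^sub>1\<^sup>2\<close>, which every representation sends to a
 positive contraction, and its powers.\<close>

definition ga_cut :: "('g, 'n) monoid_scheme => ('g => complex) => real => 'g => complex" where
 "ga_cut G f L = (\<lambda>g. ga_single \<one>\<^bsub>G\<^esub> g + of_real (- 1 / L) * ga_conv G (ga_star G f) f g)"

primrec ga_pow :: "('g, 'n) monoid_scheme => ('g => complex) => nat => 'g => complex" where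
 "ga_pow G f 0 = ga_single \<one>\<^bsub>G\<^esub>"
| "ga_pow G f (Suc n) = ga_conv G f (ga_pow G f n)"

lemma (in group) ga_cut_closed: "f \<in> group_algebra G ==> ga_cut G f L \<in> group_algebra G"
 unfolding ga_cut_def
 by (intro group_algebra_add group_algebra_scale group_algebra_conv group_algebra_star group_algebra_single) auto

lemma (in group) ga_pow_closed: "f \<in> group_algebra G ==> ga_pow G f n \<in> group_algebra G"
 by (induction n) (auto intro: group_algebra_single group_algebra_conv)

lemma l1norm_nonneg: "0 <= l1norm f" unfolding l1norm_def by (rule sum_nonneg) auto

context unitary_action
begin

lemma rho_pow: "f \<in> group_algebra G ==> x \<in> \<H> ==> rho (ga_pow G f n) x = (rho f ^^ n) x"
 by (induction n) (simp_all add: rho_single rho_conv G.ga_pow_closed)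

lemma rho_cut:
 assumes f: "f \<in> group_algebra G" and L: "L > 0" "(l1norm f)\<^sup>2 <= L"
 defines "K \<equiv> rho (ga_cut G f L)"
 shows "linear_op K" "selfadj K"
  "!!x. x \<in> \<H> ==> Re (ip (K x) x) = (nm x)\<^sup>2 - (nm (rho f x))\<^sup>2 / L"
  "!!x. x \<in> \<H> ==> 0 <= Re (ip (K x) x)"
  "!!x. x \<in> \<H> ==> nm (K x) <= nm x"
  "!!x. x \<in> \<H> ==> K x = x \<ominus> of_real (1 / L) \<odot> rho (ga_star G f) (rho f x)"
proof -
 note fs = G.group_algebra_star[OF f] and fc = G.ga_cut_closed[OF f, of L]
 show Kl: "linear_op K" unfolding K_def by (rule rho_linear[OF fc])
 note l = linear_opD[OF Kl]
 have e: "ip (rho (ga_star G f) (rho f x)) z = ip (rho f x) (rho f z)" if "x \<in> \<H>" "z \<in> \<H>" for x z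
  using rho_star[OF f that(2), of "rho f x"] that f fs cinner_commute[of "rho f z" "rho f x"]
   cinner_commute[of z "rho (ga_star G f) (rho f x)"] by simp
 have ipK: "ip (K x) z = ip x z - of_real (1 / L) * ip (rho f x) (rho f z)"
  if x: "x \<in> \<H>" and z: "z \<in> \<H>" for x z
 proof -
  have "K x = x \<oplus> of_real (- 1 / L) \<odot> rho (ga_star G f) (rho f x)"
   unfolding K_def ga_cut_def using x f fs
   by (subst rho_add) (simp_all add: rho_single rho_scale rho_conv group_algebra_scale group_algebra_single
     G.group_algebra_conv del: of_real_minus of_real_divide)
  thus ?thesis using x z f fs e[OF x z] by simp
 qed
 show K6: "K x = x \<ominus> of_real (1 / L) \<odot> rho (ga_star G f) (rho f x)" if x: "x \<in> \<H>" for x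
 proof (rule vec_eqI)
  fix z assume z: "z \<in> \<H>"
  show "ip (K x) z = ip (x \<ominus> of_real (1 / L) \<odot> rho (ga_star G f) (rho f x)) z"
   using ipK[OF x z] e[OF x z] x z f fs by simp
 qed (use x f fs l in auto)
 show Ks: "selfadj K" unfolding selfadj_def
 proof (intro ballI)
  fix x y assume x: "x \<in> \<H>" and y: "y \<in> \<H>"
  have "ip x (K y) = cnj (ip (K y) x)" using x y l by (intro cinner_commute) auto
  also have "\<dots> = ip x y - of_real (1 / L) * ip (rho f x) (rho f y)"
   using ipK[OF y x] cinner_commute[of x y] cinner_commute[of "rho f x" "rho f y"] x y f by simp
  finally show "ip (K x) y = ip x (K y)" using ipK[OF x y] by simp
 qed
 show K3: "Re (ip (K x) x) = (nm x)\<^sup>2 - (nm (rho f x))\<^sup>2 / L" if x: "x \<in> \<H>" for x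
  using ipK[OF x x] x f by (simp add: nm_sq)
 show K4: "0 <= Re (ip (K x) x)" if x: "x \<in> \<H>" for x
 proof -
  have "(nm (rho f x))\<^sup>2 <= (l1norm f * nm x)\<^sup>2"
   using rho_bound[OF f x] f x by (intro power_mono) auto
  also have "\<dots> <= L * (nm x)\<^sup>2" using L(2) by (simp add: power_mult_distrib mult_right_mono)
  finally have "(nm (rho f x))\<^sup>2 / L <= (nm x)\<^sup>2" using L(1) by (simp add: field_simps)
  thus ?thesis using K3[OF x] by simp
 qed
 have K3': "Re (ip (K x) x) <= 1 * (nm x)\<^sup>2" if x: "x \<in> \<H>" for x using K3[OF x] L by simp
 show "nm (K x) <= nm x" if x: "x \<in> \<H>" for x
 proof -
  have "(nm (K x))\<^sup>2 <= 1 * Re (ip (K x) x)"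
   by (rule positive_form_bound[OF Kl Ks x K4 zero_less_one K3']) (use l x in auto)
  hence "(nm (K x))\<^sup>2 <= (nm x)\<^sup>2" using K3'[OF x] by simp
  thus ?thesis by (rule power2_le_imp_le) (use x in auto)
 qed
qed

lemma rho_star_bound:
 assumes f: "f \<in> group_algebra G" and M: "!!x. x \<in> \<H> ==> nm (rho f x) <= M * nm x" and y: "y \<in> \<H>"
 shows "nm (rho (ga_star G f) y) <= M * nm y"
proof -
 let ?s = "rho (ga_star G f) y"
 have s: "?s \<in> \<H>" using G.group_algebra_star[OF f] y by simp
 show ?thesis
 proof (cases "?s = \<zero>")
  case True
  have "0 <= M * nm y" using M[OF y] nm_ge0[of "rho f y"] f y by (smt (verit) rho_closed)
  thus ?thesis using True by simp
 next
  case False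
  hence p: "nm ?s > 0" using nm_pos s by blast
  have "(nm ?s)\<^sup>2 = Re (ip (rho f ?s) y)" using rho_star[OF f s y] nm_sq[OF s] by simp
  also have "\<dots> <= nm (rho f ?s) * nm y"
   using cauchy_schwarz[of "rho f ?s" y] complex_Re_le_cmod[of "ip (rho f ?s) y"] s y f by fastforce
  also have "\<dots> <= (M * nm ?s) * nm y" using M[OF s] y by (intro mult_right_mono) auto
  finally have "nm ?s * nm ?s <= (M * nm y) * nm ?s" by (simp add: power2_eq_square mult_ac)
  thus ?thesis using p by simp
 qed
qed

lemma cut_power_norm:
 assumes f: "f \<in> group_algebra G" and L: "L > 0" "(l1norm f)\<^sup>2 <= L" and x: "x \<in> \<H>"
 shows "(nm (rho (ga_conv G f (ga_pow G (ga_cut G f L) n)) x))\<^sup>2 <= L / (2 * real n + 1) * (nm x)\<^sup>2"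
proof -
 define K where "K = rho (ga_cut G f L)"
 note k = rho_cut[OF f L, folded K_def] and fc = G.ga_cut_closed[OF f, of L]
 define y where "y = (K ^^ n) x"
 have y: "y \<in> \<H>" unfolding y_def using linear_opD(1)[OF linear_op_funpow[OF k(1)] x] .
 have e: "rho (ga_conv G f (ga_pow G (ga_cut G f L) n)) x = rho f y"
  using x by (simp add: rho_conv[OF f G.ga_pow_closed[OF fc] x] rho_pow[OF fc x] y_def K_def)
 have "(nm (rho f y))\<^sup>2 = L * ((nm y)\<^sup>2 - Re (ip (K y) y))" using k(3)[OF y] L by simp
 moreover have "(2 * real n + 1) * ((nm y)\<^sup>2 - Re (ip (K y) y)) <= (nm x)\<^sup>2"
  unfolding y_def by (rule contraction_decrement[OF k(1,2,4) x])
 hence "L * ((2 * real n + 1) * ((nm y)\<^sup>2 - Re (ip (K y) y))) <= L * (nm x)\<^sup>2" using L by simp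
 ultimately have "(2 * real n + 1) * (nm (rho f y))\<^sup>2 <= L * (nm x)\<^sup>2" by (simp add: mult_ac)
 moreover have "2 * real n + 1 > 0" by linarith
 ultimately show ?thesis unfolding e by (simp add: field_simps)
qed

lemma cut_power_close:
 assumes f: "f \<in> group_algebra G" and L: "L > 0" "(l1norm f)\<^sup>2 <= L"
  and M: "!!x. x \<in> \<H> ==> nm (rho f x) <= M * nm x" "M \<ge> 0" and x: "x \<in> \<H>"
 shows "nm (rho f x \<ominus> rho (ga_conv G f (ga_pow G (ga_cut G f L) n)) x) <= M * (real n * (M\<^sup>2 / L)) * nm x"
proof -
 define K where "K = rho (ga_cut G f L)"
 note k = rho_cut[OF f L, folded K_def] and fc = G.ga_cut_closed[OF f, of L]
 note kl = linear_opD[OF k(1)]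
 have pc[simp]: "(K ^^ j) x \<in> \<H>" for j using linear_opD(1)[OF linear_op_funpow[OF k(1)] x] .
 have one: "nm (x \<ominus> K x) <= M\<^sup>2 / L * nm x"
 proof -
  let ?s = "rho (ga_star G f) (rho f x)"
  have s: "?s \<in> \<H>" using f G.group_algebra_star[OF f] x by simp
  have "x \<ominus> K x = of_real (1 / L) \<odot> ?s" unfolding k(6)[OF x] by (rule vec_eqI) (use x s in auto)
  hence "nm (x \<ominus> K x) = 1 / L * nm ?s" using s L by (simp add: norm_divide)
  also have "\<dots> <= 1 / L * (M * (M * nm x))"
  proof (rule mult_left_mono)
   have "nm ?s <= M * nm (rho f x)" by (rule rho_star_bound[OF f M(1)]) (use f x in auto)
   also have "\<dots> <= M * (M * nm x)" using M(1)[OF x] M(2) by (rule mult_left_mono)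
   finally show "nm ?s <= M * (M * nm x)" .
  qed (use L in simp)
  finally show ?thesis by (simp add: power2_eq_square mult_ac)
 qed
 have many: "nm (x \<ominus> (K ^^ j) x) <= real j * (M\<^sup>2 / L) * nm x" for j
 proof (induction j)
  case (Suc j)
  have "nm (x \<ominus> K ((K ^^ j) x)) <= nm (x \<ominus> K x) + nm (K x \<ominus> K ((K ^^ j) x))"
   using x kl by (intro nm_triangle_diff) auto
  also have "K x \<ominus> K ((K ^^ j) x) = K (x \<ominus> (K ^^ j) x)" using kl(4)[OF x pc] by simp
  also have "nm (K (x \<ominus> (K ^^ j) x)) <= nm (x \<ominus> (K ^^ j) x)" using x by (intro k(5)) simp
  finally have "nm (x \<ominus> (K ^^ Suc j) x) <= M\<^sup>2 / L * nm x + real j * (M\<^sup>2 / L) * nm x"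
   using one Suc by simp
  thus ?case by (simp add: algebra_simps add_divide_distrib)
 qed (use x in simp)
 have "rho f x \<ominus> rho (ga_conv G f (ga_pow G (ga_cut G f L) n)) x = rho f (x \<ominus> (K ^^ n) x)"
  unfolding rho_conv[OF f G.ga_pow_closed[OF fc] x] rho_pow[OF fc x] K_def[symmetric]
  using linear_opD(4)[OF rho_linear[OF f] x pc] by simp
 hence "nm (rho f x \<ominus> rho (ga_conv G f (ga_pow G (ga_cut G f L) n)) x) <= M * nm (x \<ominus> (K ^^ n) x)"
  using M(1)[of "x \<ominus> (K ^^ n) x"] x by simp
 also have "\<dots> <= M * (real n * (M\<^sup>2 / L) * nm x)" using many[of n] M(2) by (rule mult_left_mono)
 finally show ?thesis by (simp add: mult_ac)
qed

end

lemma (in unitary_action) opnorm_le_cstar_norm: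
 fixes H' :: hilbert_univ
 assumes f: "f \<in> group_algebra G" and r: "unitary_rep G H' \<pi>'"
 shows "opnorm H' (group_algebra_rep H' \<pi>' f) <= cstar_norm G f"
 unfolding cstar_norm_def
proof (rule cSup_upper)
 show "bdd_above {opnorm H (group_algebra_rep H \<pi> f) |(H :: hilbert_univ) \<pi>. unitary_rep G H \<pi>}"
 proof (rule bdd_aboveI[of _ "l1norm f"])
  fix y assume "y \<in> {opnorm H (group_algebra_rep H \<pi> f) |(H :: hilbert_univ) \<pi>. unitary_rep G H \<pi>}"
  then obtain K \<theta> where K: "y = opnorm (K :: hilbert_univ) (group_algebra_rep K \<theta> f)" "unitary_rep G K \<theta>" by blast
  interpret k: unitary_action K G \<theta> by (rule unitary_rep_action[OF K(2) G.group_axioms])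
  show "y <= l1norm f" unfolding K(1) by (rule k.opnorm_le) (use k.rho_bound[OF f] l1norm_nonneg in auto)
 qed
qed (use r in blast)

lemma (in unitary_action) cstar_norm_leI:
 fixes H' :: hilbert_univ
 assumes r: "unitary_rep G H' \<pi>'" and C: "0 <= C"
  and b: "!!(K :: hilbert_univ) \<theta> x. unitary_rep G K \<theta> ==> x \<in> carrier K ==>
   hnorm K (group_algebra_rep K \<theta> f x) <= C * hnorm K x"
 shows "cstar_norm G f <= C"
 unfolding cstar_norm_def
proof (rule cSup_least)
 fix y assume "y \<in> {opnorm H (group_algebra_rep H \<pi> f) |(H :: hilbert_univ) \<pi>. unitary_rep G H \<pi>}"
 then obtain K \<theta> where K: "y = opnorm (K :: hilbert_univ) (group_algebra_rep K \<theta> f)" "unitary_rep G K \<theta>" by blast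
 interpret k: unitary_action K G \<theta> by (rule unitary_rep_action[OF K(2) G.group_axioms])
 show "y <= C" unfolding K(1) by (rule k.opnorm_le[OF b[OF K(2)] C])
qed (use r in blast)

context unitary_action
begin

text \<open>Every element of the group algebra can be changed, by half of its norm in the given
 representation, into one whose norm in \<^emph>\<open>all\<close> representations is controlled by its norm in the given
 one: \<open>f (1 - f\<^sup>* f / L)\<^sup>n\<close> with \<open>n\<close> of order \<open>L / M\<^sup>2\<close> cuts \<open>f\<close> off at height \<open>M\<close>.\<close>

lemma lift_with_norm_control:
 assumes f: "f \<in> group_algebra G" and M: "0 < M" "!!x. x \<in> \<H> ==> nm (rho f x) <= M * nm x"
 shows "\<exists>f'\<in>group_algebra G. (\<forall>(K :: hilbert_univ) \<theta>. unitary_rep G K \<theta> -->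
    (\<forall>x\<in>carrier K. hnorm K (group_algebra_rep K \<theta> f' x) <= 2 * M * hnorm K x)) \<and>
   (\<forall>x\<in>\<H>. nm (rho f x \<ominus> rho f' x) <= M / 2 * nm x)"
proof -
 define L where "L = (l1norm f)\<^sup>2 + 1"
 have L: "L > 0" "(l1norm f)\<^sup>2 <= L" by (auto simp: L_def add_nonneg_pos)
 define \<eta> where "\<eta> = M\<^sup>2 / L"
 have eta: "\<eta> > 0" using M L by (simp add: \<eta>_def)
 define n where "n = nat \<lfloor>1 / (2 * \<eta>)\<rfloor>"
 have "0 <= 1 / (2 * \<eta>)" using eta by simp
 hence n: "real n <= 1 / (2 * \<eta>)" "1 / (2 * \<eta>) < real n + 1"
  unfolding n_def by (auto simp: of_nat_nat)
 define f' where "f' = ga_conv G f (ga_pow G (ga_cut G f L) n)"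
 have f'c: "f' \<in> group_algebra G" unfolding f'_def
  by (intro G.group_algebra_conv f G.ga_pow_closed G.ga_cut_closed)
 have "hnorm K (group_algebra_rep K \<theta> f' x) <= 2 * M * hnorm K x"
  if K: "unitary_rep G K \<theta>" and x: "x \<in> carrier K" for K :: hilbert_univ and \<theta> x
 proof -
  interpret k: unitary_action K G \<theta> by (rule unitary_rep_action[OF K G.group_axioms])
  have "(k.nm (k.rho f' x))\<^sup>2 <= L / (2 * real n + 1) * (k.nm x)\<^sup>2"
   unfolding f'_def by (rule k.cut_power_norm[OF f L x])
  also have "\<dots> <= (2 * \<eta> * L) * (k.nm x)\<^sup>2"
  proof (rule mult_right_mono)
   have "1 / (2 * \<eta>) <= 2 * real n + 1" using n by linarith
   hence "1 <= (2 * real n + 1) * (2 * \<eta>)" using eta by (simp add: pos_divide_le_eq)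
   hence "L * 1 <= L * ((2 * real n + 1) * (2 * \<eta>))" using L by (intro mult_left_mono) auto
   thus "L / (2 * real n + 1) <= 2 * \<eta> * L" by (simp add: pos_divide_le_eq add_pos_nonneg mult_ac)
  qed simp
  also have "\<dots> = 2 * M\<^sup>2 * (k.nm x)\<^sup>2" using L by (simp add: \<eta>_def)
  also have "\<dots> <= (2 * M * k.nm x)\<^sup>2" by (simp add: power_mult_distrib)
  finally show ?thesis by (rule power2_le_imp_le) (use M x in auto)
 qed
 moreover have "nm (rho f x \<ominus> rho f' x) <= M / 2 * nm x" if x: "x \<in> \<H>" for x
 proof -
  have "nm (rho f x \<ominus> rho f' x) <= M * (real n * (M\<^sup>2 / L)) * nm x"
   unfolding f'_def by (rule cut_power_close[OF f L M(2) _ x]) (use M in auto)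
  also have "\<dots> <= M * (1 / 2) * nm x"
  proof (intro mult_right_mono mult_left_mono)
   have "real n * \<eta> <= 1 / (2 * \<eta>) * \<eta>" using n(1) eta by (intro mult_right_mono) auto
   also have "\<dots> = 1 / 2" using eta by simp
   finally show "real n * (M\<^sup>2 / L) <= 1 / 2" unfolding \<eta>_def .
  qed (use M x in auto)
  finally show ?thesis by simp
 qed
 ultimately show ?thesis using f'c by blast
qed

definition approximable :: "('h => 'h) => bool" where
 "approximable A \<longleftrightarrow> linear_op A \<and>
   (\<forall>\<epsilon>>0. \<exists>f\<in>group_algebra G. \<forall>x\<in>\<H>. nm (A x \<ominus> rho f x) <= \<epsilon> * nm x)"

lemma approximableD:
 assumes "approximable A" shows "linear_op A"
  "\<epsilon> > 0 ==> \<exists>f\<in>group_algebra G. \<forall>x\<in>\<H>. nm (A x \<ominus> rho f x) <= \<epsilon> * nm x"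
 using assms by (auto simp: approximable_def)

lemma approximable_bounded:
 assumes "approximable A" shows "\<exists>C>0. \<forall>x\<in>\<H>. nm (A x) <= C * nm x"
proof -
 note l = linear_opD[OF approximableD(1)[OF assms]]
 obtain f where f: "f \<in> group_algebra G" "\<forall>x\<in>\<H>. nm (A x \<ominus> rho f x) <= 1 * nm x"
  using approximableD(2)[OF assms zero_less_one] by blast
 have "nm (A x) <= (l1norm f + 1) * nm x" if x: "x \<in> \<H>" for x
  using nm_le_diff[of "A x" "rho f x"] rho_bound[OF f(1) x] f x l by (force simp: algebra_simps)
 moreover have "l1norm f + 1 > 0" using l1norm_nonneg[of f] by linarith
 ultimately show ?thesis by blast
qed

text \<open>An operator that is a limit of operators from the group algebra is the limit of a series whose
 terms decay geometrically in the maximal norm.\<close>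

lemma approximable_cauchy_lift:
 fixes A
 assumes A: "approximable A"
 obtains S where "!!n. S n \<in> group_algebra G"
  "!!n x. x \<in> \<H> ==> nm (A x \<ominus> rho (S n) x) <= (3/4) ^ n * nm x"
  "!!n (K :: hilbert_univ) \<theta> x. unitary_rep G K \<theta> ==> x \<in> carrier K ==>
    hnorm K (group_algebra_rep K \<theta> (S (Suc n) - S n) x) <= 3 * (3/4) ^ n * hnorm K x"
proof -
 note l = linear_opD[OF approximableD(1)[OF A]]
 define P where "P n f \<longleftrightarrow> f \<in> group_algebra G \<and> (\<forall>x\<in>\<H>. nm (A x \<ominus> rho f x) <= (3/4) ^ n * nm x)" for n f
 define Q where "Q n f f' \<longleftrightarrow> (\<forall>(K :: hilbert_univ) \<theta>. unitary_rep G K \<theta> -->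
   (\<forall>x\<in>carrier K. hnorm K (group_algebra_rep K \<theta> (f' - f) x) <= 3 * (3/4) ^ n * hnorm K x))"
  for n :: nat and f f' :: "'g => complex"
 have 0: "\<exists>f. P 0 f" using approximableD(2)[OF A zero_less_one] by (auto simp: P_def)
 have step: "\<exists>f'. P (Suc n) f' \<and> Q n f f'" if "P n f" for f n
 proof -
  define d :: real where "d = (3/4) ^ n"
  have d: "d > 0" by (simp add: d_def)
  have f: "f \<in> group_algebra G" "!!x. x \<in> \<H> ==> nm (A x \<ominus> rho f x) <= d * nm x"
   using that by (auto simp: P_def d_def)
  obtain h where h: "h \<in> group_algebra G" "!!x. x \<in> \<H> ==> nm (A x \<ominus> rho h x) <= d / 8 * nm x"
   using approximableD(2)[OF A, of "d / 8"] d by auto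
  define k where "k = h - f"
  have k: "k \<in> group_algebra G" unfolding k_def by (rule group_algebra_diff[OF h(1) f(1)])
  have kb: "nm (rho k x) <= (9/8 * d) * nm x" if x: "x \<in> \<H>" for x
  proof -
   have "rho k x = rho h x \<ominus> rho f x" unfolding k_def by (rule rho_diff[OF h(1) f(1) x])
   hence "nm (rho k x) <= nm (rho h x \<ominus> A x) + nm (A x \<ominus> rho f x)"
    using nm_triangle_diff[of "rho h x" "A x" "rho f x"] h f l x by simp
   also have "nm (rho h x \<ominus> A x) = nm (A x \<ominus> rho h x)" using h l x by (intro nm_minus_commute) auto
   finally show ?thesis using h(2)[OF x] f(2)[OF x] by (simp add: algebra_simps)
  qed
  obtain k' where k': "k' \<in> group_algebra G"
   "!!(K :: hilbert_univ) \<theta> x. unitary_rep G K \<theta> ==> x \<in> carrier K ==> hnorm K (group_algebra_rep K \<theta> k' x) <= 2 * (9/8 * d) * hnorm K x"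
   "!!x. x \<in> \<H> ==> nm (rho k x \<ominus> rho k' x) <= (9/8 * d) / 2 * nm x"
   using lift_with_norm_control[OF k _ kb] d by auto
  define f' where "f' = (\<lambda>g. f g + k' g)"
  have f': "f' \<in> group_algebra G" unfolding f'_def by (rule group_algebra_add[OF f(1) k'(1)])
  have ff: "f' - f = k'" by (simp add: f'_def fun_eq_iff)
  have "nm (A x \<ominus> rho f' x) <= 3/4 * d * nm x" if x: "x \<in> \<H>" for x
  proof -
   have "A x \<ominus> rho f' x = (A x \<ominus> rho h x) \<oplus> (rho k x \<ominus> rho k' x)"
    unfolding f'_def k_def rho_add[OF f(1) k'(1) x] rho_diff[OF h(1) f(1) x]
    by (rule vec_eqI) (use f(1) h(1) k'(1) l x in auto)
   hence "nm (A x \<ominus> rho f' x) <= nm (A x \<ominus> rho h x) + nm (rho k x \<ominus> rho k' x)"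
    using nm_triangle[of "A x \<ominus> rho h x" "rho k x \<ominus> rho k' x"] h k k' l x by simp
   also have "\<dots> <= d / 8 * nm x + (9/8 * d) / 2 * nm x" using h(2)[OF x] k'(3)[OF x] by (rule add_mono)
   also have "\<dots> = 11/16 * (d * nm x)" by simp
   also have "\<dots> <= 3/4 * (d * nm x)" using d x by (intro mult_right_mono) auto
   finally show ?thesis by (simp add: mult_ac)
  qed
  hence "P (Suc n) f'" using f' by (simp add: P_def d_def)
  moreover have "Q n f f'" unfolding Q_def ff
  proof (intro allI impI ballI)
   fix K :: hilbert_univ and \<theta> x assume K: "unitary_rep G K \<theta>" "x \<in> carrier K"
   interpret K: unitary_action K G \<theta> by (rule unitary_rep_action[OF K(1) G.group_axioms])
   have "2 * (9/8 * d) * hnorm K x <= 3 * d * hnorm K x" using d K(2) by (intro mult_right_mono) auto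
   thus "hnorm K (group_algebra_rep K \<theta> k' x) <= 3 * (3/4) ^ n * hnorm K x"
    using k'(2)[OF K] unfolding d_def by (rule order_trans[rotated])
  qed
  ultimately show ?thesis by blast
 qed
 obtain S where S: "!!n. P n (S n)" "!!n. Q n (S n) (S (Suc n))"
  using dependent_nat_choice[of P Q, OF 0] step by metis
 show ?thesis
 proof (rule that)
  show "S n \<in> group_algebra G" for n using S(1) by (simp add: P_def)
  show "nm (A x \<ominus> rho (S n) x) <= (3/4) ^ n * nm x" if "x \<in> \<H>" for n x
   using S(1) that by (simp add: P_def)
  show "hnorm K (group_algebra_rep K \<theta> (S (Suc n) - S n) x) <= 3 * (3/4) ^ n * hnorm K x"
   if "unitary_rep G K \<theta>" "x \<in> carrier K" for n and K :: hilbert_univ and \<theta> x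
   using S(2) that by (simp add: Q_def)
 qed
qed

lemma geometric_series_cauchy:
 fixes K :: hilbert_univ
 assumes S: "!!n. S n \<in> group_algebra G"
  and d: "!!n (K :: hilbert_univ) \<theta> x. unitary_rep G K \<theta> ==> x \<in> carrier K ==>
    hnorm K (group_algebra_rep K \<theta> (S (Suc n) - S n) x) <= 3 * (3/4) ^ n * hnorm K x"
  and r: "unitary_rep G K \<theta>"
 shows "S \<in> cstar_cauchy G"
proof -
 have le: "hnorm K (group_algebra_rep K \<theta> (S (m + k) - S m) x) <= 12 * (3/4) ^ m * (1 - (3/4) ^ k) * hnorm K x"
  if K: "unitary_rep G K \<theta>" and x: "x \<in> carrier K" for K :: hilbert_univ and \<theta> x m k
 proof -
  interpret K: unitary_action K G \<theta> by (rule unitary_rep_action[OF K G.group_axioms])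
  note [simp] = K.rho_diff[OF S S x]
  show ?thesis
  proof (induction k)
   case 0 show ?case unfolding K.rho_diff[OF S S x] using S x by simp
  next
   case (Suc k)
   have "K.nm (K.rho (S (m + Suc k)) x \<ominus>\<^bsub>K\<^esub> K.rho (S m) x)
    <= K.nm (K.rho (S (m + Suc k)) x \<ominus>\<^bsub>K\<^esub> K.rho (S (m + k)) x) + K.nm (K.rho (S (m + k)) x \<ominus>\<^bsub>K\<^esub> K.rho (S m) x)"
    using S x by (intro K.nm_triangle_diff) auto
   also have "\<dots> <= 3 * (3/4) ^ (m + k) * K.nm x + 12 * (3/4) ^ m * (1 - (3/4) ^ k) * K.nm x"
    using d[OF K x, of "m + k"] Suc unfolding K.rho_diff[OF S S x] by (intro add_mono) simp_all
   also have "\<dots> = 12 * (3/4) ^ m * (1 - (3/4) ^ Suc k) * K.nm x"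
    by (simp add: power_add algebra_simps)
   finally show ?case unfolding K.rho_diff[OF S S x] .
  qed
 qed
 have le': "cstar_norm G (S i - S j) <= 12 * (3/4) ^ n" if ij: "n <= i" "n <= j" for i j n
 proof (rule cstar_norm_leI[OF r])
  fix K :: hilbert_univ and \<theta> x assume K: "unitary_rep G K \<theta>" and x: "x \<in> carrier K"
  interpret K: unitary_action K G \<theta> by (rule unitary_rep_action[OF K G.group_axioms])
  have *: "K.nm (K.rho (S b - S a) x) <= 12 * (3/4) ^ n * K.nm x" if "n <= a" "a <= b" for a b
  proof -
   have "K.nm (K.rho (S b - S a) x) <= 12 * (3/4) ^ a * (1 - (3/4) ^ (b - a)) * K.nm x"
    using le[OF K x, of a "b - a"] that by simp
   also have "\<dots> <= 12 * (3/4) ^ n * 1 * K.nm x"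
    using that x by (intro mult_right_mono mult_mono power_decreasing) (auto intro: power_le_one)
   finally show ?thesis by simp
  qed
  show "K.nm (K.rho (S i - S j) x) <= 12 * (3/4) ^ n * K.nm x"
  proof (cases "i <= j")
   case True
   have "K.nm (K.rho (S i - S j) x) = K.nm (K.rho (S j - S i) x)"
    using S x by (simp add: K.rho_diff K.nm_minus_commute)
   thus ?thesis using *[of i j] True ij by simp
  qed (use *[of j i] ij in simp)
 qed simp
 have "(\<lambda>n. 12 * (3/4) ^ n :: real) \<longlonglongrightarrow> 0" by real_asymp
 hence "\<exists>N. \<forall>m\<ge>N. \<forall>n\<ge>N. cstar_norm G (S m - S n) < \<epsilon>" if "\<epsilon> > 0" for \<epsilon>
 proof -
  have "\<forall>\<^sub>F n in sequentially. 12 * (3/4) ^ n < \<epsilon>" using order_tendstoD(2)[OF \<open>_ \<longlonglongrightarrow> 0\<close> that] .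
  then obtain N where "12 * (3/4) ^ N < \<epsilon>" by (auto simp: eventually_sequentially)
  thus ?thesis using le'[of N] by (meson le_less_trans)
 qed
 thus ?thesis using S by (simp add: cstar_cauchy_def)
qed

end

lemma (in complex_hilbert) opnorm_diff_unique:
 assumes A: "A \<in> bounded_ops H" and B: "B \<in> bounded_ops H"
  and F: "!!n. F n \<in> bounded_ops H"
  and a: "(\<lambda>n. opnorm H (op_diff H (F n) A)) \<longlonglongrightarrow> 0" and b: "(\<lambda>n. opnorm H (op_diff H (F n) B)) \<longlonglongrightarrow> 0"
 shows "A = B"
proof -
 note diff = op_diff_bounded
 show ?thesis
 proof (rule extensionalityI[OF bounded_opsD(2)[OF A] bounded_opsD(2)[OF B]])
  fix x assume x: "x \<in> \<H>"
  note cl = linear_opD(1)[OF bounded_opsD(1)]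
  have *: "nm (A x \<ominus> B x) <= (opnorm H (op_diff H (F n) A) + opnorm H (op_diff H (F n) B)) * nm x" for n
  proof -
   have "nm (A x \<ominus> B x) <= nm (A x \<ominus> F n x) + nm (F n x \<ominus> B x)"
    by (rule nm_triangle_diff) (use cl A B F x in auto)
   also have "nm (A x \<ominus> F n x) = nm (op_diff H (F n) A x)"
    using x cl[OF A x] cl[OF F x] by (simp add: op_diff_def nm_minus_commute)
   also have "nm (F n x \<ominus> B x) = nm (op_diff H (F n) B x)" using x by (simp add: op_diff_def)
   finally show ?thesis
    using opnorm_bound[OF diff[OF F A] x, of n] opnorm_bound[OF diff[OF F B] x, of n] by (simp add: distrib_right)
  qed
  have "(\<lambda>n. (opnorm H (op_diff H (F n) A) + opnorm H (op_diff H (F n) B)) * nm x) \<longlonglongrightarrow> (0 + 0) * nm x"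
   by (intro tendsto_intros a b)
  hence "nm (A x \<ominus> B x) <= (0 + 0) * nm x" using * LIMSEQ_le_const by blast
  hence "nm (A x \<ominus> B x) = 0" using cl[OF A x] cl[OF B x] by (intro antisym) (auto simp del: nm_eq0)
  hence z: "A x \<ominus> B x = \<zero>" using cl[OF A x] cl[OF B x] by simp
  show "A x = B x"
  proof (rule vec_eqI)
   fix w assume w: "w \<in> \<H>"
   have "ip (A x \<ominus> B x) w = 0" using z w by simp
   thus "ip (A x) w = ip (B x) w" using cl[OF A x] cl[OF B x] w by simp
  qed (use cl A B x in auto)
 qed
qed

context
 fixes G :: "('g, 'n) monoid_scheme" and H :: hilbert_univ (structure) and \<pi>
 assumes grp: "group G" and r: "unitary_rep G H \<pi>"
begin

interpretation unitary_action H G \<pi> by (rule unitary_rep_action[OF r grp])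

lemma cstar_norm_nonneg: assumes "f \<in> group_algebra G" shows "0 <= cstar_norm G f"
 using opnorm_le_cstar_norm[OF assms r] opnorm_ge0[OF rho_bounded_op[OF assms]] by linarith

lemma cstar_rep_class:
 assumes F: "F \<in> cstar_cauchy G" and A: "A \<in> bounded_ops H"
  and lim: "(\<lambda>n. opnorm H (op_diff H (rho (F n)) A)) \<longlonglongrightarrow> 0"
 shows "cstar_rel G `` {F} \<in> max_cstar_algebra G" "cstar_rep H \<pi> (cstar_rel G `` {F}) = A"
proof -
 show "cstar_rel G `` {F} \<in> max_cstar_algebra G" unfolding max_cstar_algebra_def using F by (rule quotientI)
 have Fg: "F n \<in> group_algebra G" for n using F by (simp add: cstar_cauchy_def)
 note Al = linear_opD[OF bounded_opsD(1)[OF A]]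
 have "cstar_norm G (\<lambda>g. 0) <= 0"
 proof (rule cstar_norm_leI[OF r])
  fix K :: hilbert_univ and \<theta> x assume K: "unitary_rep G K \<theta>" and x: "x \<in> carrier K"
  interpret K: unitary_action K G \<theta> by (rule unitary_rep_action[OF K grp])
  have "K.nm (K.rho (\<lambda>g. 0) x) <= l1norm (\<lambda>g :: 'g. 0 :: complex) * K.nm x"
   by (rule K.rho_bound[OF _ x]) (rule group_algebraI[of "{}"], auto)
  thus "K.nm (K.rho (\<lambda>g. 0) x) <= 0 * K.nm x" by (simp add: l1norm_def)
 qed simp
 hence "cstar_norm G (\<lambda>g. 0) = 0" using cstar_norm_nonneg[OF group_algebraI[of "{}" G "\<lambda>g. 0"]] by simp
 moreover have "F n - F n = (\<lambda>g. 0)" for n by (simp add: fun_eq_iff)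
 ultimately have FF: "F \<in> cstar_rel G `` {F}" using F by (simp add: cstar_rel_def)
 show "cstar_rep H \<pi> (cstar_rel G `` {F}) = A"
  unfolding cstar_rep_def
 proof (rule the_equality)
  have "(\<lambda>n. opnorm H (op_diff H (rho (F' n)) A)) \<longlonglongrightarrow> 0" if "F' \<in> cstar_rel G `` {F}" for F'
  proof -
   have F': "F' n \<in> group_algebra G" for n using that by (auto simp: cstar_rel_def cstar_cauchy_def)
   have l: "(\<lambda>n. cstar_norm G (F n - F' n)) \<longlonglongrightarrow> 0" using that by (simp add: cstar_rel_def)
   have ub: "opnorm H (op_diff H (rho (F' n)) A) <= cstar_norm G (F n - F' n) + opnorm H (op_diff H (rho (F n)) A)"
    (is "_ <= ?c + ?o") for n
   proof (rule opnorm_le)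
    have D: "F n - F' n \<in> group_algebra G" by (rule group_algebra_diff[OF Fg F'])
    have B: "op_diff H (rho (F n)) A \<in> bounded_ops H" by (rule op_diff_bounded[OF rho_bounded_op[OF Fg] A])
    show "0 <= ?c + ?o" using cstar_norm_nonneg[OF D] opnorm_ge0[OF B] by simp
    fix x assume x: "x \<in> \<H>"
    have "nm (rho (F' n) x \<ominus> A x) <= nm (rho (F' n) x \<ominus> rho (F n) x) + nm (rho (F n) x \<ominus> A x)"
     using F' Fg Al x by (intro nm_triangle_diff) auto
    also have "nm (rho (F' n) x \<ominus> rho (F n) x) = nm (rho (F n - F' n) x)"
     using F' Fg x by (simp add: rho_diff nm_minus_commute)
    also have "\<dots> <= ?c * nm x"
     using opnorm_bound[OF rho_bounded_op[OF D] x] mult_right_mono[OF opnorm_le_cstar_norm[OF D r] nm_ge0[OF x]] by linarith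
    also have "nm (rho (F n) x \<ominus> A x) <= ?o * nm x" using opnorm_bound[OF B x] x by (simp add: op_diff_def)
    finally have "nm (rho (F' n) x \<ominus> A x) <= (?c + ?o) * nm x" by (simp only: distrib_right)
    moreover have "op_diff H (rho (F' n)) A x = rho (F' n) x \<ominus> A x" using x by (simp add: op_diff_def)
    ultimately show "nm (op_diff H (rho (F' n)) A x) <= (?c + ?o) * nm x" by (simp only:)
   qed
   have lb: "0 <= opnorm H (op_diff H (rho (F' n)) A)" for n
    by (rule opnorm_ge0[OF op_diff_bounded[OF rho_bounded_op[OF F'] A]])
   show ?thesis
    by (rule tendsto_sandwich[OF _ _ tendsto_const tendsto_add_zero[OF l lim]]) (use ub lb in auto)
  qed
  thus "A \<in> bounded_ops H \<and> (\<forall>F'\<in>cstar_rel G `` {F}. (\<lambda>n. opnorm H (op_diff H (rho (F' n)) A)) \<longlonglongrightarrow> 0)"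
   using A by blast
  fix B assume B: "B \<in> bounded_ops H \<and> (\<forall>F'\<in>cstar_rel G `` {F}. (\<lambda>n. opnorm H (op_diff H (rho (F' n)) B)) \<longlonglongrightarrow> 0)"
  show "B = A" by (rule opnorm_diff_unique[of B A "\<lambda>n. rho (F n)"]) (use B A FF lim rho_bounded_op Fg in auto)
 qed
qed

lemma approximable_in_image:
 assumes A: "approximable A" and Ae: "A \<in> bounded_ops H"
 shows "A \<in> cstar_rep H \<pi> ` max_cstar_algebra G"
proof -
 obtain S where S: "!!n. S n \<in> group_algebra G"
  "!!n x. x \<in> \<H> ==> nm (A x \<ominus> rho (S n) x) <= (3/4) ^ n * nm x"
  "!!n (K :: hilbert_univ) \<theta> x. unitary_rep G K \<theta> ==> x \<in> carrier K ==>
    hnorm K (group_algebra_rep K \<theta> (S (Suc n) - S n) x) <= 3 * (3/4) ^ n * hnorm K x"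
  using approximable_cauchy_lift[OF A] by blast
 note Al = linear_opD[OF bounded_opsD(1)[OF Ae]]
 have c: "S \<in> cstar_cauchy G" by (rule geometric_series_cauchy[OF S(1) S(3) r])
 have "(\<lambda>n. opnorm H (op_diff H (rho (S n)) A)) \<longlonglongrightarrow> 0"
 proof (rule tendsto_sandwich[OF _ _ tendsto_const])
  show "(\<lambda>n. (3/4) ^ n :: real) \<longlonglongrightarrow> 0" by (rule LIMSEQ_power_zero) simp
  have b: "nm (op_diff H (rho (S n)) A x) <= (3/4) ^ n * nm x" if "x \<in> \<H>" for n x
   using S(1,2) that Al by (simp add: op_diff_def nm_minus_commute)
  show "\<forall>\<^sub>F n in sequentially. opnorm H (op_diff H (rho (S n)) A) <= (3/4) ^ n"
   using b by (intro always_eventually allI opnorm_le) auto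
  have "op_diff H (rho (S n)) A \<in> bounded_ops H" for n
   by (rule op_diff_bounded[OF rho_bounded_op[OF S(1)] Ae])
  thus "\<forall>\<^sub>F n in sequentially. 0 <= opnorm H (op_diff H (rho (S n)) A)"
   using opnorm_ge0 by simp
 qed
 note cls = cstar_rep_class[OF c Ae this]
 show ?thesis using cls by blast
qed

lemma cstar_rep_element:
 assumes f: "f \<in> group_algebra G"
 shows "cstar_rel G `` {\<lambda>n. f} \<in> max_cstar_algebra G" "cstar_rep H \<pi> (cstar_rel G `` {\<lambda>n. f}) = rho f"
proof -
 have z: "cstar_norm G (f - f) = 0"
 proof -
  have D: "f - f \<in> group_algebra G" by (rule group_algebra_diff[OF f f])
  have "cstar_norm G (f - f) <= 0"
  proof (rule cstar_norm_leI[OF r])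
   fix K :: hilbert_univ and \<theta> x assume K: "unitary_rep G K \<theta>" and x: "x \<in> carrier K"
   interpret K: unitary_action K G \<theta> by (rule unitary_rep_action[OF K grp])
   show "K.nm (K.rho (f - f) x) <= 0 * K.nm x" using K.rho_bound[OF D x] by (simp add: l1norm_def)
  qed simp
  thus ?thesis using cstar_norm_nonneg[OF D] by simp
 qed
 have c: "(\<lambda>n. f) \<in> cstar_cauchy G" using f z by (simp add: cstar_cauchy_def)
 have "opnorm H (op_diff H (rho f) (rho f)) = 0"
 proof -
  have "nm (op_diff H (rho f) (rho f) x) = 0" if "x \<in> \<H>" for x
   using that f by (simp add: op_diff_def a_minus_def M.r_neg)
  hence "nm (op_diff H (rho f) (rho f) x) <= 0 * nm x" if "x \<in> \<H>" for x using that by simp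
  hence le: "opnorm H (op_diff H (rho f) (rho f)) <= 0" by (rule opnorm_le) auto
  have "op_diff H (rho f) (rho f) \<in> bounded_ops H"
   by (rule op_diff_bounded[OF rho_bounded_op[OF f] rho_bounded_op[OF f]])
  thus ?thesis using le opnorm_ge0 by fastforce
 qed
 hence lim: "(\<lambda>n. opnorm H (op_diff H (rho f) (rho f))) \<longlonglongrightarrow> 0" by simp
 show "cstar_rel G `` {\<lambda>n. f} \<in> max_cstar_algebra G" "cstar_rep H \<pi> (cstar_rel G `` {\<lambda>n. f}) = rho f"
  using cstar_rep_class[OF c rho_bounded_op[OF f] lim] by blast+
qed

end

lemma not_weakly_equivalentI:
 fixes H K :: hilbert_univ
 assumes "group G" "unitary_rep G H \<pi>" "unitary_rep G K \<theta>" "f \<in> group_algebra G"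
  "opnorm H (group_algebra_rep H \<pi> f) ~= opnorm K (group_algebra_rep K \<theta> f)"
 shows "\<not> weakly_equivalent G H \<pi> K \<theta>"
 using assms cstar_rep_element[OF assms(1,2,4)] cstar_rep_element[OF assms(1,3,4)]
 unfolding weakly_equivalent_def by metis

section \<open>Closed subspaces as Hilbert spaces\<close>

text \<open>Addition is extended by treating vectors outside the subspace as zero; this makes the distance
 function symmetric and nonnegative on the whole type.\<close>

definition sub_hilbert :: "('h, 'm) inner_module_scheme => 'h set => ('h, 'm) inner_module_scheme" where
 "sub_hilbert H K = H\<lparr>carrier := K,
   add := (\<lambda>x y. (if x \<in> K then x else \<zero>\<^bsub>H\<^esub>) \<oplus>\<^bsub>H\<^esub> (if y \<in> K then y else \<zero>\<^bsub>H\<^esub>))\<rparr>"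

lemma sub_hilbert_simps [simp]:
 "carrier (sub_hilbert H K) = K" "\<zero>\<^bsub>sub_hilbert H K\<^esub> = \<zero>\<^bsub>H\<^esub>" "c \<odot>\<^bsub>sub_hilbert H K\<^esub> x = c \<odot>\<^bsub>H\<^esub> x"
 "cinner (sub_hilbert H K) = cinner H" "hnorm (sub_hilbert H K) x = hnorm H x"
 by (simp_all add: sub_hilbert_def hnorm_def)

lemma sub_hilbert_add: "[|x \<in> K; y \<in> K|] ==> x \<oplus>\<^bsub>sub_hilbert H K\<^esub> y = x \<oplus>\<^bsub>H\<^esub> y"
 by (simp add: sub_hilbert_def)

context hspace
begin

lemma separable_iff:
 "separable_space (htopology H) \<longleftrightarrow>
   (\<exists>D. countable D \<and> D \<subseteq> \<H> \<and> (\<forall>x\<in>\<H>. \<forall>\<epsilon>>0. \<exists>d\<in>D. nm (x \<ominus> d) < \<epsilon>))"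
proof -
 have "MS.mtopology closure_of D = \<H> \<longleftrightarrow> (\<forall>x\<in>\<H>. \<forall>\<epsilon>>0. \<exists>d\<in>D. nm (x \<ominus> d) < \<epsilon>)"
  if "D \<subseteq> \<H>" for D
 proof
  assume L: "MS.mtopology closure_of D = \<H>"
  show "\<forall>x\<in>\<H>. \<forall>\<epsilon>>0. \<exists>d\<in>D. nm (x \<ominus> d) < \<epsilon>"
  proof (intro ballI allI impI)
   fix x and \<epsilon> :: real assume "x \<in> \<H>" "\<epsilon> > 0"
   hence "\<exists>d\<in>D. d \<in> MS.mball x \<epsilon>" using L unfolding MS.metric_closure_of by blast
   thus "\<exists>d\<in>D. nm (x \<ominus> d) < \<epsilon>" by (simp add: hdist_nm) blast
  qed
 next
  assume R: "\<forall>x\<in>\<H>. \<forall>\<epsilon>>0. \<exists>d\<in>D. nm (x \<ominus> d) < \<epsilon>"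
  have "\<exists>d\<in>D. d \<in> MS.mball x \<epsilon>" if "x \<in> \<H>" "\<epsilon> > 0" for x \<epsilon>
  proof -
   obtain d where "d \<in> D" "nm (x \<ominus> d) < \<epsilon>" using R \<open>x \<in> \<H>\<close> \<open>\<epsilon> > 0\<close> by blast
   thus ?thesis using \<open>x \<in> \<H>\<close> \<open>D \<subseteq> \<H>\<close> by (intro bexI[of _ d]) (auto simp: hdist_nm)
  qed
  thus "MS.mtopology closure_of D = \<H>" unfolding MS.metric_closure_of by blast
 qed
 hence "(D \<subseteq> \<H> \<and> MS.mtopology closure_of D = \<H>) \<longleftrightarrow>
   (D \<subseteq> \<H> \<and> (\<forall>x\<in>\<H>. \<forall>\<epsilon>>0. \<exists>d\<in>D. nm (x \<ominus> d) < \<epsilon>))" for D by blast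
 thus ?thesis unfolding separable_space_def htopology_def MS.topspace_mtopology by simp
qed

lemma sub_module: assumes K: "csub K" shows "Module.module complex_ring (sub_hilbert H K)"
proof -
 note D = csubD(1-4)[OF K] and KH = csub_mem[OF K]
 have neg: "(-1) \<odot> x \<oplus> x = \<zero>" if "x \<in> \<H>" for x by (rule vec_eqI) (use that in auto)
 have "abelian_group (sub_hilbert H K)"
 proof (rule abelian_groupI)
  fix x y z assume x: "x \<in> carrier (sub_hilbert H K)" and y: "y \<in> carrier (sub_hilbert H K)" and z: "z \<in> carrier (sub_hilbert H K)"
  show "x \<oplus>\<^bsub>sub_hilbert H K\<^esub> y \<in> carrier (sub_hilbert H K)" using x y D by (simp add: sub_hilbert_add)
  show "x \<oplus>\<^bsub>sub_hilbert H K\<^esub> y \<oplus>\<^bsub>sub_hilbert H K\<^esub> z = x \<oplus>\<^bsub>sub_hilbert H K\<^esub> (y \<oplus>\<^bsub>sub_hilbert H K\<^esub> z)"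
   using x y z D KH by (simp add: sub_hilbert_add M.a_assoc)
  show "x \<oplus>\<^bsub>sub_hilbert H K\<^esub> y = y \<oplus>\<^bsub>sub_hilbert H K\<^esub> x"
   using x y KH by (simp add: sub_hilbert_add M.a_comm)
  show "\<zero>\<^bsub>sub_hilbert H K\<^esub> \<oplus>\<^bsub>sub_hilbert H K\<^esub> x = x" using x D KH by (simp add: sub_hilbert_add)
  show "\<exists>y\<in>carrier (sub_hilbert H K). y \<oplus>\<^bsub>sub_hilbert H K\<^esub> x = \<zero>\<^bsub>sub_hilbert H K\<^esub>"
   using x D(4)[of x "-1"] neg[of x] KH by (intro bexI[of _ "(-1) \<odot> x"]) (auto simp: sub_hilbert_add)
 qed (use D in simp)
 thus ?thesis
 proof (rule moduleI[OF R.is_cring])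
  fix a b x y assume x: "x \<in> carrier (sub_hilbert H K)" and y: "y \<in> carrier (sub_hilbert H K)"
  show "(a \<oplus>\<^bsub>complex_ring\<^esub> b) \<odot>\<^bsub>sub_hilbert H K\<^esub> x = a \<odot>\<^bsub>sub_hilbert H K\<^esub> x \<oplus>\<^bsub>sub_hilbert H K\<^esub> b \<odot>\<^bsub>sub_hilbert H K\<^esub> x"
   using x D KH smult_l_distr[of a b x] by (simp add: sub_hilbert_add)
  show "a \<odot>\<^bsub>sub_hilbert H K\<^esub> (x \<oplus>\<^bsub>sub_hilbert H K\<^esub> y) = a \<odot>\<^bsub>sub_hilbert H K\<^esub> x \<oplus>\<^bsub>sub_hilbert H K\<^esub> a \<odot>\<^bsub>sub_hilbert H K\<^esub> y"
   using x y D KH smult_r_distr[of a x y] by (simp add: sub_hilbert_add)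
  show "a \<otimes>\<^bsub>complex_ring\<^esub> b \<odot>\<^bsub>sub_hilbert H K\<^esub> x = a \<odot>\<^bsub>sub_hilbert H K\<^esub> (b \<odot>\<^bsub>sub_hilbert H K\<^esub> x)"
   using x KH smult_assoc1[of a b x] by simp
 qed (use D KH in auto)
qed

lemma sub_minus:
 assumes K: "csub K"
 defines "cl \<equiv> \<lambda>x. if x \<in> K then x else \<zero>"
 shows "x \<ominus>\<^bsub>sub_hilbert H K\<^esub> y = cl x \<ominus> cl y"
proof -
 interpret S: Module.module complex_ring "sub_hilbert H K" by (rule sub_module[OF K])
 note D = csubD(1-4)[OF K] csubD(6)[OF K] and KH = csub_mem[OF K]
 have neg: "(-1) \<odot> x = \<ominus> x" "x \<oplus> \<ominus> x = \<zero>" if "x \<in> \<H>" for x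
  by (rule vec_eqI, use that in auto)+
 have m: "\<ominus>\<^bsub>sub_hilbert H K\<^esub> y = \<ominus> (cl y)"
 proof (cases "y \<in> K")
  case True
  have "\<ominus> y \<in> K" using D(4)[OF True, of "-1"] neg(1)[OF KH[OF True]] by simp
  thus ?thesis using True neg(2)[OF KH[OF True]] KH[OF True]
   by (intro S.M.minus_equality) (auto simp: cl_def sub_hilbert_add M.l_neg)
 next
  case False
  have "a_inv (sub_hilbert H K) y = (THE z. z \<in> K \<and> z = \<zero>)"
   unfolding a_inv_def m_inv_def using False D(2) KH
   by (intro arg_cong[where f=The] ext) (auto simp: sub_hilbert_def)
  also have "\<dots> = \<zero>" using D(2) by (intro the_equality) auto
  also have "\<zero> = \<ominus> \<zero>" by (rule vec_eqI) simp_all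
  finally show ?thesis using False by (simp add: cl_def)
 qed
 have "cl y \<in> K" using D(2) by (simp add: cl_def)
 hence "\<ominus> (cl y) \<in> K" using D(4)[of "cl y" "-1"] neg(1)[of "cl y"] KH by simp
 thus ?thesis unfolding a_minus_def m by (auto simp: sub_hilbert_def cl_def)
qed

lemma hspace_sub: assumes K: "csub K" shows "hspace (sub_hilbert H K)"
proof -
 interpret S: Module.module complex_ring "sub_hilbert H K" by (rule sub_module[OF K])
 note D = csubD(1-4)[OF K] csubD(6)[OF K] and KH = csub_mem[OF K]
 define cl where "cl x = (if x \<in> K then x else \<zero>)" for x
 have clK: "cl x \<in> K" "cl x \<in> \<H>" for x using D(2) KH by (auto simp: cl_def)
 have cli: "cl x = x" if "x \<in> K" for x using that by (simp add: cl_def)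
 have dist: "hdist (sub_hilbert H K) x y = nm (cl x \<ominus> cl y)" for x y
  by (simp add: hdist_def sub_minus[OF K] cl_def)
 have met: "Metric_space (carrier (sub_hilbert H K)) (hdist (sub_hilbert H K))"
 proof
  fix x y z
  show "0 <= hdist (sub_hilbert H K) x y" unfolding dist using clK by simp
  show "hdist (sub_hilbert H K) x y = hdist (sub_hilbert H K) y x" unfolding dist using clK by (intro nm_minus_commute) auto
  assume x: "x \<in> carrier (sub_hilbert H K)" and y: "y \<in> carrier (sub_hilbert H K)"
  show "(hdist (sub_hilbert H K) x y = 0) = (x = y)" unfolding dist using x y KH by (simp add: cli hdist_nm[symmetric])
  assume z: "z \<in> carrier (sub_hilbert H K)"
  show "hdist (sub_hilbert H K) x z <= hdist (sub_hilbert H K) x y + hdist (sub_hilbert H K) y z"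
   unfolding dist using clK by (intro nm_triangle_diff) auto
 qed
 interpret T: Metric_space K "hdist (sub_hilbert H K)" using met by simp
 have "T.mcomplete" unfolding T.mcomplete_def
 proof (intro allI impI)
  fix s assume s: "T.MCauchy s"
  have sK: "s n \<in> K" for n using s by (auto simp: T.MCauchy_def)
  have "\<exists>l. tends s l"
  proof (rule hcomplete)
   show "s n \<in> \<H>" for n using sK KH by blast
   show "\<exists>N. \<forall>m\<ge>N. \<forall>n\<ge>N. nm (s m \<ominus> s n) < \<epsilon>" if "\<epsilon> > 0" for \<epsilon>
    using s that sK unfolding T.MCauchy_def dist by (simp add: cli)
  qed
  then obtain l where l: "tends s l" by blast
  have lK: "l \<in> K" using csubD(5)[OF K sK l] .
  have "limitin T.mtopology s l sequentially"
   unfolding T.limit_metric_sequentially dist using lK sK tendsD(3)[OF l] tendsD(1,2)[OF l]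
   by (auto simp: cli LIMSEQ_iff)
  thus "\<exists>x. limitin T.mtopology s x sequentially" by blast
 qed
 hence "complex_hilbert_axioms (sub_hilbert H K)"
  using KH cinner_self_nonneg cinner_self_eq_0
  by (unfold_locales) (auto simp: sub_hilbert_add intro: cinner_commute)
 thus ?thesis
  using met by (intro hspace.intro complex_hilbert.intro sub_module[OF K] hspace_axioms.intro)
qed

lemma sub_minus_mem: "csub K ==> x \<in> K ==> y \<in> K ==> x \<ominus>\<^bsub>sub_hilbert H K\<^esub> y = x \<ominus> y"
 by (simp add: sub_minus)

lemma sub_tends:
 assumes K: "csub K"
 shows "hspace.tends (sub_hilbert H K) x l \<longleftrightarrow> tends x l \<and> (\<forall>n. x n \<in> K) \<and> l \<in> K"
proof (cases "(\<forall>n. x n \<in> K) \<and> l \<in> K")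
 case True
 hence "(\<lambda>n. nm (x n \<ominus>\<^bsub>sub_hilbert H K\<^esub> l)) = (\<lambda>n. nm (x n \<ominus> l))" using sub_minus_mem[OF K] by auto
 moreover have "!!n. x n \<in> \<H>" "l \<in> \<H>" using True csub_mem[OF K] by auto
 ultimately show ?thesis unfolding hspace.tends_def[OF hspace_sub[OF K]] tends_def using True by simp
next
 case False
 thus ?thesis unfolding hspace.tends_def[OF hspace_sub[OF K]] by auto
qed

lemma sub_csub:
 assumes K: "csub K" and W: "hspace.csub (sub_hilbert H K) W" shows "csub W" "W \<subseteq> K"
proof -
 interpret S: hspace "sub_hilbert H K" by (rule hspace_sub[OF K])
 note D = S.csubD[OF W]
 show WK: "W \<subseteq> K" using D(1) by simp
 show "csub W"
 proof (rule csubI)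
  show "W \<subseteq> \<H>" using WK csub_mem[OF K] by blast
  show "x \<oplus> y \<in> W" if "x \<in> W" "y \<in> W" for x y using D(3)[OF that] that WK by (auto simp: sub_hilbert_add subset_iff)
  show "l \<in> W" if "!!n. x n \<in> W" "tends x l" for x l
   using D(5)[of x l] that WK csubD(5)[OF K] unfolding sub_tends[OF K] by blast
 qed (use D in auto)
qed

lemma sub_separable:
 assumes K: "csub K" and s: "separable_space (htopology H)"
 shows "separable_space (htopology (sub_hilbert H K))"
proof -
 interpret S: hspace "sub_hilbert H K" by (rule hspace_sub[OF K])
 obtain D where D: "countable D" "D \<subseteq> \<H>" "!!x \<epsilon>. x \<in> \<H> ==> \<epsilon> > 0 ==> \<exists>d\<in>D. nm (x \<ominus> d) < \<epsilon>"
  using s unfolding separable_iff by blast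
 show ?thesis unfolding S.separable_iff
 proof (intro exI[of _ "oproj K ` D"] conjI ballI allI impI)
  show "oproj K ` D \<subseteq> carrier (sub_hilbert H K)" using D(2) oproj(1)[OF K] by auto
  fix x and \<epsilon> :: real assume x: "x \<in> carrier (sub_hilbert H K)" and e: "\<epsilon> > 0"
  hence xK: "x \<in> K" and xH: "x \<in> \<H>" using csub_mem[OF K] by auto
  obtain d where d: "d \<in> D" "nm (x \<ominus> d) < \<epsilon>" using D(3)[OF xH e] by blast
  have dH: "d \<in> \<H>" using d D by blast
  have "x \<ominus> oproj K d = oproj K (x \<ominus> d)"
   using linear_opD(4)[OF oproj_linear[OF K] xH dH] oproj_id[OF K xK] by simp
  hence "nm (x \<ominus> oproj K d) < \<epsilon>" using oproj_le(1)[OF K, of "x \<ominus> d"] d xH dH by simp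
  thus "\<exists>d\<in>oproj K ` D. S.nm (x \<ominus>\<^bsub>sub_hilbert H K\<^esub> d) < \<epsilon>"
   using d(1) xK oproj(1)[OF K dH]
   by (intro bexI[of _ "oproj K d"]) (simp_all add: sub_minus_mem[OF K])
 qed (use D in simp)
qed

lemma sub_sum:
 assumes K: "csub K" and f: "!!i. i \<in> I ==> f i \<in> K"
 shows "finsum (sub_hilbert H K) f I = finsum H f I"
proof -
 interpret S: hspace "sub_hilbert H K" by (rule hspace_sub[OF K])
 show ?thesis
 proof (cases "finite I")
  case True
  thus ?thesis using f
  proof (induction I)
   case empty thus ?case by simp
  next
   case (insert i I)
   have "f \<in> insert i I \<rightarrow> \<H>" using insert.prems csub_mem[OF K] by auto
   moreover have "finsum H f I \<in> K" using insert by (intro csub_sum[OF K]) auto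
   ultimately show ?case using insert by (subst S.M.finsum_insert) (auto simp: M.finsum_insert sub_hilbert_add)
  qed
 next
  case False thus ?thesis by (simp add: S.M.finsum_infinite M.finsum_infinite)
 qed
qed

end

lemma (in complex_hilbert) hom_unitary_groupI:
 assumes G: "group G"
  and lin: "!!g. g \<in> carrier G ==> linear_op (r g)"
  and iso: "!!g x y. [|g \<in> carrier G; x \<in> \<H>; y \<in> \<H>|] ==> ip (r g x) (r g y) = ip x y"
  and mult: "!!g h x. [|g \<in> carrier G; h \<in> carrier G; x \<in> \<H>|] ==> r (g \<otimes>\<^bsub>G\<^esub> h) x = r g (r h x)"
  and one: "!!x. x \<in> \<H> ==> r \<one>\<^bsub>G\<^esub> x = x"
 shows "(\<lambda>g. restrict (r g) (\<H>)) \<in> hom G (unitary_group H)"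
proof -
 interpret G: group G by (rule G)
 note c = linear_opD[OF lin]
 have bij: "bij_betw (restrict (r g) (\<H>)) (\<H>) (\<H>)" if g: "g \<in> carrier G" for g
 proof (rule bij_betw_byWitness[where f'="r (inv\<^bsub>G\<^esub> g)"])
  show "\<forall>x\<in>\<H>. r (inv\<^bsub>G\<^esub> g) (restrict (r g) (\<H>) x) = x"
   using g mult[of "inv\<^bsub>G\<^esub> g" g] one by simp
  show "\<forall>x\<in>\<H>. restrict (r g) (\<H>) (r (inv\<^bsub>G\<^esub> g) x) = x"
   using g mult[of g "inv\<^bsub>G\<^esub> g"] one c(1)[of "inv\<^bsub>G\<^esub> g"] by simp
 qed (use c(1) g in auto)
 have mem: "restrict (r g) (\<H>) \<in> carrier (unitary_group H)" if g: "g \<in> carrier G" for g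
 proof -
  have "restrict (r g) (\<H>) \<in> bounded_ops H"
  proof (rule bounded_opsI[where C=1])
   show "linear_op (restrict (r g) (\<H>))" using lin[OF g] by (auto simp: linear_op_def)
   show "nm (restrict (r g) (\<H>) x) <= 1 * nm x" if "x \<in> \<H>" for x
    using iso[OF g that that] that by (simp add: hnorm_def)
  qed simp
  thus ?thesis using bij[OF g] iso[OF g] by (simp add: unitary_group_def)
 qed
 have Bij: "restrict (r g) (\<H>) \<in> Bij (\<H>)" if "g \<in> carrier G" for g
  using bij[OF that] by (simp add: Bij_def)
 show ?thesis
 proof (rule homI)
  fix g h assume g: "g \<in> carrier G" and h: "h \<in> carrier G"
  show "restrict (r (g \<otimes>\<^bsub>G\<^esub> h)) (\<H>) =
    restrict (r g) (\<H>) \<otimes>\<^bsub>unitary_group H\<^esub> restrict (r h) (\<H>)"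
   using Bij g h mult[OF g h] c(1)[OF h] by (auto simp: unitary_group_def BijGroup_def compose_def)
 qed (rule mem)
qed

section \<open>The norm closure of the group algebra\<close>

locale hspace_action = hspace H + unitary_action H G \<pi>
 for H :: "('h, 'm) inner_module_scheme" (structure) and G :: "('g, 'n) monoid_scheme" and \<pi>
begin

lemma approximable_rho: assumes f: "f \<in> group_algebra G" shows "approximable (rho f)"
 unfolding approximable_def
proof (intro conjI allI impI rho_linear[OF f] bexI[OF _ f] ballI)
 fix \<epsilon> :: real and x assume "\<epsilon> > 0" "x \<in> \<H>"
 thus "nm (rho f x \<ominus> rho f x) <= \<epsilon> * nm x" using f by simp
qed

lemma approximable_lim:
 assumes A: "linear_op A" and B: "!!\<epsilon>. \<epsilon> > 0 ==> \<exists>B. approximable B \<and> (\<forall>x\<in>\<H>. nm (A x \<ominus> B x) <= \<epsilon> * nm x)"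
 shows "approximable A"
 unfolding approximable_def
proof (intro conjI allI impI A)
 fix \<epsilon> :: real assume e: "\<epsilon> > 0"
 obtain B where B: "approximable B" "!!x. x \<in> \<H> ==> nm (A x \<ominus> B x) <= \<epsilon> / 2 * nm x"
  using B[of "\<epsilon> / 2"] e by auto
 obtain f where f: "f \<in> group_algebra G" "!!x. x \<in> \<H> ==> nm (B x \<ominus> rho f x) <= \<epsilon> / 2 * nm x"
  using approximableD(2)[OF B(1), of "\<epsilon> / 2"] e by auto
 have "nm (A x \<ominus> rho f x) <= \<epsilon> * nm x" if x: "x \<in> \<H>" for x
 proof -
  have "nm (A x \<ominus> rho f x) <= nm (A x \<ominus> B x) + nm (B x \<ominus> rho f x)"
   using x f linear_opD(1)[OF A] linear_opD(1)[OF approximableD(1)[OF B(1)]] by (intro nm_triangle_diff) auto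
  thus ?thesis using B(2)[OF x] f(2)[OF x] by simp
 qed
 thus "\<exists>f\<in>group_algebra G. \<forall>x\<in>\<H>. nm (A x \<ominus> rho f x) <= \<epsilon> * nm x" using f(1) by blast
qed

lemma approximable_cong:
 assumes "approximable A" "!!x. x \<in> \<H> ==> A x = B x" shows "approximable B"
 using assms by (simp add: approximable_def linear_op_def)

lemma approximable_add:
 assumes A: "approximable A" and B: "approximable B" shows "approximable (\<lambda>x. A x \<oplus> B x)"
 unfolding approximable_def
proof (intro conjI allI impI)
 note a = linear_opD[OF approximableD(1)[OF A]] and b = linear_opD[OF approximableD(1)[OF B]]
 show "linear_op (\<lambda>x. A x \<oplus> B x)"
  unfolding linear_op_def using a(1-3) b(1-3) by (auto intro!: vec_eqI simp: algebra_simps)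
 fix \<epsilon> :: real assume e: "\<epsilon> > 0"
 obtain f where f: "f \<in> group_algebra G" "!!x. x \<in> \<H> ==> nm (A x \<ominus> rho f x) <= \<epsilon> / 2 * nm x"
  using approximableD(2)[OF A, of "\<epsilon> / 2"] e by auto
 obtain h where h: "h \<in> group_algebra G" "!!x. x \<in> \<H> ==> nm (B x \<ominus> rho h x) <= \<epsilon> / 2 * nm x"
  using approximableD(2)[OF B, of "\<epsilon> / 2"] e by auto
 have "nm (A x \<oplus> B x \<ominus> rho (\<lambda>g. f g + h g) x) <= \<epsilon> * nm x" if x: "x \<in> \<H>" for x
 proof -
  have "A x \<oplus> B x \<ominus> rho (\<lambda>g. f g + h g) x = (A x \<ominus> rho f x) \<oplus> (B x \<ominus> rho h x)"
   unfolding rho_add[OF f(1) h(1) x] by (rule vec_eqI) (use x f(1) h(1) a b in auto)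
  hence "nm (A x \<oplus> B x \<ominus> rho (\<lambda>g. f g + h g) x) <= nm (A x \<ominus> rho f x) + nm (B x \<ominus> rho h x)"
   using nm_triangle[of "A x \<ominus> rho f x" "B x \<ominus> rho h x"] x f(1) h(1) a b by simp
  thus ?thesis using f(2)[OF x] h(2)[OF x] by simp
 qed
 thus "\<exists>f\<in>group_algebra G. \<forall>x\<in>\<H>. nm (A x \<oplus> B x \<ominus> rho f x) <= \<epsilon> * nm x"
  using group_algebra_add[OF f(1) h(1)] by blast
qed

lemma approximable_comp:
 assumes A: "approximable A" and B: "approximable B" shows "approximable (\<lambda>x. A (B x))"
 unfolding approximable_def
proof (intro conjI allI impI)
 note a = linear_opD[OF approximableD(1)[OF A]] and b = linear_opD[OF approximableD(1)[OF B]]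
 show "linear_op (\<lambda>x. A (B x))" unfolding linear_op_def using a(1-3) b(1-3) by simp
 fix \<epsilon> :: real assume e: "\<epsilon> > 0"
 obtain C where C: "C > 0" "!!x. x \<in> \<H> ==> nm (B x) <= C * nm x" using approximable_bounded[OF B] by blast
 define d where "d = \<epsilon> / (2 * C)"
 have d: "d > 0" using e C by (simp add: d_def)
 obtain f where f: "f \<in> group_algebra G" "!!x. x \<in> \<H> ==> nm (A x \<ominus> rho f x) <= d * nm x"
  using approximableD(2)[OF A d] by auto
 define m where "m = l1norm f + 1"
 have m: "m > 0" using l1norm_nonneg[of f] by (simp add: m_def)
 obtain h where h: "h \<in> group_algebra G" "!!x. x \<in> \<H> ==> nm (B x \<ominus> rho h x) <= \<epsilon> / (2 * m) * nm x"
  using approximableD(2)[OF B, of "\<epsilon> / (2 * m)"] e m by auto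
 have "nm (A (B x) \<ominus> rho (ga_conv G f h) x) <= \<epsilon> * nm x" if x: "x \<in> \<H>" for x
 proof -
  have "nm (A (B x) \<ominus> rho f (rho h x)) <= nm (A (B x) \<ominus> rho f (B x)) + nm (rho f (B x) \<ominus> rho f (rho h x))"
   using x f(1) h(1) a b by (intro nm_triangle_diff) auto
  also have "rho f (B x) \<ominus> rho f (rho h x) = rho f (B x \<ominus> rho h x)"
   using linear_opD(4)[OF rho_linear[OF f(1)]] b(1)[OF x] rho_closed[OF h(1) x] by simp
  also have "nm (A (B x) \<ominus> rho f (B x)) <= d * (C * nm x)"
   using f(2)[OF b(1)[OF x]] mult_left_mono[OF C(2)[OF x]] d by (meson less_imp_le order_trans)
  also have "d * (C * nm x) = \<epsilon> / 2 * nm x" using C by (simp add: d_def)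
  also have "nm (rho f (B x \<ominus> rho h x)) <= m * nm (B x \<ominus> rho h x)"
   using rho_bound[OF f(1), of "B x \<ominus> rho h x"] nm_ge0[of "B x \<ominus> rho h x"] b(1)[OF x] rho_closed[OF h(1) x]
   unfolding m_def distrib_right by (metis add_increasing2 mult_1 diff_closed)
  also have "\<dots> <= m * (\<epsilon> / (2 * m) * nm x)" using h(2)[OF x] m by (intro mult_left_mono) auto
  also have "\<dots> = \<epsilon> / 2 * nm x" using m by simp
  finally show ?thesis using rho_conv[OF f(1) h(1) x] by simp
 qed
 thus "\<exists>f\<in>group_algebra G. \<forall>x\<in>\<H>. nm (A (B x) \<ominus> rho f x) <= \<epsilon> * nm x"
  using G.group_algebra_conv[OF f(1) h(1)] by blast
qed

lemma approximable_scale_id: "approximable (\<lambda>x. c \<odot> x)"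
proof -
 have e: "ga_single \<one>\<^bsub>G\<^esub> \<in> group_algebra G" by (rule group_algebra_single) simp
 show ?thesis
  by (rule approximable_cong[OF approximable_rho[OF group_algebra_scale[OF e, of c]]])
   (simp add: rho_scale[OF e] rho_single)
qed

lemma approximable_scale: "approximable A ==> approximable (\<lambda>x. c \<odot> A x)"
 by (rule approximable_comp[OF approximable_scale_id])

lemma approximable_funpow: "approximable A ==> approximable (A ^^ n)"
proof (induction n)
 case 0
 show ?case by (rule approximable_cong[OF approximable_scale_id[of 1]]) simp
next
 case (Suc n)
 show ?case by (rule approximable_cong[OF approximable_comp[OF Suc.prems Suc.IH[OF Suc.prems]]]) simp
qed

lemma approximable_sum:
 assumes "finite I" "!!i. i \<in> I ==> approximable (A i)" shows "approximable (\<lambda>x. finsum H (\<lambda>i. A i x) I)"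
 using assms
proof (induction I)
 case empty
 show ?case by (rule approximable_cong[OF approximable_scale_id[of 0]]) (use smult_l_null in simp)
next
 case (insert i I)
 show ?case
  by (rule approximable_cong[OF approximable_add[of "A i" "\<lambda>x. finsum H (\<lambda>i. A i x) I"]])
   (use insert linear_opD(1)[OF approximableD(1)] in \<open>auto simp: M.finsum_insert Pi_def\<close>)
qed

lemma approximable_invariant:
 assumes A: "approximable A" and W: "csub W" and inv: "!!g x. [|g \<in> carrier G; x \<in> W|] ==> \<pi> g x \<in> W" and x: "x \<in> W"
 shows "A x \<in> W"
proof -
 have xH: "x \<in> \<H>" using csub_mem[OF W x] .
 have rW: "rho f x \<in> W" if f: "f \<in> group_algebra G" for f
  unfolding group_algebra_rep_def using group_algebraD[OF f] inv[OF _ x] csubD(4)[OF W] xH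
  by (auto intro!: csub_sum[OF W])
 have "\<exists>f\<in>group_algebra G. nm (A x \<ominus> rho f x) <= 1 / (real n + 1) * nm x" for n
  using approximableD(2)[OF A, of "1 / (real n + 1)"] xH by (auto simp: add_pos_nonneg)
 then obtain f where f: "!!n. f n \<in> group_algebra G" "!!n. nm (A x \<ominus> rho (f n) x) <= 1 / (real n + 1) * nm x" by metis
 have Ax: "A x \<in> \<H>" using linear_opD(1)[OF approximableD(1)[OF A] xH] .
 have "tends (\<lambda>n. rho (f n) x) (A x)" unfolding tends_def
 proof (intro conjI allI Ax)
  show "(\<lambda>n. nm (rho (f n) x \<ominus> A x)) \<longlonglongrightarrow> 0"
  proof (rule Lim_null_comparison)
   show "\<forall>\<^sub>F n in sequentially. norm (nm (rho (f n) x \<ominus> A x)) <= 1 / (real n + 1) * nm x"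
    using f(2) nm_minus_commute[OF rho_closed[OF f(1) xH] Ax] rho_closed[OF f(1) xH] Ax by simp
   have "(\<lambda>n. 1 / (real n + 1)) \<longlonglongrightarrow> 0"
    using LIMSEQ_Suc[OF lim_const_over_n[of "1::real"]] by (simp add: add.commute)
   thus "(\<lambda>n. 1 / (real n + 1) * nm x) \<longlonglongrightarrow> 0" by (rule tendsto_mult_left_zero)
  qed
 qed (use f xH in simp)
 thus ?thesis by (rule csubD(5)[OF W rW[OF f(1)]])
qed

lemma orthogonal_invariant:
 assumes W: "W \<subseteq> \<H>" and inv: "!!g x. [|g \<in> carrier G; x \<in> W|] ==> \<pi> g x \<in> W"
  and g: "g \<in> carrier G" and x: "x \<in> {x \<in> \<H>. \<forall>w\<in>W. ip x w = 0}"
 shows "\<pi> g x \<in> {x \<in> \<H>. \<forall>w\<in>W. ip x w = 0}"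
 using x g W inv[of "inv\<^bsub>G\<^esub> g"] by (auto simp: act_adj subset_iff)

end

section \<open>Traceable subrepresentations\<close>

context hspace
begin

lemma exists_unit:
 assumes W: "csub W" and x: "x \<in> W" "x ~= \<zero>" shows "\<exists>u\<in>W. nm u = 1"
proof -
 have n: "nm x > 0" using nm_pos[OF csub_mem[OF W x(1)] x(2)] .
 show ?thesis
  by (rule bexI[of _ "of_real (1 / nm x) \<odot> x"])
   (use n x csubD(4)[OF W] csub_mem[OF W x(1)] in \<open>auto simp: norm_divide\<close>)
qed

lemma exists_unit_orthogonal:
 assumes E: "csub E" and Q: "csub Q" and EQ: "E \<subseteq> Q" "x \<in> Q" "x \<notin> E"
 shows "\<exists>u\<in>Q. nm u = 1 \<and> (\<forall>w\<in>E. ip u w = 0)"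
proof -
 have xH: "x \<in> \<H>" using EQ csub_mem[OF Q] by blast
 note o = oproj[OF E xH]
 define N where "N = Q \<inter> {x \<in> \<H>. \<forall>w\<in>E. ip x w = 0}"
 have N: "csub N" unfolding N_def by (intro csub_Int Q orthogonal_csub csubD(1)[OF E])
 have "x \<ominus> oproj E x \<in> N" using o EQ xH csubD(6)[OF Q] by (auto simp: N_def)
 moreover have "x \<ominus> oproj E x ~= \<zero>"
 proof
  assume z: "x \<ominus> oproj E x = \<zero>"
  have "x = oproj E x"
  proof (rule vec_eqI)
   fix w assume w: "w \<in> \<H>"
   have "ip (x \<ominus> oproj E x) w = 0" using z w by simp
   thus "ip x w = ip (oproj E x) w" using xH o w by simp
  qed (use xH o in auto)
  thus False using o EQ by metis
 qed
 ultimately obtain u where "u \<in> N" "nm u = 1" using exists_unit[OF N] by blast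
 thus ?thesis unfolding N_def by blast
qed

text \<open>A maximal orthonormal set spans.\<close>

lemma bounded_orthonormal_basis:
 assumes Q: "csub Q" and n: "!!U. finite U ==> orthonormal U ==> U \<subseteq> Q ==> card U <= n"
 obtains U where "finite U" "orthonormal U" "U \<subseteq> Q" "!!x. x \<in> Q ==> fproj U x = x"
proof -
 define P where "P k \<longleftrightarrow> (\<exists>U. finite U \<and> orthonormal U \<and> U \<subseteq> Q \<and> card U = k)" for k
 have "orthonormal {}" by (simp add: orthonormal_def)
 hence "P 0" unfolding P_def by (intro exI[of _ "{}"]) auto
 moreover have "\<forall>k. P k --> k <= n" using n by (auto simp: P_def)
 ultimately obtain k where k: "P k" "!!j. P j ==> j <= k" using Nat.ex_has_greatest_nat[of P 0 n] by blast
 then obtain U where U: "finite U" "orthonormal U" "U \<subseteq> Q" "card U = k" by (auto simp: P_def)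
 have "fproj U x = x" if x: "x \<in> Q" for x
 proof (rule ccontr)
  assume ne: "fproj U x ~= x"
  have xH: "x \<in> \<H>" using csub_mem[OF Q x] .
  have pQ: "fproj U x \<in> Q" unfolding fproj_def using U csubD(4)[OF Q] by (intro csub_sum[OF Q]) auto
  define N where "N = Q \<inter> {x \<in> \<H>. \<forall>w\<in>U. ip x w = 0}"
  have UH: "U \<subseteq> \<H>" using U(2) by (simp add: orthonormal_def)
  have N: "csub N" unfolding N_def by (intro csub_Int Q orthogonal_csub UH)
  have "x \<ominus> fproj U x \<in> N"
   using ip_fproj_mem[OF U(2,1) xH] csubD(6)[OF Q x pQ] xH U UH by (auto simp: N_def)
  moreover have "x \<ominus> fproj U x ~= \<zero>"
  proof
   assume z: "x \<ominus> fproj U x = \<zero>"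
   have "fproj U x = x"
   proof (rule vec_eqI)
    fix w assume w: "w \<in> \<H>"
    have "ip (x \<ominus> fproj U x) w = 0" using z w by simp
    thus "ip (fproj U x) w = ip x w" using xH U w by simp
   qed (use xH U in auto)
   thus False using ne by simp
  qed
  ultimately obtain u where u: "u \<in> N" "nm u = 1" using exists_unit[OF N] by blast
  have "orthonormal (insert u U)" "u \<notin> U"
   using orthonormal_insert[OF U(2), of u] u by (auto simp: N_def)
  hence "P (Suc k)" unfolding P_def using U u by (intro exI[of _ "insert u U"]) (auto simp: N_def)
  thus False using k(2) by fastforce
 qed
 thus ?thesis using that U by blast
qed

end

context hspace_action
begin

lemma approximable_eigenprojection:
 assumes T: "approximable T" and s: "s > 0"
  and E: "csub (eigenspace T s)"
  and d: "0 <= \<delta>" "\<delta> < 1" "!!n x. x \<in> \<H> ==>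
   nm (of_real (1 / s ^ n) \<odot> (T ^^ n) x \<ominus> oproj (eigenspace T s) x) <= \<delta> ^ n * nm x"
 shows "approximable (oproj (eigenspace T s))"
proof (rule approximable_lim[OF oproj_linear[OF E]])
 fix \<epsilon> :: real assume e: "\<epsilon> > 0"
 have "(\<lambda>n. \<delta> ^ n) \<longlonglongrightarrow> 0" using d by (intro LIMSEQ_power_zero) simp
 hence "\<forall>\<^sub>F n in sequentially. \<delta> ^ n < \<epsilon>" using e order_tendstoD(2) by blast
 then obtain n where n: "\<delta> ^ n < \<epsilon>" by (auto simp: eventually_sequentially)
 define B where "B x = of_real (1 / s ^ n) \<odot> (T ^^ n) x" for x
 have B: "approximable B" unfolding B_def by (intro approximable_scale approximable_funpow T)
 have "nm (oproj (eigenspace T s) x \<ominus> B x) <= \<epsilon> * nm x" if x: "x \<in> \<H>" for x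
 proof -
  have "nm (oproj (eigenspace T s) x \<ominus> B x) = nm (B x \<ominus> oproj (eigenspace T s) x)"
   using oproj(3)[OF E x] linear_opD(1)[OF approximableD(1)[OF B] x] by (rule nm_minus_commute)
  also have "\<dots> <= \<delta> ^ n * nm x" unfolding B_def by (rule d(3)[OF x])
  also have "\<dots> <= \<epsilon> * nm x" using n x by (intro mult_right_mono) auto
  finally show ?thesis .
 qed
 thus "\<exists>B. approximable B \<and> (\<forall>x\<in>\<H>. nm (oproj (eigenspace T s) x \<ominus> B x) <= \<epsilon> * nm x)" using B by blast
qed

text \<open>Compressing a self-adjoint element to a projection of minimal rank gives a scalar: otherwise the
 top eigenprojection of the compression, shifted to be positive, would have smaller rank.\<close>

lemma compression_scalar_selfadj:
 assumes Q: "csub Q" and aQ: "approximable (oproj Q)"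
  and n: "!!U. finite U ==> orthonormal U ==> U \<subseteq> Q ==> card U <= n"
  and minimal: "!!E. [|csub E; E \<subseteq> Q; approximable (oproj E); \<exists>u\<in>E. nm u = 1;
   !!U. finite U ==> orthonormal U ==> U \<subseteq> E ==> Suc (card U) <= n|] ==> False"
  and A: "approximable A" "selfadj A"
 shows "\<exists>c. \<forall>x\<in>Q. oproj Q (A x) = c \<odot> x"
proof -
 note QH = csub_mem[OF Q] and q = oproj[OF Q] and ql = linear_opD[OF oproj_linear[OF Q]]
 note al = linear_opD[OF approximableD(1)[OF A(1)]]
 obtain m where m: "m > 0" "!!x. x \<in> \<H> ==> nm (A x) <= m * nm x" using approximable_bounded[OF A(1)] by blast
 define q where "q = oproj Q"
 have qc[simp]: "x \<in> \<H> ==> q x \<in> \<H>" and qQ: "x \<in> \<H> ==> q x \<in> Q" for x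
  using q by (auto simp: q_def)
 have qs: "ip (q x) y = ip x (q y)" if "x \<in> \<H>" "y \<in> \<H>" for x y
  using oproj_selfadj[OF Q] that by (simp add: q_def selfadj_def)
 have qn: "nm (q x) <= nm x" if "x \<in> \<H>" for x using oproj_le(1)[OF Q that] by (simp add: q_def)
 have qid: "q x = x" if "x \<in> Q" for x using oproj_id[OF Q that] by (simp add: q_def)
 define B where "B x = q (A (q x)) \<oplus> of_real m \<odot> q x" for x
 have aB: "approximable B" unfolding B_def q_def
  by (intro approximable_add approximable_scale approximable_comp[OF aQ] approximable_comp[OF A(1) aQ] aQ)
 note Bl = linear_opD[OF approximableD(1)[OF aB]]
 have BQ: "B x \<in> Q" if "x \<in> \<H>" for x
  unfolding B_def using that al csubD(3,4)[OF Q] qQ by simp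
 have ipB: "ip (B x) y = ip (A (q x)) (q y) + of_real m * ip (q x) (q y)" if "x \<in> \<H>" "y \<in> \<H>" for x y
 proof -
  have "ip (q x) y = ip (q x) (q y)" using qs[of "q x" y] qid[OF qQ] that by simp
  moreover have "ip (q (A (q x))) y = ip (A (q x)) (q y)" using that al by (intro qs) auto
  ultimately show ?thesis using that al by (simp add: B_def)
 qed
 have Bs: "selfadj B" unfolding selfadj_def
 proof (intro ballI)
  fix x y assume x: "x \<in> \<H>" and y: "y \<in> \<H>"
  have "ip x (B y) = cnj (ip (B y) x)" using x y Bl by (intro cinner_commute) auto
  also have "\<dots> = cnj (ip (A (q y)) (q x)) + of_real m * cnj (ip (q y) (q x))" using ipB[OF y x] by simp
  also have "cnj (ip (A (q y)) (q x)) = ip (q x) (A (q y))" using x y al by (intro cinner_commute[symmetric]) auto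
  also have "\<dots> = ip (A (q x)) (q y)" using A(2) x y by (simp add: selfadj_def)
  also have "cnj (ip (q y) (q x)) = ip (q x) (q y)" using x y by (intro cinner_commute[symmetric]) auto
  finally show "ip (B x) y = ip x (B y)" using ipB[OF x y] by simp
 qed
 have ReA: "\<bar>Re (ip (A (q x)) (q x))\<bar> <= m * (nm (q x))\<^sup>2" if x: "x \<in> \<H>" for x
 proof -
  have "\<bar>Re (ip (A (q x)) (q x))\<bar> <= nm (A (q x)) * nm (q x)"
   using abs_Re_le_cmod[of "ip (A (q x)) (q x)"] cauchy_schwarz[of "A (q x)" "q x"] x al by fastforce
  also have "\<dots> <= (m * nm (q x)) * nm (q x)" using m(2)[of "q x"] x by (intro mult_right_mono) auto
  finally show ?thesis by (simp add: power2_eq_square)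
 qed
 have pos: "0 <= Re (ip (B x) x)" if x: "x \<in> \<H>" for x
  using ReA[OF x] ipB[OF x x] x by (simp add: ip_self)
 have up: "Re (ip (B x) x) <= (2 * m) * (nm x)\<^sup>2" if x: "x \<in> \<H>" for x
 proof -
  have "Re (ip (B x) x) <= 2 * m * (nm (q x))\<^sup>2" using ReA[OF x] ipB[OF x x] x by (simp add: ip_self)
  also have "\<dots> <= 2 * m * (nm x)\<^sup>2" using qn[OF x] x m by (intro mult_left_mono power_mono) auto
  finally show ?thesis .
 qed
 obtain C where C: "!!x. x \<in> \<H> ==> nm (B x) <= C * nm x" using approximable_bounded[OF aB] by blast
 define vals where "vals = (\<lambda>x. Re (ip (B x) x)) ` {x \<in> \<H>. nm x <= 1}"
 define s where "s = Sup vals"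
 have bX: "bdd_above vals" unfolding vals_def
 proof (rule bdd_aboveI2)
  fix x assume "x \<in> {x \<in> \<H>. nm x <= 1}"
  hence x: "x \<in> \<H>" "nm x <= 1" by auto
  have "(nm x)\<^sup>2 <= 1" using x by (simp add: power_le_one)
  hence "2 * m * (nm x)\<^sup>2 <= 2 * m * 1" using m by (intro mult_left_mono) auto
  thus "Re (ip (B x) x) <= 2 * m" using up[OF x(1)] by simp
 qed
 have 0: "0 \<in> vals" unfolding vals_def by (rule image_eqI[of _ _ "\<zero>"]) (use Bl in auto)
 have s0: "0 <= s" unfolding s_def using 0 bX by (rule cSup_upper)
 have sup: "Re (ip (B x) x) <= s * (nm x)\<^sup>2" if x: "x \<in> \<H>" for x
 proof (cases "x = \<zero>")
  case True thus ?thesis using Bl by simp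
 next
  case False
  hence nx: "nm x > 0" using nm_pos x by blast
  define y where "y = of_real (1 / nm x) \<odot> x"
  have y: "y \<in> \<H>" "nm y <= 1" using x nx by (auto simp: y_def norm_divide)
  have "Re (ip (B y) y) <= s" unfolding s_def using y bX by (intro cSup_upper) (auto simp: vals_def)
  moreover have "Re (ip (B y) y) = Re (ip (B x) x) / (nm x)\<^sup>2"
   using x Bl nx by (simp add: y_def power2_eq_square)
  ultimately show ?thesis using nx by (simp add: divide_le_eq)
 qed
 have main: "\<forall>x\<in>Q. B x = of_real s \<odot> x"
 proof (cases "s = 0")
  case True
  show ?thesis
  proof
   fix x assume x: "x \<in> Q"
   note xH = QH[OF x]
   have "Re (ip (B (B x)) (B x)) <= 1 * (nm (B x))\<^sup>2" 
    by (rule order_trans[OF sup[OF Bl(1)[OF xH]] mult_right_mono]) (use True in auto)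
   hence "(nm (B x))\<^sup>2 <= 1 * Re (ip (B x) x)"
    by (intro positive_form_bound approximableD(1)[OF aB] Bs xH pos) auto
   moreover have "Re (ip (B x) x) <= 0" using sup[OF xH] True by simp
   ultimately have "(nm (B x))\<^sup>2 <= 0" by linarith
   hence "nm (B x) = 0" by simp
   thus "B x = of_real s \<odot> x" using True xH Bl(1)[OF xH] smult_l_null by simp
  qed
 next
  case False
  hence sp: "s > 0" using s0 by simp
  obtain U where U: "finite U" "orthonormal U" "U \<subseteq> Q" "!!x. x \<in> Q ==> fproj U x = x"
   using bounded_orthonormal_basis[OF Q n] by blast
  have UH: "u \<in> \<H>" if "u \<in> U" for u using U(3) QH that by blast
  have fin: "B x = finsum H (\<lambda>u. ip x u \<odot> B u) U" if x: "x \<in> \<H>" for x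
  proof (rule vec_eqI)
   fix z assume z: "z \<in> \<H>"
   have Bq: "B x = B (q x)" using qid[OF qQ[OF x]] x by (simp add: B_def)
   have "ip (B x) z = ip (q x) (B z)" unfolding Bq using Bs x z by (simp add: selfadj_def)
   also have "q x = fproj U (q x)" using U(4) qQ[OF x] by simp
   also have "ip (fproj U (q x)) (B z) = (\<Sum>u\<in>U. ip (q x) u * ip u (B z))"
    by (rule ip_fproj[OF U(2,1)]) (use x z Bl in auto)
   also have "\<dots> = (\<Sum>u\<in>U. ip x u * ip (B u) z)"
   proof (rule sum.cong)
    fix u assume u: "u \<in> U"
    have "ip (q x) u = ip x u" using qs[OF x UH[OF u]] qid U(3) u by auto
    moreover have "ip u (B z) = ip (B u) z" using Bs UH[OF u] z by (simp add: selfadj_def)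
    ultimately show "ip (q x) u * ip u (B z) = ip x u * ip (B u) z" by simp
   qed simp
   finally show "ip (B x) z = ip (finsum H (\<lambda>u. ip x u \<odot> B u) U) z"
    using U(1) UH Bl x z by (simp add: ip_sum_left)
  qed (use x Bl UH in auto)
  have top: "\<exists>x\<in>\<H>. Re (ip (B x) x) > s' * (nm x)\<^sup>2" if "s' < s" for s'
  proof -
   have "max s' 0 < Sup vals" using that sp by (simp add: s_def)
   then obtain y where "y \<in> vals" "max s' 0 < y" using less_cSupD[of vals "max s' 0"] 0 by blast
   then obtain x where x: "x \<in> \<H>" "nm x <= 1" "max s' 0 < Re (ip (B x) x)"
    unfolding vals_def by blast
   have "s' * (nm x)\<^sup>2 <= max s' 0 * (nm x)\<^sup>2" by (intro mult_right_mono) auto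
   also have "\<dots> <= max s' 0 * 1" using x by (intro mult_left_mono power_le_one) auto
   finally show ?thesis using x by (intro bexI[of _ x]) auto
  qed
  have BU: "B u \<in> \<H>" if "u \<in> U" for u using Bl(1)[OF UH[OF that]] .
  have gap: "Re (ip (B x) x) <= 0 * (nm x)\<^sup>2 + Re (ip (finsum H (\<lambda>u. ip x u \<odot> B u) U) x)" if "x \<in> \<H>" for x
   using fin[OF that] by simp
  define E where "E = eigenspace B s"
  have E: "csub E" unfolding E_def by (rule eigenspace_csub[OF approximableD(1)[OF aB] C])
  have EQ: "E \<subseteq> Q"
  proof
   fix x assume "x \<in> E"
   hence x: "x \<in> \<H>" "B x = of_real s \<odot> x" by (auto simp: E_def eigenspace_def)
   have "x = of_real (1 / s) \<odot> B x" unfolding x(2) by (rule vec_eqI) (use x(1) sp in auto)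
   thus "x \<in> Q" using csubD(4)[OF Q BQ[OF x(1)]] by metis
  qed
  have u1: "\<exists>u\<in>E. nm u = 1" unfolding E_def
   by (rule top_spectral_projection(1)[OF approximableD(1)[OF aB] Bs C pos sp sp sup U(1) UH BU gap top])
  have "\<exists>\<delta>\<ge>0. \<delta> < 1 \<and> (\<forall>n. \<forall>x\<in>\<H>.
    nm (of_real (1 / s ^ n) \<odot> (B ^^ n) x \<ominus> oproj (eigenspace B s) x) <= \<delta> ^ n * nm x)"
   by (rule top_spectral_projection(2)[OF approximableD(1)[OF aB] Bs C pos sp sp sup U(1) UH BU gap top])
  then obtain \<delta> where "0 <= \<delta>" "\<delta> < 1" "!!n x. x \<in> \<H> ==>
    nm (of_real (1 / s ^ n) \<odot> (B ^^ n) x \<ominus> oproj (eigenspace B s) x) <= \<delta> ^ n * nm x" by blast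
  hence aE: "approximable (oproj E)" unfolding E_def
   by (intro approximable_eigenprojection[OF aB sp E[unfolded E_def]]) auto
  have "Q \<subseteq> E"
  proof (rule ccontr)
   assume "\<not> Q \<subseteq> E"
   then obtain x where "x \<in> Q" "x \<notin> E" by blast
   then obtain u where u: "u \<in> Q" "nm u = 1" "\<forall>w\<in>E. ip u w = 0"
    using exists_unit_orthogonal[OF E Q EQ] by blast
   show False
   proof (rule minimal[OF E EQ aE u1])
    fix V assume V: "finite V" "orthonormal V" "V \<subseteq> E"
    have "orthonormal (insert u V)" "u \<notin> V"
     using orthonormal_insert[OF V(2) QH[OF u(1)] u(2)] u(3) V(3) by auto
    thus "Suc (card V) <= n" using n[of "insert u V"] V u(1) EQ by auto
   qed
  qed
  thus ?thesis by (auto simp: E_def eigenspace_def)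
 qed
 have "q (A x) = (of_real s - of_real m) \<odot> x" if x: "x \<in> Q" for x
 proof (rule vec_eqI)
  note xH = QH[OF x]
  fix z assume z: "z \<in> \<H>"
  have "ip (B x) z = of_real s * ip x z" using main x xH z by simp
  moreover have "ip (B x) z = ip (q (A x)) z + of_real m * ip x z"
   using qid[OF x] xH z al by (simp add: B_def)
  ultimately have "ip (q (A x)) z + of_real m * ip x z = of_real s * ip x z" by simp
  thus "ip (q (A x)) z = ip ((of_real s - of_real m) \<odot> x) z" using xH z by (simp add: algebra_simps)
 qed (use QH[OF x] al in auto)
 thus ?thesis unfolding q_def by blast
qed

text \<open>Among the nonzero projections below \<open>W\<close> in the closure take one of least rank: self-adjoint
 elements compress to scalars on it, hence all elements do.\<close>

lemma minimal_projection:
 assumes W: "csub W" and aW: "approximable (oproj W)" and u: "u \<in> W" "nm u = 1"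
  and N: "!!U. finite U ==> orthonormal U ==> U \<subseteq> W ==> card U <= N"
 obtains Q v where "csub Q" "Q \<subseteq> W" "approximable (oproj Q)" "v \<in> Q" "nm v = 1"
  "!!f. f \<in> group_algebra G ==> \<exists>c. oproj Q (rho f v) = c \<odot> v"
proof -
 define P where "P n Q \<longleftrightarrow> csub Q \<and> Q \<subseteq> W \<and> approximable (oproj Q) \<and> (\<exists>u\<in>Q. nm u = 1) \<and>
  (\<forall>U. finite U \<and> orthonormal U \<and> U \<subseteq> Q --> card U <= n)" for n Q
 have ex: "\<exists>n. \<exists>Q. P n Q" using assms unfolding P_def by blast
 define n where "n = (LEAST n. \<exists>Q. P n Q)"
 obtain Q where Q: "P n Q" using LeastI_ex[OF ex] by (auto simp: n_def)
 have least: "n <= k" if "P k E" for k E unfolding n_def using that by (intro Least_le) blast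
 have c: "csub Q" "Q \<subseteq> W" "approximable (oproj Q)" using Q by (auto simp: P_def)
 obtain v where v: "v \<in> Q" "nm v = 1" using Q by (auto simp: P_def)
 have card: "card U <= n" if "finite U" "orthonormal U" "U \<subseteq> Q" for U using Q that by (auto simp: P_def)
 have sc: "\<exists>c. \<forall>x\<in>Q. oproj Q (A x) = c \<odot> x" if A: "approximable A" "selfadj A" for A
 proof (rule compression_scalar_selfadj[OF c(1,3) card _ A])
  fix E assume E: "csub E" "E \<subseteq> Q" "approximable (oproj E)" "\<exists>u\<in>E. nm u = 1"
   "!!U. finite U ==> orthonormal U ==> U \<subseteq> E ==> Suc (card U) <= n"
  have "orthonormal {}" by (simp add: orthonormal_def)
  hence "n \<ge> 1" using E(5)[of "{}"] by simp
  have "P (n - 1) E" unfolding P_def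
  proof (intro conjI allI impI)
   show "E \<subseteq> W" using E(2) c(2) by blast
   fix U assume "finite U \<and> orthonormal U \<and> U \<subseteq> E"
   thus "card U <= n - 1" using E(5)[of U] by auto
  qed (rule E)+
  from least[OF this] show False using \<open>n \<ge> 1\<close> by simp
 qed
 have "\<exists>c. oproj Q (rho f v) = c \<odot> v" if f: "f \<in> group_algebra G" for f
 proof -
  note fs = G.group_algebra_star[OF f]
  have vH: "v \<in> \<H>" using csub_mem[OF c(1) v(1)] .
  have star: "ip (rho (ga_star G f) x) y = ip x (rho f y)" if "x \<in> \<H>" "y \<in> \<H>" for x y
   using rho_star[OF f that(2,1)] that f fs cinner_commute[of "rho f y" x] cinner_commute[of y "rho (ga_star G f) x"]
   by simp
  define A1 where "A1 x = (1/2) \<odot> (rho f x \<oplus> rho (ga_star G f) x)" for x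
  define A2 where "A2 x = (- \<i>/2) \<odot> (rho f x \<oplus> (-1) \<odot> rho (ga_star G f) x)" for x
  have a1: "approximable A1" unfolding A1_def by (intro approximable_scale approximable_add approximable_rho f fs)
  have a2: "approximable A2" unfolding A2_def by (intro approximable_scale approximable_add approximable_rho f fs)
  have s1: "selfadj A1" unfolding selfadj_def A1_def using f fs rho_star[OF f] star by simp
  have s2: "selfadj A2" unfolding selfadj_def A2_def using f fs rho_star[OF f] star by (simp add: algebra_simps)
  obtain c1 where c1: "oproj Q (A1 v) = c1 \<odot> v" using sc[OF a1 s1] v by blast
  obtain c2 where c2: "oproj Q (A2 v) = c2 \<odot> v" using sc[OF a2 s2] v by blast
  note l = linear_opD[OF oproj_linear[OF c(1)]]
  have A12: "A1 v \<in> \<H>" "A2 v \<in> \<H>"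
   using vH linear_opD(1)[OF approximableD(1)[OF a1]] linear_opD(1)[OF approximableD(1)[OF a2]] by auto
  have "rho f v = A1 v \<oplus> \<i> \<odot> A2 v"
   by (rule vec_eqI) (use f fs vH in \<open>auto simp: A1_def A2_def algebra_simps\<close>)
  hence "oproj Q (rho f v) = c1 \<odot> v \<oplus> \<i> \<odot> (c2 \<odot> v)" using l A12 c1 c2 by simp
  also have "\<dots> = (c1 + \<i> * c2) \<odot> v" by (rule vec_eqI) (use vH in \<open>auto simp: algebra_simps\<close>)
  finally show ?thesis by blast
 qed
 thus ?thesis using that c v by blast
qed

definition cyclic_space :: "'h => 'h set" where
 "cyclic_space v = {x \<in> \<H>. \<forall>\<epsilon>>0. \<exists>f\<in>group_algebra G. nm (x \<ominus> rho f v) < \<epsilon>}"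

lemma cyclic_space_csub: assumes v: "v \<in> \<H>" shows "csub (cyclic_space v)"
proof (rule csubI)
 have z: "(\<lambda>g. 0) \<in> group_algebra G" by (rule group_algebraI[of "{}"]) auto
 have "nm (rho (\<lambda>g. 0) v) = 0" using rho_bound[OF z v] rho_closed[OF z v]
  by (intro antisym) (auto simp: l1norm_def simp del: nm_eq0)
 hence "rho (\<lambda>g. 0) v = \<zero>" using rho_closed[OF z v] by simp
 thus "\<zero> \<in> cyclic_space v" unfolding cyclic_space_def using z by (auto intro!: bexI[OF _ z])
next
 fix x y assume x: "x \<in> cyclic_space v" and y: "y \<in> cyclic_space v"
 hence xy: "x \<in> \<H>" "y \<in> \<H>" by (auto simp: cyclic_space_def)
 have "\<exists>f\<in>group_algebra G. nm (x \<oplus> y \<ominus> rho f v) < \<epsilon>" if e: "\<epsilon> > 0" for \<epsilon>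
 proof -
  obtain f where f: "f \<in> group_algebra G" "nm (x \<ominus> rho f v) < \<epsilon> / 2"
   using x e half_gt_zero[OF e] unfolding cyclic_space_def by blast
  obtain h where h: "h \<in> group_algebra G" "nm (y \<ominus> rho h v) < \<epsilon> / 2"
   using y e half_gt_zero[OF e] unfolding cyclic_space_def by blast
  have "x \<oplus> y \<ominus> rho (\<lambda>g. f g + h g) v = (x \<ominus> rho f v) \<oplus> (y \<ominus> rho h v)"
   unfolding rho_add[OF f(1) h(1) v] by (rule vec_eqI) (use xy f(1) h(1) v in auto)
  hence "nm (x \<oplus> y \<ominus> rho (\<lambda>g. f g + h g) v) < \<epsilon>"
   using nm_triangle[of "x \<ominus> rho f v" "y \<ominus> rho h v"] f h xy v by simp
  thus ?thesis using group_algebra_add[OF f(1) h(1)] by blast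
 qed
 thus "x \<oplus> y \<in> cyclic_space v" using xy by (simp add: cyclic_space_def)
next
 fix c x assume x: "x \<in> cyclic_space v"
 hence xH: "x \<in> \<H>" by (auto simp: cyclic_space_def)
 have "\<exists>f\<in>group_algebra G. nm (c \<odot> x \<ominus> rho f v) < \<epsilon>" if e: "\<epsilon> > 0" for \<epsilon>
 proof -
  have "\<epsilon> / (cmod c + 1) > 0" using e by (simp add: add_nonneg_pos)
  then obtain f where f: "f \<in> group_algebra G" "nm (x \<ominus> rho f v) < \<epsilon> / (cmod c + 1)"
   using x unfolding cyclic_space_def by blast
  have p: "cmod c + 1 > 0" by (simp add: add_nonneg_pos)
  have "c \<odot> x \<ominus> rho (\<lambda>g. c * f g) v = c \<odot> (x \<ominus> rho f v)"
   unfolding rho_scale[OF f(1) v] by (rule vec_eqI) (use xH f(1) v in \<open>auto simp: algebra_simps\<close>)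
  hence "nm (c \<odot> x \<ominus> rho (\<lambda>g. c * f g) v) = cmod c * nm (x \<ominus> rho f v)" using xH f(1) v by simp
  also have "\<dots> <= (cmod c + 1) * nm (x \<ominus> rho f v)" using xH f(1) v by (intro mult_right_mono) auto
  also have "\<dots> < \<epsilon>" using f(2) p by (simp add: pos_less_divide_eq mult.commute)
  finally show ?thesis using group_algebra_scale[OF f(1)] by blast
 qed
 thus "c \<odot> x \<in> cyclic_space v" using xH by (simp add: cyclic_space_def)
next
 fix x l assume x: "!!n. x n \<in> cyclic_space v" and t: "tends x l"
 have "\<exists>f\<in>group_algebra G. nm (l \<ominus> rho f v) < \<epsilon>" if e: "\<epsilon> > 0" for \<epsilon>
 proof -
  have "\<forall>\<^sub>F n in sequentially. nm (x n \<ominus> l) < \<epsilon> / 2" using order_tendstoD(2)[OF tendsD(3)[OF t] half_gt_zero[OF e]] .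
  then obtain n where n: "nm (x n \<ominus> l) < \<epsilon> / 2" by (auto simp: eventually_sequentially)
  obtain f where f: "f \<in> group_algebra G" "nm (x n \<ominus> rho f v) < \<epsilon> / 2"
   using x[of n] half_gt_zero[OF e] unfolding cyclic_space_def by blast
  have "nm (l \<ominus> rho f v) <= nm (l \<ominus> x n) + nm (x n \<ominus> rho f v)"
   by (rule nm_triangle_diff) (use tendsD[OF t] f(1) v in auto)
  also have "nm (l \<ominus> x n) = nm (x n \<ominus> l)" by (rule nm_minus_commute) (use tendsD[OF t] in auto)
  finally show ?thesis using n f by (intro bexI[OF _ f(1)]) simp
 qed
 thus "l \<in> cyclic_space v" using tendsD(1)[OF t] by (simp add: cyclic_space_def)
qed (auto simp: cyclic_space_def)

lemma cyclic_space_rho: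
 assumes v: "v \<in> \<H>" and f: "f \<in> group_algebra G" shows "rho f v \<in> cyclic_space v"
 unfolding cyclic_space_def using v f by (auto intro!: bexI[OF _ f])

lemma cyclic_space_base: assumes v: "v \<in> \<H>" shows "v \<in> cyclic_space v"
 using cyclic_space_rho[OF v group_algebra_single[of "\<one>\<^bsub>G\<^esub>" G]] rho_single[of "\<one>\<^bsub>G\<^esub>" v] v by simp

lemma cyclic_space_invariant:
 assumes v: "v \<in> \<H>" and g: "g \<in> carrier G" and x: "x \<in> cyclic_space v"
 shows "\<pi> g x \<in> cyclic_space v"
proof -
 have xH: "x \<in> \<H>" using x by (simp add: cyclic_space_def)
 have "\<exists>f\<in>group_algebra G. nm (\<pi> g x \<ominus> rho f v) < \<epsilon>" if e: "\<epsilon> > 0" for \<epsilon>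
 proof -
  obtain f where f: "f \<in> group_algebra G" "nm (x \<ominus> rho f v) < \<epsilon>" using x e unfolding cyclic_space_def by blast
  have s: "ga_single g \<in> group_algebra G" by (rule group_algebra_single[OF g])
  have "\<pi> g x \<ominus> rho (ga_conv G (ga_single g) f) v = \<pi> g (x \<ominus> rho f v)"
   using linear_opD(4)[OF act_linear[OF g] xH] v f(1) by (simp add: rho_conv[OF s f(1) v] rho_single[OF g])
  hence "nm (\<pi> g x \<ominus> rho (ga_conv G (ga_single g) f) v) < \<epsilon>" using f g xH v by simp
  thus ?thesis using G.group_algebra_conv[OF s f(1)] by blast
 qed
 thus ?thesis using act_closed[OF g xH] by (simp add: cyclic_space_def)
qed

lemma cyclic_space_least:
 assumes v: "v \<in> W" and W: "csub W" and inv: "!!g x. [|g \<in> carrier G; x \<in> W|] ==> \<pi> g x \<in> W"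
 shows "cyclic_space v \<subseteq> W"
proof
 have vH: "v \<in> \<H>" using csub_mem[OF W v] .
 fix x assume x: "x \<in> cyclic_space v"
 hence xH: "x \<in> \<H>" by (simp add: cyclic_space_def)
 have "1 / (real n + 1) > 0" for n by (simp add: add_nonneg_pos)
 hence "\<exists>f\<in>group_algebra G. nm (x \<ominus> rho f v) < 1 / (real n + 1)" for n
  using x unfolding cyclic_space_def by blast
 then obtain f where f: "!!n. f n \<in> group_algebra G" "!!n. nm (x \<ominus> rho (f n) v) < 1 / (real n + 1)" by metis
 have "tends (\<lambda>n. rho (f n) v) x" unfolding tends_def
 proof (intro conjI allI xH)
  show "(\<lambda>n. nm (rho (f n) v \<ominus> x)) \<longlonglongrightarrow> 0"
  proof (rule Lim_null_comparison)
   show "\<forall>\<^sub>F n in sequentially. norm (nm (rho (f n) v \<ominus> x)) <= 1 / (real n + 1)"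
    using f(2) nm_minus_commute[OF rho_closed[OF f(1) vH] xH] rho_closed[OF f(1) vH] xH
    by (simp add: less_imp_le)
   show "(\<lambda>n. 1 / (real n + 1)) \<longlonglongrightarrow> 0"
    using LIMSEQ_Suc[OF lim_const_over_n[of "1::real"]] by (simp add: add.commute)
  qed
 qed (use f vH in simp)
 moreover have "rho (f n) v \<in> W" for n
  using approximable_invariant[OF approximable_rho[OF f(1)] W inv v] by blast
 ultimately show "x \<in> W" by (intro csubD(5)[OF W, of "\<lambda>n. rho (f n) v" x])
qed

end

context hspace_action
begin

text \<open>If the closure contains the projection onto a cyclic vector, it contains all operators of rank
 one, hence all compact operators: these are limits of operators \<open>\<Sum>\<langle>x, A\<^sup>* u\<rangle> u\<close>.\<close>

lemma rank_one_approximable: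
 assumes v: "v \<in> \<H>" and q: "approximable (\<lambda>x. ip x v \<odot> v)"
  and cyc: "cyclic_space v = \<H>" and y: "y \<in> \<H>" and z: "z \<in> \<H>"
 shows "approximable (\<lambda>x. ip x z \<odot> y)"
proof -
 have lin: "linear_op (\<lambda>x. ip x b \<odot> a)" if "a \<in> \<H>" "b \<in> \<H>" for a b
  unfolding linear_op_def using that by (auto intro!: vec_eqI simp: algebra_simps)
 have bas: "approximable (\<lambda>x. ip x (rho h v) \<odot> rho f v)" if f: "f \<in> group_algebra G" and h: "h \<in> group_algebra G" for f h
 proof (rule approximable_cong)
  note hs = G.group_algebra_star[OF h]
  show "approximable (\<lambda>x. rho f (ip (rho (ga_star G h) x) v \<odot> v))"
   by (rule approximable_comp[OF approximable_rho[OF f] approximable_comp[OF q approximable_rho[OF hs]]])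
  fix x assume x: "x \<in> \<H>"
  have "ip (rho (ga_star G h) x) v = ip x (rho h v)"
   using rho_star[OF h v x] x v h hs cinner_commute[of "rho h v" x] cinner_commute[of v "rho (ga_star G h) x"] by simp
  thus "rho f (ip (rho (ga_star G h) x) v \<odot> v) = ip x (rho h v) \<odot> rho f v"
   using linear_opD(3)[OF rho_linear[OF f] v] by simp
 qed
 show ?thesis
 proof (rule approximable_lim[OF lin[OF y z]])
  fix \<epsilon> :: real assume e: "\<epsilon> > 0"
  have dense: "\<exists>f\<in>group_algebra G. nm c * nm (x \<ominus> rho f v) <= \<epsilon> / 2" if x: "x \<in> \<H>" and c: "c \<in> \<H>" for x c
  proof -
   have p: "nm c + 1 > 0" using c by (simp add: add_nonneg_pos)
   hence "\<epsilon> / 2 / (nm c + 1) > 0" using e by simp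
   then obtain f where f: "f \<in> group_algebra G" "nm (x \<ominus> rho f v) < \<epsilon> / 2 / (nm c + 1)"
    using x cyc unfolding cyclic_space_def by blast
   have "nm c * nm (x \<ominus> rho f v) <= (nm c + 1) * nm (x \<ominus> rho f v)" using f x v by (intro mult_right_mono) auto
   also have "\<dots> <= \<epsilon> / 2" using f(2) p by (simp only: pos_less_divide_eq less_imp_le mult.commute)
   finally show ?thesis using f(1) by blast
  qed
  obtain f where f: "f \<in> group_algebra G" "nm z * nm (y \<ominus> rho f v) <= \<epsilon> / 2" using dense[OF y z] by blast
  define u where "u = rho f v"
  have u: "u \<in> \<H>" using f v by (simp add: u_def)
  obtain h where h: "h \<in> group_algebra G" "nm u * nm (z \<ominus> rho h v) <= \<epsilon> / 2" using dense[OF z u] by blast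
  define w where "w = rho h v"
  have w: "w \<in> \<H>" using h v by (simp add: w_def)
  have "nm (ip x z \<odot> y \<ominus> ip x w \<odot> u) <= \<epsilon> * nm x" if x: "x \<in> \<H>" for x
  proof -
   have "ip x z \<odot> y \<ominus> ip x w \<odot> u = ip x z \<odot> (y \<ominus> u) \<oplus> ip x (z \<ominus> w) \<odot> u"
    by (rule vec_eqI) (use x w y z u in \<open>auto simp: algebra_simps\<close>)
   hence "nm (ip x z \<odot> y \<ominus> ip x w \<odot> u) <= cmod (ip x z) * nm (y \<ominus> u) + cmod (ip x (z \<ominus> w)) * nm u"
    using nm_triangle[of "ip x z \<odot> (y \<ominus> u)" "ip x (z \<ominus> w) \<odot> u"] y u by simp
   also have "\<dots> <= (nm x * nm z) * nm (y \<ominus> u) + (nm x * nm (z \<ominus> w)) * nm u"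
    using x y z u w by (intro add_mono mult_right_mono cauchy_schwarz) auto
   also have "\<dots> = nm x * (nm z * nm (y \<ominus> u) + nm u * nm (z \<ominus> w))" by (simp add: algebra_simps)
   also have "\<dots> <= nm x * \<epsilon>" using f(2) h(2) x by (intro mult_left_mono) (auto simp: u_def w_def)
   finally show ?thesis by (simp add: mult.commute)
  qed
  thus "\<exists>B. approximable B \<and> (\<forall>x\<in>\<H>. nm (ip x z \<odot> y \<ominus> B x) <= \<epsilon> * nm x)"
   using bas[OF f(1) h(1)] unfolding u_def w_def by blast
 qed
qed

lemma compact_approximable:
 assumes v: "v \<in> \<H>" and q: "approximable (\<lambda>x. ip x v \<odot> v)"
  and cyc: "cyclic_space v = \<H>" and A: "A \<in> compact_ops H"
 shows "approximable A"
proof -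
 have Ab: "A \<in> bounded_ops H" using A by (simp add: compact_ops_def)
 note l = linear_opD[OF bounded_opsD(1)[OF Ab]]
 obtain C where C: "!!x. x \<in> \<H> ==> nm (A x) <= C * nm x" using bounded_opsD(3)[OF Ab] by blast
 define S where "S = A ` {x \<in> \<H>. nm x <= 1}"
 have "compactin MS.mtopology (MS.mtopology closure_of S)"
  using A by (simp add: compact_ops_def S_def htopology_def)
 hence tb: "MS.mtotally_bounded (MS.mtopology closure_of S)" by (rule MS.compactin_imp_mtotally_bounded)
 have SH: "S \<subseteq> \<H>" using l by (auto simp: S_def)
 have Scl: "S \<subseteq> MS.mtopology closure_of S" using SH by (intro closure_of_subset) simp
 show ?thesis
 proof (rule approximable_lim[OF bounded_opsD(1)[OF Ab]])
  fix \<epsilon> :: real assume e: "\<epsilon> > 0"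
  obtain Y where Y: "finite Y" "Y \<subseteq> MS.mtopology closure_of S"
   "MS.mtopology closure_of S \<subseteq> (\<Union>y\<in>Y. MS.mball y \<epsilon>)"
   using tb[unfolded MS.mtotally_bounded_def, rule_format, OF e] by (elim exE conjE)
  have YH: "Y \<subseteq> \<H>" using Y(2) closure_of_subset_topspace[of MS.mtopology S] by auto
  obtain U where U: "finite U" "orthonormal U" "U \<subseteq> \<H>" "\<forall>y\<in>Y. fproj U y = y"
   using gram_schmidt[OF Y(1) csub_carrier YH] by blast
  have "\<exists>a\<in>\<H>. \<forall>x\<in>\<H>. ip (A x) u = ip x a" if u: "u \<in> U" for u
  proof (rule riesz[OF csub_carrier, where C="C * nm u"])
   have uH: "u \<in> \<H>" using u U by auto
   fix x assume x: "x \<in> \<H>"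
   have "cmod (ip (A x) u) <= nm (A x) * nm u" using cauchy_schwarz[OF l(1)[OF x] uH] .
   also have "\<dots> <= (C * nm x) * nm u" using C[OF x] uH by (intro mult_right_mono) auto
   finally show "cmod (ip (A x) u) <= C * nm u * nm x" by (simp add: mult_ac)
   show "ip (A (x \<oplus> y)) u = ip (A x) u + ip (A y) u" if "y \<in> \<H>" for y using l x that uH by simp
   show "ip (A (c \<odot> x)) u = c * ip (A x) u" for c using l x uH by simp
  qed
  then obtain a where a: "!!u. u \<in> U ==> a u \<in> \<H>" "!!u x. u \<in> U ==> x \<in> \<H> ==> ip (A x) u = ip x (a u)"
   by metis
  define B where "B x = finsum H (\<lambda>u. ip x (a u) \<odot> u) U" for x
  have aB: "approximable B" unfolding B_def
   by (rule approximable_sum[OF U(1) rank_one_approximable[OF v q cyc]]) (use a U in auto)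
  have BA: "B x = fproj U (A x)" if x: "x \<in> \<H>" for x
   unfolding B_def fproj_def using a U(3) x by (intro M.finsum_cong') auto
  have unit: "nm (A x \<ominus> B x) <= \<epsilon>" if x: "x \<in> \<H>" "nm x <= 1" for x
  proof -
   have "A x \<in> MS.mtopology closure_of S" using x Scl by (auto simp: S_def)
   then obtain y where y: "y \<in> Y" "hdist H y (A x) < \<epsilon>" using Y(3) by auto
   have yH: "y \<in> \<H>" using y YH by blast
   have Axy: "A x \<ominus> y \<in> \<H>" using l x yH by simp
   have "A x \<ominus> fproj U (A x) = (A x \<ominus> y) \<ominus> fproj U (A x \<ominus> y)"
   proof (rule vec_eqI)
    fix w assume w: "w \<in> \<H>"
    have "ip (fproj U (A x \<ominus> y)) w = ip (fproj U (A x)) w - ip (fproj U y) w"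
     using fproj_selfadj[OF U(2,1) _ w] Axy l(1)[OF x(1)] yH w U by simp
    thus "ip (A x \<ominus> fproj U (A x)) w = ip (A x \<ominus> y \<ominus> fproj U (A x \<ominus> y)) w"
     using U y w Axy yH l(1)[OF x(1)] by simp
   qed (use l x yH U in auto)
   hence "nm (A x \<ominus> B x) <= nm (A x \<ominus> y)" using fproj_le(2)[OF U(2,1) Axy] BA[OF x(1)] by simp
   also have "\<dots> = nm (y \<ominus> A x)" using l x yH by (intro nm_minus_commute) auto
   finally show ?thesis using y(2) by (simp add: hdist_nm)
  qed
  note Bl = linear_opD[OF approximableD(1)[OF aB]]
  have "nm (A x \<ominus> B x) <= \<epsilon> * nm x" if x: "x \<in> \<H>" for x
  proof (cases "x = \<zero>")
   case True thus ?thesis using l(5) Bl(5) by simp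
  next
   case False
   hence nx: "nm x > 0" using nm_pos x by blast
   define t where "t = complex_of_real (1 / nm x)"
   have t: "cmod t = 1 / nm x" using nx by (simp add: t_def norm_divide)
   have "nm (A (t \<odot> x) \<ominus> B (t \<odot> x)) <= \<epsilon>" by (rule unit) (use x t nx in auto)
   moreover have "A (t \<odot> x) \<ominus> B (t \<odot> x) = t \<odot> (A x \<ominus> B x)"
    by (rule vec_eqI) (use x l Bl in \<open>auto simp: algebra_simps\<close>)
   ultimately have "1 / nm x * nm (A x \<ominus> B x) <= \<epsilon>" using x l Bl t by simp
   thus ?thesis using nx by (simp add: field_simps)
  qed
  thus "\<exists>B. approximable B \<and> (\<forall>x\<in>\<H>. nm (A x \<ominus> B x) <= \<epsilon> * nm x)" using aB by blast
 qed
qed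

definition sub_rep :: "'h set => 'g => 'h => 'h" where
 "sub_rep K g = restrict (\<pi> g) K"

lemma sub_action:
 assumes K: "csub K" and inv: "!!g x. [|g \<in> carrier G; x \<in> K|] ==> \<pi> g x \<in> K"
 shows "hspace_action (sub_hilbert H K) G (sub_rep K)"
proof -
 interpret S: hspace "sub_hilbert H K" by (rule hspace_sub[OF K])
 note KH = csub_mem[OF K] and a = linear_opD[OF act_linear]
 have "(\<lambda>g. restrict (\<pi> g) (carrier (sub_hilbert H K))) \<in> hom G (unitary_group (sub_hilbert H K))"
 proof (rule S.hom_unitary_groupI[OF G.group_axioms])
  show "S.linear_op (\<pi> g)" if g: "g \<in> carrier G" for g
   unfolding S.linear_op_def using inv[OF g] a(2,3)[OF g] KH by (auto simp: sub_hilbert_add)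
 qed (use KH rep_mem(3) act_mult in auto)
 moreover have "(\<lambda>g. restrict (\<pi> g) (carrier (sub_hilbert H K))) = sub_rep K" by (auto simp: sub_rep_def)
 ultimately show ?thesis
  by (intro hspace_action.intro unitary_action.intro unitary_action_axioms.intro S.hspace_axioms
    S.complex_hilbert_axioms G.group_axioms) simp
qed

lemma sub_rho:
 assumes K: "csub K" and inv: "!!g x. [|g \<in> carrier G; x \<in> K|] ==> \<pi> g x \<in> K"
  and f: "f \<in> group_algebra G" and x: "x \<in> K"
 shows "group_algebra_rep (sub_hilbert H K) (sub_rep K) f x = rho f x"
proof -
 have "finsum (sub_hilbert H K) (\<lambda>g. f g \<odot> \<pi> g x) {g. f g ~= 0} = finsum H (\<lambda>g. f g \<odot> \<pi> g x) {g. f g ~= 0}"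
  using group_algebraD(3)[OF f] inv[OF _ x] csubD(4)[OF K] by (intro sub_sum[OF K]) auto
 thus ?thesis using x csub_mem[OF K x] by (simp add: group_algebra_rep_def sub_rep_def)
qed

end

text \<open>The core of the argument: a finite spectral projection of an element of the group algebra, cut
 down to a minimal projection \<open>Q\<close>, yields a vector \<open>v\<close> whose cyclic subspace is irreducible, with
 \<open>Q\<close> acting there as the projection onto \<open>v\<close>.\<close>

theorem traceable_subrepresentation:
 fixes H :: hilbert_univ (structure) and G :: "('g, 'n) monoid_scheme"
 assumes act: "hspace_action H G \<pi>" and sep: "separable_space (htopology H)"
  and W: "hspace.csub H W" and aW: "unitary_action.approximable H G \<pi> (hspace.oproj H W)"
  and u: "u \<in> W" "hnorm H u = 1"
  and N: "!!U. finite U ==> complex_hilbert.orthonormal H U ==> U \<subseteq> W ==> card U <= N"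
  and p: "p \<in> group_algebra G" and s: "0 <= s"
  and eig: "!!w. w \<in> W ==> group_algebra_rep H \<pi> p w = of_real s \<odot> w"
  and bd: "!!x. x \<in> carrier H ==> hnorm H (group_algebra_rep H \<pi> p x) <= s * hnorm H x"
 obtains K where "hspace.csub H K" "!!g x. [|g \<in> carrier G; x \<in> K|] ==> \<pi> g x \<in> K"
  "traceable_rep G (sub_hilbert H K) (\<lambda>g. restrict (\<pi> g) K)"
  "opnorm (sub_hilbert H K) (group_algebra_rep (sub_hilbert H K) (\<lambda>g. restrict (\<pi> g) K) p) = s"
  "\<exists>v\<in>K. hnorm H v = 1"
proof -
 interpret hspace_action H G \<pi> by (rule act)
 obtain Q v where Q: "csub Q" "Q \<subseteq> W" "approximable (oproj Q)" and v: "v \<in> Q" "nm v = 1"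
  and sc: "!!f. f \<in> group_algebra G ==> \<exists>c. oproj Q (rho f v) = c \<odot> v"
  using minimal_projection[OF W aW u N] by blast
 have vH: "v \<in> carrier H" using csub_mem[OF Q(1) v(1)] .
 have vv: "ip v v = 1" using ip_self[OF vH] v by simp
 note ql = linear_opD[OF oproj_linear[OF Q(1)]]
 define K where "K = cyclic_space v"
 have K: "csub K" unfolding K_def by (rule cyclic_space_csub[OF vH])
 have inv: "\<pi> g x \<in> K" if "g \<in> carrier G" "x \<in> K" for g x
  using cyclic_space_invariant[OF vH] that by (simp add: K_def)
 have vK: "v \<in> K" unfolding K_def by (rule cyclic_space_base[OF vH])
 note KH = csub_mem[OF K]
 have qrho: "oproj Q (rho f v) = ip (rho f v) v \<odot> v" if f: "f \<in> group_algebra G" for f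
 proof -
  obtain c where c: "oproj Q (rho f v) = c \<odot> v" using sc[OF f] by blast
  have "ip (rho f v) v = ip (oproj Q (rho f v)) v" using oproj_ip[OF Q(1) _ v(1)] f vH by simp
  also have "\<dots> = c" using c vH vv by simp
  finally show ?thesis using c by simp
 qed
 have qK: "oproj Q x = ip x v \<odot> v" if x: "x \<in> K" for x
 proof -
  have xH: "x \<in> carrier H" using KH[OF x] .
  define D where "D y = oproj Q y \<ominus> ip y v \<odot> v" for y
  have Dc: "D y \<in> carrier H" if "y \<in> carrier H" for y using that ql vH by (simp add: D_def)
  have "nm (D x) <= 2 * e" if e: "e > 0" for e
  proof -
   obtain f where f: "f \<in> group_algebra G" "nm (x \<ominus> rho f v) < e" using x e unfolding K_def cyclic_space_def by blast
   define y where "y = x \<ominus> rho f v"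
   have yH: "y \<in> carrier H" using xH f vH by (simp add: y_def)
   have "D x = D y"
   proof (rule vec_eqI)
    fix z assume z: "z \<in> carrier H"
    have "oproj Q y = oproj Q x \<ominus> oproj Q (rho f v)" unfolding y_def using ql(4) xH f(1) vH by simp
    thus "ip (D x) z = ip (D y) z" using xH yH f(1) vH z ql(1) qrho[OF f(1)]
     by (simp add: D_def y_def algebra_simps)
   qed (use Dc xH yH in auto)
   hence "nm (D x) = nm (D y)" by simp
   also have "nm (D y) <= nm (oproj Q y) + nm (ip y v \<odot> v)" unfolding D_def using ql yH vH by (intro nm_diff_le) auto
   also have "\<dots> <= nm y + nm y"
    using oproj_le(1)[OF Q(1) yH] cauchy_schwarz[OF yH vH] v vH by (intro add_mono) auto
   finally show ?thesis using f(2) by (simp add: y_def)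
  qed
  hence "nm (D x) <= 0 + e" if "e > 0" for e using that by (metis add_0 half_gt_zero mult_2 field_sum_of_halves)
  hence "nm (D x) <= 0" by (rule field_le_epsilon)
  hence "D x = \<zero>" using Dc[OF xH] nm_ge0[OF Dc[OF xH]] by (metis antisym nm_eq0)
  show ?thesis
  proof (rule vec_eqI)
   fix z assume z: "z \<in> carrier H"
   have "ip (D x) z = 0" using \<open>D x = \<zero>\<close> z by simp
   thus "ip (oproj Q x) z = ip (ip x v \<odot> v) z" using xH vH z ql by (simp add: D_def)
  qed (use ql xH vH in auto)
 qed
 define S where "S = sub_hilbert H K"
 interpret S: hspace_action S G "sub_rep K" unfolding S_def by (rule sub_action[OF K inv])
 have Ssimp: "carrier S = K" "\<zero>\<^bsub>S\<^esub> = \<zero>" "c \<odot>\<^bsub>S\<^esub> x = c \<odot> x" "cinner S = cinner H" "hnorm S x = nm x" for c x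
  by (simp_all add: S_def)
 have Sminus: "x \<ominus>\<^bsub>S\<^esub> y = x \<ominus> y" if "x \<in> K" "y \<in> K" for x y using sub_minus_mem[OF K that] by (simp add: S_def)
 have Srho: "S.rho f x = rho f x" if "f \<in> group_algebra G" "x \<in> K" for f x
  using sub_rho[OF K inv that] by (simp add: S_def)
 have rhoK: "rho f x \<in> K" if "f \<in> group_algebra G" "x \<in> K" for f x
  by (rule approximable_invariant[OF approximable_rho[OF that(1)] K inv that(2)])
 have sepS: "separable_hilbert S" unfolding separable_hilbert_def separable_hilbert_axioms_def
  using sub_separable[OF K sep] S.complex_hilbert_axioms by (simp add: S_def)
 have urep: "unitary_rep G S (sub_rep K)" unfolding unitary_rep_def using sepS S.rep by simp
 have cyc: "S.cyclic_space v = carrier S"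
 proof
  show "S.cyclic_space v \<subseteq> carrier S" by (auto simp: S.cyclic_space_def)
  show "carrier S \<subseteq> S.cyclic_space v"
  proof
   fix x assume "x \<in> carrier S"
   hence x: "x \<in> K" by (simp add: Ssimp)
   have "\<exists>f\<in>group_algebra G. S.nm (x \<ominus>\<^bsub>S\<^esub> S.rho f v) < \<epsilon>" if "\<epsilon> > 0" for \<epsilon>
   proof -
    obtain f where f: "f \<in> group_algebra G" "nm (x \<ominus> rho f v) < \<epsilon>"
     using x \<open>\<epsilon> > 0\<close> unfolding K_def cyclic_space_def by blast
    thus ?thesis using x vK rhoK by (intro bexI[of _ f]) (auto simp: Srho Sminus Ssimp)
   qed
   thus "x \<in> S.cyclic_space v" using x by (simp add: S.cyclic_space_def Ssimp)
  qed
 qed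
 have q: "S.approximable (\<lambda>x. S.ip x v \<odot>\<^bsub>S\<^esub> v)" unfolding S.approximable_def
 proof (intro conjI allI impI)
  have "v \<in> carrier S" using vK by (simp add: Ssimp(1))
  thus "S.linear_op (\<lambda>x. S.ip x v \<odot>\<^bsub>S\<^esub> v)" unfolding S.linear_op_def
   by (auto intro!: S.vec_eqI simp: algebra_simps)
  fix \<epsilon> :: real assume "\<epsilon> > 0"
  then obtain f where f: "f \<in> group_algebra G" "!!x. x \<in> carrier H ==> nm (oproj Q x \<ominus> rho f x) <= \<epsilon> * nm x"
   using approximableD(2)[OF Q(3)] by blast
  have "S.nm (S.ip x v \<odot>\<^bsub>S\<^esub> v \<ominus>\<^bsub>S\<^esub> S.rho f x) <= \<epsilon> * S.nm x" if "x \<in> carrier S" for x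
   using f(2)[of x] that KH qK f(1) csubD(4)[OF K vK] rhoK[OF f(1)] by (simp add: Srho Sminus Ssimp)
  thus "\<exists>f\<in>group_algebra G. \<forall>x\<in>carrier S. S.nm (S.ip x v \<odot>\<^bsub>S\<^esub> v \<ominus>\<^bsub>S\<^esub> S.rho f x) <= \<epsilon> * S.nm x" using f(1) by blast
 qed
 have irr: "irreducible_rep G S (sub_rep K)" unfolding irreducible_rep_def
 proof (intro conjI urep allI impI)
  show "carrier S ~= {\<zero>\<^bsub>S\<^esub>}" using vK v(2) nm_zero by (auto simp: Ssimp)
  fix Y assume Y: "submodule Y complex_ring S \<and> closedin (htopology S) Y \<and> (\<forall>g\<in>carrier G. sub_rep K g ` Y \<subseteq> Y)"
  have SY: "S.csub Y" using Y by (simp add: S.csub_def)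
  have Yc: "csub Y" "Y \<subseteq> K" using sub_csub[OF K] SY unfolding S_def by blast+
  have Yi: "\<pi> g x \<in> Y" if "g \<in> carrier G" "x \<in> Y" for g x
   using Y that Yc(2) by (force simp: sub_rep_def image_subset_iff)
  define Z where "Z = {x \<in> carrier H. \<forall>w\<in>Y. ip x w = 0}"
  have Z: "csub Z" unfolding Z_def by (rule orthogonal_csub[OF csubD(1)[OF Yc(1)]])
  have Zi: "\<pi> g x \<in> Z" if "g \<in> carrier G" "x \<in> Z" for g x
   using orthogonal_invariant[OF csubD(1)[OF Yc(1)] Yi that(1)] that(2) by (simp add: Z_def)
  note o = oproj[OF Yc(1) vH]
  define w where "w = oproj Y v"
  define w' where "w' = v \<ominus> w"
  have w: "w \<in> Y" "w \<in> carrier H" using o by (auto simp: w_def)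
  have w': "w' \<in> Z" using o vH by (auto simp: w'_def w_def Z_def)
  have w'H: "w' \<in> carrier H" using w' by (simp add: Z_def)
  have Qw: "oproj Q w \<in> Y" by (rule approximable_invariant[OF Q(3) Yc(1) Yi w(1)])
  have Qw': "oproj Q w' \<in> Z" by (rule approximable_invariant[OF Q(3) Z Zi w'])
  have Qwv: "oproj Q w = ip w v \<odot> v" using qK Yc(2) w by blast
  show "Y = {\<zero>\<^bsub>S\<^esub>} \<or> Y = carrier S"
  proof (cases "ip w v = 0")
   case False
   have "v = (1 / ip w v) \<odot> oproj Q w" unfolding Qwv by (rule vec_eqI) (use False vH in auto)
   hence "v \<in> Y" using csubD(4)[OF Yc(1) Qw] by metis
   hence "K \<subseteq> Y" unfolding K_def by (rule cyclic_space_least[OF _ Yc(1) Yi])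
   thus ?thesis using Yc by (simp add: Ssimp)
  next
   case True
   have "oproj Q w' = v"
   proof -
    have "oproj Q w' = oproj Q v \<ominus> oproj Q w" unfolding w'_def using ql(4)[OF vH w(2)] .
    also have "\<dots> = v" unfolding Qwv oproj_id[OF Q(1) v(1)] True
     by (rule vec_eqI) (use vH in auto)
    finally show ?thesis .
   qed
   hence "v \<in> Z" using Qw' by simp
   hence "K \<subseteq> Z" unfolding K_def by (rule cyclic_space_least[OF _ Z Zi])
   have "y = \<zero>" if y: "y \<in> Y" for y
   proof -
    have "y \<in> Z" using y Yc(2) \<open>K \<subseteq> Z\<close> by blast
    hence "ip y y = 0" using y by (simp add: Z_def)
    thus ?thesis using csub_mem[OF Yc(1) y] cinner_self_eq_0 by blast
   qed
   hence "Y = {\<zero>}" using csubD(2)[OF Yc(1)] by blast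
   thus ?thesis by (simp add: Ssimp)
  qed
 qed
 have tr: "traceable_rep G S (sub_rep K)" unfolding traceable_rep_def
 proof (intro conjI irr subsetI)
  fix A assume A: "A \<in> compact_ops S"
  have "S.approximable A" by (rule S.compact_approximable[OF _ q cyc A]) (simp add: Ssimp vK)
  moreover have "A \<in> bounded_ops S" using A by (simp add: compact_ops_def)
  ultimately show "A \<in> cstar_rep S (sub_rep K) ` max_cstar_algebra G"
   by (rule approximable_in_image[OF G.group_axioms urep])
 qed
 have opn: "opnorm S (S.rho p) = s"
 proof (rule S.opnorm_eqI[OF S.rho_bounded_op[OF p] _ s])
  show "S.nm (S.rho p x) <= s * S.nm x" if "x \<in> carrier S" for x
   using bd[of x] that KH by (simp add: Srho[OF p] Ssimp)
  show "v \<in> carrier S" "S.nm v = 1" using vK v by (auto simp: Ssimp)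
  show "S.nm (S.rho p v) = s" using eig[of v] v Q(2) vK vH s by (auto simp: Srho[OF p] Ssimp)
 qed
 have sr: "sub_rep K = (\<lambda>g. restrict (\<pi> g) K)" by (auto simp: sub_rep_def)
 show ?thesis using that[OF K inv] tr opn vK v unfolding S_def sr by blast
qed

text \<open>On a finite-dimensional invariant subspace weak convergence to zero is convergence in norm, which
 is impossible for the images of a unit vector under unitary operators.\<close>

lemma (in hspace_action) mixing_infinite_dimensional:
 assumes K: "csub K" and inv: "!!g x. [|g \<in> carrier G; x \<in> K|] ==> \<pi> g x \<in> K" and v: "v \<in> K" "nm v = 1"
  and g: "!!n. g n \<in> carrier G"
  and mix: "!!x y. [|x \<in> \<H>; y \<in> \<H>|] ==> (\<lambda>n. ip (\<pi> (g n) x) y) \<longlonglongrightarrow> 0"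
 shows "\<not> finite_dimensional (sub_hilbert H K)"
proof
 assume "finite_dimensional (sub_hilbert H K)"
 then obtain B where B: "finite B" "B \<subseteq> K"
  "!!x. x \<in> K ==> \<exists>c. x = finsum (sub_hilbert H K) (\<lambda>b. c b \<odot> b) B"
  by (auto simp: finite_dimensional_def)
 note KH = csub_mem[OF K]
 obtain U where U: "finite U" "orthonormal U" "U \<subseteq> K" "\<forall>b\<in>B. fproj U b = b"
  using gram_schmidt[OF B(1) K B(2)] by blast
 have UH: "u \<in> \<H>" if "u \<in> U" for u using U KH that by blast
 have BH: "b \<in> \<H>" if "b \<in> B" for b using B KH that by blast
 have U4: "fproj U x = x" if x: "x \<in> K" for x
 proof (rule vec_eqI)
  obtain c where "x = finsum (sub_hilbert H K) (\<lambda>b. c b \<odot> b) B" using B(3)[OF x] by blast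
  hence c: "x = finsum H (\<lambda>b. c b \<odot> b) B" using B(2) csubD(4)[OF K] by (subst (asm) sub_sum[OF K]) auto
  fix z assume z: "z \<in> \<H>"
  have zU: "fproj U z \<in> \<H>" using U z by simp
  have "ip (fproj U x) z = ip x (fproj U z)" by (rule fproj_selfadj[OF U(2,1) KH[OF x] z])
  also have "\<dots> = (\<Sum>b\<in>B. c b * ip b (fproj U z))"
   unfolding c using BH zU by (simp add: ip_sum_left[OF B(1)])
  also have "\<dots> = (\<Sum>b\<in>B. c b * ip b z)"
   using fproj_selfadj[OF U(2,1) BH z] U(4) by (intro sum.cong) auto
  also have "\<dots> = ip x z" unfolding c using BH z by (simp add: ip_sum_left[OF B(1)])
  finally show "ip (fproj U x) z = ip x z" .
 qed (use x KH U in auto)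
 have "(\<lambda>n. \<Sum>u\<in>U. (cmod (ip (\<pi> (g n) v) u))\<^sup>2) \<longlonglongrightarrow> (\<Sum>u\<in>U. (cmod 0)\<^sup>2)"
  by (intro tendsto_sum tendsto_power tendsto_norm mix KH[OF v(1)] UH)
 moreover have "(\<Sum>u\<in>U. (cmod (ip (\<pi> (g n) v) u))\<^sup>2) = 1" for n
 proof -
  have "\<pi> (g n) v \<in> K" using inv[OF g v(1)] .
  thus ?thesis using fproj_nm_sq(1)[OF U(2,1) KH, of "\<pi> (g n) v"] U4 v(2) KH[OF v(1)] g by simp
 qed
 ultimately have "(\<lambda>n. 1 :: real) \<longlonglongrightarrow> 0" by simp
 thus False using LIMSEQ_unique[OF tendsto_const, of "1 :: real" 0] by simp
qed

section \<open>The Hilbert space of square summable functions\<close>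

definition square_summable :: "'v set => ('v => complex) set" where
 "square_summable W = {f. (\<forall>x. x \<notin> W --> f x = 0) \<and> (\<lambda>x. (cmod (f x))\<^sup>2) summable_on UNIV}"

text \<open>As for closed subspaces, addition treats functions outside the carrier as zero.\<close>

definition ell2 :: "'v set => ('v => complex) inner_module" where
 "ell2 W = \<lparr>carrier = square_summable W, mult = undefined, one = undefined, zero = (\<lambda>_. 0),
   add = (\<lambda>f g x. (if f \<in> square_summable W then f x else 0) + (if g \<in> square_summable W then g x else 0)),
   smult = (\<lambda>c f x. c * f x), cinner = (\<lambda>f g. \<Sum>\<^sub>\<infinity>x. f x * cnj (g x))\<rparr>"

definition delta :: "'v => 'v => complex" where
 "delta x = (\<lambda>y. if y = x then 1 else 0)"

lemma ell2_simps:
 "carrier (ell2 W) = square_summable W" "\<zero>\<^bsub>ell2 W\<^esub> = (\<lambda>_. 0)" "c \<odot>\<^bsub>ell2 W\<^esub> f = (\<lambda>x. c * f x)"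
 "cinner (ell2 W) f g = (\<Sum>\<^sub>\<infinity>x. f x * cnj (g x))"
 by (simp_all add: ell2_def)

lemma ell2_add: "[|f \<in> square_summable W; g \<in> square_summable W|] ==> f \<oplus>\<^bsub>ell2 W\<^esub> g = (\<lambda>x. f x + g x)"
 by (simp add: ell2_def)

lemma square_summableD:
 "f \<in> square_summable W ==> (\<lambda>x. (cmod (f x))\<^sup>2) summable_on UNIV"
 "f \<in> square_summable W ==> x \<notin> W ==> f x = 0"
 by (auto simp: square_summable_def)

lemma square_summable_add:
 assumes "f \<in> square_summable W" "g \<in> square_summable W" shows "(\<lambda>x. f x + g x) \<in> square_summable W"
proof -
 have "(\<lambda>x. 2 * (cmod (f x))\<^sup>2 + 2 * (cmod (g x))\<^sup>2) summable_on UNIV"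
  using assms by (intro summable_on_add summable_on_cmult_right square_summableD(1))
 hence "(\<lambda>x. (cmod (f x + g x))\<^sup>2) summable_on UNIV"
 proof (rule summable_on_comparison_test)
  fix x
  have "(cmod (f x + g x))\<^sup>2 <= (cmod (f x) + cmod (g x))\<^sup>2" by (intro power_mono norm_triangle_ineq) simp
  also have "\<dots> <= 2 * (cmod (f x))\<^sup>2 + 2 * (cmod (g x))\<^sup>2"
   using sum_squares_bound[of "cmod (f x)" "cmod (g x)"] by (simp add: power2_sum)
  finally show "(cmod (f x + g x))\<^sup>2 <= 2 * (cmod (f x))\<^sup>2 + 2 * (cmod (g x))\<^sup>2" .
 qed simp
 thus ?thesis using assms by (simp add: square_summable_def)
qed

lemma square_summable_scale: "f \<in> square_summable W ==> (\<lambda>x. c * f x) \<in> square_summable W"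
 by (auto simp: square_summable_def norm_mult power_mult_distrib intro!: summable_on_cmult_right)

lemma square_summable_minus: "f \<in> square_summable W ==> (\<lambda>x. - f x) \<in> square_summable W"
 using square_summable_scale[of f W "-1"] by simp

lemma square_summable_finite:
 assumes "finite F" "F \<subseteq> W" "!!x. x \<notin> F ==> f x = 0" shows "f \<in> square_summable W"
proof -
 have "finite {x. (cmod (f x))\<^sup>2 ~= 0}" using assms(3) by (intro finite_subset[OF _ assms(1)]) force
 thus ?thesis unfolding square_summable_def using assms(2,3)
  by (auto intro!: finite_nonzero_values_imp_summable_on)
qed

lemma delta_square_summable: "x \<in> W ==> delta x \<in> square_summable W"
 by (rule square_summable_finite[of "{x}"]) (auto simp: delta_def)

lemma ell2_prod_summable:
 assumes "f \<in> square_summable W" "g \<in> square_summable W" shows "(\<lambda>x. f x * cnj (g x)) summable_on UNIV"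
proof (rule abs_summable_summable)
 have "(\<lambda>x. (cmod (f x))\<^sup>2 + (cmod (g x))\<^sup>2) summable_on UNIV"
  using assms by (intro summable_on_add square_summableD(1))
 thus "(\<lambda>x. norm (f x * cnj (g x))) summable_on UNIV"
 proof (rule summable_on_comparison_test)
  fix x
  have "cmod (f x) * cmod (g x) <= (cmod (f x))\<^sup>2 + (cmod (g x))\<^sup>2"
   using sum_squares_bound[of "cmod (f x)" "cmod (g x)"]
    mult_nonneg_nonneg[OF norm_ge_zero[of "f x"] norm_ge_zero[of "g x"]] by linarith
  thus "norm (f x * cnj (g x)) <= (cmod (f x))\<^sup>2 + (cmod (g x))\<^sup>2" by (simp add: norm_mult)
 qed simp
qed

lemma ell2_cinner_self:
 assumes "f \<in> square_summable W" shows "cinner (ell2 W) f f = of_real (\<Sum>\<^sub>\<infinity>x. (cmod (f x))\<^sup>2)"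
proof -
 have "((\<lambda>x. (cmod (f x))\<^sup>2) has_sum (\<Sum>\<^sub>\<infinity>x. (cmod (f x))\<^sup>2)) UNIV"
  using square_summableD(1)[OF assms] by simp
 hence "((\<lambda>x. complex_of_real ((cmod (f x))\<^sup>2)) has_sum of_real (\<Sum>\<^sub>\<infinity>x. (cmod (f x))\<^sup>2)) UNIV"
  by (rule has_sum_of_real)
 thus ?thesis unfolding ell2_simps complex_norm_square by (rule infsumI)
qed

lemma ell2_hnorm:
 assumes "f \<in> square_summable W" shows "hnorm (ell2 W) f = sqrt (\<Sum>\<^sub>\<infinity>x. (cmod (f x))\<^sup>2)"
 unfolding hnorm_def ell2_cinner_self[OF assms] by simp

lemma ell2_module: "Module.module complex_ring (ell2 W)"
proof -
 have "abelian_group (ell2 W)"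
 proof (rule abelian_groupI)
  fix f g h assume f: "f \<in> carrier (ell2 W)" and g: "g \<in> carrier (ell2 W)" and h: "h \<in> carrier (ell2 W)"
  show "f \<oplus>\<^bsub>ell2 W\<^esub> g \<in> carrier (ell2 W)" using f g by (simp add: ell2_simps ell2_add square_summable_add)
  show "f \<oplus>\<^bsub>ell2 W\<^esub> g \<oplus>\<^bsub>ell2 W\<^esub> h = f \<oplus>\<^bsub>ell2 W\<^esub> (g \<oplus>\<^bsub>ell2 W\<^esub> h)"
   using f g h by (simp add: ell2_simps ell2_add square_summable_add add.assoc)
  show "f \<oplus>\<^bsub>ell2 W\<^esub> g = g \<oplus>\<^bsub>ell2 W\<^esub> f" using f g by (simp add: ell2_simps ell2_add add.commute)
  have z: "(\<lambda>_. 0) \<in> square_summable W" by (simp add: square_summable_def)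
  show "\<zero>\<^bsub>ell2 W\<^esub> \<oplus>\<^bsub>ell2 W\<^esub> f = f" using f z by (simp add: ell2_simps ell2_add)
  show "\<exists>g\<in>carrier (ell2 W). g \<oplus>\<^bsub>ell2 W\<^esub> f = \<zero>\<^bsub>ell2 W\<^esub>"
   using f square_summable_minus[of f W] by (intro bexI[of _ "\<lambda>x. - f x"]) (auto simp: ell2_simps ell2_add)
 qed (simp add: ell2_simps square_summable_def)
 thus ?thesis
 proof (rule moduleI[OF cring_from_type_algebra])
  fix a b and f g assume f: "f \<in> carrier (ell2 W)" and g: "g \<in> carrier (ell2 W)"
  note s = square_summable_scale
  show "a \<odot>\<^bsub>ell2 W\<^esub> f \<in> carrier (ell2 W)" using f s by (simp add: ell2_simps)
  show "(a \<oplus>\<^bsub>complex_ring\<^esub> b) \<odot>\<^bsub>ell2 W\<^esub> f = a \<odot>\<^bsub>ell2 W\<^esub> f \<oplus>\<^bsub>ell2 W\<^esub> b \<odot>\<^bsub>ell2 W\<^esub> f"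
   using f s[of f W] by (simp add: ell2_simps ell2_add distrib_right)
  show "a \<odot>\<^bsub>ell2 W\<^esub> (f \<oplus>\<^bsub>ell2 W\<^esub> g) = a \<odot>\<^bsub>ell2 W\<^esub> f \<oplus>\<^bsub>ell2 W\<^esub> a \<odot>\<^bsub>ell2 W\<^esub> g"
   using f g s[of _ W] by (simp add: ell2_simps ell2_add distrib_left)
  show "a \<otimes>\<^bsub>complex_ring\<^esub> b \<odot>\<^bsub>ell2 W\<^esub> f = a \<odot>\<^bsub>ell2 W\<^esub> (b \<odot>\<^bsub>ell2 W\<^esub> f)"
   by (simp add: ell2_simps mult.assoc)
  show "\<one>\<^bsub>complex_ring\<^esub> \<odot>\<^bsub>ell2 W\<^esub> f = f" by (simp add: ell2_simps)
 qed
qed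

lemma ell2_minus:
 "f \<ominus>\<^bsub>ell2 W\<^esub> g = (\<lambda>x. (if f \<in> square_summable W then f x else 0) - (if g \<in> square_summable W then g x else 0))"
proof -
 interpret S: Module.module complex_ring "ell2 W" by (rule ell2_module)
 have z: "(\<lambda>_. 0) \<in> square_summable W" by (simp add: square_summable_def)
 have "\<ominus>\<^bsub>ell2 W\<^esub> g = (\<lambda>x. - (if g \<in> square_summable W then g x else 0))"
 proof (cases "g \<in> square_summable W")
  case True
  thus ?thesis using square_summable_minus[OF True]
   by (intro S.M.minus_equality) (auto simp: ell2_simps ell2_add)
 next
  case False
  have "a_inv (ell2 W) g = (THE z. z = (\<lambda>_. 0))"
   unfolding a_inv_def m_inv_def using False z by (intro arg_cong[where f=The] ext) (auto simp: ell2_def)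
  thus ?thesis using False by simp
 qed
 moreover have "(\<lambda>x. - (if g \<in> square_summable W then g x else 0)) \<in> square_summable W"
  using z square_summable_minus[of g W] by (cases "g \<in> square_summable W") simp_all
 ultimately show ?thesis unfolding a_minus_def by (simp add: ell2_def)
qed

lemma ell2_minus_mem:
 "[|f \<in> square_summable W; g \<in> square_summable W|] ==> f \<ominus>\<^bsub>ell2 W\<^esub> g = (\<lambda>x. f x - g x)"
 by (simp add: ell2_minus)

lemma square_summable_diff:
 "[|f \<in> square_summable W; g \<in> square_summable W|] ==> (\<lambda>x. f x - g x) \<in> square_summable W"
 using square_summable_add[of f W "\<lambda>x. - g x"] square_summable_minus[of g W] by simp

text \<open>Each finite partial sum of squares passes to the limit; this is what makes the space complete.\<close>

lemma ell2_pointwise_limit: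
 assumes s: "!!n. s n \<in> square_summable W" and lim: "!!x. (\<lambda>n. s n x) \<longlonglongrightarrow> f x"
  and b: "\<forall>\<^sub>F n in sequentially. (\<Sum>\<^sub>\<infinity>x. (cmod (s n x))\<^sup>2) <= C"
 shows "f \<in> square_summable W" "(\<Sum>\<^sub>\<infinity>x. (cmod (f x))\<^sup>2) <= C"
proof -
 have fin: "(\<Sum>x\<in>F. (cmod (f x))\<^sup>2) <= C" if F: "finite F" for F
 proof (rule tendsto_upperbound)
  show "(\<lambda>n. \<Sum>x\<in>F. (cmod (s n x))\<^sup>2) \<longlonglongrightarrow> (\<Sum>x\<in>F. (cmod (f x))\<^sup>2)"
   by (intro tendsto_sum tendsto_power tendsto_norm lim)
  have "(\<Sum>x\<in>F. (cmod (s n x))\<^sup>2) <= (\<Sum>\<^sub>\<infinity>x. (cmod (s n x))\<^sup>2)" for n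
   using F by (intro finite_sum_le_infsum square_summableD(1)[OF s]) auto
  thus "\<forall>\<^sub>F n in sequentially. (\<Sum>x\<in>F. (cmod (s n x))\<^sup>2) <= C"
   by (intro eventually_mono[OF b]) (meson order_trans)
 qed simp
 have "(\<lambda>x. (cmod (f x))\<^sup>2) summable_on UNIV"
  by (rule nonneg_bdd_above_summable_on) (use fin in \<open>auto intro!: bdd_aboveI[of _ C]\<close>)
 moreover have "f x = 0" if "x \<notin> W" for x
  using lim[of x] square_summableD(2)[OF s that] LIMSEQ_unique[OF tendsto_const, of "0 :: complex" "f x"] by simp
 ultimately show "f \<in> square_summable W" by (simp add: square_summable_def)
 show "(\<Sum>\<^sub>\<infinity>x. (cmod (f x))\<^sup>2) <= C"
  by (rule infsum_le_finite_sums[OF square_summableD(1)[OF \<open>f \<in> square_summable W\<close>]]) (use fin in auto)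
qed

lemma complex_hilbert_axioms_ell2_core:
 assumes f: "f \<in> square_summable W" and g: "g \<in> square_summable W" and h: "h \<in> square_summable W"
 shows "cinner (ell2 W) (f \<oplus>\<^bsub>ell2 W\<^esub> g) h = cinner (ell2 W) f h + cinner (ell2 W) g h"
  "cinner (ell2 W) (c \<odot>\<^bsub>ell2 W\<^esub> f) g = c * cinner (ell2 W) f g"
  "cinner (ell2 W) g f = cnj (cinner (ell2 W) f g)"
  "cinner (ell2 W) f f \<in> \<real>\<^sub>\<ge>\<^sub>0" "cinner (ell2 W) f f = 0 ==> f = \<zero>\<^bsub>ell2 W\<^esub>"
proof -
 show "cinner (ell2 W) (f \<oplus>\<^bsub>ell2 W\<^esub> g) h = cinner (ell2 W) f h + cinner (ell2 W) g h"
  using ell2_prod_summable[OF f h] ell2_prod_summable[OF g h] by (simp add: ell2_add[OF f g] ell2_simps distrib_right infsum_add)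
 show "cinner (ell2 W) (c \<odot>\<^bsub>ell2 W\<^esub> f) g = c * cinner (ell2 W) f g"
  by (simp add: ell2_simps mult.assoc infsum_cmult_right')
 have "cnj (cinner (ell2 W) f g) = (\<Sum>\<^sub>\<infinity>x. cnj (f x * cnj (g x)))" unfolding ell2_simps by (rule infsum_cnj[symmetric])
 thus "cinner (ell2 W) g f = cnj (cinner (ell2 W) f g)" by (simp add: ell2_simps mult.commute)
 show "cinner (ell2 W) f f \<in> \<real>\<^sub>\<ge>\<^sub>0" unfolding ell2_cinner_self[OF f] by (simp add: infsum_nonneg)
 assume "cinner (ell2 W) f f = 0"
 hence z: "(\<Sum>\<^sub>\<infinity>x. (cmod (f x))\<^sup>2) = 0" unfolding ell2_cinner_self[OF f] by simp
 have "(cmod (f x))\<^sup>2 = 0" for x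
  using nonneg_infsum_le_0D[of "\<lambda>x. (cmod (f x))\<^sup>2" UNIV x] z square_summableD(1)[OF f] by simp
 thus "f = \<zero>\<^bsub>ell2 W\<^esub>" by (auto simp: ell2_simps)
qed

lemma hspace_ell2: "hspace (ell2 W)"
proof -
 interpret S: Module.module complex_ring "ell2 W" by (rule ell2_module)
 define cl where "cl f = (if f \<in> square_summable W then f else (\<lambda>_. 0))" for f :: "'a => complex"
 have clm: "cl f \<in> square_summable W" for f by (simp add: cl_def square_summable_def)
 have cli: "cl f = f" if "f \<in> square_summable W" for f using that by (simp add: cl_def)
 define N where "N f = sqrt (\<Sum>\<^sub>\<infinity>x. (cmod (f x))\<^sup>2)" for f :: "'a => complex"
 have dist: "hdist (ell2 W) f g = N (\<lambda>x. cl f x - cl g x)" for f g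
 proof -
  have "f \<ominus>\<^bsub>ell2 W\<^esub> g = (\<lambda>x. cl f x - cl g x)" by (auto simp: ell2_minus cl_def fun_eq_iff)
  thus ?thesis using ell2_hnorm[OF square_summable_diff[OF clm clm]] by (simp add: hdist_def N_def)
 qed
 have N0: "N f \<ge> 0" for f unfolding N_def by (simp add: infsum_nonneg)
 have N0D: "f = (\<lambda>_. 0)" if "f \<in> square_summable W" "N f = 0" for f
  using complex_hilbert_axioms_ell2_core(5)[OF that(1) that(1) that(1)] that(2) ell2_cinner_self[OF that(1)]
  by (simp add: N_def ell2_simps)
 have sqN: "(\<Sum>\<^sub>\<infinity>x. (cmod (h x))\<^sup>2) = (N h)\<^sup>2" for h by (simp add: N_def infsum_nonneg)
 have tri: "N (\<lambda>x. f x + g x) <= N f + N g" if f: "f \<in> square_summable W" and g: "g \<in> square_summable W" for f g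
 proof (rule power2_le_imp_le)
  have fin: "L2_set (\<lambda>x. cmod (h x)) F <= N h" if "h \<in> square_summable W" "finite F" for h F
   unfolding L2_set_def N_def using that by (intro real_sqrt_le_mono finite_sum_le_infsum square_summableD(1)) auto
  have "(\<Sum>x\<in>F. (cmod (f x + g x))\<^sup>2) <= (N f + N g)\<^sup>2" if F: "finite F" for F
  proof -
   have "L2_set (\<lambda>x. cmod (f x + g x)) F <= L2_set (\<lambda>x. cmod (f x) + cmod (g x)) F"
    by (rule L2_set_mono) (auto intro: norm_triangle_ineq)
   also have "\<dots> <= N f + N g"
    using L2_set_triangle_ineq[of "\<lambda>x. cmod (f x)" "\<lambda>x. cmod (g x)" F] fin[OF f F] fin[OF g F] by linarith
   finally show ?thesis using real_sqrt_le_iff[of _ "(N f + N g)\<^sup>2"] N0[of f] N0[of g] by (simp add: L2_set_def)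
  qed
  thus "(N (\<lambda>x. f x + g x))\<^sup>2 <= (N f + N g)\<^sup>2"
   unfolding sqN[symmetric, of "\<lambda>x. f x + g x"]
   by (intro infsum_le_finite_sums square_summableD(1)[OF square_summable_add[OF f g]])
 qed (use N0[of f] N0[of g] in simp)
 have met: "Metric_space (square_summable W) (hdist (ell2 W))"
 proof
  fix f g h
  show "0 <= hdist (ell2 W) f g" unfolding dist by (rule N0)
  show "hdist (ell2 W) f g = hdist (ell2 W) g f" unfolding dist N_def by (simp add: norm_minus_commute)
  assume f: "f \<in> square_summable W" and g: "g \<in> square_summable W"
  show "(hdist (ell2 W) f g = 0) = (f = g)"
  proof
   assume "hdist (ell2 W) f g = 0"
   hence "(\<lambda>x. f x - g x) = (\<lambda>_. 0)" using N0D[OF square_summable_diff[OF f g]] f g by (simp add: dist cli)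
   thus "f = g" by (auto simp: fun_eq_iff)
  qed (simp add: dist N_def)
  assume h: "h \<in> square_summable W"
  show "hdist (ell2 W) f h <= hdist (ell2 W) f g + hdist (ell2 W) g h"
   using tri[OF square_summable_diff[OF f g] square_summable_diff[OF g h]] f g h by (simp add: dist cli)
 qed
 interpret T: Metric_space "square_summable W" "hdist (ell2 W)" by (rule met)
 have "T.mcomplete" unfolding T.mcomplete_def
 proof (intro allI impI)
  fix s assume c: "T.MCauchy s"
  have s: "s n \<in> square_summable W" for n using c by (auto simp: T.MCauchy_def)
  have cau: "\<exists>M. \<forall>m\<ge>M. \<forall>n\<ge>M. N (\<lambda>x. s m x - s n x) < \<epsilon>" if pos: "\<epsilon> > 0" for \<epsilon>
  proof -
   obtain M where "!!m n. M <= m ==> M <= n ==> hdist (ell2 W) (s m) (s n) < \<epsilon>"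
    using c[unfolded T.MCauchy_def, THEN conjunct2, rule_format, OF pos] by (elim exE) blast
   thus ?thesis using s by (auto simp: dist cli)
  qed
  have pt: "cmod (h x) <= N h" if "h \<in> square_summable W" for h x
  proof -
   have "(\<Sum>x\<in>{x}. (cmod (h x))\<^sup>2) <= (\<Sum>\<^sub>\<infinity>x. (cmod (h x))\<^sup>2)"
    by (intro finite_sum_le_infsum square_summableD(1)[OF that]) auto
   hence "(cmod (h x))\<^sup>2 <= (N h)\<^sup>2" by (simp add: sqN)
   thus ?thesis by (rule power2_le_imp_le) (rule N0)
  qed
  have "convergent (\<lambda>n. s n x)" for x
  proof -
   have "\<exists>M. \<forall>m\<ge>M. \<forall>n\<ge>M. cmod (s m x - s n x) < \<epsilon>" if "\<epsilon> > 0" for \<epsilon>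
    using cau[OF that] pt[OF square_summable_diff[OF s s]] by (meson le_less_trans)
   hence "Cauchy (\<lambda>n. s n x)" unfolding Cauchy_def dist_norm by blast
   thus ?thesis by (simp add: Cauchy_convergent_iff)
  qed
  then obtain f where f: "!!x. (\<lambda>n. s n x) \<longlonglongrightarrow> f x" unfolding convergent_def by metis
  have close: "(\<lambda>x. s m x - f x) \<in> square_summable W \<and> N (\<lambda>x. s m x - f x) <= \<epsilon>"
   if M: "\<forall>m\<ge>M. \<forall>n\<ge>M. N (\<lambda>x. s m x - s n x) < \<epsilon>" and m: "m \<ge> M" for m M \<epsilon>
  proof -
   have e: "0 <= \<epsilon>" using M[rule_format, OF m m] N0[of "\<lambda>x. s m x - s m x"] by linarith
   have l: "(\<lambda>n. s m x - s n x) \<longlonglongrightarrow> s m x - f x" for x by (intro tendsto_intros f)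
   have "\<forall>\<^sub>F n in sequentially. (\<Sum>\<^sub>\<infinity>x. (cmod (s m x - s n x))\<^sup>2) <= \<epsilon>\<^sup>2"
    using eventually_ge_at_top[of M]
   proof eventually_elim
    case (elim n)
    have "N (\<lambda>x. s m x - s n x) <= \<epsilon>" using M m elim by (simp add: less_imp_le)
    thus ?case unfolding sqN by (intro power_mono N0)
   qed
   from ell2_pointwise_limit[of "\<lambda>n x. s m x - s n x" W, OF square_summable_diff[OF s s] l this]
   have "(\<lambda>x. s m x - f x) \<in> square_summable W" "(N (\<lambda>x. s m x - f x))\<^sup>2 <= \<epsilon>\<^sup>2" by (simp_all add: sqN)
   thus ?thesis using power2_le_imp_le e by blast
  qed
  obtain M where M: "\<forall>m\<ge>M. \<forall>n\<ge>M. N (\<lambda>x. s m x - s n x) < 1" using cau[of 1] by auto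
  have "(\<lambda>x. s M x - (s M x - f x)) \<in> square_summable W"
   using square_summable_diff[OF s[of M]] close[OF M order_refl] by blast
  hence fm: "f \<in> square_summable W" by simp
  have "limitin T.mtopology s f sequentially"
   unfolding T.limit_metric_sequentially
  proof (intro conjI fm allI impI)
   fix \<epsilon> :: real assume e: "\<epsilon> > 0"
   obtain M where M: "\<forall>m\<ge>M. \<forall>n\<ge>M. N (\<lambda>x. s m x - s n x) < \<epsilon> / 2" using cau[of "\<epsilon> / 2"] e by auto
   have "hdist (ell2 W) (s n) f < \<epsilon>" if "n \<ge> M" for n
    using close[OF M that] e fm s by (simp add: dist cli)
   thus "\<exists>N. \<forall>n\<ge>N. s n \<in> square_summable W \<and> hdist (ell2 W) (s n) f < \<epsilon>" using s by blast
  qed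
  thus "\<exists>x. limitin T.mtopology s x sequentially" by blast
 qed
 hence "complex_hilbert_axioms (ell2 W)"
  unfolding complex_hilbert_axioms_def ell2_simps(1)
  using complex_hilbert_axioms_ell2_core(1,2,4,5)[where W=W]
  by (intro conjI allI impI complex_hilbert_axioms_ell2_core(3)[where W=W]) blast+
 thus ?thesis
  using met by (intro hspace.intro complex_hilbert.intro ell2_module hspace_axioms.intro) (auto simp: ell2_simps(1))
qed

lemma ell2_ip_delta: "cinner (ell2 W) f (delta x) = f x"
proof -
 have "(\<Sum>\<^sub>\<infinity>y. f y * cnj (delta x y)) = (\<Sum>\<^sub>\<infinity>y\<in>{x}. f y * cnj (delta x y))"
  by (rule infsum_cong_neutral) (auto simp: delta_def)
 thus ?thesis by (simp add: ell2_simps delta_def)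
qed

text \<open>The point masses are total: the orthogonal complement of their closed span is zero.\<close>

lemma ell2_total:
 assumes M: "hspace.csub (ell2 W) M" and d: "!!x. x \<in> W ==> delta x \<in> M"
 shows "M = carrier (ell2 W)"
proof
 interpret hspace "ell2 W" by (rule hspace_ell2)
 show "M \<subseteq> carrier (ell2 W)" by (rule csubD(1)[OF M])
 show "carrier (ell2 W) \<subseteq> M"
 proof
  fix f assume f: "f \<in> carrier (ell2 W)"
  note o = oproj[OF M f]
  define g where "g = f \<ominus>\<^bsub>ell2 W\<^esub> oproj M f"
  have g: "g \<in> square_summable W" using f o by (simp add: g_def flip: ell2_simps(1))
  have "g x = 0" for x
  proof (cases "x \<in> W")
   case True
   hence "ip g (delta x) = 0" unfolding g_def using o(2) d by blast
   thus ?thesis by (simp add: ell2_ip_delta)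
  qed (rule square_summableD(2)[OF g])
  moreover have "g = (\<lambda>x. f x - oproj M f x)"
   unfolding g_def using f o by (intro ell2_minus_mem) (auto simp: ell2_simps(1))
  ultimately have "f = oproj M f" by (auto simp: fun_eq_iff)
  thus "f \<in> M" using o(1) by metis
 qed
qed

lemma ell2_finite_approx:
 assumes f: "f \<in> square_summable W" and e: "\<epsilon> > 0"
 shows "\<exists>F. finite F \<and> F \<subseteq> W \<and> (\<Sum>\<^sub>\<infinity>x. (cmod (f x - (if x \<in> F then f x else 0)))\<^sup>2) < \<epsilon>"
proof -
 note s = square_summableD(1)[OF f]
 obtain F where F: "finite F" "dist (\<Sum>x\<in>F. (cmod (f x))\<^sup>2) (\<Sum>\<^sub>\<infinity>x. (cmod (f x))\<^sup>2) <= \<epsilon> / 2"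
  using infsum_finite_approximation[OF s, of "\<epsilon> / 2"] e by auto
 define F' where "F' = F \<inter> W"
 have eq: "(\<Sum>x\<in>F'. (cmod (f x))\<^sup>2) = (\<Sum>x\<in>F. (cmod (f x))\<^sup>2)"
  using F square_summableD(2)[OF f] unfolding F'_def by (intro sum.mono_neutral_left) auto
 have F': "finite F'" "F' \<subseteq> W" using F by (auto simp: F'_def)
 have "(\<Sum>\<^sub>\<infinity>x. (cmod (f x))\<^sup>2) = (\<Sum>\<^sub>\<infinity>x\<in>F' \<union> (UNIV - F'). (cmod (f x))\<^sup>2)" by simp
 also have "\<dots> = (\<Sum>\<^sub>\<infinity>x\<in>F'. (cmod (f x))\<^sup>2) + (\<Sum>\<^sub>\<infinity>x\<in>UNIV - F'. (cmod (f x))\<^sup>2)"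
  using F' summable_on_subset_banach[OF s] by (intro infsum_Un_disjoint) auto
 also have "(\<Sum>\<^sub>\<infinity>x\<in>UNIV - F'. (cmod (f x))\<^sup>2) = (\<Sum>\<^sub>\<infinity>x. (cmod (f x - (if x \<in> F' then f x else 0)))\<^sup>2)"
  by (rule infsum_cong_neutral) auto
 finally have "(\<Sum>\<^sub>\<infinity>x. (cmod (f x - (if x \<in> F' then f x else 0)))\<^sup>2) <= \<epsilon> / 2"
  using F' F(2) eq by (simp add: dist_real_def)
 thus ?thesis using F' e by (intro exI[of _ F']) simp
qed

lemma ell2_separable: assumes W: "countable W" shows "separable_space (htopology (ell2 W))"
proof -
 interpret hspace "ell2 W" by (rule hspace_ell2)
 obtain Q :: "complex set" where Qc: "countable Q" and Q: "!!U. open U ==> U ~= {} ==> \<exists>q\<in>Q. q \<in> U"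
  using countable_dense_setE[where 'a = complex] by metis
 have Qd: "\<exists>q\<in>Q. cmod (z - q) < e" if "e > 0" for z e using Q[of "ball z e"] that by (auto simp: dist_norm)
 define D where "D = (\<Union>F\<in>{F. finite F \<and> F \<subseteq> W}. (\<lambda>q x. if x \<in> F then q x else 0) ` (F \<rightarrow>\<^sub>E Q))"
 have Dc: "countable D" unfolding D_def
  using countable_Collect_finite_subset[OF W] Qc by (intro countable_UN countable_image) (auto intro: countable_PiE simp: conj_commute)
 have "(\<lambda>x. if x \<in> F then q x else 0) \<in> square_summable W" if "finite F" "F \<subseteq> W" for F q
  by (rule square_summable_finite[OF that]) simp
 hence Dm: "D \<subseteq> square_summable W" unfolding D_def by blast
 have Dmem: "(\<lambda>x. if x \<in> F then q x else 0) \<in> D" if F: "finite F" "F \<subseteq> W" and q: "!!x. x \<in> F ==> q x \<in> Q" for F q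
  unfolding D_def using F q by (intro UN_I[of F] image_eqI[of _ _ "restrict q F"]) auto
 show ?thesis unfolding separable_iff
 proof (intro exI[of _ D] conjI ballI allI impI Dc)
  show "D \<subseteq> carrier (ell2 W)" using Dm by (simp add: ell2_simps)
  fix f and \<epsilon> :: real assume f: "f \<in> carrier (ell2 W)" and e: "\<epsilon> > 0"
  have fs: "f \<in> square_summable W" using f by (simp add: ell2_simps)
  obtain F where F: "finite F" "F \<subseteq> W" "(\<Sum>\<^sub>\<infinity>x. (cmod (f x - (if x \<in> F then f x else 0)))\<^sup>2) < (\<epsilon> / 2)\<^sup>2"
   using ell2_finite_approx[OF fs, of "(\<epsilon> / 2)\<^sup>2"] e by auto
  define h where "h x = (if x \<in> F then f x else 0)" for x
  have hs: "h \<in> square_summable W" by (rule square_summable_finite[OF F(1,2)]) (simp add: h_def)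
  have n1: "nm (f \<ominus>\<^bsub>ell2 W\<^esub> h) < \<epsilon> / 2"
  proof -
   have "sqrt (\<Sum>\<^sub>\<infinity>x. (cmod (f x - h x))\<^sup>2) < sqrt ((\<epsilon> / 2)\<^sup>2)" using F(3) by (intro real_sqrt_less_mono) (simp add: h_def)
   thus ?thesis using e unfolding ell2_minus_mem[OF fs hs] ell2_hnorm[OF square_summable_diff[OF fs hs]] by simp
  qed
  define \<eta> where "\<eta> = \<epsilon> / (2 * (real (card F) + 1))"
  have eta: "\<eta> > 0" using e by (simp add: \<eta>_def add_nonneg_pos)
  have "\<forall>x. \<exists>q. q \<in> Q \<and> cmod (f x - q) < \<eta>" using Qd[OF eta] by blast
  then obtain q where q: "!!x. q x \<in> Q" "!!x. cmod (f x - q x) < \<eta>" by (auto dest!: choice)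
  define d where "d x = (if x \<in> F then q x else 0)" for x
  have dD: "d \<in> D" unfolding d_def by (rule Dmem[OF F(1,2) q(1)])
  have ds: "d \<in> square_summable W" using dD Dm by blast
  have n2: "nm (h \<ominus>\<^bsub>ell2 W\<^esub> d) < \<epsilon> / 2"
  proof -
   have "(\<Sum>\<^sub>\<infinity>x. (cmod (h x - d x))\<^sup>2) = (\<Sum>\<^sub>\<infinity>x\<in>F. (cmod (h x - d x))\<^sup>2)"
    by (rule infsum_cong_neutral) (auto simp: h_def d_def)
   also have "\<dots> = (\<Sum>x\<in>F. (cmod (f x - q x))\<^sup>2)" using F by (simp add: h_def d_def)
   also have "\<dots> <= (\<Sum>x\<in>F. \<eta>\<^sup>2)" using q(2) by (intro sum_mono power_mono) (auto simp: less_imp_le)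
   also have "\<dots> = real (card F) * \<eta>\<^sup>2" by simp
   also have "\<dots> <= (real (card F))\<^sup>2 * \<eta>\<^sup>2"
   proof (rule mult_right_mono)
    have "card F <= (card F)\<^sup>2" by (simp add: power2_eq_square)
    thus "real (card F) <= (real (card F))\<^sup>2" by (metis of_nat_le_iff of_nat_power)
   qed simp
   also have "\<dots> < ((real (card F) + 1) * \<eta>)\<^sup>2"
    using eta by (simp add: power_mult_distrib power_strict_mono)
   also have "(real (card F) + 1) * \<eta> = \<epsilon> / 2"
   proof -
    have "real (card F) + 1 ~= 0" by linarith
    thus ?thesis by (simp add: \<eta>_def field_simps)
   qed
   finally have "sqrt (\<Sum>\<^sub>\<infinity>x. (cmod (h x - d x))\<^sup>2) < sqrt ((\<epsilon> / 2)\<^sup>2)" by (rule real_sqrt_less_mono)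
   thus ?thesis using e unfolding ell2_minus_mem[OF hs ds] ell2_hnorm[OF square_summable_diff[OF hs ds]] by simp
  qed
  have "nm (f \<ominus>\<^bsub>ell2 W\<^esub> d) <= nm (f \<ominus>\<^bsub>ell2 W\<^esub> h) + nm (h \<ominus>\<^bsub>ell2 W\<^esub> d)"
   using fs hs ds by (intro nm_triangle_diff) (auto simp: ell2_simps(1))
  thus "\<exists>d\<in>D. nm (f \<ominus>\<^bsub>ell2 W\<^esub> d) < \<epsilon>" using n1 n2 dD by (intro bexI[of _ d]) auto
 qed
qed

section \<open>Rooted trees\<close>

definition gdist :: "('v \<times> 'v) set => 'v => 'v => nat" where
 "gdist E x y = (LEAST n. (x, y) \<in> E ^^ n)"

lemma rtrancl_distinct_path:
 assumes "(u, v) \<in> R\<^sup>*"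
 shows "\<exists>xs. xs ~= [] \<and> hd xs = u \<and> last xs = v \<and> distinct xs \<and> successively (\<lambda>a b. (a, b) \<in> R) xs"
 using assms
proof (induction rule: converse_rtrancl_induct)
 case base
 show ?case by (rule exI[of _ "[v]"]) simp
next
 case (step u w)
 then obtain xs where xs: "xs ~= []" "hd xs = w" "last xs = v" "distinct xs" "successively (\<lambda>a b. (a, b) \<in> R) xs" by blast
 show ?case
 proof (cases "u \<in> set xs")
  case True
  then obtain ys zs where yz: "xs = ys @ u # zs" by (meson split_list)
  show ?thesis
   by (rule exI[of _ "u # zs"]) (use xs yz in \<open>auto simp: successively_append_iff\<close>)
 next
  case False
  show ?thesis
   by (rule exI[of _ "u # xs"]) (use xs False step(1) in \<open>auto simp: successively_Cons\<close>)
 qed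
qed

locale rooted_tree =
 fixes V :: "'v set" and E :: "('v \<times> 'v) set" and r :: 'v
 assumes tree: "tree_graph V E" and root: "r \<in> V"
begin

lemma edge_sym: "(x, y) \<in> E ==> (y, x) \<in> E"
 using tree by (auto simp: tree_graph_def simple_graph_def sym_def)

lemma edge_neq: "(x, y) \<in> E ==> x ~= y"
 using tree by (auto simp: tree_graph_def simple_graph_def irrefl_def)

lemma edge_V: "(x, y) \<in> E ==> x \<in> V" "(x, y) \<in> E ==> y \<in> V"
 using tree by (auto simp: tree_graph_def simple_graph_def)

lemma connected: "x \<in> V ==> y \<in> V ==> (x, y) \<in> E\<^sup>*"
 using tree by (auto simp: tree_graph_def graph_connected_def)

text \<open>A path joining the ends of an edge without using it would close up to a cycle.\<close>

lemma edge_bridge: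
 assumes e: "(u, v) \<in> E" shows "(u, v) \<notin> (E - {(u, v), (v, u)})\<^sup>*"
proof
 assume path: "(u, v) \<in> (E - {(u, v), (v, u)})\<^sup>*"
 obtain xs where xs: "xs ~= []" "hd xs = u" "last xs = v" "distinct xs"
  "successively (\<lambda>a b. (a, b) \<in> E - {(u, v), (v, u)}) xs" using rtrancl_distinct_path[OF path] by (elim exE conjE)
 have three: "3 <= length xs"
 proof (rule ccontr)
  assume "\<not> 3 <= length xs"
  hence "length xs = 0 \<or> length xs = 1 \<or> length xs = 2" by linarith
  thus False
  proof (elim disjE)
   assume "length xs = 1"
   then obtain a where "xs = [a]" by (auto simp: length_Suc_conv)
   thus False using xs edge_neq[OF e] by simp
  next
   assume "length xs = 2"
   then obtain a b where "xs = [a, b]" by (auto simp: length_Suc_conv numeral_2_eq_2)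
   thus False using xs by simp
  qed (use xs in simp)
 qed
 have "successively (\<lambda>a b. (a, b) \<in> E) xs" using xs(5) by (rule successively_mono) auto
 hence "graph_cycle E xs" unfolding graph_cycle_def xs(2,3) using three xs(4) edge_sym[OF e] by (intro conjI)
 thus False using tree by (auto simp: tree_graph_def)
qed

lemma gdist_path: assumes "x \<in> V" "y \<in> V" shows "(x, y) \<in> E ^^ gdist E x y"
proof -
 obtain n where "(x, y) \<in> E ^^ n" using connected[OF assms] by (auto simp: rtrancl_power)
 thus ?thesis unfolding gdist_def by (rule LeastI[of "\<lambda>n. (x, y) \<in> E ^^ n"])
qed

lemma gdist_le: "(x, y) \<in> E ^^ n ==> gdist E x y <= n"
 unfolding gdist_def by (rule Least_le)

lemma gdist_self [simp]: "gdist E x x = 0"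
 using gdist_le[of x x 0] by simp

lemma gdist_0: "[|x \<in> V; y \<in> V; gdist E x y = 0|] ==> x = y"
 using gdist_path[of x y] by simp

lemma gdist_triangle: assumes "x \<in> V" "y \<in> V" "z \<in> V" shows "gdist E x z <= gdist E x y + gdist E y z"
 using gdist_path[OF assms(1,2)] gdist_path[OF assms(2,3)] by (intro gdist_le) (auto simp: relpow_add)

lemma gdist_edge: assumes "(x, y) \<in> E" shows "gdist E x y <= 1"
 using gdist_le[of x y 1] assms by simp

lemma gdist_commute: assumes "x \<in> V" "y \<in> V" shows "gdist E x y = gdist E y x"
proof -
 have sym: "(b, a) \<in> E ^^ n" if "(a, b) \<in> E ^^ n" for a b n
  using that
 proof (induction n arbitrary: b)
  case (Suc n)
  then obtain c where "(a, c) \<in> E ^^ n" "(c, b) \<in> E" by auto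
  thus ?case using Suc.IH edge_sym by (meson relpow_Suc_I2)
 qed simp
 have le: "gdist E b a <= gdist E a b" if "a \<in> V" "b \<in> V" for a b
  by (rule gdist_le[OF sym[OF gdist_path[OF that]]])
 show ?thesis using le[OF assms] le[OF assms(2,1)] by simp
qed

abbreviation depth :: "'v => nat" where "depth x \<equiv> gdist E x r"

definition par :: "'v => 'v" where
 "par x = (SOME y. (x, y) \<in> E \<and> depth x = Suc (depth y))"

lemma depth_edge: assumes "(x, y) \<in> E" shows "depth x <= Suc (depth y)"
 using gdist_triangle[OF edge_V[OF assms] root] gdist_edge[OF assms] by simp

lemma par: assumes x: "x \<in> V" "x ~= r" shows "(x, par x) \<in> E" "depth x = Suc (depth (par x))"
proof -
 have "depth x ~= 0" using gdist_0[OF x(1) root] x(2) by blast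
 then obtain n where n: "depth x = Suc n" by (cases "depth x") auto
 then obtain y where y: "(x, y) \<in> E" "(y, r) \<in> E ^^ n" using gdist_path[OF x(1) root] by (metis relpow_Suc_D2)
 have "depth y <= n" using gdist_le[OF y(2)] .
 hence "depth x = Suc (depth y)" using n depth_edge[OF y(1)] by simp
 hence "\<exists>y. (x, y) \<in> E \<and> depth x = Suc (depth y)" using y by blast
 hence "(x, par x) \<in> E \<and> depth x = Suc (depth (par x))" unfolding par_def by (rule someI_ex)
 thus "(x, par x) \<in> E" "depth x = Suc (depth (par x))" by auto
qed

lemma par_V: "[|x \<in> V; x ~= r|] ==> par x \<in> V"
 using par(1) edge_V by blast

lemma depth_0 [simp]: "depth r = 0" by simp

text \<open>Two neighbours of \<open>x\<close> that are not farther from the root than \<open>x\<close> are connected through the root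
 without passing through \<open>x\<close>; hence every vertex has only one such neighbour, its parent.\<close>

lemma lower_neighbour_par:
 assumes e: "(x, y) \<in> E" and d: "depth y <= depth x" shows "x ~= r" "y = par x"
proof -
 note xV = edge_V(1)[OF e] and yV = edge_V(2)[OF e]
 show xr: "x ~= r"
 proof
  assume "x = r"
  hence "y = r" using d gdist_0[OF yV root] by simp
  thus False using edge_neq[OF e] \<open>x = r\<close> by simp
 qed
 define A where "A = {(a, b) \<in> E. a ~= x \<and> b ~= x}"
 have toroot: "(a, r) \<in> A\<^sup>*" if "a \<in> V" "a ~= x" "depth a <= depth x" for a
  using that
 proof (induction "depth a" arbitrary: a)
  case 0
  thus ?case using gdist_0[OF _ root] by auto
 next
  case (Suc n)
  have ar: "a ~= r" using Suc.hyps(2) by auto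
  note p = par[OF Suc.prems(1) ar] par_V[OF Suc.prems(1) ar]
  have px: "par a ~= x" using p(2) Suc.prems(3) by auto
  have "(par a, r) \<in> A\<^sup>*" by (rule Suc.hyps(1)) (use p Suc px in auto)
  moreover have "(a, par a) \<in> A" using p Suc.prems px by (simp add: A_def)
  ultimately show ?case by (rule converse_rtrancl_into_rtrancl[rotated])
 qed
 have symA: "(b, a) \<in> A\<^sup>*" if "(a, b) \<in> A\<^sup>*" for a b
 proof -
  have "sym A" using edge_sym by (auto simp: A_def sym_def)
  thus ?thesis using that by (meson sym_rtrancl symD)
 qed
 note px = par[OF xV xr]
 show "y = par x"
 proof (rule ccontr)
  assume ne: "y ~= par x"
  have "(y, r) \<in> A\<^sup>*" "(par x, r) \<in> A\<^sup>*"
   using toroot[OF yV] toroot[OF edge_V(2)[OF px(1)]] edge_neq[OF e] edge_neq[OF px(1)] d px(2) by auto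
  hence "(par x, y) \<in> A\<^sup>*" using symA by (meson rtrancl_trans)
  moreover have "A \<subseteq> E - {(x, y), (y, x)}" by (auto simp: A_def)
  ultimately have "(par x, y) \<in> (E - {(x, y), (y, x)})\<^sup>*" using rtrancl_mono by blast
  moreover have "(x, par x) \<in> E - {(x, y), (y, x)}" using px(1) ne edge_neq[OF px(1)] by auto
  ultimately have "(x, y) \<in> (E - {(x, y), (y, x)})\<^sup>*" by (rule converse_rtrancl_into_rtrancl[rotated])
  thus False using edge_bridge[OF e] by blast
 qed
qed

lemma edge_cases:
 assumes "(x, y) \<in> E" obtains "x ~= r" "y = par x" | "y ~= r" "x = par y"
 using lower_neighbour_par[OF assms] lower_neighbour_par[OF edge_sym[OF assms]] by (meson linear)

inductive_set desc :: "'v => 'v set" for x where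
 self: "x \<in> V ==> x \<in> desc x"
| child: "[|y \<in> V; y ~= r; par y \<in> desc x|] ==> y \<in> desc x"

lemma desc_depth: "y \<in> desc x ==> y = x \<or> depth x < depth y"
 by (induction rule: desc.induct) (use par(2) in fastforce)+

lemma desc_V: "y \<in> desc x ==> y \<in> V \<and> x \<in> V"
 by (induction rule: desc.induct) auto

lemma desc_antisym: "y \<in> desc x ==> x \<in> desc y ==> x = y"
 using desc_depth[of y x] desc_depth[of x y] by auto

lemma desc_root: "y \<in> V ==> y \<in> desc r"
proof (induction "depth y" arbitrary: y)
 case 0
 thus ?case using gdist_0[OF _ root] desc.self[OF root] by auto
next
 case (Suc n)
 have yr: "y ~= r" using Suc.hyps(2) by auto
 show ?case by (rule desc.child[OF Suc.prems yr Suc.hyps(1)]) (use par(2)[OF Suc.prems yr] par_V[OF Suc.prems yr] Suc in auto)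
qed

lemma finite_ancestors: "y \<in> V ==> finite {x. y \<in> desc x}"
proof (induction "depth y" arbitrary: y)
 case 0
 hence "y = r" using gdist_0[OF _ root] by auto
 hence "{x. y \<in> desc x} \<subseteq> {r}" using desc_depth desc_V gdist_0[OF _ root] by fastforce
 thus ?case by (rule finite_subset) simp
next
 case (Suc n)
 have yr: "y ~= r" using Suc.hyps(2) by auto
 have "{x. y \<in> desc x} \<subseteq> insert y {x. par y \<in> desc x}" by (auto elim: desc.cases)
 moreover have "finite {x. par y \<in> desc x}"
  by (rule Suc.hyps(1)) (use par(2)[OF Suc.prems yr] par_V[OF Suc.prems yr] Suc in auto)
 ultimately show ?case by (meson finite_insert finite_subset)
qed

text \<open>The edge from \<open>x\<close> to its parent is the only exit from the descendants of \<open>x\<close>, so all paths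
 from \<open>x\<close> to other vertices pass through it.\<close>

lemma desc_exit:
 assumes y: "y \<in> desc x" and e: "(y, z) \<in> E" and z: "z \<notin> desc x" shows "y = x" "z = par x"
proof -
 have "y = x \<and> z = par x" using e
 proof (cases rule: edge_cases)
  case 1
  have "y = x \<or> par y \<in> desc x" using y by (auto elim: desc.cases)
  thus ?thesis using 1 z by auto
 next
  case 2
  hence "z \<in> desc x" using y edge_V(2)[OF e] desc.child[of z x] by simp
  thus ?thesis using z by simp
 qed
 thus "y = x" "z = par x" by auto
qed

lemma gdist_outside:
 assumes x: "x \<in> V" "x ~= r" and y: "y \<in> V" "y \<notin> desc x" shows "gdist E x y = Suc (gdist E (par x) y)"
proof (rule antisym)
 have "Suc (gdist E (par x) y) <= n" if "(a, y) \<in> E ^^ n" "a \<in> desc x" for a n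
  using that
 proof (induction n arbitrary: a)
  case 0
  thus ?case using y by simp
 next
  case (Suc n)
  then obtain b where b: "(a, b) \<in> E" "(b, y) \<in> E ^^ n" by (metis relpow_Suc_D2)
  show ?case
  proof (cases "b \<in> desc x")
   case True
   thus ?thesis using Suc.IH[OF b(2)] by simp
  next
   case False
   hence "b = par x" using desc_exit(2)[OF Suc.prems(2) b(1)] by simp
   thus ?thesis using gdist_le[OF b(2)] by simp
  qed
 qed
 thus "Suc (gdist E (par x) y) <= gdist E x y" using gdist_path[OF x(1) y(1)] desc.self[OF x(1)] by blast
 show "gdist E x y <= Suc (gdist E (par x) y)"
  using gdist_triangle[OF x(1) par_V[OF x] y(1)] gdist_edge[OF par(1)[OF x]] by simp
qed

end

section \<open>Groups acting on a tree\<close>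

locale tree_action = rooted_tree V E r + G: group G
 for V :: "'v set" and E :: "('v \<times> 'v) set" and r :: 'v and G :: "('g, 'n) monoid_scheme" (structure) +
 fixes act :: "'g => 'v => 'v"
 assumes act_V: "[|g \<in> carrier G; x \<in> V|] ==> act g x \<in> V"
  and act_one: "x \<in> V ==> act \<one> x = x"
  and act_mult: "[|g \<in> carrier G; h \<in> carrier G; x \<in> V|] ==> act (g \<otimes> h) x = act g (act h x)"
  and act_E: "[|g \<in> carrier G; (x, y) \<in> E|] ==> (act g x, act g y) \<in> E"
  and countable_V: "countable V"
begin

lemma act_inv [simp]:
 assumes "g \<in> carrier G" "x \<in> V"
 shows "act (inv g) (act g x) = x" "act g (act (inv g) x) = x"
 using assms act_mult[of "inv g" g x] act_mult[of g "inv g" x] act_one by auto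

lemma act_bij: "g \<in> carrier G ==> bij_betw (act g) V V"
 by (rule bij_betw_byWitness[where f'="act (inv g)"]) (use act_V in auto)

lemma act_gdist:
 assumes g: "g \<in> carrier G" and x: "x \<in> V" and y: "y \<in> V" shows "gdist E (act g x) (act g y) = gdist E x y"
proof -
 have p: "(act h a, act h b) \<in> E ^^ n" if "(a, b) \<in> E ^^ n" "h \<in> carrier G" for a b n h
  using that by (induction n arbitrary: b) (auto intro: act_E)
 have le: "gdist E (act h a) (act h b) <= gdist E a b" if "h \<in> carrier G" "a \<in> V" "b \<in> V" for h a b
  by (rule gdist_le[OF p[OF gdist_path[OF that(2,3)] that(1)]])
 show ?thesis using le[OF g x y] le[of "inv g" "act g x" "act g y"] g x y act_V by simp
qed

text \<open>The vertices at which \<open>g\<close> does not respect the parent relation; their images lie on the path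
 from \<open>g r\<close> to the root.\<close>

definition exceptional :: "'g => 'v set" where
 "exceptional g = {x \<in> V. x = r \<or> act g x = r \<or> par (act g x) ~= act g (par x)}"

lemma exceptional_flip:
 assumes g: "g \<in> carrier G" and x: "x \<in> exceptional g" "x ~= r"
 shows "act g (par x) ~= r" "par (act g (par x)) = act g x"
proof -
 have xV: "x \<in> V" using x by (simp add: exceptional_def)
 have "(act g x, act g (par x)) \<in> E" by (rule act_E[OF g par(1)[OF xV x(2)]])
 hence "act g (par x) ~= r \<and> act g x = par (act g (par x))"
  by (cases rule: edge_cases) (use x in \<open>auto simp: exceptional_def\<close>)
 thus "act g (par x) ~= r" "par (act g (par x)) = act g x" by auto
qed

lemma finite_exceptional: assumes g: "g \<in> carrier G" shows "finite (exceptional g)"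
proof -
 let ?A = "{z. act g r \<in> desc z}"
 have "exceptional g \<subseteq> insert r ((\<lambda>z. act (inv g) (par z)) ` ?A)"
 proof
  fix x assume x: "x \<in> exceptional g"
  show "x \<in> insert r ((\<lambda>z. act (inv g) (par z)) ` ?A)"
  proof (cases "x = r")
   case False
   have xV: "x \<in> V" using x by (simp add: exceptional_def)
   define z where "z = act g (par x)"
   note f = exceptional_flip[OF g x False, folded z_def]
   have zV: "z \<in> V" unfolding z_def by (rule act_V[OF g par_V[OF xV False]])
   have "act g r \<in> desc z"
   proof (rule ccontr)
    assume "act g r \<notin> desc z"
    hence "gdist E z (act g r) = Suc (gdist E (act g x) (act g r))"
     using gdist_outside[OF zV f(1) act_V[OF g root]] f(2) by simp
    hence "depth (par x) = Suc (depth x)"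
     using act_gdist[OF g par_V[OF xV False] root] act_gdist[OF g xV root] by (simp add: z_def)
    thus False using par(2)[OF xV False] by simp
   qed
   moreover have "x = act (inv g) (par z)" using f(2) g xV by simp
   ultimately show ?thesis by blast
  qed simp
 qed
 moreover have "finite ?A" by (rule finite_ancestors[OF act_V[OF g root]])
 ultimately show ?thesis by (meson finite_imageI finite_insert finite_subset)
qed

end

section \<open>The deformed permutation representations\<close>

context hspace
begin

lemma csub_null_functionals:
 assumes add: "!!n x y. [|x \<in> carrier H; y \<in> carrier H|] ==> \<phi> n (x \<oplus> y) = \<phi> n x + \<phi> n y"
  and sc: "!!n c x. x \<in> carrier H ==> \<phi> n (c \<odot> x) = c * \<phi> n x"
  and bd: "!!n x. x \<in> carrier H ==> cmod (\<phi> n x) <= C * nm x"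
 shows "csub {x \<in> carrier H. (\<lambda>n. \<phi> n x) \<longlonglongrightarrow> (0 :: complex)}" (is "csub ?M")
proof (rule csubI)
 have "\<phi> n \<zero> = 0" for n using sc[of \<zero> n 0] by (simp add: smult_r_null)
 thus "\<zero> \<in> ?M" by simp
 show "x \<oplus> y \<in> ?M" if "x \<in> ?M" "y \<in> ?M" for x y
  using that add tendsto_add_zero[of "\<lambda>n. \<phi> n x" sequentially "\<lambda>n. \<phi> n y"] by simp
 show "c \<odot> x \<in> ?M" if "x \<in> ?M" for c x
  using that sc tendsto_mult_right_zero[of "\<lambda>n. \<phi> n x" sequentially c] by simp
 fix x l assume x: "!!n. x n \<in> ?M" and t: "tends x l"
 have lH: "l \<in> carrier H" using tendsD(1)[OF t] .
 have xH: "x k \<in> carrier H" for k using tendsD(2)[OF t] .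
 have "(\<lambda>n. \<phi> n l) \<longlonglongrightarrow> 0"
 proof (rule LIMSEQ_I)
  fix e :: real assume e: "e > 0"
  have "(\<lambda>k. C * nm (x k \<ominus> l)) \<longlonglongrightarrow> 0" using tendsD(3)[OF t] by (rule tendsto_mult_right_zero)
  hence "\<forall>\<^sub>F k in sequentially. C * nm (x k \<ominus> l) < e / 2" using order_tendstoD(2) half_gt_zero[OF e] by blast
  then obtain k where k: "C * nm (x k \<ominus> l) < e / 2" by (auto simp: eventually_sequentially)
  have "(\<lambda>n. \<phi> n (x k)) \<longlonglongrightarrow> 0" using x by simp
  then obtain N where N: "!!n. n \<ge> N ==> cmod (\<phi> n (x k)) < e / 2"
   using LIMSEQ_D[of "\<lambda>n. \<phi> n (x k)" 0 "e / 2"] e by auto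
  have "cmod (\<phi> n l - 0) < e" if "n \<ge> N" for n
  proof -
   have "l = x k \<oplus> (l \<ominus> x k)" by (rule vec_eqI) (use lH xH in auto)
   hence "\<phi> n l = \<phi> n (x k) + \<phi> n (l \<ominus> x k)" using add[of "x k" "l \<ominus> x k" n] lH xH by simp
   moreover have "cmod (\<phi> n (l \<ominus> x k)) <= C * nm (x k \<ominus> l)"
    using bd[of "l \<ominus> x k" n] nm_minus_commute[OF lH xH, of k] lH xH by simp
   ultimately show ?thesis using N[OF that] k norm_triangle_ineq[of "\<phi> n (x k)" "\<phi> n (l \<ominus> x k)"] by simp
  qed
  thus "\<exists>N. \<forall>n\<ge>N. cmod (\<phi> n l - 0) < e" by blast
 qed
 thus "l \<in> ?M" using lH by simp
qed simp

lemma csub_equal_functionals: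
 assumes add: "!!x y. [|x \<in> carrier H; y \<in> carrier H|] ==> \<phi> (x \<oplus> y) = \<phi> x + \<phi> y"
  and sc: "!!c x. x \<in> carrier H ==> \<phi> (c \<odot> x) = c * \<phi> x"
  and bd: "!!x. x \<in> carrier H ==> cmod (\<phi> x) <= C * nm x"
 shows "csub {x \<in> carrier H. \<phi> x = (0 :: complex)}"
proof -
 have "{x \<in> carrier H. \<phi> x = 0} = {x \<in> carrier H. (\<lambda>n. \<phi> x) \<longlonglongrightarrow> 0}" by (simp add: LIMSEQ_const_iff)
 thus ?thesis using csub_null_functionals[of "\<lambda>n. \<phi>" C] assms by simp
qed

end

lemma ell2_finsum:
 assumes "finite I" "!!i. i \<in> I ==> f i \<in> square_summable W"
 shows "finsum (ell2 W) f I = (\<lambda>z. \<Sum>i\<in>I. f i z)" "(\<lambda>z. \<Sum>i\<in>I. f i z) \<in> square_summable W"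
proof -
 interpret L: hspace "ell2 W" by (rule hspace_ell2)
 have "finsum (ell2 W) f I = (\<lambda>z. \<Sum>i\<in>I. f i z) \<and> (\<lambda>z. \<Sum>i\<in>I. f i z) \<in> square_summable W"
  using assms
 proof (induction I)
  case empty thus ?case by (simp add: ell2_simps square_summable_def)
 next
  case (insert i I)
  have "f \<in> insert i I \<rightarrow> carrier (ell2 W)" using insert.prems by (auto simp: ell2_simps)
  thus ?case using insert
   by (subst L.M.finsum_insert) (auto simp: ell2_add ell2_simps square_summable_add)
 qed
 thus "finsum (ell2 W) f I = (\<lambda>z. \<Sum>i\<in>I. f i z)" "(\<lambda>z. \<Sum>i\<in>I. f i z) \<in> square_summable W" by auto
qed

context rooted_tree
begin

abbreviation l2_space :: "('v => complex) set" ("\<L>") where "\<L> \<equiv> square_summable V"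

interpretation L: hspace "ell2 V" by (rule hspace_ell2)

text \<open>The vectors \<open>e\<^sub>x\<close> with \<open>\<langle>e\<^sub>x, e\<^sub>y\<rangle> = q\<^bsup>d(x,y)\<^esup>\<close>, realized as \<open>e\<^sub>x = q e\<^sub>p + \<surd>(1-q\<^sup>2) \<delta>\<^sub>x\<close> where
 \<open>p\<close> is the parent of \<open>x\<close>.\<close>

primrec evec_depth :: "real => nat => 'v => 'v => complex" where
 "evec_depth q 0 x = delta x"
| "evec_depth q (Suc n) x =
   (\<lambda>z. of_real q * evec_depth q n (par x) z + of_real (sqrt (1 - q\<^sup>2)) * delta x z)"

definition evec :: "real => 'v => 'v => complex" where
 "evec q x = evec_depth q (depth x) x"

lemma evec_root: "evec q r = delta r" by (simp add: evec_def)

lemma evec_step: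
 "[|x \<in> V; x ~= r|] ==> evec q x = (\<lambda>z. of_real q * evec q (par x) z + of_real (sqrt (1 - q\<^sup>2)) * delta x z)"
 using par(2)[of x] by (simp add: evec_def)

lemma depth_induct [consumes 1, case_names base step]:
 assumes "x \<in> V" "P r" "!!x. [|x \<in> V; x ~= r; P (par x)|] ==> P x" shows "P x"
 using assms(1)
proof (induction "depth x" arbitrary: x)
 case 0
 thus ?case using gdist_0[OF _ root] assms(2) by metis
next
 case (Suc n)
 have xr: "x ~= r" using Suc.hyps(2) by auto
 show ?case using Suc par(2)[OF Suc.prems xr] par_V[OF Suc.prems xr] assms(3)[OF Suc.prems xr] by simp
qed

lemma evec_support: "x \<in> V ==> evec q x z ~= 0 ==> x \<in> desc z"
proof (induction rule: depth_induct)
 case base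
 thus ?case using desc.self[OF root] by (auto simp: evec_root delta_def split: if_splits)
next
 case (step x)
 show ?case
 proof (cases "z = x")
  case True thus ?thesis using desc.self[OF step.hyps(1)] by simp
 next
  case False
  hence "evec q (par x) z ~= 0" using step evec_step[OF step.hyps(1,2), of q] by (auto simp: delta_def)
  thus ?thesis using step desc.child by blast
 qed
qed

lemma evec_mem: "x \<in> V ==> evec q x \<in> \<L>"
 by (rule square_summable_finite[of "{z. x \<in> desc z}"])
  (use finite_ancestors desc_V evec_support in blast)+

lemma evec_zero_q: "x \<in> V ==> evec 0 x = delta x"
 by (induction rule: depth_induct) (auto simp: evec_root evec_step)

lemma evec_gram:
 assumes q: "0 <= q" "q <= 1" shows "x \<in> V ==> y \<in> V ==> L.ip (evec q x) (evec q y) = of_real (q ^ gdist E x y)"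
proof (induction "depth x + depth y" arbitrary: x y rule: less_induct)
 case less
 define w where "w = sqrt (1 - q\<^sup>2)"
 have q2: "q\<^sup>2 <= 1" using q by (simp add: power_le_one)
 have w2: "w * w = 1 - q * q" using q2 by (simp add: w_def power2_eq_square flip: real_sqrt_mult)
 have C: "a \<in> V ==> evec q a \<in> carrier (ell2 V)" "a \<in> V ==> delta a \<in> carrier (ell2 V)" for a
  using evec_mem delta_square_summable by (auto simp: ell2_simps)
 have dl: "L.ip (delta a) f = cnj (f a)" if "a \<in> V" "f \<in> carrier (ell2 V)" for a f
  using L.cinner_commute[OF that(2) C(2)[OF that(1)]] by (simp add: ell2_ip_delta)
 have st: "evec q a = of_real q \<odot>\<^bsub>ell2 V\<^esub> evec q (par a) \<oplus>\<^bsub>ell2 V\<^esub> of_real w \<odot>\<^bsub>ell2 V\<^esub> delta a"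
  if "a \<in> V" "a ~= r" for a
  using evec_step[OF that, of q] square_summable_scale[OF evec_mem[OF par_V[OF that]], of "of_real q" q]
   square_summable_scale[OF delta_square_summable[OF that(1)], of "of_real w"]
  by (simp add: ell2_simps ell2_add w_def)
 \<comment> \<open>outside the descendants of \<open>x\<close> the vector \<open>e\<^sub>y\<close> is orthogonal to \<open>\<delta>\<^sub>x\<close>\<close>
 have out: "L.ip (evec q a) (evec q b) = of_real (q ^ gdist E a b)"
  if a: "a \<in> V" and b: "b \<in> V" and nd: "b \<notin> desc a" and m: "depth a + depth b = depth x + depth y" for a b
 proof -
  have ar: "a ~= r" using desc_root[OF b] nd by auto
  note p = par_V[OF a ar]
  have "evec q b a = 0" using evec_support[OF b] nd by blast
  hence "L.ip (delta a) (evec q b) = 0" using dl[OF a C(1)[OF b]] by simp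
  hence "L.ip (evec q a) (evec q b) = of_real q * L.ip (evec q (par a)) (evec q b)"
   using C a b p unfolding st[OF a ar] by simp
  also have "L.ip (evec q (par a)) (evec q b) = of_real (q ^ gdist E (par a) b)"
   by (rule less.hyps) (use par(2)[OF a ar] m p b in auto)
  finally show ?thesis using gdist_outside[OF a ar b nd] by simp
 qed
 show ?case
 proof (cases "y \<in> desc x")
  case False
  thus ?thesis using out[OF less.prems] by simp
 next
  case True
  show ?thesis
  proof (cases "x = y")
   case False
   hence "x \<notin> desc y" using True desc_antisym by blast
   hence "L.ip (evec q y) (evec q x) = of_real (q ^ gdist E y x)" using out[OF less.prems(2,1)] by simp
   thus ?thesis using L.cinner_commute[OF C(1)[OF less.prems(2)] C(1)[OF less.prems(1)]] gdist_commute[OF less.prems] by simp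
  next
   case xy: True
   show ?thesis
   proof (cases "x = r")
    case True
    thus ?thesis using xy by (simp add: evec_root ell2_ip_delta) (simp add: delta_def)
   next
    case False
    note x = less.prems(1) and p = par_V[OF less.prems(1) False]
    have 1: "L.ip (evec q (par x)) (evec q (par x)) = 1"
     using less.hyps[of "par x" "par x"] par(2)[OF x False] xy p by simp
    have z: "evec q (par x) x = 0"
     using evec_support[OF p, of q x] desc_depth[of "par x" x] par(2)[OF x False] by fastforce
    define a b where "a = evec q (par x)" and "b = delta x"
    have ab: "a \<in> carrier (ell2 V)" "b \<in> carrier (ell2 V)" "L.ip a b = 0" "L.ip b a = 0" "L.ip b b = 1"
     unfolding a_def b_def using C(1)[OF p] C(2)[OF x] z dl[OF x C(1)[OF p]]
     by (simp_all add: ell2_ip_delta) (simp add: delta_def)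
    have "L.ip (evec q x) (evec q x) = of_real (q * q) * L.ip (evec q (par x)) (evec q (par x)) + of_real (w * w)"
     unfolding st[OF x False] a_def[symmetric] b_def[symmetric] using ab by simp
    also have "\<dots> = of_real (q * q + w * w)" using 1 by simp
    also have "q * q + w * w = 1" using w2 by simp
    finally show ?thesis using xy by simp
   qed
  qed
 qed
qed

lemma evec_total:
 assumes q: "0 <= q" "q < 1" and M: "L.csub M" and e: "!!x. x \<in> V ==> evec q x \<in> M"
 shows "M = carrier (ell2 V)"
proof (rule ell2_total[OF M])
 fix x assume x: "x \<in> V"
 show "delta x \<in> M"
 proof (cases "x = r")
  case True
  thus ?thesis using e[OF root] by (simp add: evec_root)
 next
  case False
  have "q\<^sup>2 < 1" using q by (simp add: power_less_one_iff)
  hence w: "sqrt (1 - q\<^sup>2) ~= 0" by simp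
  define d where "d = of_real (1 / sqrt (1 - q\<^sup>2)) \<odot>\<^bsub>ell2 V\<^esub> (evec q x \<ominus>\<^bsub>ell2 V\<^esub> of_real q \<odot>\<^bsub>ell2 V\<^esub> evec q (par x))"
  have "d \<in> M" unfolding d_def using e[OF x] e[OF par_V[OF x False]] L.csubD(4,6)[OF M] by blast
  moreover have "d = delta x"
  proof -
   have "d = (\<lambda>z. of_real (1 / sqrt (1 - q\<^sup>2)) * (evec q x z - of_real q * evec q (par x) z))"
    unfolding d_def using evec_mem[OF x, of q] square_summable_scale[OF evec_mem[OF par_V[OF x False]], of "of_real q" q]
    by (simp add: ell2_simps ell2_minus_mem)
   thus ?thesis using w evec_step[OF x False, of q] by (simp add: fun_eq_iff)
  qed
  ultimately show ?thesis by simp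
 qed
qed

lemma evec_continuous: "x \<in> V ==> continuous_on {0..1} (\<lambda>q. evec q x z)"
proof (induction rule: depth_induct)
 case (step x)
 have "continuous_on {0..1} (\<lambda>q. of_real q * evec q (par x) z + of_real (sqrt (1 - q\<^sup>2)) * delta x z :: complex)"
  by (intro continuous_intros step)
 thus ?case using evec_step[OF step.hyps(1,2)] by simp
qed (simp add: evec_root)

end

context tree_action
begin

interpretation L: hspace "ell2 V" by (rule hspace_ell2)

lemma Lcar [simp]: "carrier (ell2 V) = \<L>" by (simp add: ell2_simps)

lemma ell2_closed [simp]:
 "f \<in> \<L> ==> h \<in> \<L> ==> f \<oplus>\<^bsub>ell2 V\<^esub> h \<in> \<L>"
 "f \<in> \<L> ==> h \<in> \<L> ==> f \<ominus>\<^bsub>ell2 V\<^esub> h \<in> \<L>"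
 "f \<in> \<L> ==> c \<odot>\<^bsub>ell2 V\<^esub> f \<in> \<L>"
 using L.M.a_closed L.diff_closed L.scale_closed by simp_all

text \<open>The image of \<open>\<delta>\<^sub>x\<close> under the unitary operator with \<open>e\<^sub>x \<mapsto> e\<^bsub>gx\<^esub>\<close>: it is \<open>\<delta>\<^bsub>gx\<^esub>\<close> unless \<open>x\<close> is
 exceptional for \<open>g\<close>.\<close>

definition delta_image :: "real => 'g => 'v => 'v => complex" where
 "delta_image q g x = (if x = r then evec q (act g r)
   else if x \<in> exceptional g then
    (\<lambda>z. of_real (sqrt (1 - q\<^sup>2)) * evec q (act g x) z - of_real q * delta (act g (par x)) z)
   else delta (act g x))"

definition perm_op :: "'g => ('v => complex) => 'v => complex" where
 "perm_op g f = (\<lambda>z. if z \<in> V then f (act (inv g) z) else 0)"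

definition defect :: "real => 'g => 'v => 'v => complex" where
 "defect q g x = (\<lambda>z. delta_image q g x z - delta (act g x) z)"

text \<open>The operator with \<open>\<delta>\<^sub>x \<mapsto> delta_image q g x\<close>, written as a perturbation of finite rank of the
 permutation operator so that it is visibly defined on all of \<open>\<ell>\<^sup>2\<close>.\<close>

definition deform :: "real => 'g => ('v => complex) => 'v => complex" where
 "deform q g f = (\<lambda>z. perm_op g f z + (\<Sum>x\<in>exceptional g. f x * defect q g x z))"

lemma exceptional_V: "x \<in> exceptional g ==> x \<in> V" by (simp add: exceptional_def)

lemma delta_image_mem: assumes "g \<in> carrier G" "x \<in> V" shows "delta_image q g x \<in> \<L>"
 unfolding delta_image_def using assms
 by (auto intro!: square_summable_diff square_summable_scale delta_square_summable evec_mem act_V par_V root)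

lemma defect_mem: assumes "g \<in> carrier G" "x \<in> V" shows "defect q g x \<in> \<L>"
 unfolding defect_def using delta_image_mem[OF assms] delta_square_summable[OF act_V[OF assms]]
 by (rule square_summable_diff)

lemma perm_op_mem:
 assumes g: "g \<in> carrier G" and f: "f \<in> \<L>"
 shows "perm_op g f \<in> \<L>" "L.nm (perm_op g f) = L.nm f"
proof -
 note b = act_bij[OF G.inv_closed[OF g]]
 have sV: "(\<lambda>z. (cmod (f z))\<^sup>2) summable_on V"
  using square_summableD(1)[OF f] by (rule summable_on_subset_banach) simp
 hence "(\<lambda>z. (cmod (f (act (inv g) z)))\<^sup>2) summable_on V"
  using summable_on_reindex_bij_betw[OF b, of "\<lambda>z. (cmod (f z))\<^sup>2"] by simp
 also have "?this \<longleftrightarrow> (\<lambda>z. (cmod (perm_op g f z))\<^sup>2) summable_on UNIV"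
  by (rule summable_on_cong_neutral) (auto simp: perm_op_def)
 finally show m: "perm_op g f \<in> \<L>" by (simp add: square_summable_def perm_op_def)
 have "(\<Sum>\<^sub>\<infinity>z. (cmod (perm_op g f z))\<^sup>2) = (\<Sum>\<^sub>\<infinity>z\<in>V. (cmod (f (act (inv g) z)))\<^sup>2)"
  by (rule infsum_cong_neutral) (auto simp: perm_op_def)
 also have "\<dots> = (\<Sum>\<^sub>\<infinity>z\<in>V. (cmod (f z))\<^sup>2)"
  using infsum_reindex_bij_betw[OF b, of "\<lambda>z. (cmod (f z))\<^sup>2"] by simp
 also have "\<dots> = (\<Sum>\<^sub>\<infinity>z. (cmod (f z))\<^sup>2)"
  by (rule infsum_cong_neutral) (use square_summableD(2)[OF f] in auto)
 finally show "L.nm (perm_op g f) = L.nm f" using m f by (simp add: ell2_hnorm)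
qed

lemma pointwise_le_nm: assumes f: "f \<in> \<L>" shows "cmod (f x) <= L.nm f"
proof (cases "x \<in> V")
 case True
 have d: "delta x \<in> carrier (ell2 V)" using delta_square_summable[OF True] by simp
 have "L.ip (delta x) (delta x) = 1" unfolding ell2_ip_delta by (simp add: delta_def)
 hence "L.nm (delta x) = 1" by (simp add: hnorm_def)
 thus ?thesis using L.cauchy_schwarz[of f "delta x"] f d by (simp add: ell2_ip_delta)
next
 case False thus ?thesis using square_summableD(2)[OF f] f by simp
qed

lemma deform_eq:
 assumes g: "g \<in> carrier G" and f: "f \<in> \<L>"
 shows "deform q g f \<in> \<L>"
  "deform q g f = perm_op g f \<oplus>\<^bsub>ell2 V\<^esub> finsum (ell2 V) (\<lambda>x. f x \<odot>\<^bsub>ell2 V\<^esub> defect q g x) (exceptional g)"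
proof -
 have s: "(\<lambda>z. f x * defect q g x z) \<in> \<L>" if "x \<in> exceptional g" for x
  by (intro square_summable_scale defect_mem[OF g] exceptional_V[OF that])
 note fs = ell2_finsum[OF finite_exceptional[OF g], of "\<lambda>x z. f x * defect q g x z", OF s]
 show "deform q g f \<in> \<L>" unfolding deform_def
  using perm_op_mem(1)[OF g f] fs(2) by (rule square_summable_add)
 show "deform q g f = perm_op g f \<oplus>\<^bsub>ell2 V\<^esub> finsum (ell2 V) (\<lambda>x. f x \<odot>\<^bsub>ell2 V\<^esub> defect q g x) (exceptional g)"
  unfolding ell2_simps(3) fs(1)[simplified] by (simp add: ell2_add[OF perm_op_mem(1)[OF g f] fs(2)] deform_def)
qed

lemma deform_linear: assumes g: "g \<in> carrier G" shows "L.linear_op (deform q g)"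
 unfolding L.linear_op_def
proof (intro conjI ballI allI)
 fix f h c assume f: "f \<in> carrier (ell2 V)" and h: "h \<in> carrier (ell2 V)"
 show "deform q g (f \<oplus>\<^bsub>ell2 V\<^esub> h) = deform q g f \<oplus>\<^bsub>ell2 V\<^esub> deform q g h"
  using f h deform_eq(1)[OF g]
  by (simp add: ell2_add deform_def perm_op_def fun_eq_iff distrib_right sum.distrib)
 show "deform q g (c \<odot>\<^bsub>ell2 V\<^esub> f) = c \<odot>\<^bsub>ell2 V\<^esub> deform q g f"
  by (simp add: ell2_simps deform_def perm_op_def fun_eq_iff distrib_left sum_distrib_left mult.assoc)
qed (use deform_eq(1)[OF g] in auto)

lemma deform_bounded:
 assumes g: "g \<in> carrier G" and f: "f \<in> \<L>"
 shows "L.nm (deform q g f) <= (1 + (\<Sum>x\<in>exceptional g. L.nm (defect q g x))) * L.nm f"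
proof -
 have dm: "defect q g x \<in> carrier (ell2 V)" if "x \<in> exceptional g" for x
  using defect_mem[OF g exceptional_V[OF that]] by simp
 have "L.nm (deform q g f) <= L.nm (perm_op g f) + L.nm (finsum (ell2 V) (\<lambda>x. f x \<odot>\<^bsub>ell2 V\<^esub> defect q g x) (exceptional g))"
  unfolding deform_eq(2)[OF g f] using perm_op_mem(1)[OF g f] dm by (intro L.nm_triangle L.hsum_closed) auto
 also have "L.nm (finsum (ell2 V) (\<lambda>x. f x \<odot>\<^bsub>ell2 V\<^esub> defect q g x) (exceptional g))
   <= (\<Sum>x\<in>exceptional g. L.nm (f x \<odot>\<^bsub>ell2 V\<^esub> defect q g x))"
  using dm by (intro L.nm_sum_le finite_exceptional[OF g]) auto
 also have "\<dots> <= (\<Sum>x\<in>exceptional g. L.nm f * L.nm (defect q g x))"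
  using dm pointwise_le_nm[OF f] by (intro sum_mono) (auto intro!: mult_right_mono)
 finally show ?thesis using perm_op_mem(2)[OF g f] by (simp add: algebra_simps sum_distrib_left)
qed

lemma deform_delta: assumes g: "g \<in> carrier G" and x: "x \<in> V" shows "deform q g (delta x) = delta_image q g x"
proof
 fix z
 have "(\<Sum>y\<in>exceptional g. delta x y * defect q g y z) = (if x \<in> exceptional g then defect q g x z else 0)"
 proof -
  have "(\<Sum>y\<in>exceptional g. delta x y * defect q g y z) = (\<Sum>y\<in>exceptional g. if y = x then defect q g y z else 0)"
   by (intro sum.cong) (auto simp: delta_def)
  thus ?thesis using finite_exceptional[OF g] by simp
 qed
 moreover have "perm_op g (delta x) z = delta (act g x) z"
  using act_inv[OF g] x act_V[OF g x] by (auto simp: perm_op_def delta_def)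
 moreover have "delta_image q g x = delta (act g x)" if "x \<notin> exceptional g"
  using that x by (auto simp: delta_image_def exceptional_def)
 ultimately show "deform q g (delta x) z = delta_image q g x z" by (auto simp: deform_def defect_def)
qed

lemma deform_evec:
 assumes q: "0 <= q" "q <= 1" and g: "g \<in> carrier G"
 shows "x \<in> V ==> deform q g (evec q x) = evec q (act g x)"
proof (induction rule: depth_induct)
 case base
 show ?case using deform_delta[OF g root, of q] unfolding evec_root delta_image_def by simp
next
 case (step x)
 define w where "w = sqrt (1 - q\<^sup>2)"
 have q2: "q\<^sup>2 <= 1" using q by (simp add: power_le_one)
 have w2: "q * q + w * w = 1" using q2 by (simp add: w_def power2_eq_square flip: real_sqrt_mult)
 note p = par_V[OF step.hyps(1,2)]
 have st: "evec q x = of_real q \<odot>\<^bsub>ell2 V\<^esub> evec q (par x) \<oplus>\<^bsub>ell2 V\<^esub> of_real w \<odot>\<^bsub>ell2 V\<^esub> delta x"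
  using evec_step[OF step.hyps(1,2), of q] square_summable_scale[OF evec_mem[OF p], of "of_real q" q]
   square_summable_scale[OF delta_square_summable[OF step.hyps(1)], of "of_real w"]
  by (simp add: ell2_simps ell2_add w_def)
 note l = L.linear_opD[OF deform_linear[OF g, of q]]
 have m: "evec q (par x) \<in> carrier (ell2 V)" "delta x \<in> carrier (ell2 V)"
  using evec_mem[OF p] delta_square_summable[OF step.hyps(1)] by auto
 have "deform q g (evec q x) = of_real q \<odot>\<^bsub>ell2 V\<^esub> evec q (act g (par x)) \<oplus>\<^bsub>ell2 V\<^esub> of_real w \<odot>\<^bsub>ell2 V\<^esub> delta_image q g x"
  unfolding st using l(2,3) m step.IH deform_delta[OF g step.hyps(1)] by simp
 also have "\<dots> = (\<lambda>z. of_real q * evec q (act g (par x)) z + of_real w * delta_image q g x z)"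
  using square_summable_scale[OF evec_mem[OF act_V[OF g p]], of "of_real q" q]
   square_summable_scale[OF delta_image_mem[OF g step.hyps(1)], of "of_real w" q]
  by (simp add: ell2_simps ell2_add)
 also have "\<dots> = evec q (act g x)"
 proof (cases "x \<in> exceptional g")
  case False
  hence "act g x ~= r" "par (act g x) = act g (par x)" using step.hyps by (auto simp: exceptional_def)
  thus ?thesis using False step.hyps(2) evec_step[OF act_V[OF g step.hyps(1)], of q]
   by (simp add: delta_image_def w_def)
 next
  case True
  note f = exceptional_flip[OF g True step.hyps(2)]
  have "evec q (act g (par x)) = (\<lambda>z. of_real q * evec q (act g x) z + of_real w * delta (act g (par x)) z)"
   using evec_step[OF act_V[OF g p] f(1), of q] f(2) by (simp add: w_def)
  hence "of_real q * evec q (act g (par x)) z + of_real w * delta_image q g x z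
    = of_real (q * q + w * w) * evec q (act g x) z" for z
   using True step.hyps(2) by (simp add: delta_image_def w_def[symmetric] algebra_simps)
  thus ?thesis unfolding w2 by simp
 qed
 finally show ?case .
qed

lemma deform_isometry:
 assumes q: "0 <= q" "q < 1" and g: "g \<in> carrier G" and f: "f \<in> \<L>" and h: "h \<in> \<L>"
 shows "L.ip (deform q g f) (deform q g h) = L.ip f h"
proof -
 let ?U = "deform q g"
 note l = L.linear_opD[OF deform_linear[OF g, of q]]
 define B where "B = 1 + (\<Sum>x\<in>exceptional g. L.nm (defect q g x))"
 have bU: "L.nm (?U f) <= B * L.nm f" if "f \<in> \<L>" for f
  unfolding B_def by (rule deform_bounded[OF g that])
 have M: "L.csub {f \<in> carrier (ell2 V). L.ip (?U f) (?U h) - L.ip f h = 0}" if h: "h \<in> \<L>" for h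
 proof (rule L.csub_equal_functionals[where C = "B * L.nm (?U h) + L.nm h"])
  fix f k c assume f: "f \<in> carrier (ell2 V)" and k: "k \<in> carrier (ell2 V)"
  show "L.ip (?U (f \<oplus>\<^bsub>ell2 V\<^esub> k)) (?U h) - L.ip (f \<oplus>\<^bsub>ell2 V\<^esub> k) h
   = (L.ip (?U f) (?U h) - L.ip f h) + (L.ip (?U k) (?U h) - L.ip k h)"
   using f k h l deform_eq(1)[OF g] by simp
  show "L.ip (?U (c \<odot>\<^bsub>ell2 V\<^esub> f)) (?U h) - L.ip (c \<odot>\<^bsub>ell2 V\<^esub> f) h = c * (L.ip (?U f) (?U h) - L.ip f h)"
   using f h l deform_eq(1)[OF g] by (simp add: algebra_simps)
  have "cmod (L.ip (?U f) (?U h) - L.ip f h) <= cmod (L.ip (?U f) (?U h)) + cmod (L.ip f h)"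
   by (rule norm_triangle_ineq4)
  also have "\<dots> <= L.nm (?U f) * L.nm (?U h) + L.nm f * L.nm h"
   using f h deform_eq(1)[OF g] by (intro add_mono L.cauchy_schwarz) auto
  also have "\<dots> <= (B * L.nm f) * L.nm (?U h) + L.nm f * L.nm h"
   using bU f h deform_eq(1)[OF g] by (intro add_mono mult_right_mono) auto
  finally show "cmod (L.ip (?U f) (?U h) - L.ip f h) <= (B * L.nm (?U h) + L.nm h) * L.nm f"
   by (simp add: algebra_simps)
 qed
 have 1: "L.ip (?U f) (?U (evec q y)) = L.ip f (evec q y)" if f: "f \<in> \<L>" and y: "y \<in> V" for f y
 proof -
  have "{f \<in> carrier (ell2 V). L.ip (?U f) (?U (evec q y)) - L.ip f (evec q y) = 0} = carrier (ell2 V)"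
  proof (rule evec_total[OF q M[OF evec_mem[OF y]]])
   fix x assume x: "x \<in> V"
   show "evec q x \<in> {f \<in> carrier (ell2 V). L.ip (?U f) (?U (evec q y)) - L.ip f (evec q y) = 0}"
    using q x y evec_mem[OF x] evec_gram[of q] act_V[OF g] act_gdist[OF g x y] by (simp add: deform_evec[OF _ _ g])
  qed
  thus ?thesis using f by auto
 qed
 have "{h \<in> carrier (ell2 V). L.ip (?U h) (?U f) - L.ip h f = 0} = carrier (ell2 V)"
 proof (rule evec_total[OF q M[OF f]])
  fix x assume x: "x \<in> V"
  have "L.ip (?U (evec q x)) (?U f) = cnj (L.ip (?U f) (?U (evec q x)))"
   using f evec_mem[OF x] deform_eq(1)[OF g] by (intro L.cinner_commute) auto
  also have "\<dots> = cnj (L.ip f (evec q x))" using 1[OF f x] by simp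
  also have "\<dots> = L.ip (evec q x) f" using f evec_mem[OF x] by (intro L.cinner_commute[symmetric]) auto
  finally show "evec q x \<in> {h \<in> carrier (ell2 V). L.ip (?U h) (?U f) - L.ip h f = 0}" using evec_mem[OF x] by simp
 qed
 hence "L.ip (?U h) (?U f) = L.ip h f" using h by auto
 thus ?thesis using L.cinner_commute[of "?U h" "?U f"] L.cinner_commute[of h f] f h deform_eq(1)[OF g] by simp
qed

lemma deform_nm:
 "[|0 <= q; q < 1; g \<in> carrier G; f \<in> \<L>|] ==> L.nm (deform q g f) = L.nm f"
 using deform_isometry[of q g f f] by (simp add: hnorm_def)

text \<open>As the vectors \<open>e\<^sub>x\<close> are total, the homomorphism law for the deformed operators reduces to the
 action on vertices.\<close>

lemma evec_operator_eq:
 assumes q: "0 <= q" "q < 1" and A: "L.linear_op A" "!!f. f \<in> \<L> ==> L.nm (A f) <= L.nm f"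
  and B: "L.linear_op B" "!!f. f \<in> \<L> ==> L.nm (B f) <= L.nm f"
  and e: "!!x. x \<in> V ==> A (evec q x) = B (evec q x)" and f: "f \<in> \<L>"
 shows "A f = B f"
proof (rule L.vec_eqI)
 note a = L.linear_opD[OF A(1)] and b = L.linear_opD[OF B(1)]
 show "A f \<in> carrier (ell2 V)" "B f \<in> carrier (ell2 V)" using a(1) b(1) f by auto
 fix z assume z: "z \<in> carrier (ell2 V)"
 have "L.csub {f \<in> carrier (ell2 V). L.ip (A f) z - L.ip (B f) z = 0}"
 proof (rule L.csub_equal_functionals[where C = "2 * L.nm z"])
  fix f k c assume f: "f \<in> carrier (ell2 V)" and k: "k \<in> carrier (ell2 V)"
  show "L.ip (A (f \<oplus>\<^bsub>ell2 V\<^esub> k)) z - L.ip (B (f \<oplus>\<^bsub>ell2 V\<^esub> k)) z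
   = (L.ip (A f) z - L.ip (B f) z) + (L.ip (A k) z - L.ip (B k) z)"
   using a(1,2) b(1,2) f k z by simp
  show "L.ip (A (c \<odot>\<^bsub>ell2 V\<^esub> f)) z - L.ip (B (c \<odot>\<^bsub>ell2 V\<^esub> f)) z = c * (L.ip (A f) z - L.ip (B f) z)"
   using a(1,3) b(1,3) f z by (simp add: algebra_simps)
  have "cmod (L.ip (A f) z - L.ip (B f) z) <= cmod (L.ip (A f) z) + cmod (L.ip (B f) z)" by (rule norm_triangle_ineq4)
  also have "\<dots> <= L.nm (A f) * L.nm z + L.nm (B f) * L.nm z"
   using a(1) b(1) f z by (intro add_mono L.cauchy_schwarz) auto
  also have "\<dots> <= L.nm f * L.nm z + L.nm f * L.nm z"
   using A(2) B(2) f z by (intro add_mono mult_right_mono) auto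
  finally show "cmod (L.ip (A f) z - L.ip (B f) z) <= 2 * L.nm z * L.nm f" by (simp add: mult_ac)
 qed
 hence "{f \<in> carrier (ell2 V). L.ip (A f) z - L.ip (B f) z = 0} = carrier (ell2 V)"
  by (rule evec_total[OF q]) (use e evec_mem in auto)
 thus "L.ip (A f) z = L.ip (B f) z" using f by auto
qed

definition tree_rep :: "real => 'g => ('v => complex) => 'v => complex" where
 "tree_rep q g = restrict (deform q g) (\<L>)"

lemma tree_rep_action:
 assumes q: "0 <= q" "q < 1" shows "hspace_action (ell2 V) G (tree_rep q)"
proof -
 have "(\<lambda>g. restrict (deform q g) (carrier (ell2 V))) \<in> hom G (unitary_group (ell2 V))"
 proof (rule L.hom_unitary_groupI[OF G.group_axioms deform_linear])
  fix g h f assume g: "g \<in> carrier G" and h: "h \<in> carrier G" and f: "f \<in> carrier (ell2 V)"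
  note lg = deform_linear[OF g, of q] and lh = deform_linear[OF h, of q] and lgh = deform_linear[OF G.m_closed[OF g h], of q]
  have comp: "L.linear_op (\<lambda>f. deform q g (deform q h f))"
   unfolding L.linear_op_def using L.linear_opD(1-3)[OF lg] L.linear_opD(1-3)[OF lh] by simp
  show "deform q (g \<otimes> h) f = deform q g (deform q h f)"
   by (rule evec_operator_eq[OF q lgh _ comp])
    (use q f g h in \<open>auto simp: deform_nm deform_eq(1) deform_evec act_V act_mult\<close>)
 next
  fix f assume f: "f \<in> carrier (ell2 V)"
  have "L.linear_op (\<lambda>f. f)" by (simp add: L.linear_op_def)
  show "deform q \<one> f = f"
   by (rule evec_operator_eq[OF q deform_linear[OF G.one_closed] _ \<open>L.linear_op (\<lambda>f. f)\<close>])
    (use q f in \<open>auto simp: deform_nm deform_evec act_one\<close>)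
 qed (use deform_isometry q in auto)
 moreover have "(\<lambda>g. restrict (deform q g) (carrier (ell2 V))) = tree_rep q" by (auto simp: tree_rep_def)
 ultimately show ?thesis
  by (intro hspace_action.intro unitary_action.intro unitary_action_axioms.intro L.hspace_axioms
    L.complex_hilbert_axioms G.group_axioms) simp
qed

lemma delta_image_zero_q: "g \<in> carrier G ==> x \<in> V ==> delta_image 0 g x = delta (act g x)"
 using evec_zero_q act_V root by (auto simp: delta_image_def)

lemma deform_zero_q: "g \<in> carrier G ==> deform 0 g f = perm_op g f"
 using delta_image_zero_q exceptional_V by (auto simp: deform_def defect_def intro!: sum.neutral)

lemma delta_image_continuous:
 assumes g: "g \<in> carrier G" and x: "x \<in> V" and q0: "q0 \<in> {0..1}"
 shows "((\<lambda>q. L.nm (delta_image q g x \<ominus>\<^bsub>ell2 V\<^esub> delta_image q0 g x)) \<longlongrightarrow> 0) (at q0 within {0..1})"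
proof -
 define A where "A = {z. act g r \<in> desc z} \<union> {z. act g x \<in> desc z} \<union> {act g x, act g (par x)}"
 have A: "finite A" unfolding A_def using finite_ancestors act_V[OF g] root x by auto
 have supp: "delta_image q g x z = 0" if "z \<notin> A" for q z
  using that evec_support[OF act_V[OF g root], of q z] evec_support[OF act_V[OF g x], of q z]
  by (auto simp: delta_image_def A_def delta_def)
 have c1: "continuous_on {0..1} (\<lambda>q. evec q (act g y) z)" if "y \<in> V" for y z by (rule evec_continuous[OF act_V[OF g that]])
 have cont: "continuous_on {0..1} (\<lambda>q. delta_image q g x z)" for z
  unfolding delta_image_def using c1[OF root] c1[OF x] by (cases "x = r"; cases "x \<in> exceptional g") (auto intro!: continuous_intros)
 have "((\<lambda>q. sqrt (\<Sum>z\<in>A. (cmod (delta_image q g x z - delta_image q0 g x z))\<^sup>2)) \<longlongrightarrow>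
   sqrt (\<Sum>z\<in>A. (cmod (delta_image q0 g x z - delta_image q0 g x z))\<^sup>2)) (at q0 within {0..1})"
  using cont q0 by (intro tendsto_real_sqrt tendsto_sum tendsto_power tendsto_norm tendsto_diff tendsto_const)
   (auto simp: continuous_on_def)
 moreover have "L.nm (delta_image q g x \<ominus>\<^bsub>ell2 V\<^esub> delta_image q0 g x) =
   sqrt (\<Sum>z\<in>A. (cmod (delta_image q g x z - delta_image q0 g x z))\<^sup>2)" for q
 proof -
  note m = delta_image_mem[OF g x]
  have "(\<Sum>\<^sub>\<infinity>z. (cmod (delta_image q g x z - delta_image q0 g x z))\<^sup>2)
    = (\<Sum>\<^sub>\<infinity>z\<in>A. (cmod (delta_image q g x z - delta_image q0 g x z))\<^sup>2)"
   by (rule infsum_cong_neutral) (use supp in auto)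
  thus ?thesis unfolding ell2_minus_mem[OF m m] ell2_hnorm[OF square_summable_diff[OF m m]] using A by simp
 qed
 ultimately show ?thesis by simp
qed

end

section \<open>The lazy random walk and its top eigenvalue\<close>

definition lazy_walk :: "('g, 'n) monoid_scheme => 'g set => 'g => complex" where
 "lazy_walk G S = (\<lambda>g. (if g = \<one>\<^bsub>G\<^esub> then 1 / 2 else 0) + (if g \<in> S then 1 / (2 * of_nat (card S)) else 0))"

context unitary_action
begin

context
 fixes S assumes S: "finite S" "S \<subseteq> carrier G" "S ~= {}" "!!s. s \<in> S ==> inv\<^bsub>G\<^esub> s \<in> S"
begin

lemma card_S: "real (card S) > 0" using S by (simp add: card_gt_0_iff)

lemma lazy_walk_mem: "lazy_walk G S \<in> group_algebra G"
 by (rule group_algebraI[of "insert \<one>\<^bsub>G\<^esub> S"]) (use S in \<open>auto simp: lazy_walk_def\<close>)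

lemma ip_lazy:
 assumes f: "f \<in> carrier H" and h: "h \<in> carrier H"
 shows "ip (rho (lazy_walk G S) f) h = ip f h / 2 + (\<Sum>s\<in>S. ip (\<pi> s f) h) / (2 * of_nat (card S))"
proof -
 let ?I = "insert \<one>\<^bsub>G\<^esub> S" and ?c = "1 / (2 * of_nat (card S)) :: complex"
 have I: "finite ?I" using S by simp
 have "ip (rho (lazy_walk G S) f) h = (\<Sum>g\<in>?I. lazy_walk G S g * ip (\<pi> g f) h)"
  by (rule ip_rho_sum[OF lazy_walk_mem f h I]) (auto simp: lazy_walk_def split: if_splits)
 also have "\<dots> = (\<Sum>g\<in>?I. (if g = \<one>\<^bsub>G\<^esub> then ip (\<pi> g f) h / 2 else 0) + (if g \<in> S then ?c * ip (\<pi> g f) h else 0))"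
  by (intro sum.cong) (auto simp: lazy_walk_def distrib_right)
 also have "\<dots> = (\<Sum>g\<in>?I. if g = \<one>\<^bsub>G\<^esub> then ip (\<pi> g f) h / 2 else 0) + (\<Sum>g\<in>?I. if g \<in> S then ?c * ip (\<pi> g f) h else 0)"
  by (rule sum.distrib)
 also have "(\<Sum>g\<in>?I. if g = \<one>\<^bsub>G\<^esub> then ip (\<pi> g f) h / 2 else 0) = ip f h / 2" using I f by simp
 also have "(\<Sum>g\<in>?I. if g \<in> S then ?c * ip (\<pi> g f) h else 0) = (\<Sum>g\<in>S. ?c * ip (\<pi> g f) h)"
  using I by (intro sum.mono_neutral_cong_right) auto
 finally show ?thesis by (simp add: sum_divide_distrib)
qed

lemma lazy_selfadj: "selfadj (rho (lazy_walk G S))"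
 unfolding selfadj_def
proof (intro ballI)
 fix f h assume f: "f \<in> carrier H" and h: "h \<in> carrier H"
 have b: "bij_betw (m_inv G) S S"
  by (rule bij_betw_byWitness[where f'="m_inv G"]) (use S in auto)
 have "(\<Sum>s\<in>S. ip (\<pi> s f) h) = (\<Sum>s\<in>S. ip f (\<pi> (inv\<^bsub>G\<^esub> s) h))"
  using S f h by (intro sum.cong act_adj) auto
 also have "\<dots> = (\<Sum>s\<in>S. ip f (\<pi> s h))" by (rule sum.reindex_bij_betw[OF b])
 finally have 1: "(\<Sum>s\<in>S. ip (\<pi> s f) h) = (\<Sum>s\<in>S. ip f (\<pi> s h))" .
 have "ip f (rho (lazy_walk G S) h) = cnj (ip (rho (lazy_walk G S) h) f)"
  using f h lazy_walk_mem by (intro cinner_commute) auto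
 also have "\<dots> = cnj (ip h f) / 2 + (\<Sum>s\<in>S. cnj (ip (\<pi> s h) f)) / (2 * of_nat (card S))"
  unfolding ip_lazy[OF h f] by simp
 also have "cnj (ip h f) = ip f h" using f h by (intro cinner_commute[symmetric]) auto
 also have "(\<Sum>s\<in>S. cnj (ip (\<pi> s h) f)) = (\<Sum>s\<in>S. ip f (\<pi> s h))"
  using f h S by (intro sum.cong cinner_commute[symmetric]) auto
 finally show "ip (rho (lazy_walk G S) f) h = ip f (rho (lazy_walk G S) h)" using ip_lazy[OF f h] 1 by simp
qed

lemma lazy_form:
 assumes f: "f \<in> carrier H"
 shows "Re (ip (rho (lazy_walk G S) f) f) = (nm f)\<^sup>2 - (\<Sum>s\<in>S. (nm (\<pi> s f \<ominus> f))\<^sup>2) / (4 * real (card S))"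
proof -
 have "Re (ip (\<pi> s f) f) = (nm f)\<^sup>2 - (nm (\<pi> s f \<ominus> f))\<^sup>2 / 2" if "s \<in> S" for s
  using nm_diff_sq[of "\<pi> s f" f] S that f by auto
 hence "(\<Sum>s\<in>S. Re (ip (\<pi> s f) f)) = (\<Sum>s\<in>S. (nm f)\<^sup>2 - (nm (\<pi> s f \<ominus> f))\<^sup>2 / 2)" by simp
 also have "\<dots> = real (card S) * (nm f)\<^sup>2 - (\<Sum>s\<in>S. (nm (\<pi> s f \<ominus> f))\<^sup>2) / 2"
  by (simp add: sum_subtractf sum_divide_distrib)
 finally have 1: "(\<Sum>s\<in>S. Re (ip (\<pi> s f) f)) = real (card S) * (nm f)\<^sup>2 - (\<Sum>s\<in>S. (nm (\<pi> s f \<ominus> f))\<^sup>2) / 2" .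
 have "ip (rho (lazy_walk G S) f) f = ip f f / of_real 2 + (\<Sum>s\<in>S. ip (\<pi> s f) f) / of_real (2 * real (card S))"
  unfolding ip_lazy[OF f f] by simp
 hence "Re (ip (rho (lazy_walk G S) f) f) = (nm f)\<^sup>2 / 2 + (\<Sum>s\<in>S. Re (ip (\<pi> s f) f)) / (2 * real (card S))"
  using nm_sq[OF f] by (simp only: plus_complex.sel Re_divide_of_real Re_sum)
 thus ?thesis unfolding 1 using card_S by (simp add: field_simps)
qed

lemma lazy_form_bounds:
 assumes f: "f \<in> carrier H"
 shows "0 <= Re (ip (rho (lazy_walk G S) f) f)" "Re (ip (rho (lazy_walk G S) f) f) <= (nm f)\<^sup>2"
proof -
 have "(\<Sum>s\<in>S. (nm (\<pi> s f \<ominus> f))\<^sup>2) <= (\<Sum>s\<in>S. 4 * (nm f)\<^sup>2)"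
 proof (rule sum_mono)
  fix s assume s: "s \<in> S"
  have "nm (\<pi> s f \<ominus> f) <= 2 * nm f" using nm_diff_le[of "\<pi> s f" f] S s f by auto
  hence "(nm (\<pi> s f \<ominus> f))\<^sup>2 <= (2 * nm f)\<^sup>2" using S s f by (intro power_mono) auto
  thus "(nm (\<pi> s f \<ominus> f))\<^sup>2 <= 4 * (nm f)\<^sup>2" by (simp add: power_mult_distrib)
 qed
 hence "(\<Sum>s\<in>S. (nm (\<pi> s f \<ominus> f))\<^sup>2) / (4 * real (card S)) <= (nm f)\<^sup>2"
  using card_S by (simp add: pos_divide_le_eq mult_ac)
 thus "0 <= Re (ip (rho (lazy_walk G S) f) f)" unfolding lazy_form[OF f] by simp
 show "Re (ip (rho (lazy_walk G S) f) f) <= (nm f)\<^sup>2" unfolding lazy_form[OF f] by (simp add: sum_nonneg)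
qed

end

end

locale gapped_tree_action = tree_action V E r G act
 for V :: "'v set" and E :: "('v \<times> 'v) set" and r :: 'v and G :: "('g, 'n) monoid_scheme" (structure) and act :: "'g => 'v => 'v" +
 fixes S :: "'g set"
 assumes S: "finite S" "S \<subseteq> carrier G" "S ~= {}" "!!s. s \<in> S ==> inv s \<in> S"
  and gap: "\<exists>\<epsilon>>0. \<forall>f\<in>square_summable V. \<exists>s\<in>S.
   \<epsilon> * hnorm (ell2 V) f <= hnorm (ell2 V) (perm_op s f \<ominus>\<^bsub>ell2 V\<^esub> f)"
begin

interpretation L: hspace "ell2 V" by (rule hspace_ell2)

abbreviation walk :: "'g => complex" where "walk \<equiv> lazy_walk G S"

definition walk_op :: "real => ('v => complex) => 'v => complex" where
 "walk_op q = group_algebra_rep (ell2 V) (tree_rep q) walk"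

definition walk_form :: "real => ('v => complex) => real" where
 "walk_form q f = Re (L.ip (walk_op q f) f)"

definition top :: "real => real" where
 "top q = Sup (walk_form q ` {f \<in> \<L>. L.nm f <= 1})"

lemma card_S_pos: "real (card S) > 0" using S by (simp add: card_gt_0_iff)

lemma walk_op:
 assumes q: "0 <= q" "q < 1"
 shows "L.linear_op (walk_op q)" "L.selfadj (walk_op q)"
  "!!f. f \<in> \<L> ==> 0 <= walk_form q f" "!!f. f \<in> \<L> ==> walk_form q f <= (L.nm f)\<^sup>2"
  "!!f h. f \<in> \<L> ==> h \<in> \<L> ==>
   L.ip (walk_op q f) h = L.ip f h / 2 + (\<Sum>s\<in>S. L.ip (deform q s f) h) / (2 * of_nat (card S))"
  "!!f. f \<in> \<L> ==> walk_form q f = (L.nm f)\<^sup>2 - (\<Sum>s\<in>S. (L.nm (deform q s f \<ominus>\<^bsub>ell2 V\<^esub> f))\<^sup>2) / (4 * real (card S))"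
proof -
 interpret A: hspace_action "ell2 V" G "tree_rep q" by (rule tree_rep_action[OF q])
 show "L.linear_op (walk_op q)" unfolding walk_op_def by (rule A.rho_linear[OF A.lazy_walk_mem[OF S]])
 show "L.selfadj (walk_op q)" unfolding walk_op_def by (rule A.lazy_selfadj[OF S])
 show "0 <= walk_form q f" "walk_form q f <= (L.nm f)\<^sup>2" if "f \<in> \<L>" for f
  unfolding walk_form_def walk_op_def using A.lazy_form_bounds[OF S, of f] that by auto
 show "L.ip (walk_op q f) h = L.ip f h / 2 + (\<Sum>s\<in>S. L.ip (deform q s f) h) / (2 * of_nat (card S))"
  if "f \<in> \<L>" "h \<in> \<L>" for f h
  unfolding walk_op_def using A.ip_lazy[OF S, of f h] that by (simp add: tree_rep_def)
 show "walk_form q f = (L.nm f)\<^sup>2 - (\<Sum>s\<in>S. (L.nm (deform q s f \<ominus>\<^bsub>ell2 V\<^esub> f))\<^sup>2) / (4 * real (card S))"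
  if "f \<in> \<L>" for f
  unfolding walk_form_def walk_op_def using A.lazy_form[OF S, of f] that by (simp add: tree_rep_def)
qed

lemma walk_gap: "\<exists>\<rho><1. \<forall>f\<in>\<L>. walk_form 0 f <= \<rho> * (L.nm f)\<^sup>2"
proof -
 obtain \<epsilon> where e: "\<epsilon> > 0" "!!f. f \<in> \<L> ==> \<exists>s\<in>S. \<epsilon> * L.nm f <= L.nm (perm_op s f \<ominus>\<^bsub>ell2 V\<^esub> f)"
  using gap by blast
 have "walk_form 0 f <= (1 - \<epsilon>\<^sup>2 / (4 * real (card S))) * (L.nm f)\<^sup>2" if f: "f \<in> \<L>" for f
 proof -
  obtain s where s: "s \<in> S" "\<epsilon> * L.nm f <= L.nm (perm_op s f \<ominus>\<^bsub>ell2 V\<^esub> f)" using e(2)[OF f] by blast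
  have "(\<epsilon> * L.nm f)\<^sup>2 <= (L.nm (perm_op s f \<ominus>\<^bsub>ell2 V\<^esub> f))\<^sup>2" using s e f by (intro power_mono) auto
  also have "\<dots> <= (\<Sum>s\<in>S. (L.nm (perm_op s f \<ominus>\<^bsub>ell2 V\<^esub> f))\<^sup>2)"
   using S(1) s(1) by (intro member_le_sum) auto
  also have "\<dots> = (\<Sum>s\<in>S. (L.nm (deform 0 s f \<ominus>\<^bsub>ell2 V\<^esub> f))\<^sup>2)"
   using S(2) by (intro sum.cong) (auto simp: deform_zero_q)
  finally have "\<epsilon>\<^sup>2 * (L.nm f)\<^sup>2 / (4 * real (card S)) <= (\<Sum>s\<in>S. (L.nm (deform 0 s f \<ominus>\<^bsub>ell2 V\<^esub> f))\<^sup>2) / (4 * real (card S))"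
   using card_S_pos by (intro divide_right_mono) (auto simp: power_mult_distrib)
  thus ?thesis using walk_op(6)[of 0 f] f by (simp add: left_diff_distrib)
 qed
 moreover have "1 - \<epsilon>\<^sup>2 / (4 * real (card S)) < 1" using e card_S_pos by simp
 ultimately show ?thesis by blast
qed

lemma deform_diff:
 assumes g: "g \<in> carrier G" and f: "f \<in> \<L>"
 shows "deform q g f \<ominus>\<^bsub>ell2 V\<^esub> deform q' g f
  = finsum (ell2 V) (\<lambda>x. f x \<odot>\<^bsub>ell2 V\<^esub> (delta_image q g x \<ominus>\<^bsub>ell2 V\<^esub> delta_image q' g x)) (exceptional g)"
proof -
 have m: "delta_image p g x \<in> \<L>" if "x \<in> exceptional g" for p x
  using delta_image_mem[OF g exceptional_V[OF that]] .
 have "finsum (ell2 V) (\<lambda>x. f x \<odot>\<^bsub>ell2 V\<^esub> (delta_image q g x \<ominus>\<^bsub>ell2 V\<^esub> delta_image q' g x)) (exceptional g)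
   = (\<lambda>z. \<Sum>x\<in>exceptional g. (f x \<odot>\<^bsub>ell2 V\<^esub> (delta_image q g x \<ominus>\<^bsub>ell2 V\<^esub> delta_image q' g x)) z)"
  by (rule ell2_finsum[OF finite_exceptional[OF g]]) (simp add: m)
 also have "\<dots> = (\<lambda>z. \<Sum>x\<in>exceptional g. f x * (delta_image q g x z - delta_image q' g x z))"
  using m by (auto simp: ell2_minus_mem ell2_simps fun_eq_iff intro!: sum.cong)
 also have "\<dots> = (\<lambda>z. deform q g f z - deform q' g f z)"
  by (simp add: deform_def defect_def fun_eq_iff sum_subtractf[symmetric] algebra_simps)
 finally show ?thesis using deform_eq(1)[OF g f] by (simp add: ell2_minus_mem)
qed

definition modulus :: "real => real => real" where
 "modulus q q' = (\<Sum>s\<in>S. \<Sum>x\<in>exceptional s. L.nm (delta_image q s x \<ominus>\<^bsub>ell2 V\<^esub> delta_image q' s x))"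

lemma modulus_tendsto: assumes "q0 \<in> {0..1}" shows "((\<lambda>q. modulus q q0) \<longlongrightarrow> 0) (at q0 within {0..1})"
proof -
 have "((\<lambda>q. modulus q q0) \<longlongrightarrow> (\<Sum>s\<in>S. \<Sum>x\<in>exceptional s. 0)) (at q0 within {0..1})"
  unfolding modulus_def using S(2) exceptional_V
  by (intro tendsto_sum delta_image_continuous assms) blast+
 thus ?thesis by simp
qed

lemma walk_form_diff:
 assumes q: "0 <= q" "q < 1" and q': "0 <= q'" "q' < 1" and f: "f \<in> \<L>"
 shows "walk_form q f - walk_form q' f = Re ((\<Sum>s\<in>S. L.ip (deform q s f \<ominus>\<^bsub>ell2 V\<^esub> deform q' s f) f) / (2 * of_nat (card S)))"
proof -
 have "deform p s f \<in> \<L>" if "s \<in> S" for p s using deform_eq(1) S(2) that f by blast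
 hence "(\<Sum>s\<in>S. L.ip (deform q s f \<ominus>\<^bsub>ell2 V\<^esub> deform q' s f) f) = (\<Sum>s\<in>S. L.ip (deform q s f) f - L.ip (deform q' s f) f)"
  using f by (intro sum.cong) auto
 thus ?thesis unfolding walk_form_def walk_op(5)[OF q f f] walk_op(5)[OF q' f f]
  by (simp add: sum_subtractf diff_divide_distrib)
qed

lemma walk_form_modulus:
 assumes q: "0 <= q" "q < 1" and q': "0 <= q'" "q' < 1" and f: "f \<in> \<L>"
 shows "walk_form q f - walk_form q' f <= modulus q q' * (L.nm f)\<^sup>2"
proof -
 define D where "D s = deform q s f \<ominus>\<^bsub>ell2 V\<^esub> deform q' s f" for s
 define m where "m s = (\<Sum>x\<in>exceptional s. L.nm (delta_image q s x \<ominus>\<^bsub>ell2 V\<^esub> delta_image q' s x))" for s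
 have nD: "cmod (L.ip (D s) f) <= m s * (L.nm f)\<^sup>2" if s: "s \<in> S" for s
 proof -
  have sG: "s \<in> carrier G" using S(2) s by blast
  have di: "delta_image q s x \<ominus>\<^bsub>ell2 V\<^esub> delta_image q' s x \<in> \<L>" if "x \<in> exceptional s" for x
   using delta_image_mem[OF sG exceptional_V[OF that]] by simp
  have "L.nm (D s) <= (\<Sum>x\<in>exceptional s. L.nm (f x \<odot>\<^bsub>ell2 V\<^esub> (delta_image q s x \<ominus>\<^bsub>ell2 V\<^esub> delta_image q' s x)))"
   unfolding D_def deform_diff[OF sG f] by (rule L.nm_sum_le[OF finite_exceptional[OF sG]]) (simp add: di)
  also have "\<dots> <= (\<Sum>x\<in>exceptional s. L.nm f * L.nm (delta_image q s x \<ominus>\<^bsub>ell2 V\<^esub> delta_image q' s x))"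
   using di pointwise_le_nm[OF f] by (intro sum_mono) (auto intro!: mult_right_mono)
  finally have n: "L.nm (D s) <= m s * L.nm f" by (simp add: m_def sum_distrib_left mult.commute)
  have "cmod (L.ip (D s) f) <= L.nm (D s) * L.nm f"
   using deform_eq(1)[OF sG f] f by (intro L.cauchy_schwarz) (auto simp: D_def)
  also have "\<dots> <= (m s * L.nm f) * L.nm f" using n f by (intro mult_right_mono) auto
  finally show ?thesis by (simp add: power2_eq_square)
 qed
 have m0: "0 <= m s" if "s \<in> S" for s
  unfolding m_def using delta_image_mem exceptional_V S(2) that by (intro sum_nonneg L.nm_ge0) (auto simp: subset_iff)
 have "walk_form q f - walk_form q' f <= cmod ((\<Sum>s\<in>S. L.ip (D s) f) / (2 * of_nat (card S)))"
  unfolding walk_form_diff[OF q q' f] D_def by (rule complex_Re_le_cmod)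
 also have "\<dots> = cmod (\<Sum>s\<in>S. L.ip (D s) f) / (2 * real (card S))" by (simp add: norm_divide norm_mult)
 also have "\<dots> <= (\<Sum>s\<in>S. m s * (L.nm f)\<^sup>2) / (2 * real (card S))"
  using nD by (intro divide_right_mono order_trans[OF norm_sum] sum_mono) auto
 also have "\<dots> <= (\<Sum>s\<in>S. m s * (L.nm f)\<^sup>2) / 1"
 proof (rule divide_left_mono)
  have "1 <= card S" using card_S_pos by simp
  thus "1 <= 2 * real (card S)" by linarith
  show "0 <= (\<Sum>s\<in>S. m s * (L.nm f)\<^sup>2)" using m0 by (intro sum_nonneg) auto
 qed (use card_S_pos in simp)
 finally show ?thesis by (simp add: modulus_def m_def sum_distrib_right)
qed

lemma top:
 assumes q: "0 <= q" "q < 1"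
 shows "0 <= top q" "!!f. f \<in> \<L> ==> walk_form q f <= top q * (L.nm f)\<^sup>2"
  "!!c. (!!f. f \<in> \<L> ==> walk_form q f <= c * (L.nm f)\<^sup>2) ==> 0 <= c ==> top q <= c"
  "!!c. 0 < top q ==> c < top q ==> \<exists>f\<in>\<L>. walk_form q f > c * (L.nm f)\<^sup>2"
proof -
 define R where "R = walk_form q ` {f \<in> \<L>. L.nm f <= 1}"
 have z: "(\<lambda>_. 0) \<in> \<L>" by (simp add: square_summable_def)
 have nz: "L.nm (\<lambda>_. 0) = 0" using L.nm_zero by (simp add: ell2_simps)
 have ne: "R ~= {}" using z nz by (auto simp: R_def)
 have bd: "bdd_above R" unfolding R_def
 proof (rule bdd_aboveI2)
  fix f assume f: "f \<in> {f \<in> \<L>. L.nm f <= 1}"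
  have "walk_form q f <= (L.nm f)\<^sup>2" using walk_op(4)[OF q] f by blast
  also have "\<dots> <= 1" using f by (auto intro!: power_le_one)
  finally show "walk_form q f <= 1" .
 qed
 have "0 <= walk_form q (\<lambda>_. 0)" using walk_op(3)[OF q z] .
 also have "\<dots> <= top q" unfolding top_def R_def[symmetric] using z nz bd by (intro cSup_upper) (auto simp: R_def)
 finally show t0: "0 <= top q" .
 show "walk_form q f <= top q * (L.nm f)\<^sup>2" if f: "f \<in> \<L>" for f
 proof (cases "L.nm f = 0")
  case True
  thus ?thesis using walk_op(4)[OF q f] by simp
 next
  case False
  have nf: "L.nm f > 0" using False f by (simp add: less_le del: L.nm_eq0)
  define c where "c = complex_of_real (1 / L.nm f)"
  have c: "cmod c = 1 / L.nm f" "cnj c = c" using nf by (auto simp: c_def norm_divide)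
  have cf: "c \<odot>\<^bsub>ell2 V\<^esub> f \<in> \<L>" "L.nm (c \<odot>\<^bsub>ell2 V\<^esub> f) <= 1" using f nf c L.nm_scale[of f c] by auto
  have "walk_form q (c \<odot>\<^bsub>ell2 V\<^esub> f) <= top q" unfolding top_def R_def[symmetric] using cf bd by (intro cSup_upper) (auto simp: R_def)
  moreover have "walk_form q (c \<odot>\<^bsub>ell2 V\<^esub> f) = walk_form q f / (L.nm f)\<^sup>2"
   using f L.linear_opD(1,3)[OF walk_op(1)[OF q]] by (simp add: walk_form_def c_def power2_eq_square)
  ultimately show ?thesis using nf by (simp add: divide_le_eq)
 qed
 show "top q <= c" if "!!f. f \<in> \<L> ==> walk_form q f <= c * (L.nm f)\<^sup>2" "0 <= c" for c
  unfolding top_def R_def[symmetric]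
 proof (rule cSup_least[OF ne])
  fix y assume "y \<in> R"
  then obtain f where f: "f \<in> \<L>" "L.nm f <= 1" "y = walk_form q f" by (auto simp: R_def)
  have "c * (L.nm f)\<^sup>2 <= c * 1" using f that(2) by (intro mult_left_mono power_le_one) auto
  thus "y <= c" using that(1)[OF f(1)] f(3) by simp
 qed
 show "\<exists>f\<in>\<L>. walk_form q f > c * (L.nm f)\<^sup>2" if "0 < top q" "c < top q" for c
 proof -
  have "max c 0 < Sup R" using that by (simp add: top_def R_def)
  then obtain y where "y \<in> R" "max c 0 < y" using less_cSupD[OF ne] by blast
  then obtain f where f: "f \<in> \<L>" "L.nm f <= 1" "max c 0 < walk_form q f" by (auto simp: R_def)
  have "c * (L.nm f)\<^sup>2 <= max c 0 * (L.nm f)\<^sup>2" by (intro mult_right_mono) auto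
  also have "\<dots> <= max c 0 * 1" using f by (intro mult_left_mono power_le_one) auto
  finally show ?thesis using f by (intro bexI[of _ f]) auto
 qed
qed

lemma top_modulus:
 assumes q: "0 <= q" "q < 1" and q': "0 <= q'" "q' < 1" shows "top q - top q' <= modulus q q'"
proof -
 have m0: "0 <= modulus q q'"
  unfolding modulus_def using delta_image_mem exceptional_V S(2) by (intro sum_nonneg L.nm_ge0) (auto simp: subset_iff)
 have "top q <= top q' + modulus q q'"
 proof (rule top(3)[OF q])
  fix f assume f: "f \<in> \<L>"
  show "walk_form q f <= (top q' + modulus q q') * (L.nm f)\<^sup>2"
   using walk_form_modulus[OF q q' f] top(2)[OF q' f] by (simp add: distrib_right)
 qed (use m0 top(1)[OF q'] in simp)
 thus ?thesis by simp
qed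

lemma modulus_commute: "modulus q q' = modulus q' q"
 unfolding modulus_def
proof (intro sum.cong refl)
 fix s x assume s: "s \<in> S" and x: "x \<in> exceptional s"
 have "delta_image p s x \<in> carrier (ell2 V)" for p using delta_image_mem[of s x] S(2) s exceptional_V[OF x] by auto
 thus "L.nm (delta_image q s x \<ominus>\<^bsub>ell2 V\<^esub> delta_image q' s x) = L.nm (delta_image q' s x \<ominus>\<^bsub>ell2 V\<^esub> delta_image q s x)"
  by (intro L.nm_minus_commute)
qed

lemma top_continuous: assumes b: "b < 1" shows "continuous_on {0..b} top"
 unfolding continuous_on_def
proof
 fix q0 assume q0: "q0 \<in> {0..b}"
 have "((\<lambda>q. top q - top q0) \<longlongrightarrow> 0) (at q0 within {0..b})"
 proof (rule Lim_null_comparison)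
  have "\<bar>top q - top q0\<bar> <= modulus q q0" if "q \<in> {0..b}" for q
   using top_modulus[of q q0] top_modulus[of q0 q] modulus_commute[of q q0] that q0 b by auto
  thus "\<forall>\<^sub>F q in at q0 within {0..b}. norm (top q - top q0) <= modulus q q0"
   by (auto simp: eventually_at_filter)
  have "((\<lambda>q. modulus q q0) \<longlongrightarrow> 0) (at q0 within {0..1})" using q0 b by (intro modulus_tendsto) auto
  thus "((\<lambda>q. modulus q q0) \<longlongrightarrow> 0) (at q0 within {0..b})"
   by (rule tendsto_within_subset) (use b in auto)
 qed
 thus "(top \<longlongrightarrow> top q0) (at q0 within {0..b})" by (simp add: LIM_zero_iff)
qed

lemma top_near_1: assumes t: "t < 1" shows "\<exists>q. 0 < q \<and> q < 1 \<and> t < top q"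
proof -
 define h where "h q = 1 / 2 + (\<Sum>s\<in>S. q ^ gdist E (act s r) r) / (2 * real (card S))" for q :: real
 have h1: "h 1 = 1" using card_S_pos by (simp add: h_def)
 have "isCont h 1" unfolding h_def using card_S_pos by (intro continuous_intros) auto
 moreover have "(\<lambda>n. 1 - inverse (real (Suc (Suc n)))) \<longlonglongrightarrow> 1 - 0"
  using LIMSEQ_Suc[OF LIMSEQ_inverse_real_of_nat] by (intro tendsto_intros)
 ultimately have "(\<lambda>n. h (1 - inverse (real (Suc (Suc n))))) \<longlonglongrightarrow> h 1"
  by (intro isCont_tendsto_compose[of 1 h]) auto
 hence "\<forall>\<^sub>F n in sequentially. t < h (1 - inverse (real (Suc (Suc n))))"
  using order_tendstoD(1) t h1 by metis
 then obtain n where n: "t < h (1 - inverse (real (Suc (Suc n))))" by (auto simp: eventually_sequentially)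
 define q where "q = 1 - inverse (real (Suc (Suc n)))"
 have q: "0 < q" "q < 1" by (auto simp: q_def field_simps)
 have er: "evec q r \<in> \<L>" by (rule evec_mem[OF root])
 have ip1: "L.ip (evec q r) (evec q r) = 1" using evec_gram[of q r r] q root by simp
 hence nr: "L.nm (evec q r) = 1" by (simp add: hnorm_def)
 have "L.ip (deform q s (evec q r)) (evec q r) = of_real (q ^ gdist E (act s r) r)" if "s \<in> S" for s
  using that S(2) q deform_evec[of q s r] evec_gram[of q "act s r" r] root act_V[of s r] by (auto simp: subset_iff)
 hence "L.ip (walk_op q (evec q r)) (evec q r) = of_real (h q)"
  using walk_op(5)[OF less_imp_le[OF q(1)] q(2) er er] ip1 by (simp add: h_def)
 hence "walk_form q (evec q r) = h q" by (simp add: walk_form_def)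
 hence "h q <= top q" using top(2)[OF less_imp_le[OF q(1)] q(2) er] nr by simp
 thus ?thesis using n q by (intro exI[of _ q]) (simp add: q_def)
qed

text \<open>The top of the spectrum is at most \<open>\<rho>\<close> for \<open>q = 0\<close>, exceeds \<open>t\<close> for \<open>q\<close> near \<open>1\<close>, and is continuous.\<close>

lemma top_attains:
 assumes rho: "!!f. f \<in> \<L> ==> walk_form 0 f <= \<rho> * (L.nm f)\<^sup>2"
  and t: "\<rho> < t" "0 < t" "t < 1"
 obtains q where "0 < q" "q < 1" "top q = t"
proof -
 have "walk_form 0 f <= max \<rho> 0 * (L.nm f)\<^sup>2" if "f \<in> \<L>" for f
  using rho[OF that] mult_right_mono[of \<rho> "max \<rho> 0" "(L.nm f)\<^sup>2"] by simp
 hence t0: "top 0 <= max \<rho> 0" by (intro top(3)) auto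
 have t00: "top 0 <= t" using t0 t by linarith
 obtain q1 where q1: "0 < q1" "q1 < 1" "t < top q1" using top_near_1[OF t(3)] by blast
 obtain q where q: "0 <= q" "q <= q1" "top q = t"
  using IVT'[of top 0 t q1, OF t00 less_imp_le[OF q1(3)] less_imp_le[OF q1(1)] top_continuous[OF q1(2)]] by blast
 have "q ~= 0" using q t0 t by auto
 thus ?thesis using that[of q] q q1 by simp
qed

lemma walk_op_nm:
 assumes q: "0 <= q" "q < 1" and t: "top q = t" "0 < t" and f: "f \<in> \<L>"
 shows "L.nm (walk_op q f) <= t * L.nm f"
proof -
 note l = L.linear_opD[OF walk_op(1)[OF q]]
 have wf: "walk_op q f \<in> \<L>" using l(1) f by simp
 have "(L.nm (walk_op q f))\<^sup>2 <= t * Re (L.ip (walk_op q f) f)"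
  by (rule L.positive_form_bound[OF walk_op(1,2)[OF q] _ _ t(2)])
   (use f wf walk_op(3)[OF q] top(2)[OF q wf] t in \<open>auto simp: walk_form_def\<close>)
 also have "\<dots> <= t * (t * (L.nm f)\<^sup>2)" using top(2)[OF q f] t by (intro mult_left_mono) (auto simp: walk_form_def)
 finally have "(L.nm (walk_op q f))\<^sup>2 <= (t * L.nm f)\<^sup>2" by (simp add: power2_eq_square mult_ac)
 thus ?thesis by (rule power2_le_imp_le) (use t f in auto)
qed

text \<open>The walk operators for \<open>q\<close> and for \<open>0\<close> differ by an operator of finite rank, and the latter is at
 most \<open>\<rho>\<close>; so above \<open>\<rho>\<close> only isolated eigenvalues of finite multiplicity can occur.\<close>

lemma top_eigenprojection:
 assumes q: "0 <= q" "q < 1" and rho: "!!f. f \<in> \<L> ==> walk_form 0 f <= \<rho> * (L.nm f)\<^sup>2"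
  and t: "top q = t" "\<rho> < t" "0 < t"
 defines "W \<equiv> L.eigenspace (walk_op q) t"
 shows "L.csub W" "\<exists>v\<in>W. L.nm v = 1" "unitary_action.approximable (ell2 V) G (tree_rep q) (L.oproj W)"
  "\<exists>N. \<forall>U. finite U \<and> L.orthonormal U \<and> U \<subseteq> W --> card U <= N"
proof -
 interpret A: hspace_action "ell2 V" G "tree_rep q" by (rule tree_rep_action[OF q])
 note T = walk_op(1,2)[OF q]
 define I where "I = Sigma S exceptional"
 define a where "a i = delta (snd i)" for i :: "'g \<times> 'v"
 define b where "b i = (1 / (2 * of_nat (card S))) \<odot>\<^bsub>ell2 V\<^esub> (delta_image q (fst i) (snd i) \<ominus>\<^bsub>ell2 V\<^esub> delta_image 0 (fst i) (snd i))"
  for i :: "'g \<times> 'v"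
 have I: "finite I" unfolding I_def using S(1,2) finite_exceptional by (intro finite_SigmaI) auto
 have a: "a i \<in> carrier (ell2 V)" if "i \<in> I" for i
  using that delta_square_summable[OF exceptional_V[of "snd i" "fst i"]] by (auto simp: a_def I_def)
 have b: "b i \<in> carrier (ell2 V)" if "i \<in> I" for i
  using that S(2) exceptional_V delta_image_mem by (auto simp: b_def I_def subset_iff)
 have gap': "Re (L.ip (walk_op q f) f) <= \<rho> * (L.nm f)\<^sup>2 + Re (L.ip (finsum (ell2 V) (\<lambda>i. L.ip f (a i) \<odot>\<^bsub>ell2 V\<^esub> b i) I) f)"
  if f: "f \<in> carrier (ell2 V)" for f
 proof -
  have fs: "f \<in> \<L>" using f by simp
  have "L.ip (finsum (ell2 V) (\<lambda>i. L.ip f (a i) \<odot>\<^bsub>ell2 V\<^esub> b i) I) f = (\<Sum>i\<in>I. f (snd i) * L.ip (b i) f)"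
   using I b f by (subst L.ip_sum_left) (auto simp: a_def ell2_ip_delta)
  also have "\<dots> = (\<Sum>s\<in>S. \<Sum>x\<in>exceptional s. f x * L.ip (b (s, x)) f)"
   unfolding I_def using S(1,2) finite_exceptional by (subst sum.Sigma) (auto simp: case_prod_beta)
  also have "\<dots> = (\<Sum>s\<in>S. L.ip (deform q s f \<ominus>\<^bsub>ell2 V\<^esub> deform 0 s f) f / (2 * of_nat (card S)))"
  proof (rule sum.cong)
   fix s assume s: "s \<in> S"
   have sG: "s \<in> carrier G" using S(2) s by blast
   define d where "d x = delta_image q s x \<ominus>\<^bsub>ell2 V\<^esub> delta_image 0 s x" for x
   have d: "d x \<in> carrier (ell2 V)" if "x \<in> exceptional s" for x
    using delta_image_mem[OF sG exceptional_V[OF that]] by (simp add: d_def)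
   have "L.ip (deform q s f \<ominus>\<^bsub>ell2 V\<^esub> deform 0 s f) f = (\<Sum>x\<in>exceptional s. f x * L.ip (d x) f)"
    unfolding deform_diff[OF sG fs] d_def[symmetric]
    using d f by (subst L.ip_sum_left[OF finite_exceptional[OF sG]]) auto
   thus "(\<Sum>x\<in>exceptional s. f x * L.ip (b (s, x)) f) = L.ip (deform q s f \<ominus>\<^bsub>ell2 V\<^esub> deform 0 s f) f / (2 * of_nat (card S))"
    unfolding b_def fst_conv snd_conv d_def[symmetric] using d f
    by (simp add: sum_divide_distrib)
  qed simp
  finally have "L.ip (finsum (ell2 V) (\<lambda>i. L.ip f (a i) \<odot>\<^bsub>ell2 V\<^esub> b i) I) f
    = (\<Sum>s\<in>S. L.ip (deform q s f \<ominus>\<^bsub>ell2 V\<^esub> deform 0 s f) f) / (2 * of_nat (card S))"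
   by (simp add: sum_divide_distrib)
  hence "Re (L.ip (finsum (ell2 V) (\<lambda>i. L.ip f (a i) \<odot>\<^bsub>ell2 V\<^esub> b i) I) f) = walk_form q f - walk_form 0 f"
   using walk_form_diff[OF q, of 0 f] fs by simp
  thus ?thesis using rho[OF fs] by (simp add: walk_form_def)
 qed
 have bT: "L.nm (walk_op q f) <= t * L.nm f" if "f \<in> carrier (ell2 V)" for f
  using walk_op_nm[OF q t(1,3)] that by simp
 have pos: "0 <= Re (L.ip (walk_op q f) f)" if "f \<in> carrier (ell2 V)" for f
  using walk_op(3)[OF q] that by (simp add: walk_form_def)
 have sup: "Re (L.ip (walk_op q f) f) <= t * (L.nm f)\<^sup>2" if "f \<in> carrier (ell2 V)" for f
  using top(2)[OF q] that t(1) by (simp add: walk_form_def)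
 have att: "\<exists>f\<in>carrier (ell2 V). Re (L.ip (walk_op q f) f) > s' * (L.nm f)\<^sup>2" if "s' < t" for s'
  using top(4)[OF q, of s'] t that by (simp add: walk_form_def)
 show Wc: "L.csub W" unfolding W_def by (rule L.eigenspace_csub[OF T(1) bT])
 show "\<exists>v\<in>W. L.nm v = 1" unfolding W_def
  by (rule L.top_spectral_projection(1)[OF T bT pos t(2,3) sup I a b gap' att])
 show "\<exists>N. \<forall>U. finite U \<and> L.orthonormal U \<and> U \<subseteq> W --> card U <= N" unfolding W_def
  by (rule L.top_spectral_projection(3)[OF T bT pos t(2,3) sup I a b gap' att])
 have "\<exists>\<delta>\<ge>0. \<delta> < 1 \<and> (\<forall>n. \<forall>x\<in>carrier (ell2 V).
   L.nm (of_real (1 / t ^ n) \<odot>\<^bsub>ell2 V\<^esub> (walk_op q ^^ n) x \<ominus>\<^bsub>ell2 V\<^esub> L.oproj W x) <= \<delta> ^ n * L.nm x)" unfolding W_def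
  by (rule L.top_spectral_projection(2)[OF T bT pos t(2,3) sup I a b gap' att])
 then obtain \<delta> where d: "0 <= \<delta>" "\<delta> < 1" "!!n x. x \<in> carrier (ell2 V) ==>
   L.nm (of_real (1 / t ^ n) \<odot>\<^bsub>ell2 V\<^esub> (walk_op q ^^ n) x \<ominus>\<^bsub>ell2 V\<^esub> L.oproj W x) <= \<delta> ^ n * L.nm x" by blast
 have aT: "A.approximable (walk_op q)" unfolding walk_op_def by (rule A.approximable_rho[OF A.lazy_walk_mem[OF S]])
 show "A.approximable (L.oproj W)" unfolding W_def
  by (rule A.approximable_eigenprojection[OF aT t(3) Wc[unfolded W_def] d(1,2) d(3)[unfolded W_def]])
qed

text \<open>If all vertices \<open>g r\<close> were within distance \<open>D\<close> of the root, the coefficients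
 \<open>\<langle>T\<^sup>n e\<^sub>r, e\<^sub>r\<rangle>\<close> would stay above \<open>q\<^sup>D\<close>, contradicting \<open>\<parallel>T\<parallel> < 1\<close>.\<close>

lemma orbit_unbounded:
 assumes q: "0 < q" "q < 1" and t: "top q = t" "0 < t" "t < 1"
 shows "\<exists>g\<in>carrier G. D < gdist E (act g r) r"
proof (rule ccontr)
 assume "\<not> ?thesis"
 hence D: "gdist E (act g r) r <= D" if "g \<in> carrier G" for g using that by (meson not_less)
 have q0: "0 <= q" "q <= 1" using q by auto
 interpret A: hspace_action "ell2 V" G "tree_rep q" by (rule tree_rep_action[OF q0(1) q(2)])
 note l = L.linear_opD[OF walk_op(1)[OF q0(1) q(2)]]
 have em: "evec q (act g r) \<in> \<L>" if "g \<in> carrier G" for g by (rule evec_mem[OF act_V[OF that root]])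
 have er: "evec q r \<in> \<L>" by (rule evec_mem[OF root])
 define v where "v n = (walk_op q ^^ n) (evec q r)" for n
 have vm: "v n \<in> \<L>" for n
  using L.linear_opD(1)[OF L.linear_op_funpow[OF walk_op(1)[OF q0(1) q(2)]]] er by (simp add: v_def)
 have low: "q ^ D <= Re (L.ip (v n) (evec q (act h r)))" if h: "h \<in> carrier G" for n h
  using h
 proof (induction n arbitrary: h)
  case 0
  have "Re (L.ip (evec q r) (evec q (act h r))) = q ^ gdist E r (act h r)"
   using evec_gram[OF q0 root act_V[OF 0 root]] by simp
  also have "gdist E r (act h r) = gdist E (act h r) r" by (rule gdist_commute[OF root act_V[OF 0 root]])
  finally show ?case using power_decreasing[OF D[OF 0] q0] by (simp add: v_def)
 next
  case (Suc n)
  have s: "q ^ D <= Re (L.ip (deform q s (v n)) (evec q (act h r)))" if s: "s \<in> S" for s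
  proof -
   have sG: "s \<in> carrier G" using S(2) s by blast
   have iG: "inv s \<otimes> h \<in> carrier G" using sG Suc.prems by simp
   have "L.ip (deform q s (v n)) (evec q (act h r)) = L.ip (v n) (deform q (inv s) (evec q (act h r)))"
    using A.act_adj[of s "v n" "evec q (act h r)"] sG vm em[OF Suc.prems] by (simp add: tree_rep_def)
   also have "deform q (inv s) (evec q (act h r)) = evec q (act (inv s \<otimes> h) r)"
    using deform_evec[OF q0, of "inv s" "act h r"] sG Suc.prems act_V[OF Suc.prems root] act_mult[of "inv s" h r] root by simp
   finally show ?thesis using Suc.IH[OF iG] by simp
  qed
  have "Re (L.ip (v (Suc n)) (evec q (act h r))) = Re (L.ip (v n) (evec q (act h r))) / 2
    + (\<Sum>s\<in>S. Re (L.ip (deform q s (v n)) (evec q (act h r)))) / (2 * real (card S))"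
  proof -
   have "L.ip (v (Suc n)) (evec q (act h r)) = L.ip (v n) (evec q (act h r)) / of_real 2
    + (\<Sum>s\<in>S. L.ip (deform q s (v n)) (evec q (act h r))) / of_real (2 * real (card S))"
    using walk_op(5)[OF q0(1) q(2) vm em[OF Suc.prems]] by (simp add: v_def)
   thus ?thesis by (simp only: plus_complex.sel Re_divide_of_real Re_sum)
  qed
  also have "\<dots> \<ge> q ^ D / 2 + (\<Sum>s\<in>S. q ^ D) / (2 * real (card S))"
   using Suc.IH[OF Suc.prems] s by (intro add_mono divide_right_mono sum_mono) auto
  also have "q ^ D / 2 + (\<Sum>s\<in>S. q ^ D) / (2 * real (card S)) = q ^ D" using card_S_pos by simp
  finally show ?case .
 qed
 have ner: "L.nm (evec q r) = 1" using evec_gram[OF q0 root root] by (simp add: hnorm_def)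
 have vn: "L.nm (v n) <= t ^ n" for n
 proof (induction n)
  case (Suc n)
  have "L.nm (v (Suc n)) <= t * L.nm (v n)" using walk_op_nm[OF q0(1) q(2) t(1,2) vm[of n]] by (simp add: v_def)
  also have "\<dots> <= t * t ^ n" using Suc t by (intro mult_left_mono) auto
  finally show ?case by simp
 qed (simp add: v_def ner)
 have "q ^ D <= t ^ n" for n
 proof -
  have "q ^ D <= Re (L.ip (v n) (evec q r))" using low[of "\<one>" n] act_one[OF root] by simp
  also have "\<dots> <= L.nm (v n) * L.nm (evec q r)"
   using L.cauchy_schwarz[of "v n" "evec q r"] complex_Re_le_cmod[of "L.ip (v n) (evec q r)"] vm er by fastforce
  finally show ?thesis using vn[of n] ner by simp
 qed
 moreover have "(\<lambda>n. t ^ n) \<longlonglongrightarrow> 0" using t by (intro LIMSEQ_power_zero) simp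
 ultimately have "q ^ D <= 0" by (meson LIMSEQ_le_const)
 thus False using zero_less_power[OF q(1), of D] by linarith
qed

lemma mixing_sequence:
 assumes q: "0 < q" "q < 1" and t: "top q = t" "0 < t" "t < 1"
 obtains g where "!!n. g n \<in> carrier G"
  "!!f h. f \<in> \<L> ==> h \<in> \<L> ==> (\<lambda>n. L.ip (deform q (g n) f) h) \<longlonglongrightarrow> 0"
proof -
 have q0: "0 <= q" "q <= 1" using q by auto
 obtain g where g: "!!n. g n \<in> carrier G" "!!n. n < gdist E (act (g n) r) r"
  using orbit_unbounded[OF q t] by metis
 have ee: "(\<lambda>n. L.ip (deform q (g n) (evec q x)) (evec q y)) \<longlonglongrightarrow> 0" if x: "x \<in> V" and y: "y \<in> V" for x y
 proof (rule Lim_null_comparison)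
  define c where "c = gdist E r x + gdist E y r"
  have "norm (L.ip (deform q (g n) (evec q x)) (evec q y)) <= q ^ (n - c)" for n
  proof -
   note gx = act_V[OF g(1) x, of n] and gr = act_V[OF g(1) root, of n]
   have "gdist E (act (g n) r) r <= gdist E (act (g n) r) (act (g n) x) + gdist E (act (g n) x) y + gdist E y r"
    using gdist_triangle[OF gr gx root] gdist_triangle[OF gx y root] by simp
   also have "gdist E (act (g n) r) (act (g n) x) = gdist E r x" by (rule act_gdist[OF g(1) root x])
   finally have "n - c <= gdist E (act (g n) x) y" using g(2)[of n] by (simp add: c_def)
   thus ?thesis using deform_evec[OF q0 g(1) x] evec_gram[OF q0 gx y] power_decreasing[OF _ q0] q
    by (simp add: norm_power)
  qed
  thus "\<forall>\<^sub>F n in sequentially. norm (L.ip (deform q (g n) (evec q x)) (evec q y)) <= q ^ (n - c)" by simp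
  have "(\<lambda>n. q ^ n) \<longlonglongrightarrow> 0" using q by (intro LIMSEQ_power_zero) simp
  moreover have "(\<lambda>n. q ^ (n + c - c)) = (\<lambda>n. q ^ n)" by simp
  ultimately show "(\<lambda>n. q ^ (n - c)) \<longlonglongrightarrow> 0" using LIMSEQ_offset[of "\<lambda>n. q ^ (n - c)" c 0] by simp
 qed
 note l = L.linear_opD[OF deform_linear[OF g(1)]] and nU = deform_nm[OF q0(1) q(2) g(1)] and mU = deform_eq(1)[OF g(1)]
 have fe: "(\<lambda>n. L.ip (deform q (g n) f) (evec q y)) \<longlonglongrightarrow> 0" if f: "f \<in> \<L>" and y: "y \<in> V" for f y
 proof -
  have ey: "evec q y \<in> \<L>" by (rule evec_mem[OF y])
  have "L.csub {f \<in> carrier (ell2 V). (\<lambda>n. L.ip (deform q (g n) f) (evec q y)) \<longlonglongrightarrow> 0}"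
  proof (rule L.csub_null_functionals[where C = "L.nm (evec q y)"])
   fix n f assume "f \<in> carrier (ell2 V)"
   thus "cmod (L.ip (deform q (g n) f) (evec q y)) <= L.nm (evec q y) * L.nm f"
    using L.cauchy_schwarz[of "deform q (g n) f" "evec q y"] nU[of f n] mU[of f q n] ey by (simp add: mult.commute)
  qed (use l ey mU in auto)
  hence "{f \<in> carrier (ell2 V). (\<lambda>n. L.ip (deform q (g n) f) (evec q y)) \<longlonglongrightarrow> 0} = carrier (ell2 V)"
   by (rule evec_total[OF q0(1) q(2)]) (use ee y evec_mem in auto)
  thus ?thesis using f by auto
 qed
 have "(\<lambda>n. L.ip (deform q (g n) f) h) \<longlonglongrightarrow> 0" if f: "f \<in> \<L>" and h: "h \<in> \<L>" for f h
 proof -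
  have cm: "cnj (L.ip (deform q (g n) f) k) = L.ip k (deform q (g n) f)" if "k \<in> \<L>" for k n
   using that mU[OF f] by (intro L.cinner_commute[symmetric]) auto
  have "L.csub {h \<in> carrier (ell2 V). (\<lambda>n. L.ip h (deform q (g n) f)) \<longlonglongrightarrow> 0}"
  proof (rule L.csub_null_functionals[where C = "L.nm f"])
   fix n h assume "h \<in> carrier (ell2 V)"
   thus "cmod (L.ip h (deform q (g n) f)) <= L.nm f * L.nm h"
    using L.cauchy_schwarz[of h "deform q (g n) f"] nU[OF f, of n] mU[OF f, of q n] by (simp add: mult.commute)
  qed (use mU[OF f] in auto)
  hence "{h \<in> carrier (ell2 V). (\<lambda>n. L.ip h (deform q (g n) f)) \<longlonglongrightarrow> 0} = carrier (ell2 V)"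
  proof (rule evec_total[OF q0(1) q(2)])
   fix y assume y: "y \<in> V"
   have "(\<lambda>n. cnj (L.ip (deform q (g n) f) (evec q y))) \<longlonglongrightarrow> cnj 0" by (intro tendsto_cnj fe[OF f y])
   thus "evec q y \<in> {h \<in> carrier (ell2 V). (\<lambda>n. L.ip h (deform q (g n) f)) \<longlonglongrightarrow> 0}"
    using evec_mem[OF y] cm[OF evec_mem[OF y]] by simp
  qed
  hence "(\<lambda>n. L.ip h (deform q (g n) f)) \<longlonglongrightarrow> 0" using h by auto
  hence "(\<lambda>n. cnj (L.ip h (deform q (g n) f))) \<longlonglongrightarrow> cnj 0" by (intro tendsto_cnj)
  moreover have "cnj (L.ip h (deform q (g n) f)) = L.ip (deform q (g n) f) h" for n by (metis cm[OF h] complex_cnj_cnj)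
  ultimately show ?thesis by simp
 qed
 thus ?thesis using that g(1) by blast
qed

end

text \<open>The representation is a cyclic subspace generated by an eigenvector of the walk operator, for the
 value of \<open>q\<close> at which the top of its spectrum is \<open>t\<close>. The carrier is a set of functions on \<open>nat\<close>,
 which is why the vertices are numbers here.\<close>

theorem gapped_tree_action_traceable_family:
 fixes V :: "nat set" and G :: "('g, 'n) monoid_scheme"
 assumes act: "gapped_tree_action V E r G act S"
 obtains \<rho> where "\<rho> < 1" "!!t. [|\<rho> < t; 0 < t; t < 1|] ==> \<exists>(H :: hilbert_univ) \<pi>.
   traceable_rep G H \<pi> \<and> \<not> finite_dimensional H \<and> opnorm H (group_algebra_rep H \<pi> (lazy_walk G S)) = t"
proof -
 interpret gapped_tree_action V E r G act S by (rule act)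
 interpret L: hspace "ell2 V" by (rule hspace_ell2)
 obtain \<rho> where rho: "\<rho> < 1" "!!f. f \<in> square_summable V ==> walk_form 0 f <= \<rho> * (L.nm f)\<^sup>2"
  using walk_gap by blast
 show ?thesis
 proof (rule that[OF rho(1)])
  fix t assume t: "\<rho> < t" "0 < t" "t < 1"
  obtain q where q: "0 < q" "q < 1" "top q = t" using top_attains[OF rho(2) t] by blast
  have q0: "0 <= q" using q by simp
  interpret A: hspace_action "ell2 V" G "tree_rep q" by (rule tree_rep_action[OF q0 q(2)])
  note e = top_eigenprojection[OF q0 q(2) rho(2) q(3) t(1,2)]
  obtain u where u: "u \<in> L.eigenspace (walk_op q) t" "L.nm u = 1" using e(2) by blast
  obtain N where N: "!!U. finite U ==> L.orthonormal U ==> U \<subseteq> L.eigenspace (walk_op q) t ==> card U <= N"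
   using e(4) by blast
  have wm: "lazy_walk G S \<in> group_algebra G" by (rule A.lazy_walk_mem[OF S])
  obtain K where K: "L.csub K" "!!g x. [|g \<in> carrier G; x \<in> K|] ==> tree_rep q g x \<in> K"
   "traceable_rep G (sub_hilbert (ell2 V) K) (\<lambda>g. restrict (tree_rep q g) K)"
   "opnorm (sub_hilbert (ell2 V) K) (group_algebra_rep (sub_hilbert (ell2 V) K) (\<lambda>g. restrict (tree_rep q g) K) (lazy_walk G S)) = t"
   "\<exists>v\<in>K. L.nm v = 1"
  proof (rule traceable_subrepresentation[OF A.hspace_action_axioms ell2_separable[OF countable_V] e(1,3) u N wm, of t])
   show "group_algebra_rep (ell2 V) (tree_rep q) (lazy_walk G S) w = of_real t \<odot>\<^bsub>ell2 V\<^esub> w"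
    if "w \<in> L.eigenspace (walk_op q) t" for w
    using that by (simp add: L.eigenspace_def walk_op_def)
   show "L.nm (group_algebra_rep (ell2 V) (tree_rep q) (lazy_walk G S) f) <= t * L.nm f" if "f \<in> carrier (ell2 V)" for f
    using walk_op_nm[OF q0 q(2,3) t(2)] that by (simp add: walk_op_def)
  qed (use t in auto)
  obtain g where g: "!!n. g n \<in> carrier G"
   "!!f h. f \<in> square_summable V ==> h \<in> square_summable V ==> (\<lambda>n. L.ip (deform q (g n) f) h) \<longlonglongrightarrow> 0"
   using mixing_sequence[OF q t(2,3)] by blast
  obtain v where v: "v \<in> K" "L.nm v = 1" using K(5) by blast
  have "\<not> finite_dimensional (sub_hilbert (ell2 V) K)"
   by (rule A.mixing_infinite_dimensional[OF K(1,2) v g(1)]) (use g(2) in \<open>auto simp: tree_rep_def\<close>)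
  thus "\<exists>(H :: hilbert_univ) \<pi>. traceable_rep G H \<pi> \<and> \<not> finite_dimensional H
    \<and> opnorm H (group_algebra_rep H \<pi> (lazy_walk G S)) = t" using K(3,4) by blast
 qed
qed

section \<open>Means on bounded functions\<close>

definition bfun :: "'x set => ('x => complex) set" where
 "bfun Z = {f. bounded (f ` Z)}"

definition mean :: "'x set => (('x => complex) => complex) => bool" where
 "mean Z M \<longleftrightarrow> (\<forall>f\<in>bfun Z. \<forall>h\<in>bfun Z. M (\<lambda>x. f x + h x) = M f + M h) \<and>
   (\<forall>c. \<forall>f\<in>bfun Z. M (\<lambda>x. c * f x) = c * M f) \<and> M (\<lambda>_. 1) = 1 \<and>
   (\<forall>f\<in>bfun Z. (\<forall>x\<in>Z. f x \<in> \<real>\<^sub>\<ge>\<^sub>0) --> M f \<in> \<real>\<^sub>\<ge>\<^sub>0)"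

lemma bfunI: "(!!x. x \<in> Z ==> cmod (f x) <= B) ==> f \<in> bfun Z"
 by (auto simp: bfun_def bounded_iff)

lemma bfun_bound: assumes "f \<in> bfun Z" obtains B where "0 <= B" "!!x. x \<in> Z ==> cmod (f x) <= B"
proof -
 obtain B where "!!x. x \<in> Z ==> cmod (f x) <= B" using assms by (auto simp: bfun_def bounded_iff)
 thus ?thesis using that[of "max B 0"] by fastforce
qed

lemma bfun_comp: "[|f \<in> bfun Y; !!x. x \<in> Z ==> p x \<in> Y|] ==> (\<lambda>x. f (p x)) \<in> bfun Z"
 by (erule bfun_bound) (auto intro: bfunI)

lemma bfun_const [simp]: "(\<lambda>_. c) \<in> bfun Z"
 by (rule bfunI[of _ _ "cmod c"]) simp

lemma bfun_add: "[|f \<in> bfun Z; h \<in> bfun Z|] ==> (\<lambda>x. f x + h x) \<in> bfun Z"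
 by (elim bfun_bound, rule bfunI) (auto intro: norm_triangle_mono)

lemma bfun_cmult: "f \<in> bfun Z ==> (\<lambda>x. c * f x) \<in> bfun Z"
 unfolding bfun_def bounded_iff by (auto simp: norm_mult intro: mult_left_mono[OF _ norm_ge_zero])

lemma meanD:
 assumes "mean Z M"
 shows "[|f \<in> bfun Z; h \<in> bfun Z|] ==> M (\<lambda>x. f x + h x) = M f + M h"
  "f \<in> bfun Z ==> M (\<lambda>x. c * f x) = c * M f" "M (\<lambda>_. 1) = 1"
  "[|f \<in> bfun Z; !!x. x \<in> Z ==> f x \<in> \<real>\<^sub>\<ge>\<^sub>0|] ==> M f \<in> \<real>\<^sub>\<ge>\<^sub>0"
 using assms unfolding mean_def by blast+

lemma mean_real:
 assumes M: "mean Z M" and h: "!!x. x \<in> Z ==> \<bar>h x\<bar> <= B"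
 shows "Im (M (\<lambda>x. complex_of_real (h x))) = 0" "Re (M (\<lambda>x. complex_of_real (h x))) <= B"
proof -
 let ?h = "\<lambda>x. complex_of_real (h x)"
 have hb: "?h \<in> bfun Z" by (rule bfunI[of _ _ B]) (use h in simp)
 have "M (\<lambda>x. of_real B * 1 + (- 1) * ?h x) = of_real B * M (\<lambda>_. 1) + (- 1) * M ?h"
  unfolding meanD(1)[OF M bfun_const bfun_cmult[OF hb]] meanD(2)[OF M hb] meanD(2)[OF M bfun_const] ..
 moreover have "M (\<lambda>x. of_real B * 1 + (- 1) * ?h x) \<in> \<real>\<^sub>\<ge>\<^sub>0"
  using hb h by (intro meanD(4)[OF M] bfun_add bfun_const bfun_cmult) (fastforce simp: complex_nonneg_Reals_iff abs_le_iff)+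
 ultimately have "of_real B - M ?h \<in> \<real>\<^sub>\<ge>\<^sub>0" by (simp add: meanD(3)[OF M])
 thus "Im (M ?h) = 0" "Re (M ?h) <= B" by (auto simp: complex_nonneg_Reals_iff)
qed

lemma mean_bound:
 assumes M: "mean Z M" and f: "!!x. x \<in> Z ==> cmod (f x) <= B" shows "cmod (M f) <= B"
proof -
 
 \<comment> \<open>turn \<open>f\<close> so that its mean becomes its own real part\<close>
 obtain c where c: "cmod c = 1" "c * M f = of_real (cmod (M f))"
 proof (cases "M f = 0")
  case True thus ?thesis using that[of 1] by simp
 next
  case False
  moreover have "cnj (M f) * M f = of_real (cmod (M f)) * of_real (cmod (M f))"
   using complex_norm_square[of "M f"] by (simp add: power2_eq_square mult.commute)
  ultimately show ?thesis using that[of "cnj (M f) / of_real (cmod (M f))"] by (simp add: norm_divide)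
 qed
 have fb: "f \<in> bfun Z" using bfunI[of Z f B] f by blast
 have cf: "cmod (c * f x) <= B" if "x \<in> Z" for x using f[OF that] c by (simp add: norm_mult)
 have re: "\<bar>Re (c * f x)\<bar> <= B" "\<bar>Im (c * f x)\<bar> <= B" if "x \<in> Z" for x
  using cf[OF that] abs_Re_le_cmod[of "c * f x"] abs_Im_le_cmod[of "c * f x"] by linarith+
 let ?r = "\<lambda>x. complex_of_real (Re (c * f x))" and ?i = "\<lambda>x. complex_of_real (Im (c * f x))"
 have b: "?r \<in> bfun Z" "?i \<in> bfun Z" by (rule bfunI[of _ _ B]; use re in \<open>simp del: times_complex.sel\<close>)+
 have "M (\<lambda>x. ?r x + \<i> * ?i x) = M ?r + \<i> * M ?i"
  unfolding meanD(1)[OF M b(1) bfun_cmult[OF b(2)]] meanD(2)[OF M b(2)] ..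
 moreover have "(\<lambda>x. ?r x + \<i> * ?i x) = (\<lambda>x. c * f x)" by (simp add: complex_eq_iff fun_eq_iff)
 ultimately have "of_real (cmod (M f)) = M ?r + \<i> * M ?i" using meanD(2)[OF M fb, of c] c by simp
 hence "cmod (M f) = Re (M ?r) - Im (M ?i)" by (metis Re_complex_of_real Re_i_times plus_complex.sel(1) add_uminus_conv_diff)
 thus ?thesis using mean_real[of Z M "\<lambda>x. Re (c * f x)" B, OF M re(1)] mean_real[of Z M "\<lambda>x. Im (c * f x)" B, OF M re(2)] by simp
qed

lemma mean_close:
 assumes M: "mean Z M" and b: "f \<in> bfun Z" "h \<in> bfun Z" and c: "!!x. x \<in> Z ==> cmod (f x - h x) <= e"
 shows "cmod (M f - M h) <= e"
proof -
 have "M (\<lambda>x. f x + (- 1) * h x) = M f - M h"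
  unfolding meanD(1)[OF M b(1) bfun_cmult[OF b(2)]] meanD(2)[OF M b(2)] by simp
 moreover have "cmod (M (\<lambda>x. f x + (- 1) * h x)) <= e" by (rule mean_bound[OF M]) (use c in simp)
 ultimately show ?thesis by simp
qed

lemma mean_cong:
 assumes M: "mean Z M" and b: "f \<in> bfun Z" and c: "!!x. x \<in> Z ==> f x = h x" shows "M f = M h"
proof -
 have "h \<in> bfun Z" using b c by (metis (mono_tags, lifting) bfun_bound bfunI)
 thus ?thesis using mean_close[OF M b, of h 0] c by simp
qed

text \<open>Means form a closed subset of a product of discs, so a family of linear equations that is
 approximately solvable by means, finitely many equations at a time, has an exact solution.\<close>

lemma mean_compactness:
 assumes approx: "!!F \<epsilon>. [|finite F; F \<subseteq> \<Omega>; \<epsilon> > 0|] ==> \<exists>M. mean Z M \<and> (\<forall>(f, h)\<in>F. cmod (M f - M h) <= \<epsilon>)"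
  and bd: "!!f h. (f, h) \<in> \<Omega> ==> f \<in> bfun Z \<and> h \<in> bfun Z"
 obtains M where "mean Z M" "!!f h. (f, h) \<in> \<Omega> ==> M f = M h"
proof -
 define B where "B f = (SOME B. \<forall>x\<in>Z. cmod (f x) <= B)" for f
 have B: "cmod (f x) <= B f" if "f \<in> bfun Z" "x \<in> Z" for f x
 proof -
  have "\<exists>B. \<forall>x\<in>Z. cmod (f x) <= B" using that(1) unfolding bfun_def bounded_iff by auto
  from someI_ex[OF this] show ?thesis using that(2) by (simp add: B_def)
 qed
 define D where "D f = (if f \<in> bfun Z then cball (0 :: complex) (B f) else {0})" for f
 define P where "P = Pi\<^sub>E UNIV D \<inter> {M. mean Z M}"
 have "compactin (product_topology (\<lambda>_ :: 'a => complex. euclidean :: complex topology) UNIV) (Pi\<^sub>E UNIV D)"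
  unfolding compactin_PiE by (simp add: D_def)
 hence "compact (Pi\<^sub>E UNIV D)" by (simp add: euclidean_product_topology)
 have ev: "continuous_on UNIV (\<lambda>M :: ('a => complex) => complex. M f)" for f
  by (rule continuous_on_product_coordinates)
 have pos: "closed {M :: ('a => complex) => complex. M f \<in> \<real>\<^sub>\<ge>\<^sub>0}" for f
  using closed_vimage[OF closed_nonneg_Reals_complex ev[of f]] by (simp add: vimage_def)
 have "closed {M. mean Z M}"
  unfolding mean_def Ball_def
  by (intro closed_Collect_conj closed_Collect_all closed_Collect_imp open_Collect_const closed_Collect_eq
    continuous_intros ev pos)
 with \<open>compact (Pi\<^sub>E UNIV D)\<close> have cP: "compact P" unfolding P_def by (rule compact_Int_closed)
 define C where "C i = {M. cmod (M (fst (fst i)) - M (snd (fst i))) <= 1 / real (Suc (snd i))}"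
  for i :: "(('a => complex) \<times> ('a => complex)) \<times> nat"
 have clC: "closed (C i)" for i
  unfolding C_def by (intro closed_Collect_le continuous_intros ev)
 have "P \<inter> (\<Inter>i\<in>\<Omega> \<times> UNIV. C i) ~= {}"
 proof (rule compact_imp_fip_image[OF cP])
  fix J assume J: "finite J" "J \<subseteq> \<Omega> \<times> (UNIV :: nat set)"
  define N where "N = Max (insert 0 (snd ` J))"
  have N: "snd i <= N" if "i \<in> J" for i using that J(1) by (simp add: N_def)
  have "fst ` J \<subseteq> \<Omega>" using J(2) by auto
  then obtain M where M: "mean Z M" "!!p. p \<in> fst ` J ==> cmod (M (fst p) - M (snd p)) <= 1 / real (Suc N)"
   using approx[of "fst ` J" "1 / real (Suc N)"] J(1) by fastforce
  define M' where "M' f = (if f \<in> bfun Z then M f else 0)" for f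
  have "mean Z M'" using M(1) by (auto simp: mean_def M'_def bfun_add bfun_cmult)
  moreover have "M' \<in> Pi\<^sub>E UNIV D" using mean_bound[OF M(1)] B by (auto simp: M'_def D_def)
  moreover have "M' \<in> C i" if i: "i \<in> J" for i
  proof -
   have "fst i \<in> \<Omega>" using i J(2) by auto
   hence "fst (fst i) \<in> bfun Z" "snd (fst i) \<in> bfun Z" using bd[of "fst (fst i)" "snd (fst i)"] by auto
   moreover have "1 / real (Suc N) <= 1 / real (Suc (snd i))" using N[OF i] by (intro divide_left_mono) auto
   ultimately show ?thesis using M(2)[of "fst i"] i by (simp add: C_def M'_def)
  qed
  ultimately show "P \<inter> (\<Inter>i\<in>J. C i) ~= {}" unfolding P_def by blast
 qed (use clC in blast)
 then obtain M where M: "M \<in> P" "!!i. i \<in> \<Omega> \<times> UNIV ==> M \<in> C i" by blast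
 have "M f = M h" if "(f, h) \<in> \<Omega>" for f h
 proof (rule ccontr)
  assume "M f ~= M h"
  hence "cmod (M f - M h) > 0" by simp
  then obtain n where "inverse (real (Suc n)) < cmod (M f - M h)" using reals_Archimedean by blast
  thus False using M(2)[of "((f, h), n)"] that by (simp add: C_def inverse_eq_divide)
 qed
 thus ?thesis using that[of M] M(1) by (simp add: P_def)
qed

text \<open>A unit vector \<open>\<xi>\<close> gives the mean \<open>f \<mapsto> \<Sum> f |\<xi>|\<^sup>2\<close>, which is continuous in \<open>\<xi>\<close>; so almost
 invariant vectors give almost invariant means, and \<open>mean_compactness\<close> an invariant one.\<close>

lemma square_summable_mult:
 assumes x: "\<xi> \<in> square_summable V" and f: "!!v. v \<in> V ==> cmod (f v) <= B" and B: "0 <= B"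
 shows "(\<lambda>v. f v * \<xi> v) \<in> square_summable V" "hnorm (ell2 V) (\<lambda>v. f v * \<xi> v) <= B * hnorm (ell2 V) \<xi>"
proof -
 have le: "(cmod (f v * \<xi> v))\<^sup>2 <= B\<^sup>2 * (cmod (\<xi> v))\<^sup>2" for v
 proof (cases "v \<in> V")
  case True
  have "cmod (f v * \<xi> v) <= B * cmod (\<xi> v)" using f[OF True] by (simp add: norm_mult mult_right_mono)
  hence "(cmod (f v * \<xi> v))\<^sup>2 <= (B * cmod (\<xi> v))\<^sup>2" by (intro power_mono) auto
  thus ?thesis by (simp add: power_mult_distrib)
 qed (simp add: square_summableD(2)[OF x])
 have s: "(\<lambda>v. B\<^sup>2 * (cmod (\<xi> v))\<^sup>2) summable_on UNIV" by (intro summable_on_cmult_right square_summableD(1)[OF x])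
 have s': "(\<lambda>v. (cmod (f v * \<xi> v))\<^sup>2) summable_on UNIV" by (rule summable_on_comparison_test[OF s]) (use le in auto)
 thus m: "(\<lambda>v. f v * \<xi> v) \<in> square_summable V" using square_summableD(2)[OF x] by (auto simp: square_summable_def)
 have "(\<Sum>\<^sub>\<infinity>v. (cmod (f v * \<xi> v))\<^sup>2) <= (\<Sum>\<^sub>\<infinity>v. B\<^sup>2 * (cmod (\<xi> v))\<^sup>2)" by (rule infsum_mono[OF s' s le])
 also have "\<dots> = B\<^sup>2 * (\<Sum>\<^sub>\<infinity>v. (cmod (\<xi> v))\<^sup>2)" by (intro infsum_cmult_right square_summableD(1)[OF x])
 finally show "hnorm (ell2 V) (\<lambda>v. f v * \<xi> v) <= B * hnorm (ell2 V) \<xi>"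
  unfolding ell2_hnorm[OF m] ell2_hnorm[OF x] using B by (metis real_sqrt_le_mono real_sqrt_mult real_sqrt_abs abs_of_nonneg)
qed

definition vector_mean :: "'v set => ('v => complex) => ('v => complex) => complex" where
 "vector_mean V \<xi> f = cinner (ell2 V) (\<lambda>v. f v * \<xi> v) \<xi>"

lemma bfun_mult_mem: "[|\<xi> \<in> square_summable V; f \<in> bfun V|] ==> (\<lambda>v. f v * \<xi> v) \<in> square_summable V"
 by (erule bfun_bound) (rule square_summable_mult)

lemma mean_vector:
 assumes x: "\<xi> \<in> square_summable V" and n: "hnorm (ell2 V) \<xi> = 1" shows "mean V (vector_mean V \<xi>)"
proof -
 interpret L: hspace "ell2 V" by (rule hspace_ell2)
 note m = bfun_mult_mem[OF x]
 have "vector_mean V \<xi> (\<lambda>v. f v + h v) = vector_mean V \<xi> f + vector_mean V \<xi> h" if "f \<in> bfun V" "h \<in> bfun V" for f h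
  using L.cinner_add_left[of "\<lambda>v. f v * \<xi> v" "\<lambda>v. h v * \<xi> v" \<xi>] m[OF that(1)] m[OF that(2)] x
  by (simp add: vector_mean_def ell2_add distrib_right ell2_simps(1))
 moreover have "vector_mean V \<xi> (\<lambda>v. c * f v) = c * vector_mean V \<xi> f" if "f \<in> bfun V" for f c
  using L.cinner_smult_left[of "\<lambda>v. f v * \<xi> v" \<xi> c] m[OF that] x by (simp add: vector_mean_def ell2_simps mult.assoc)
 moreover have "vector_mean V \<xi> (\<lambda>_. 1) = 1" using L.ip_self[of \<xi>] x n by (simp add: vector_mean_def ell2_simps(1))
 moreover have "vector_mean V \<xi> f \<in> \<real>\<^sub>\<ge>\<^sub>0" if f: "f \<in> bfun V" "\<forall>v\<in>V. f v \<in> \<real>\<^sub>\<ge>\<^sub>0" for f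
 proof -
  define h where "h v = complex_of_real (sqrt (Re (f v)))" for v
  obtain B where B: "0 <= B" "!!v. v \<in> V ==> cmod (f v) <= B" using bfun_bound[OF f(1)] by blast
  have "h \<in> bfun V"
  proof (rule bfunI)
   fix v assume v: "v \<in> V"
   have "0 <= Re (f v)" "Re (f v) <= B" using v f(2) B(2)[OF v] complex_Re_le_cmod[of "f v"] by (auto simp: complex_nonneg_Reals_iff)
   thus "cmod (h v) <= sqrt B" by (simp add: h_def)
  qed
  note hm = m[OF this]
  have "f v * \<xi> v * cnj (\<xi> v) = h v * \<xi> v * cnj (h v * \<xi> v)" for v
  proof (cases "v \<in> V")
   case True
   hence "h v * cnj (h v) = f v" using f(2) by (auto simp: h_def complex_eq_iff complex_nonneg_Reals_iff)
   thus ?thesis by (simp add: mult_ac)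
  qed (simp add: square_summableD(2)[OF x])
  hence "vector_mean V \<xi> f = L.ip (\<lambda>v. h v * \<xi> v) (\<lambda>v. h v * \<xi> v)" by (simp only: vector_mean_def ell2_simps)
  thus ?thesis using L.cinner_self_nonneg hm by (simp add: ell2_simps(1))
 qed
 ultimately show ?thesis unfolding mean_def by blast
qed

lemma vector_mean_diff:
 assumes x: "\<xi> \<in> square_summable V" "hnorm (ell2 V) \<xi> = 1" and y: "\<eta> \<in> square_summable V" "hnorm (ell2 V) \<eta> = 1"
  and f: "!!v. v \<in> V ==> cmod (f v) <= B" and B: "0 <= B"
 shows "cmod (vector_mean V \<eta> f - vector_mean V \<xi> f) <= 2 * B * hnorm (ell2 V) (\<eta> \<ominus>\<^bsub>ell2 V\<^esub> \<xi>)"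
proof -
 interpret L: hspace "ell2 V" by (rule hspace_ell2)
 define d where "d = \<eta> \<ominus>\<^bsub>ell2 V\<^esub> \<xi>"
 have d: "d \<in> square_summable V" "d = (\<lambda>v. \<eta> v - \<xi> v)"
  using x y square_summable_diff[of \<eta> V \<xi>] by (auto simp: d_def ell2_minus_mem)
 note m = square_summable_mult[OF _ f B]
 have fm: "(\<lambda>v. f v * \<xi> v) \<in> square_summable V" "(\<lambda>v. f v * \<eta> v) \<in> square_summable V" using m(1)[OF x(1)] m(1)[OF y(1)] by auto
 have fd: "(\<lambda>v. f v * d v) = (\<lambda>v. f v * \<eta> v) \<ominus>\<^bsub>ell2 V\<^esub> (\<lambda>v. f v * \<xi> v)"
  using fm by (simp add: ell2_minus_mem d(2) right_diff_distrib)
 have "vector_mean V \<eta> f - vector_mean V \<xi> f = L.ip (\<lambda>v. f v * d v) \<eta> + L.ip (\<lambda>v. f v * \<xi> v) d"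
  unfolding vector_mean_def fd unfolding d_def using fm x y by (simp add: ell2_simps(1))
 also have "cmod \<dots> <= L.nm (\<lambda>v. f v * d v) * L.nm \<eta> + L.nm (\<lambda>v. f v * \<xi> v) * L.nm d"
  using fm m(1)[OF d(1)] d(1) y by (intro norm_triangle_mono L.cauchy_schwarz) (simp_all add: ell2_simps(1))
 also have "\<dots> <= (B * L.nm d) * 1 + (B * 1) * L.nm d"
  using m(2)[OF x(1)] m(2)[OF d(1)] d(1) x y B by (intro add_mono mult_mono) (simp_all add: ell2_simps(1))
 finally show ?thesis by (simp add: d_def)
qed

context tree_action
begin

interpretation L: hspace "ell2 V" by (rule hspace_ell2)

lemma vector_mean_perm:
 assumes g: "g \<in> carrier G" and x: "\<xi> \<in> \<L>" and f: "f \<in> bfun V"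
 shows "vector_mean V \<xi> (\<lambda>v. f (act g v)) = vector_mean V (perm_op g \<xi>) f"
proof -
 let ?a = "\<lambda>v. f (act g v) * \<xi> v"
 have a: "?a \<in> \<L>" by (rule bfun_mult_mem[OF x bfun_comp[OF f]]) (rule act_V[OF g])
 have "perm_op g ?a = (\<lambda>v. f v * perm_op g \<xi> v)" using g by (auto simp: perm_op_def)
 thus ?thesis using deform_isometry[of 0 g ?a \<xi>] g a x by (simp add: vector_mean_def deform_zero_q)
qed

lemma invariant_mean:
 assumes inv: "!!S \<epsilon>. [|finite S; S \<subseteq> carrier G; S ~= {}; !!s. s \<in> S ==> inv s \<in> S; \<epsilon> > 0|] ==>
   \<exists>f\<in>\<L>. \<forall>s\<in>S. L.nm (perm_op s f \<ominus>\<^bsub>ell2 V\<^esub> f) < \<epsilon> * L.nm f"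
 obtains \<mu> where "mean V \<mu>" "!!g f. [|g \<in> carrier G; f \<in> bfun V|] ==> \<mu> (\<lambda>v. f (act g v)) = \<mu> f"
proof -
 define \<Omega> where "\<Omega> = {((\<lambda>v. f (act g v)), f) | g f. g \<in> carrier G \<and> f \<in> bfun V}"
 have *: "\<exists>M. mean V M \<and> (\<forall>(f, h)\<in>F. cmod (M f - M h) <= \<epsilon>)"
  if F: "finite F" "F \<subseteq> \<Omega>" and e: "\<epsilon> > 0" for F \<epsilon>
 proof -
  have "\<forall>p\<in>F. \<exists>g B. g \<in> carrier G \<and> snd p \<in> bfun V \<and> fst p = (\<lambda>v. snd p (act g v)) \<and> 0 <= B \<and> (\<forall>v\<in>V. cmod (snd p v) <= B)"
  proof
   fix p assume "p \<in> F"
   then obtain g f where p: "p = ((\<lambda>v. f (act g v)), f)" "g \<in> carrier G" "f \<in> bfun V" using F(2) unfolding \<Omega>_def by blast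
   obtain B where "0 <= B" "!!v. v \<in> V ==> cmod (f v) <= B" using bfun_bound[OF p(3)] by blast
   thus "\<exists>g B. g \<in> carrier G \<and> snd p \<in> bfun V \<and> fst p = (\<lambda>v. snd p (act g v)) \<and> 0 <= B \<and> (\<forall>v\<in>V. cmod (snd p v) <= B)"
    using p by auto
  qed
  then obtain g B where gB: "!!p. p \<in> F ==> g p \<in> carrier G \<and> snd p \<in> bfun V \<and> fst p = (\<lambda>v. snd p (act (g p) v))
    \<and> 0 <= B p \<and> (\<forall>v\<in>V. cmod (snd p v) <= B p)" by metis
  define S where "S = insert \<one> (g ` F \<union> (\<lambda>p. inv (g p)) ` F)"
  define C where "C = 1 + (\<Sum>p\<in>F. 2 * B p)"
  have C: "C > 0" "!!p. p \<in> F ==> 2 * B p <= C"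
  proof -
   have "(\<Sum>p\<in>F. 2 * B p) \<ge> 0" using gB by (intro sum_nonneg) auto
   thus "C > 0" by (simp add: C_def)
   show "2 * B p <= C" if "p \<in> F" for p
    using member_le_sum[of p F "\<lambda>p. 2 * B p"] that F(1) gB by (simp add: C_def)
  qed
  have S: "finite S" "S \<subseteq> carrier G" "S ~= {}" using F(1) gB by (auto simp: S_def)
  have Si: "inv s \<in> S" if "s \<in> S" for s
  proof -
   have "s = \<one> \<or> (\<exists>p\<in>F. s = g p) \<or> (\<exists>p\<in>F. s = inv (g p))" using that by (auto simp: S_def)
   moreover have "inv (inv (g p)) \<in> S" "inv (g p) \<in> S" if "p \<in> F" for p
    using that gB[OF that] by (simp_all add: S_def)
   ultimately show ?thesis by (auto simp: S_def)
  qed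
  have "\<exists>f\<in>\<L>. \<forall>s\<in>S. L.nm (perm_op s f \<ominus>\<^bsub>ell2 V\<^esub> f) < \<epsilon> / C * L.nm f"
   by (rule inv[OF S Si]) (use e C in simp_all)
  then obtain f where f: "f \<in> \<L>" "!!s. s \<in> S ==> L.nm (perm_op s f \<ominus>\<^bsub>ell2 V\<^esub> f) < \<epsilon> / C * L.nm f"
   by blast
  have nf: "L.nm f > 0"
  proof -
   have "0 <= L.nm (perm_op \<one> f \<ominus>\<^bsub>ell2 V\<^esub> f)" using perm_op_mem[OF G.one_closed f(1)] f(1) by simp
   hence "0 < \<epsilon> / C * L.nm f" using f(2)[of "\<one>"] by (simp add: S_def)
   thus ?thesis using e C by (simp add: zero_less_mult_iff zero_less_divide_iff)
  qed
  define c where "c = complex_of_real (1 / L.nm f)"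
  define \<xi> where "\<xi> = c \<odot>\<^bsub>ell2 V\<^esub> f"
  have cc: "cmod c = 1 / L.nm f" using nf by (simp add: c_def norm_divide)
  have x: "\<xi> \<in> \<L>" "L.nm \<xi> = 1" using f(1) nf cc by (auto simp: \<xi>_def L.nm_scale)
  have close: "C * L.nm (perm_op s \<xi> \<ominus>\<^bsub>ell2 V\<^esub> \<xi>) <= \<epsilon>" if s: "s \<in> S" for s
  proof -
   have sG: "s \<in> carrier G" using s gB by (auto simp: S_def)
   note pm = perm_op_mem[OF sG]
   have "perm_op s \<xi> \<ominus>\<^bsub>ell2 V\<^esub> \<xi> = c \<odot>\<^bsub>ell2 V\<^esub> (perm_op s f \<ominus>\<^bsub>ell2 V\<^esub> f)"
    using pm(1)[OF f(1)] f(1) pm(1)[OF x(1)] x(1)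
    by (auto simp: \<xi>_def ell2_minus_mem ell2_simps perm_op_def fun_eq_iff right_diff_distrib)
   hence "L.nm (perm_op s \<xi> \<ominus>\<^bsub>ell2 V\<^esub> \<xi>) = L.nm (perm_op s f \<ominus>\<^bsub>ell2 V\<^esub> f) / L.nm f"
    using L.nm_scale[of "perm_op s f \<ominus>\<^bsub>ell2 V\<^esub> f" c] pm(1)[OF f(1)] f(1) cc by simp
   moreover have "L.nm (perm_op s f \<ominus>\<^bsub>ell2 V\<^esub> f) / L.nm f <= \<epsilon> / C" using f(2)[OF s] nf by (simp add: divide_le_eq)
   ultimately show ?thesis using C(1) by (simp add: pos_le_divide_eq mult.commute)
  qed
  have "cmod (vector_mean V \<xi> (fst p) - vector_mean V \<xi> (snd p)) <= \<epsilon>" if p: "p \<in> F" for p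
  proof -
   have g: "g p \<in> carrier G" "g p \<in> S" using gB[OF p] p by (auto simp: S_def)
   note pm = perm_op_mem[OF g(1) x(1)]
   have "vector_mean V \<xi> (fst p) = vector_mean V (perm_op (g p) \<xi>) (snd p)"
    using vector_mean_perm[OF g(1) x(1), of "snd p"] gB[OF p] by metis
   hence "cmod (vector_mean V \<xi> (fst p) - vector_mean V \<xi> (snd p)) <= 2 * B p * L.nm (perm_op (g p) \<xi> \<ominus>\<^bsub>ell2 V\<^esub> \<xi>)"
    using vector_mean_diff[OF x pm(1) _ _ , of "snd p" "B p"] pm(2) x(2) gB[OF p] by simp
   also have "\<dots> <= C * L.nm (perm_op (g p) \<xi> \<ominus>\<^bsub>ell2 V\<^esub> \<xi>)" using C(2)[OF p] pm x by (intro mult_right_mono) auto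
   also have "\<dots> <= \<epsilon>" by (rule close[OF g(2)])
   finally show ?thesis .
  qed
  thus ?thesis using mean_vector[OF x] by (intro exI[of _ "vector_mean V \<xi>"]) auto
 qed
 have bd: "f \<in> bfun V \<and> h \<in> bfun V" if "(f, h) \<in> \<Omega>" for f h
  using that act_V by (auto simp: \<Omega>_def intro: bfun_comp[of _ V])
 obtain \<mu> where "mean V \<mu>" "!!f h. (f, h) \<in> \<Omega> ==> \<mu> f = \<mu> h" using mean_compactness[OF * bd] by blast
 thus ?thesis using that[of \<mu>] unfolding \<Omega>_def by blast
qed

end

section \<open>From almost invariant vectors to amenability\<close>

text \<open>Left uniform continuity for the topology of pointwise convergence on \<open>Y\<close>.\<close>

definition uniform :: "('g, 'n) monoid_scheme => 'y set => ('g => 'y => 'y) => 'g set => ('g => complex) set" where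
 "uniform G Y \<psi> K = {h \<in> bfun K. \<forall>\<epsilon>>0. \<exists>A. finite A \<and> A \<subseteq> Y \<and>
   (\<forall>u\<in>K. \<forall>k\<in>K. (\<forall>a\<in>A. \<psi> u a = a) --> cmod (h (u \<otimes>\<^bsub>G\<^esub> k) - h k) <= \<epsilon>)}"

lemma mean_average:
 assumes R: "finite R" "R ~= {}" and p: "!!c. c \<in> R ==> p c \<in> K"
 shows "mean K (\<lambda>h. (\<Sum>c\<in>R. h (p c)) / of_nat (card R))"
proof -
 have "(\<Sum>c\<in>R. f (p c)) / of_nat (card R) \<in> \<real>\<^sub>\<ge>\<^sub>0" if "\<forall>x\<in>K. f x \<in> \<real>\<^sub>\<ge>\<^sub>0" for f :: "_ => complex"
  using that p by (auto simp: complex_nonneg_Reals_iff intro!: sum_nonneg divide_nonneg_nonneg)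
 thus ?thesis using R by (auto simp: mean_def sum.distrib add_divide_distrib sum_distrib_left)
qed

locale set_action = group G for G :: "('g, 'n) monoid_scheme" (structure) +
 fixes Y :: "'y set" and \<psi> :: "'g => 'y => 'y"
 assumes maps: "[|g \<in> carrier G; y \<in> Y|] ==> \<psi> g y \<in> Y"
  and one: "y \<in> Y ==> \<psi> \<one> y = y"
  and mult: "[|g \<in> carrier G; h \<in> carrier G; y \<in> Y|] ==> \<psi> (g \<otimes> h) y = \<psi> g (\<psi> h y)"
begin

lemma inverse_action:
 assumes "g \<in> carrier G" "y \<in> Y"
 shows "\<psi> (inv g) (\<psi> g y) = y" "\<psi> g (\<psi> (inv g) y) = y"
 using assms mult[of "inv g" g y] mult[of g "inv g" y] one by auto

text \<open>A subgroup with finite orbits has relatively compact image in the permutations of \<open>Y\<close>; averaging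
 over its finite images on finite invariant sets approximates the Haar integral.\<close>

lemma finite_orbits_mean:
 assumes K: "subgroup K G" and fin: "!!y. y \<in> Y ==> finite ((\<lambda>k. \<psi> k y) ` K)"
 obtains \<Lambda> where "mean K \<Lambda>"
  "!!h k. [|h \<in> uniform G Y \<psi> K; k \<in> K|] ==> \<Lambda> (\<lambda>x. h (k \<otimes> x)) = \<Lambda> h"
proof -
 note KG = subgroup.mem_carrier[OF K] and Km = subgroup.m_closed[OF K] and Ki = subgroup.m_inv_closed[OF K]
  and K1 = subgroup.one_closed[OF K]
 define \<Omega> where "\<Omega> = {((\<lambda>x. h (k \<otimes> x)), h) | h k. h \<in> uniform G Y \<psi> K \<and> k \<in> K}"
 have *: "\<exists>M. mean K M \<and> (\<forall>(f, h)\<in>F. cmod (M f - M h) <= \<epsilon>)" if F: "finite F" "F \<subseteq> \<Omega>" and e: "\<epsilon> > 0" for F \<epsilon>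
 proof -
  define P where "P p k A \<longleftrightarrow> k \<in> K \<and> fst p = (\<lambda>x. snd p (k \<otimes> x)) \<and> finite A \<and> A \<subseteq> Y \<and>
   (\<forall>u\<in>K. \<forall>j\<in>K. (\<forall>a\<in>A. \<psi> u a = a) --> cmod (snd p (u \<otimes> j) - snd p j) <= \<epsilon>)" for p k A
  have "\<exists>k A. P p k A" if "p \<in> F" for p
  proof -
   obtain h k where p: "p = ((\<lambda>x. h (k \<otimes> x)), h)" "h \<in> uniform G Y \<psi> K" "k \<in> K"
    using \<open>p \<in> F\<close> F(2) unfolding \<Omega>_def by blast
   have "\<forall>\<epsilon>>0. \<exists>A. finite A \<and> A \<subseteq> Y \<and> (\<forall>u\<in>K. \<forall>k\<in>K. (\<forall>a\<in>A. \<psi> u a = a) --> cmod (h (u \<otimes> k) - h k) <= \<epsilon>)"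
    using p(2) unfolding uniform_def mem_Collect_eq by (rule conjunct2)
   thus ?thesis using p e by (auto simp: P_def)
  qed
  then obtain k A where "!!p. p \<in> F ==> P p (k p) (A p)" by metis
  hence kA: "!!p. p \<in> F ==> k p \<in> K" "!!p. p \<in> F ==> fst p = (\<lambda>x. snd p (k p \<otimes> x))"
   "!!p. p \<in> F ==> finite (A p)" "!!p. p \<in> F ==> A p \<subseteq> Y"
   "!!p u j. [|p \<in> F; u \<in> K; j \<in> K; \<forall>a\<in>A p. \<psi> u a = a|] ==> cmod (snd p (u \<otimes> j) - snd p j) <= \<epsilon>"
   unfolding P_def by simp_all
  define B where "B = (\<Union>p\<in>F. \<Union>a\<in>A p. (\<lambda>k. \<psi> k a) ` K)"
  have "finite B" unfolding B_def by (intro finite_UN_I F(1) kA(3) fin) (use kA(4) in blast)+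
  moreover have "B \<subseteq> Y"
  proof
   fix b assume "b \<in> B"
   then obtain p a j where "p \<in> F" "a \<in> A p" "j \<in> K" "b = \<psi> j a" unfolding B_def by blast
   thus "b \<in> Y" using maps[OF KG] kA(4) by blast
  qed
  ultimately have B: "finite B" "B \<subseteq> Y" by blast+
  have Binv: "\<psi> j a \<in> B" if j: "j \<in> K" and a: "a \<in> B" for j a
  proof -
   obtain p c i where p: "p \<in> F" "c \<in> A p" "i \<in> K" "a = \<psi> i c" using a unfolding B_def by blast
   have "\<psi> j a = \<psi> (j \<otimes> i) c" using mult[OF KG[OF j] KG[OF p(3)]] kA(4)[OF p(1)] p by auto
   thus ?thesis unfolding B_def using Km[OF j p(3)] p by (metis UN_I image_eqI)
  qed
  have AB: "A p \<subseteq> B" if "p \<in> F" for p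
  proof
   fix a assume "a \<in> A p"
   moreover have "a = \<psi> \<one> a" using one kA(4)[OF that] calculation by auto
   ultimately show "a \<in> B" unfolding B_def using that K1 by blast
  qed
  define \<rho> where "\<rho> j = restrict (\<psi> j) B" for j
  \<comment> \<open>the image of \<open>K\<close> in the permutations of \<open>B\<close>\<close>
  define R where "R = \<rho> ` K"
  have R: "finite R" "R ~= {}"
  proof -
   have "R \<subseteq> B \<rightarrow>\<^sub>E B" using Binv by (auto simp: R_def \<rho>_def)
   thus "finite R" by (rule finite_subset) (simp add: finite_PiE B(1))
   show "R ~= {}" using K1 by (auto simp: R_def)
  qed
  define sel where "sel c = (SOME j. j \<in> K \<and> \<rho> j = c)" for c
  have sel: "sel c \<in> K" "\<rho> (sel c) = c" if "c \<in> R" for c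
  proof -
   have "\<exists>j. j \<in> K \<and> \<rho> j = c" using that by (auto simp: R_def)
   from someI_ex[OF this] show "sel c \<in> K" "\<rho> (sel c) = c" by (auto simp: sel_def)
  qed
  have same: "cmod (snd p i - snd p j) <= \<epsilon>" if p: "p \<in> F" and ij: "i \<in> K" "j \<in> K" "\<rho> i = \<rho> j" for p i j
  proof -
   let ?u = "i \<otimes> inv j"
   have "\<psi> ?u a = a" if a: "a \<in> A p" for a
   proof -
    have aB: "a \<in> B" "a \<in> Y" using AB[OF p] a B(2) by auto
    have "\<psi> i (\<psi> (inv j) a) = \<psi> j (\<psi> (inv j) a)"
     using fun_cong[OF ij(3), of "\<psi> (inv j) a"] Binv[OF Ki[OF ij(2)] aB(1)] by (simp add: \<rho>_def)
    thus ?thesis using mult[of i "inv j" a] inverse_action(2)[of j a] ij KG aB by simp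
   qed
   hence "cmod (snd p (?u \<otimes> j) - snd p j) <= \<epsilon>" using kA(5)[OF p Km[OF ij(1) Ki[OF ij(2)]] ij(2)] by blast
   moreover have "?u \<otimes> j = i" using ij KG by (simp add: m_assoc)
   ultimately show ?thesis by simp
  qed
  define M where "M h = (\<Sum>c\<in>R. h (sel c)) / of_nat (card R)" for h :: "'g => complex"
  have "cmod (M (fst p) - M (snd p)) <= \<epsilon>" if p: "p \<in> F" for p
  proof -
   define \<tau> where "\<tau> c = \<rho> (k p \<otimes> sel c)" for c
   have kG: "k p \<in> carrier G" using KG kA(1)[OF p] .
   have ks: "k p \<otimes> sel c \<in> K" if "c \<in> R" for c using Km kA(1)[OF p] sel[OF that] by blast
   have tR: "\<tau> ` R \<subseteq> R" using ks by (auto simp: \<tau>_def R_def)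
   have "inj_on \<tau> R"
   proof (rule inj_onI)
    fix c d assume c: "c \<in> R" and d: "d \<in> R" and eq: "\<tau> c = \<tau> d"
    have "\<psi> (sel c) a = \<psi> (sel d) a" if a: "a \<in> B" for a
    proof -
     have aY: "a \<in> Y" using a B(2) by blast
     have "\<psi> (k p \<otimes> sel c) a = \<psi> (k p \<otimes> sel d) a" using fun_cong[OF eq, of a] a by (simp add: \<tau>_def \<rho>_def)
     hence "\<psi> (k p) (\<psi> (sel c) a) = \<psi> (k p) (\<psi> (sel d) a)"
      using mult[OF kG] KG[OF sel(1)[OF c]] KG[OF sel(1)[OF d]] aY by simp
     thus ?thesis using inverse_action(1)[OF kG] maps[OF KG[OF sel(1)] aY] c d by metis
    qed
    hence "\<rho> (sel c) = \<rho> (sel d)" by (auto simp: \<rho>_def restrict_def)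
    thus "c = d" using sel(2) c d by metis
   qed
   hence "bij_betw \<tau> R R" using endo_inj_surj[OF R(1) tR] by (simp add: bij_betw_def)
   hence "(\<Sum>c\<in>R. snd p (sel c)) = (\<Sum>c\<in>R. snd p (sel (\<tau> c)))" by (rule sum.reindex_bij_betw[symmetric])
   hence "M (fst p) - M (snd p) = (\<Sum>c\<in>R. snd p (k p \<otimes> sel c) - snd p (sel (\<tau> c))) / of_nat (card R)"
    unfolding M_def kA(2)[OF p] by (simp add: sum_subtractf diff_divide_distrib)
   moreover have "cmod (\<Sum>c\<in>R. snd p (k p \<otimes> sel c) - snd p (sel (\<tau> c))) <= (\<Sum>c\<in>R. \<epsilon>)"
   proof (rule sum_norm_le)
    fix c assume c: "c \<in> R"
    hence "\<tau> c \<in> R" using tR by blast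
    thus "cmod (snd p (k p \<otimes> sel c) - snd p (sel (\<tau> c))) <= \<epsilon>"
     using same[OF p ks[OF c] sel(1)] sel(2) by (simp add: \<tau>_def)
   qed
   moreover have "card R > 0" using R by (simp add: card_gt_0_iff)
   ultimately show ?thesis by (simp add: norm_divide divide_le_eq mult.commute)
  qed
  moreover have "mean K M" unfolding M_def by (rule mean_average[OF R sel(1)])
  ultimately show ?thesis by (intro exI[of _ M]) auto
 qed
 have bd: "f \<in> bfun K \<and> h \<in> bfun K" if "(f, h) \<in> \<Omega>" for f h
  using that Km by (auto simp: \<Omega>_def uniform_def intro: bfun_comp[of _ K])
 obtain \<Lambda> where "mean K \<Lambda>" "!!f h. (f, h) \<in> \<Omega> ==> \<Lambda> f = \<Lambda> h" using mean_compactness[OF * bd] by blast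
 thus ?thesis using that[of \<Lambda>] unfolding \<Omega>_def by blast
qed

lemma uniform_translate:
 assumes f: "f \<in> uniform G Y \<psi> (carrier G)" and g: "g \<in> carrier G" and K: "K \<subseteq> carrier G"
 shows "(\<lambda>k. f (g \<otimes> k)) \<in> uniform G Y \<psi> K"
 unfolding uniform_def mem_Collect_eq
proof (intro conjI allI impI)
 show "(\<lambda>k. f (g \<otimes> k)) \<in> bfun K" using f g K by (auto simp: uniform_def intro: bfun_comp[of f "carrier G"])
 fix \<epsilon> :: real assume "\<epsilon> > 0"
 moreover have "\<forall>\<epsilon>>0. \<exists>A. finite A \<and> A \<subseteq> Y \<and> (\<forall>u\<in>carrier G. \<forall>k\<in>carrier G.
   (\<forall>a\<in>A. \<psi> u a = a) --> cmod (f (u \<otimes> k) - f k) <= \<epsilon>)" using f unfolding uniform_def mem_Collect_eq by (rule conjunct2)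
 ultimately obtain A where A: "finite A" "A \<subseteq> Y"
  "\<forall>u\<in>carrier G. \<forall>k\<in>carrier G. (\<forall>a\<in>A. \<psi> u a = a) --> cmod (f (u \<otimes> k) - f k) <= \<epsilon>"
  by meson
 show "\<exists>A. finite A \<and> A \<subseteq> Y \<and> (\<forall>u\<in>K. \<forall>k\<in>K. (\<forall>a\<in>A. \<psi> u a = a) -->
   cmod (f (g \<otimes> (u \<otimes> k)) - f (g \<otimes> k)) <= \<epsilon>)"
 proof (intro exI[of _ "\<psi> (inv g) ` A"] conjI ballI impI)
  show "finite (\<psi> (inv g) ` A)" using A by simp
  show "\<psi> (inv g) ` A \<subseteq> Y" using A g maps by blast
  fix u k assume u: "u \<in> K" and k: "k \<in> K" and fix_u: "\<forall>a\<in>\<psi> (inv g) ` A. \<psi> u a = a"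
  have uk: "u \<in> carrier G" "k \<in> carrier G" using u k K by auto
  let ?u = "g \<otimes> (u \<otimes> inv g)"
  have "\<psi> ?u a = a" if a: "a \<in> A" for a
  proof -
   have aY: "a \<in> Y" using a A(2) by blast
   have "\<psi> ?u a = \<psi> g (\<psi> u (\<psi> (inv g) a))" using g uk(1) aY mult maps by simp
   also have "\<dots> = a" using fix_u a g aY inverse_action(2) by simp
   finally show ?thesis .
  qed
  hence "cmod (f (?u \<otimes> (g \<otimes> k)) - f (g \<otimes> k)) <= \<epsilon>" using A(3) g uk by simp
  moreover have "?u \<otimes> (g \<otimes> k) = g \<otimes> (u \<otimes> k)"
   using g uk by (simp add: m_assoc inv_solve_left' flip: m_assoc[of "inv g" g k])
  ultimately show "cmod (f (g \<otimes> (u \<otimes> k)) - f (g \<otimes> k)) <= \<epsilon>" by simp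
 qed
qed

end

context tree_action
begin

text \<open>An invariant mean on the vertices and means on the vertex stabilizers combine to a mean on the
 group: average over the coset of elements that carry a base point to \<open>v\<close>, then over \<open>v\<close>.\<close>

lemma group_mean:
 assumes mu: "mean V \<mu>" "!!g f. [|g \<in> carrier G; f \<in> bfun V|] ==> \<mu> (\<lambda>v. f (act g v)) = \<mu> f"
  and U: "U \<subseteq> bfun (carrier G)"
  and La: "!!b. b \<in> V ==> \<exists>\<Lambda>. mean {k \<in> carrier G. act k b = b} \<Lambda> \<and>
   (\<forall>f\<in>U. \<forall>g\<in>carrier G. \<forall>h\<in>{k \<in> carrier G. act k b = b}. \<Lambda> (\<lambda>k. f (g \<otimes> (h \<otimes> k))) = \<Lambda> (\<lambda>k. f (g \<otimes> k)))"
 obtains M where "mean (carrier G) M" "!!f g. [|f \<in> U; g \<in> carrier G|] ==> M (\<lambda>x. f (g \<otimes> x)) = M f"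
proof -
 define K where "K b = {k \<in> carrier G. act k b = b}" for b
 obtain \<Lambda> where La: "!!b. b \<in> V ==> mean (K b) (\<Lambda> b)"
  "!!b f g h. [|b \<in> V; f \<in> U; g \<in> carrier G; h \<in> K b|] ==> \<Lambda> b (\<lambda>k. f (g \<otimes> (h \<otimes> k))) = \<Lambda> b (\<lambda>k. f (g \<otimes> k))"
 proof -
  define good where "good b \<Lambda> \<longleftrightarrow> mean (K b) \<Lambda> \<and> (\<forall>f\<in>U. \<forall>g\<in>carrier G. \<forall>h\<in>K b.
    \<Lambda> (\<lambda>k. f (g \<otimes> (h \<otimes> k))) = \<Lambda> (\<lambda>k. f (g \<otimes> k)))" for b \<Lambda>
  have "\<forall>b\<in>V. \<exists>\<Lambda>. good b \<Lambda>" using La unfolding good_def K_def by simp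
  from bchoice[OF this] obtain \<Lambda> where "\<forall>b\<in>V. good b (\<Lambda> b)" by blast
  thus ?thesis using that[of \<Lambda>] unfolding good_def by simp
 qed
 define orb where "orb v = (\<lambda>x. act x v) ` carrier G" for v
 have orb: "orb (act g v) = orb v" if g: "g \<in> carrier G" and v: "v \<in> V" for g v
 proof -
  have "act x (act g v) \<in> orb v" if "x \<in> carrier G" for x using that g v by (auto simp: orb_def simp flip: act_mult)
  moreover have "act x v \<in> orb (act g v)" if x: "x \<in> carrier G" for x
  proof -
   have "act x v = act (x \<otimes> inv g) (act g v)" using x g v act_V by (simp add: act_mult)
   thus ?thesis unfolding orb_def using x g by blast
  qed
  ultimately show ?thesis unfolding orb_def by blast
 qed
 define base where "base v = (SOME b. b \<in> orb v)" for v
 define tr where "tr v = (SOME x. x \<in> carrier G \<and> act x (base v) = v)" for v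
 have base_act: "base (act g v) = base v" if "g \<in> carrier G" "v \<in> V" for g v using orb[OF that] by (simp add: base_def)
 have bt: "base v \<in> V" "tr v \<in> carrier G" "act (tr v) (base v) = v" if v: "v \<in> V" for v
 proof -
  have "base v \<in> orb v" unfolding base_def by (rule someI[of _ "act \<one> v"]) (auto simp: orb_def)
  then obtain y where y: "y \<in> carrier G" "base v = act y v" by (auto simp: orb_def)
  show "base v \<in> V" using y v act_V by simp
  have "\<exists>x. x \<in> carrier G \<and> act x (base v) = v" using y v by (intro exI[of _ "inv y"]) simp
  from someI_ex[OF this] show "tr v \<in> carrier G" "act (tr v) (base v) = v" by (auto simp: tr_def)
 qed
 define Q where "Q f v = \<Lambda> (base v) (\<lambda>k. f (tr v \<otimes> k))" for f v
 have cb: "(\<lambda>k. f (tr v \<otimes> k)) \<in> bfun (K (base v))" if "f \<in> bfun (carrier G)" "v \<in> V" for f v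
  using that bt by (auto simp: K_def intro: bfun_comp[of f "carrier G"])
 have Qb: "Q f \<in> bfun V" if f: "f \<in> bfun (carrier G)" for f
 proof -
  obtain B where B: "!!x. x \<in> carrier G ==> cmod (f x) <= B" using bfun_bound[OF f] by blast
  show ?thesis unfolding Q_def
   by (rule bfunI[of _ _ B], rule mean_bound[OF La(1)]) (use B bt in \<open>auto simp: K_def\<close>)
 qed
 define M where "M f = \<mu> (Q f)" for f
 have "mean (carrier G) M"
  unfolding mean_def
 proof (intro conjI ballI allI impI)
  fix f h assume f: "f \<in> bfun (carrier G)" and h: "h \<in> bfun (carrier G)"
  have "M (\<lambda>x. f x + h x) = \<mu> (\<lambda>v. Q f v + Q h v)" unfolding M_def
   by (rule mean_cong[OF mu(1) Qb[OF bfun_add[OF f h]]])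
    (simp add: Q_def meanD(1)[OF La(1)[OF bt(1)] cb[OF f] cb[OF h]])
  thus "M (\<lambda>x. f x + h x) = M f + M h" using meanD(1)[OF mu(1) Qb[OF f] Qb[OF h]] by (simp add: M_def)
 next
  fix c f assume f: "f \<in> bfun (carrier G)"
  have "M (\<lambda>x. c * f x) = \<mu> (\<lambda>v. c * Q f v)" unfolding M_def
   by (rule mean_cong[OF mu(1) Qb[OF bfun_cmult[OF f]]]) (simp add: Q_def meanD(2)[OF La(1)[OF bt(1)] cb[OF f]])
  thus "M (\<lambda>x. c * f x) = c * M f" using meanD(2)[OF mu(1) Qb[OF f]] by (simp add: M_def)
 next
  have "M (\<lambda>_. 1) = \<mu> (\<lambda>_. 1)" unfolding M_def
   by (rule mean_cong[OF mu(1) Qb[OF bfun_const]]) (simp add: Q_def meanD(3)[OF La(1)[OF bt(1)]])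
  thus "M (\<lambda>_. 1) = 1" using meanD(3)[OF mu(1)] by simp
 next
  fix f assume f: "f \<in> bfun (carrier G)" "\<forall>x\<in>carrier G. f x \<in> \<real>\<^sub>\<ge>\<^sub>0"
  show "M f \<in> \<real>\<^sub>\<ge>\<^sub>0" unfolding M_def
  proof (rule meanD(4)[OF mu(1) Qb[OF f(1)]])
   fix v assume v: "v \<in> V"
   show "Q f v \<in> \<real>\<^sub>\<ge>\<^sub>0" unfolding Q_def
    by (rule meanD(4)[OF La(1)[OF bt(1)[OF v]] cb[OF f(1) v]]) (use f(2) bt(2)[OF v] in \<open>auto simp: K_def\<close>)
  qed
 qed
 moreover have "M (\<lambda>x. f (g \<otimes> x)) = M f" if f: "f \<in> U" and g: "g \<in> carrier G" for f g
 proof -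
  have fb: "f \<in> bfun (carrier G)" using f U by blast
  have gb: "(\<lambda>x. f (g \<otimes> x)) \<in> bfun (carrier G)" using g by (intro bfun_comp[OF fb]) simp
  have "Q (\<lambda>x. f (g \<otimes> x)) v = Q f (act g v)" if v: "v \<in> V" for v
  proof -
   let ?t = "tr v" and ?s = "tr (act g v)" and ?b = "base v"
   have gv: "act g v \<in> V" by (rule act_V[OF g v])
   have b: "base (act g v) = ?b" by (rule base_act[OF g v])
   have c: "?t \<in> carrier G" "?s \<in> carrier G" "?b \<in> V" using bt[OF v] bt[OF gv] by auto
   \<comment> \<open>two elements that carry the base point to \<open>g v\<close> differ by an element of its stabilizer\<close>
   define h where "h = inv ?s \<otimes> (g \<otimes> ?t)"
   have hG: "h \<in> carrier G" using c g by (simp add: h_def)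
   have "act h ?b = act (inv ?s) (act g v)" using c g bt(3)[OF v] act_V by (simp add: h_def act_mult)
   also have "\<dots> = act (inv ?s) (act ?s ?b)" using bt(3)[OF gv] b by simp
   finally have hK: "h \<in> K ?b" using c hG by (simp add: K_def)
   have sh: "?s \<otimes> (h \<otimes> k) = g \<otimes> (?t \<otimes> k)" if "k \<in> carrier G" for k
    using c g that by (simp add: h_def G.m_assoc flip: G.m_assoc[of ?s "inv ?s"])
   have "Q (\<lambda>x. f (g \<otimes> x)) v = \<Lambda> ?b (\<lambda>k. f (?s \<otimes> (h \<otimes> k)))"
    unfolding Q_def by (rule mean_cong[OF La(1)[OF c(3)] cb[OF gb v]]) (simp add: K_def sh)
   also have "\<dots> = Q f (act g v)" using La(2)[OF c(3) f c(2) hK] b by (simp add: Q_def)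
   finally show ?thesis .
  qed
  hence "M (\<lambda>x. f (g \<otimes> x)) = \<mu> (\<lambda>v. Q f (act g v))" unfolding M_def by (intro mean_cong[OF mu(1) Qb[OF gb]])
  thus ?thesis using mu(2)[OF g Qb[OF fb]] by (simp add: M_def)
 qed
 ultimately show ?thesis using that by blast
qed

end

lemma amenableI:
 assumes M: "mean (carrier G) M"
  and inv: "!!g f. [|g \<in> carrier G; f \<in> left_unif_cont_bounded G T|] ==> M (\<lambda>x\<in>carrier G. f (g \<otimes>\<^bsub>G\<^esub> x)) = M f"
 shows "amenable G T"
proof -
 have b: "f \<in> bfun (carrier G)" if "f \<in> left_unif_cont_bounded G T" for f
  using that by (simp add: left_unif_cont_bounded_def bfun_def)
 have r: "M (\<lambda>x\<in>carrier G. f x) = M f" if "f \<in> bfun (carrier G)" for f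
  by (rule mean_cong[OF M that, symmetric]) simp
 show ?thesis unfolding amenable_def
 proof (intro exI[of _ M] conjI ballI allI impI)
  show "M (\<lambda>x\<in>carrier G. f x + h x) = M f + M h"
   if "f \<in> left_unif_cont_bounded G T" "h \<in> left_unif_cont_bounded G T" for f h
   using r[OF bfun_add[OF b[OF that(1)] b[OF that(2)]]] meanD(1)[OF M b[OF that(1)] b[OF that(2)]] by simp
  show "M (\<lambda>x\<in>carrier G. c * f x) = c * M f" if "f \<in> left_unif_cont_bounded G T" for c f
   using r[OF bfun_cmult[OF b[OF that]]] meanD(2)[OF M b[OF that]] by simp
  show "M (\<lambda>x\<in>carrier G. 1) = 1" using r[OF bfun_const] meanD(3)[OF M] by simp
  show "M f \<in> \<real>\<^sub>\<ge>\<^sub>0" if "f \<in> left_unif_cont_bounded G T" "\<forall>x\<in>carrier G. f x \<in> \<real>\<^sub>\<ge>\<^sub>0" for f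
   using meanD(4)[OF M b[OF that(1)]] that(2) by blast
 qed (rule inv)
qed

section \<open>Closed groups of tree automorphisms\<close>

lemma graph_aut_mult:
 assumes "f \<in> carrier (graph_aut V E)" "h \<in> carrier (graph_aut V E)"
 shows "f \<otimes>\<^bsub>graph_aut V E\<^esub> h = compose V f h" "compose V f h \<in> carrier (graph_aut V E)"
proof -
 have B: "f \<in> Bij V" "h \<in> Bij V" using assms by (auto simp: graph_aut_def)
 show "f \<otimes>\<^bsub>graph_aut V E\<^esub> h = compose V f h" using B by (simp add: graph_aut_def BijGroup_def)
 show "compose V f h \<in> carrier (graph_aut V E)"
  using assms compose_Bij[OF B] funcset_mem[OF Bij_imp_funcset[OF B(2)]] by (simp add: graph_aut_def compose_eq)
qed

lemma graph_aut_maps: "[|f \<in> carrier (graph_aut V E); v \<in> V|] ==> f v \<in> V"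
 using Bij_imp_funcset[of f V] by (auto simp: graph_aut_def)

lemma graph_aut_action:
 assumes G: "group G" and hom: "\<phi> \<in> hom G (graph_aut V E)" shows "set_action G V \<phi>"
proof -
 interpret group G by (rule G)
 have aut: "\<phi> g \<in> carrier (graph_aut V E)" if "g \<in> carrier G" for g using hom that by (auto simp: hom_def)
 have mult: "\<phi> (g \<otimes>\<^bsub>G\<^esub> h) v = \<phi> g (\<phi> h v)" if "g \<in> carrier G" "h \<in> carrier G" "v \<in> V" for g h v
  using hom_mult[OF hom that(1,2)] graph_aut_mult(1)[OF aut[OF that(1)] aut[OF that(2)]] that(3) by (simp add: compose_def)
 show ?thesis
 proof
  show "\<phi> g y \<in> V" if "g \<in> carrier G" "y \<in> V" for g y by (rule graph_aut_maps[OF aut[OF that(1)] that(2)])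
  fix y assume y: "y \<in> V"
  have "inj_on (\<phi> \<one>\<^bsub>G\<^esub>) V" using aut[OF one_closed] by (simp add: graph_aut_def Bij_def bij_betw_def)
  moreover have "\<phi> \<one>\<^bsub>G\<^esub> (\<phi> \<one>\<^bsub>G\<^esub> y) = \<phi> \<one>\<^bsub>G\<^esub> y" using mult[of "\<one>\<^bsub>G\<^esub>" "\<one>\<^bsub>G\<^esub>" y] y by simp
  ultimately show "\<phi> \<one>\<^bsub>G\<^esub> y = y" using y graph_aut_maps[OF aut[OF one_closed]] by (meson inj_onD)
 qed (use mult in auto)
qed

lemma aut_topspace: "topspace (graph_aut_topology V E) = carrier (graph_aut V E)"
 using graph_aut_maps Bij_imp_extensional by (fastforce simp: graph_aut_topology_def graph_aut_def PiE_iff)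

lemma aut_open_agree:
 assumes T: "openin (graph_aut_topology V E) T" and h: "h \<in> T"
 shows "\<exists>A. finite A \<and> A \<subseteq> V \<and> (\<forall>f\<in>carrier (graph_aut V E). (\<forall>a\<in>A. f a = h a) --> f \<in> T)"
proof -
 obtain T' where T': "openin (product_topology (\<lambda>_. discrete_topology V) V) T'" "T = T' \<inter> carrier (graph_aut V E)"
  using T by (auto simp: graph_aut_topology_def openin_subtopology)
 have "h \<in> T'" using h T' by simp
 then obtain U where U: "finite {i \<in> V. U i ~= topspace (discrete_topology V)}" "h \<in> Pi\<^sub>E V U" "Pi\<^sub>E V U \<subseteq> T'"
  using T'(1)[unfolded openin_product_topology_alt] by blast
 show ?thesis
 proof (intro exI[of _ "{i \<in> V. U i ~= V}"] conjI ballI impI)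
  fix f assume f: "f \<in> carrier (graph_aut V E)" "\<forall>a\<in>{i \<in> V. U i ~= V}. f a = h a"
  have "f i \<in> U i" if "i \<in> V" for i using f graph_aut_maps[OF f(1) that] U(2) that by (cases "U i = V") auto
  moreover have "f \<in> extensional V" using f(1) by (simp add: graph_aut_def Bij_def)
  ultimately have "f \<in> Pi\<^sub>E V U" by (simp add: PiE_iff)
  thus "f \<in> T" using U(3) T'(2) f(1) by blast
 qed (use U(1) in auto)
qed

lemma aut_agree_open:
 assumes A: "finite A" "A \<subseteq> V" and h: "!!a. a \<in> A ==> h a \<in> V"
 shows "openin (graph_aut_topology V E) {f \<in> carrier (graph_aut V E). \<forall>a\<in>A. f a = h a}"
proof -
 let ?S = "\<lambda>i. if i \<in> A then {h i} else V"
 have "finite {i \<in> V. ?S i ~= topspace (discrete_topology V)}" by (rule finite_subset[OF _ A(1)]) auto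
 hence "openin (product_topology (\<lambda>_. discrete_topology V) V) (Pi\<^sub>E V ?S)"
  unfolding openin_PiE_gen using h by auto
 moreover have "f \<in> Pi\<^sub>E V ?S \<longleftrightarrow> (\<forall>a\<in>A. f a = h a)" if "f \<in> carrier (graph_aut V E)" for f
 proof -
  have "f \<in> extensional V" using that by (simp add: graph_aut_def Bij_def)
  thus ?thesis using A(2) graph_aut_maps[OF that] by (auto simp: PiE_iff)
 qed
 hence "{f \<in> carrier (graph_aut V E). \<forall>a\<in>A. f a = h a} = Pi\<^sub>E V ?S \<inter> carrier (graph_aut V E)" by blast
 ultimately show ?thesis unfolding graph_aut_topology_def openin_subtopology by blast
qed

lemma aut_closure_iff:
 assumes Q: "Q \<subseteq> carrier (graph_aut V E)"
 shows "h \<in> graph_aut_topology V E closure_of Q \<longleftrightarrow> h \<in> carrier (graph_aut V E) \<and>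
  (\<forall>A. finite A \<and> A \<subseteq> V --> (\<exists>f\<in>Q. \<forall>a\<in>A. f a = h a))" (is "_ \<longleftrightarrow> _ \<and> ?R")
proof -
 have "(\<exists>y. y \<in> Q \<and> y \<in> T)" if R: "?R" and T: "h \<in> T" "openin (graph_aut_topology V E) T" for T
 proof -
  obtain A where A: "finite A" "A \<subseteq> V" "\<forall>f\<in>carrier (graph_aut V E). (\<forall>a\<in>A. f a = h a) --> f \<in> T"
   using aut_open_agree[OF T(2,1)] by metis
  obtain f where f: "f \<in> Q" "\<forall>a\<in>A. f a = h a" using R A(1,2) by metis
  thus ?thesis using A(3) Q by (intro exI[of _ f]) (simp add: subset_iff)
 qed
 moreover have "\<exists>f\<in>Q. \<forall>a\<in>A. f a = h a"
  if h: "h \<in> carrier (graph_aut V E)" and A: "finite A" "A \<subseteq> V"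
   and R: "!!T. h \<in> T ==> openin (graph_aut_topology V E) T ==> \<exists>y. y \<in> Q \<and> y \<in> T" for A
 proof -
  let ?T = "{f \<in> carrier (graph_aut V E). \<forall>a\<in>A. f a = h a}"
  have "openin (graph_aut_topology V E) ?T" using A graph_aut_maps[OF h] by (intro aut_agree_open) auto
  moreover have "h \<in> ?T" using h by simp
  ultimately have "\<exists>y. y \<in> Q \<and> y \<in> ?T" by (rule R[rotated])
  thus ?thesis by auto
 qed
 ultimately show ?thesis unfolding in_closure_of aut_topspace by (intro iffI conjI allI impI) (elim conjE, simp)+
qed

text \<open>A uniformly continuous function on the closure is determined by its restriction to \<open>G\<close>, and
 translation by an element of the closure is uniformly close to translation by an element of \<open>G\<close>.\<close>

lemma amenable_closure:
 fixes \<phi> :: "'g => 'v => 'v"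
 assumes G: "group G" and hom: "\<phi> \<in> hom G (graph_aut V E)" and M: "mean (carrier G) M"
  and inv: "!!f g. [|f \<in> uniform G V \<phi> (carrier G); g \<in> carrier G|] ==> M (\<lambda>x. f (g \<otimes>\<^bsub>G\<^esub> x)) = M f"
 defines "C \<equiv> graph_aut_topology V E closure_of (\<phi> ` carrier G)"
 shows "amenable (graph_aut V E\<lparr>carrier := C\<rparr>) (subtopology (graph_aut_topology V E) C)" (is "amenable ?C ?T")
proof -
 interpret group G by (rule G)
 interpret A: set_action G V \<phi> by (rule graph_aut_action[OF G hom])
 let ?Aut = "carrier (graph_aut V E)"
 have aut: "\<phi> g \<in> ?Aut" if "g \<in> carrier G" for g using hom that by (auto simp: hom_def)
 have Q: "\<phi> ` carrier G \<subseteq> ?Aut" using aut by blast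
 have C: "h \<in> C \<longleftrightarrow> h \<in> ?Aut \<and> (\<forall>A. finite A \<and> A \<subseteq> V --> (\<exists>g\<in>carrier G. \<forall>a\<in>A. \<phi> g a = h a))" for h
  unfolding C_def aut_closure_iff[OF Q] by simp
 have CD: "\<exists>g\<in>carrier G. \<forall>a\<in>A. \<phi> g a = h a" if "h \<in> C" "finite A" "A \<subseteq> V" for h A using that C[of h] by simp
 have CA: "h \<in> ?Aut" if "h \<in> C" for h using that C[of h] by simp
 have phiC: "\<phi> g \<in> C" if "g \<in> carrier G" for g using C[of "\<phi> g"] aut[OF that] that by blast
 have CG: "compose V h (\<phi> g) \<in> C" if h: "h \<in> C" and g: "g \<in> carrier G" for h g
 proof -
  have "\<exists>k\<in>carrier G. \<forall>a\<in>A. \<phi> k a = compose V h (\<phi> g) a" if A: "finite A \<and> A \<subseteq> V" for A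
  proof -
   have "finite (\<phi> g ` A)" "\<phi> g ` A \<subseteq> V" using A A.maps[OF g] by auto
   from CD[OF h this] obtain k where k: "k \<in> carrier G" "\<forall>a\<in>\<phi> g ` A. \<phi> k a = h a" by blast
   thus ?thesis using A A.mult[OF k(1) g] g by (intro bexI[of _ "k \<otimes>\<^bsub>G\<^esub> g"]) (auto simp: compose_def)
  qed
  thus ?thesis using graph_aut_mult(2)[OF CA[OF h] aut[OF g]] C by simp
 qed
 have Cm: "h \<otimes>\<^bsub>?C\<^esub> k = compose V h k" if "h \<in> C" "k \<in> C" for h k
  using graph_aut_mult(1)[OF CA CA] that by simp
 have phi_mult: "\<phi> (g \<otimes>\<^bsub>G\<^esub> h) = compose V (\<phi> g) (\<phi> h)" if "g \<in> carrier G" "h \<in> carrier G" for g h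
  using hom_mult[OF hom that] graph_aut_mult(1)[OF aut aut] that by simp
 have one: "\<one>\<^bsub>?C\<^esub> = (\<lambda>v\<in>V. v)" by (simp add: graph_aut_def BijGroup_def)
 define L where "L = left_unif_cont_bounded ?C ?T"
 have Lb: "(\<lambda>x. F (\<phi> x)) \<in> bfun (carrier G)" if "F \<in> bfun C" for F using bfun_comp[OF that phiC] .
 have LC: "F \<in> bfun C" if "F \<in> L" for F using that by (simp add: L_def left_unif_cont_bounded_def bfun_def)
 have Lu: "\<exists>A. finite A \<and> A \<subseteq> V \<and> (\<forall>u\<in>C. \<forall>x\<in>C. (\<forall>a\<in>A. u a = a) --> cmod (F (compose V u x) - F x) <= \<epsilon>)"
  if F: "F \<in> L" and e: "\<epsilon> > 0" for F \<epsilon>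
 proof -
  have "\<exists>U. openin ?T U \<and> \<one>\<^bsub>?C\<^esub> \<in> U \<and> (\<forall>u\<in>U. \<forall>x\<in>carrier ?C. cmod (F (u \<otimes>\<^bsub>?C\<^esub> x) - F x) < \<epsilon>)"
   using F e unfolding L_def left_unif_cont_bounded_def by blast
  then obtain U where U: "openin ?T U" "(\<lambda>v\<in>V. v) \<in> U" "!!u x. u \<in> U ==> x \<in> C ==> cmod (F (u \<otimes>\<^bsub>?C\<^esub> x) - F x) < \<epsilon>"
   unfolding one by auto
  obtain T where T: "openin (graph_aut_topology V E) T" "U = T \<inter> C" using U(1) by (auto simp: openin_subtopology)
  obtain A where A: "finite A" "A \<subseteq> V" "\<forall>f\<in>?Aut. (\<forall>a\<in>A. f a = (\<lambda>v\<in>V. v) a) --> f \<in> T"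
   using aut_open_agree[OF T(1) IntD1[OF U(2)[unfolded T(2)]]] by metis
  have "cmod (F (compose V u x) - F x) <= \<epsilon>" if "u \<in> C" "x \<in> C" "\<forall>a\<in>A. u a = a" for u x
  proof -
   have "u a = (\<lambda>v\<in>V. v) a" if "a \<in> A" for a using that A(2) \<open>\<forall>a\<in>A. u a = a\<close> by auto
   hence "u \<in> U" using A(3) CA[OF that(1)] that T(2) by blast
   thus ?thesis using U(3)[of u x] Cm[of u x] that by simp
  qed
  thus ?thesis using A(1,2) by blast
 qed
 have Fu: "(\<lambda>x. F (\<phi> x)) \<in> uniform G V \<phi> (carrier G)" if F: "F \<in> L" for F
  unfolding uniform_def mem_Collect_eq
 proof (intro conjI allI impI)
  show "(\<lambda>x. F (\<phi> x)) \<in> bfun (carrier G)" by (rule Lb[OF LC[OF F]])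
  fix \<epsilon> :: real assume e: "\<epsilon> > 0"
  show "\<exists>A. finite A \<and> A \<subseteq> V \<and> (\<forall>u\<in>carrier G. \<forall>k\<in>carrier G. (\<forall>a\<in>A. \<phi> u a = a) --> cmod (F (\<phi> (u \<otimes>\<^bsub>G\<^esub> k)) - F (\<phi> k)) <= \<epsilon>)"
   using Lu[OF F e] phiC phi_mult by metis
 qed
 have "mean C (\<lambda>F. M (\<lambda>x. F (\<phi> x)))"
  using meanD[OF M] Lb phiC unfolding mean_def by simp
 moreover have "M (\<lambda>x. (\<lambda>y\<in>C. F (g \<otimes>\<^bsub>?C\<^esub> y)) (\<phi> x)) = M (\<lambda>x. F (\<phi> x))" if g: "g \<in> C" and F: "F \<in> L" for g F
 proof -
  let ?h = "\<lambda>x. F (compose V g (\<phi> x))"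
  have gA: "g \<in> ?Aut" by (rule CA[OF g])
  have hb: "?h \<in> bfun (carrier G)" by (rule bfun_comp[OF LC[OF F]]) (rule CG[OF g])
  have "cmod (M ?h - M (\<lambda>x. F (\<phi> x))) <= \<epsilon>" if e: "\<epsilon> > 0" for \<epsilon>
  proof -
   obtain A where A: "finite A" "A \<subseteq> V"
    "!!u x. [|u \<in> C; x \<in> C; \<forall>a\<in>A. u a = a|] ==> cmod (F (compose V u x) - F x) <= \<epsilon>" using Lu[OF F e] by metis
   have sg: "g ` V = V" using gA by (simp add: graph_aut_def Bij_def bij_betw_def)
   have iA: "inv_into V g a \<in> V" "g (inv_into V g a) = a" if "a \<in> A" for a
    using that A(2) sg inv_into_into[of a g V] f_inv_into_f[of a g V] by auto
   hence "finite (inv_into V g ` A)" "inv_into V g ` A \<subseteq> V" using A(1) by auto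
   from CD[OF g this] obtain s where s: "s \<in> carrier G" "\<forall>a\<in>inv_into V g ` A. \<phi> s a = g a" by blast
   define u where "u = compose V g (\<phi> (inv\<^bsub>G\<^esub> s))"
   have uC: "u \<in> C" unfolding u_def using CG[OF g] s(1) by simp
   have uA: "u a = a" if a: "a \<in> A" for a
   proof -
    have "\<phi> s (inv_into V g a) = a" using s(2) iA[OF a] a by simp
    hence "\<phi> (inv\<^bsub>G\<^esub> s) a = inv_into V g a" using A.inverse_action(1)[OF s(1) iA(1)[OF a]] by simp
    thus ?thesis using iA[OF a] a A(2) by (auto simp: u_def compose_def)
   qed
   have us: "compose V u (\<phi> (s \<otimes>\<^bsub>G\<^esub> x)) = compose V g (\<phi> x)" if x: "x \<in> carrier G" for x
    using s(1) x A.maps[OF x] A.inverse_action(1)[OF s(1)] A.maps[OF s(1)]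
    by (auto simp: u_def phi_mult compose_def fun_eq_iff)
   have sb: "(\<lambda>x. F (\<phi> (s \<otimes>\<^bsub>G\<^esub> x))) \<in> bfun (carrier G)" using s(1) by (intro bfun_comp[OF LC[OF F]] phiC) simp
   have "cmod (M ?h - M (\<lambda>x. F (\<phi> (s \<otimes>\<^bsub>G\<^esub> x)))) <= \<epsilon>"
   proof (rule mean_close[OF M hb sb])
    fix x assume x: "x \<in> carrier G"
    show "cmod (F (compose V g (\<phi> x)) - F (\<phi> (s \<otimes>\<^bsub>G\<^esub> x))) <= \<epsilon>"
     using A(3)[OF uC phiC[of "s \<otimes>\<^bsub>G\<^esub> x"]] uA us[OF x] s(1) x by simp
   qed
   thus ?thesis using inv[OF Fu[OF F] s(1)] by simp
  qed
  hence "M ?h = M (\<lambda>x. F (\<phi> x))" using field_le_epsilon[of "cmod (M ?h - M (\<lambda>x. F (\<phi> x)))" 0] by simp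
  moreover have "M ?h = M (\<lambda>x. (\<lambda>y\<in>C. F (g \<otimes>\<^bsub>?C\<^esub> y)) (\<phi> x))"
   by (rule mean_cong[OF M hb]) (simp add: phiC graph_aut_mult(1)[OF CA[OF g] aut])
  ultimately show ?thesis by simp
 qed
 ultimately show ?thesis unfolding L_def by (intro amenableI[where M = "\<lambda>F. M (\<lambda>x. F (\<phi> x))"]) auto
qed

section \<open>Reduction to a countable invariant subtree\<close>

text \<open>The translates of finite paths from a base vertex to the points of its orbit form a countable
 invariant subtree; it is transported to the natural numbers.\<close>

lemma countable_subtree_action:
 fixes G :: "('g, 'm) monoid_scheme" and V :: "'v set"
 assumes G: "group G" and cG: "countable (carrier G)" and tree: "tree_graph V E" and hom: "\<phi> \<in> hom G (graph_aut V E)"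
 obtains W :: "nat set" and F r act d where "tree_action W F r G act" "inj_on d W" "d ` W \<subseteq> V"
  "!!g n. [|g \<in> carrier G; n \<in> W|] ==> d (act g n) = \<phi> g (d n)"
proof -
 interpret group G by (rule G)
 interpret A: set_action G V \<phi> by (rule graph_aut_action[OF G hom])
 have aut: "\<phi> g \<in> carrier (graph_aut V E)" if "g \<in> carrier G" for g using hom that by (auto simp: hom_def)
 have aE: "(\<phi> g x, \<phi> g y) \<in> E" if "g \<in> carrier G" "(x, y) \<in> E" for g x y
  using aut[OF that(1)] that(2) tree by (auto simp: graph_aut_def tree_graph_def simple_graph_def)
 have EV: "x \<in> V \<and> y \<in> V" if "(x, y) \<in> E" for x y using that tree by (auto simp: tree_graph_def simple_graph_def)
 obtain b where b: "b \<in> V" using tree by (auto simp: tree_graph_def graph_connected_def)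
 define path where "path xs \<longleftrightarrow> xs ~= [] \<and> hd xs = b \<and> successively (\<lambda>x y. (x, y) \<in> E) xs" for xs
 have "\<exists>xs. path xs \<and> last xs = \<phi> g b" if g: "g \<in> carrier G" for g
 proof -
  have "(b, \<phi> g b) \<in> E\<^sup>*" using tree b A.maps[OF g b] by (auto simp: tree_graph_def graph_connected_def)
  from rtrancl_distinct_path[OF this] show ?thesis unfolding path_def by blast
 qed
 then obtain xs where xs: "!!g. g \<in> carrier G ==> path (xs g) \<and> last (xs g) = \<phi> g b" by metis
 define T where "T = (\<Union>h\<in>carrier G. \<Union>g\<in>carrier G. \<phi> h ` set (xs g))"
 have xV: "x \<in> V" if "path ys" "x \<in> set ys" for ys x
 proof -
  have "hd zs \<in> V ==> successively (\<lambda>x y. (x, y) \<in> E) zs ==> set zs \<subseteq> V" for zs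
   by (induction zs rule: induct_list012) (auto dest: EV)
  thus ?thesis using that b unfolding path_def by blast
 qed
 have TV: "T \<subseteq> V" unfolding T_def using xs xV A.maps by blast
 have cT: "countable T" unfolding T_def by (intro countable_UN cG countable_image countable_finite finite_set)
 have actT: "\<phi> g x \<in> T" if g: "g \<in> carrier G" and x: "x \<in> T" for g x
 proof -
  obtain h k y where h: "h \<in> carrier G" "k \<in> carrier G" "y \<in> set (xs k)" "x = \<phi> h y" using x unfolding T_def by blast
  have "y \<in> V" using xs[OF h(2)] xV h(3) by blast
  hence "\<phi> g x = \<phi> (g \<otimes>\<^bsub>G\<^esub> h) y" using A.mult[OF g h(1)] h(4) by simp
  thus ?thesis unfolding T_def using h g by blast
 qed
 have pT: "\<phi> h y \<in> T" if "h \<in> carrier G" "g \<in> carrier G" "y \<in> set (xs g)" for h g y unfolding T_def using that by blast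
 have bT: "\<phi> h b \<in> T" if h: "h \<in> carrier G" for h
  using pT[OF h h, of b] xs[OF h] hd_in_set[of "xs h"] by (auto simp: path_def)
 define e where "e = to_nat_on T"
 define d where "d = from_nat_into T"
 have ed: "e x \<in> e ` T" "d (e x) = x" if "x \<in> T" for x using that cT by (auto simp: e_def d_def)
 define W where "W = e ` T"
 define F where "F = {(m, n). m \<in> W \<and> n \<in> W \<and> (d m, d n) \<in> E}"
 define act where "act g n = e (\<phi> g (d n))" for g n
 have dW: "d n \<in> T" "e (d n) = n" if "n \<in> W" for n using that ed by (auto simp: W_def)
 have dinj: "inj_on d W" by (rule inj_on_inverseI[of _ e]) (rule dW(2))
 have eF: "(e x, e y) \<in> F" if "x \<in> T" "y \<in> T" "(x, y) \<in> E" for x y using that ed by (simp add: F_def W_def)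
 have symF: "sym F" using tree by (auto simp: F_def sym_def tree_graph_def simple_graph_def)
 have along: "(e (hd ys), e y) \<in> F\<^sup>*"
  if "successively (\<lambda>x y. (x, y) \<in> E) ys" "set ys \<subseteq> T" "y \<in> set ys" for ys y
  using that
 proof (induction ys rule: induct_list012)
  case (3 x z ys)
  have "(e x, e z) \<in> F" using 3 by (intro eF) auto
  thus ?case using 3 by (auto intro: converse_rtrancl_into_rtrancl)
 qed auto
 have conn: "(e (\<phi> h b), e (\<phi> h y)) \<in> F\<^sup>*" if h: "h \<in> carrier G" and g: "g \<in> carrier G" and y: "y \<in> set (xs g)" for h g y
 proof -
  have "successively (\<lambda>x y. (x, y) \<in> E) (map (\<phi> h) (xs g))"
   unfolding successively_map using xs[OF g] aE[OF h] by (auto simp: path_def intro: successively_mono)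
  from along[OF this, of "\<phi> h y"] show ?thesis using pT[OF h g] y xs[OF g] by (auto simp: path_def hd_map)
 qed
 have toroot: "(e b, n) \<in> F\<^sup>*" if n: "n \<in> W" for n
 proof -
  obtain h g y where h: "h \<in> carrier G" "g \<in> carrier G" "y \<in> set (xs g)" "n = e (\<phi> h y)"
   using n unfolding W_def T_def by blast
  have "\<phi> h b \<in> set (xs h)" using xs[OF h(1)] last_in_set[of "xs h"] by (auto simp: path_def)
  hence "(e b, e (\<phi> h b)) \<in> F\<^sup>*" using conn[OF one_closed h(1), of "\<phi> h b"] A.one b A.maps[OF h(1) b] by simp
  thus ?thesis using conn[OF h(1-3)] h(4) by simp
 qed
 have conF: "(m, n) \<in> F\<^sup>*" if "m \<in> W" "n \<in> W" for m n
  using toroot[OF that(1)] toroot[OF that(2)] sym_rtrancl[OF symF] by (meson rtrancl_trans symD)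
 have rW: "e b \<in> W" using bT[OF one_closed] A.one b by (simp add: W_def)
 have "\<not> graph_cycle F vs" for vs
 proof
  assume c: "graph_cycle F vs"
  have "vs ~= []" using c by (auto simp: graph_cycle_def)
  have sW: "set vs \<subseteq> W"
  proof -
   have "last zs \<in> W ==> successively (\<lambda>x y. (x, y) \<in> F) zs ==> set zs \<subseteq> W" for zs
    by (induction zs rule: induct_list012) (auto simp: F_def)
   thus ?thesis using c unfolding graph_cycle_def by (auto simp: F_def)
  qed
  have "graph_cycle E (map d vs)"
   using c \<open>vs ~= []\<close> inj_on_subset[OF dinj sW] unfolding graph_cycle_def
   by (auto simp: distinct_map successively_map last_map hd_map F_def intro: successively_mono)
  thus False using tree by (auto simp: tree_graph_def)
 qed
 hence "tree_graph W F"
  using conF rW symF tree by (auto simp: tree_graph_def simple_graph_def graph_connected_def F_def irrefl_def)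
 hence "tree_action W F (e b) G act"
 proof (intro tree_action.intro rooted_tree.intro tree_action_axioms.intro)
  show "act g x \<in> W" if "g \<in> carrier G" "x \<in> W" for g x using actT dW that by (simp add: act_def W_def)
  show "act \<one>\<^bsub>G\<^esub> x = x" if "x \<in> W" for x using dW[OF that] A.one TV by (auto simp: act_def)
  show "act (g \<otimes>\<^bsub>G\<^esub> h) x = act g (act h x)" if "g \<in> carrier G" "h \<in> carrier G" "x \<in> W" for g h x
   using A.mult[OF that(1,2)] dW(1)[OF that(3)] ed(2)[OF actT[OF that(2)]] TV by (auto simp: act_def)
  show "(act g x, act g y) \<in> F" if "g \<in> carrier G" "(x, y) \<in> F" for g x y
   using that actT dW aE unfolding act_def by (intro eF) (auto simp: F_def)
  show "countable W" unfolding W_def using cT by simp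
 qed (use rW G in auto)
 thus ?thesis
 proof (rule that[OF _ dinj])
  show "d ` W \<subseteq> V" using dW TV by blast
  show "d (act g n) = \<phi> g (d n)" if "g \<in> carrier G" "n \<in> W" for g n
   using ed(2)[OF actT] dW that by (simp add: act_def)
 qed
qed

lemma finite_sphere:
 assumes "locally_finite_graph V E" "E \<subseteq> V \<times> V" "v \<in> V" shows "finite {w. (v, w) \<in> E ^^ n}"
proof (induction n)
 case (Suc n)
 have "{w. (v, w) \<in> E ^^ Suc n} = (\<Union>u\<in>{u. (v, u) \<in> E ^^ n}. {w. (u, w) \<in> E})" by auto
 moreover have "finite {w. (u, w) \<in> E}" for u
  using assms(1,2) by (cases "u \<in> V") (auto simp: locally_finite_graph_def intro: finite_subset[of _ "{}"])
 ultimately show ?case using Suc by simp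
qed simp

context tree_action
begin

text \<open>An invariant mean on the vertices is integrated over the stabilizers: if they are finite, by
 averaging over their elements.\<close>

lemma amenable_of_finite_stabilizers:
 assumes mu: "mean V \<mu>" "!!g f. [|g \<in> carrier G; f \<in> bfun V|] ==> \<mu> (\<lambda>v. f (act g v)) = \<mu> f"
  and fin: "!!b. b \<in> V ==> finite {k \<in> carrier G. act k b = b}"
 shows "amenable G (discrete_topology (carrier G))"
proof -
 have La: "\<exists>\<Lambda>. mean {k \<in> carrier G. act k b = b} \<Lambda> \<and> (\<forall>f\<in>bfun (carrier G). \<forall>g\<in>carrier G. \<forall>h\<in>{k \<in> carrier G. act k b = b}.
    \<Lambda> (\<lambda>k. f (g \<otimes> (h \<otimes> k))) = \<Lambda> (\<lambda>k. f (g \<otimes> k)))" if b: "b \<in> V" for b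
 proof -
  let ?K = "{k \<in> carrier G. act k b = b}"
  have K: "finite ?K" "?K ~= {}" using fin[OF b] act_one[OF b] by auto
  have bij: "bij_betw (\<lambda>k. h \<otimes> k) ?K ?K" if h: "h \<in> ?K" for h
   by (rule bij_betw_byWitness[where f' = "\<lambda>k. inv h \<otimes> k"])
    (use h b act_mult act_inv(1)[of h b] in \<open>auto simp: G.m_assoc[symmetric]\<close>)
  have "(\<Sum>k\<in>?K. f (g \<otimes> (h \<otimes> k))) = (\<Sum>k\<in>?K. f (g \<otimes> k))" if "h \<in> ?K" for f :: "'g => complex" and g h
   by (rule sum.reindex_bij_betw[OF bij[OF that]])
  thus ?thesis
   using mean_average[OF K, of "\<lambda>k. k" ?K] by (intro exI[of _ "\<lambda>h. (\<Sum>k\<in>?K. h k) / of_nat (card ?K)"]) simp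
 qed
 obtain M where M: "mean (carrier G) M" "!!f g. [|f \<in> bfun (carrier G); g \<in> carrier G|] ==> M (\<lambda>x. f (g \<otimes> x)) = M f"
  using group_mean[OF mu order_refl La] by blast
 show ?thesis
 proof (rule amenableI[OF M(1)])
  fix g f assume g: "g \<in> carrier G" and "f \<in> left_unif_cont_bounded G (discrete_topology (carrier G))"
  hence f: "f \<in> bfun (carrier G)" by (simp add: left_unif_cont_bounded_def bfun_def)
  have fg: "(\<lambda>x. f (g \<otimes> x)) \<in> bfun (carrier G)" using g by (intro bfun_comp[OF f]) simp
  have "M (\<lambda>x\<in>carrier G. f (g \<otimes> x)) = M (\<lambda>x. f (g \<otimes> x))" by (rule mean_cong[OF M(1) fg, symmetric]) simp
  thus "M (\<lambda>x\<in>carrier G. f (g \<otimes> x)) = M f" using M(2)[OF f g] by simp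
 qed
qed

text \<open>Here \<open>G\<close> acts by \<open>\<phi>\<close> on the original tree and by \<open>act\<close> on the coded subtree. The stabilizers may
 be infinite, but have finite orbits in the original tree.\<close>

lemma amenable_of_locally_finite:
 assumes mu: "mean V \<mu>" "!!g f. [|g \<in> carrier G; f \<in> bfun V|] ==> \<mu> (\<lambda>v. f (act g v)) = \<mu> f"
  and hom: "\<phi> \<in> hom G (graph_aut Y D)" and fin: "!!b y. [|b \<in> V; y \<in> Y|] ==> finite ((\<lambda>k. \<phi> k y) ` {k \<in> carrier G. act k b = b})"
 defines "C \<equiv> graph_aut_topology Y D closure_of (\<phi> ` carrier G)"
 shows "amenable (graph_aut Y D\<lparr>carrier := C\<rparr>) (subtopology (graph_aut_topology Y D) C)"
proof -
 interpret A: set_action G Y \<phi> by (rule graph_aut_action[OF G.group_axioms hom])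
 have sub: "uniform G Y \<phi> (carrier G) \<subseteq> bfun (carrier G)" by (auto simp: uniform_def)
 have La: "\<exists>\<Lambda>. mean {k \<in> carrier G. act k b = b} \<Lambda> \<and> (\<forall>f\<in>uniform G Y \<phi> (carrier G). \<forall>g\<in>carrier G. \<forall>h\<in>{k \<in> carrier G. act k b = b}.
    \<Lambda> (\<lambda>k. f (g \<otimes> (h \<otimes> k))) = \<Lambda> (\<lambda>k. f (g \<otimes> k)))" if b: "b \<in> V" for b
 proof -
  let ?K = "{k \<in> carrier G. act k b = b}"
  have "act (inv k) b = b" if "k \<in> ?K" for k using act_inv(1)[of k b] that b by (metis (mono_tags, lifting) mem_Collect_eq)
  hence K: "subgroup ?K G" using b act_one act_mult by (intro G.subgroupI) auto
  obtain \<Lambda> where "mean ?K \<Lambda>" and La: "!!h k. [|h \<in> uniform G Y \<phi> ?K; k \<in> ?K|] ==> \<Lambda> (\<lambda>x. h (k \<otimes> x)) = \<Lambda> h"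
   using A.finite_orbits_mean[OF K fin[OF b]] by blast
  moreover have "\<Lambda> (\<lambda>k. f (g \<otimes> (h \<otimes> k))) = \<Lambda> (\<lambda>k. f (g \<otimes> k))"
   if "f \<in> uniform G Y \<phi> (carrier G)" "g \<in> carrier G" "h \<in> ?K" for f g h
   by (rule La[OF A.uniform_translate[OF that(1,2)] that(3)]) auto
  ultimately show ?thesis by blast
 qed
 obtain M where M: "mean (carrier G) M"
  "!!f g. [|f \<in> uniform G Y \<phi> (carrier G); g \<in> carrier G|] ==> M (\<lambda>x. f (g \<otimes> x)) = M f"
  using group_mean[OF mu sub La] by blast
 show ?thesis unfolding C_def by (rule amenable_closure[OF G.group_axioms hom M])
qed

end

theorem theorem1:
  fixes G :: "('g, 'm) monoid_scheme"
    and V :: "'v set" and E :: "('v \<times> 'v) set"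
    and \<phi> :: "'g \<Rightarrow> 'v \<Rightarrow> 'v"
  assumes "group G" and "countable (carrier G)"
    and "tree_graph V E"
    and "\<phi> \<in> hom G (graph_aut V E)"
    and "(\<not> amenable G (discrete_topology (carrier G)) \<and> (\<forall>v\<in>V. finite (stabilizer G \<phi> v)))
       \<or> (locally_finite_graph V E \<and>
          (let C = graph_aut_topology V E closure_of (\<phi> ` carrier G)
           in \<not> amenable (graph_aut V E\<lparr>carrier := C\<rparr>) (subtopology (graph_aut_topology V E) C)))"
  shows "\<exists>(I :: real set) (H :: real \<Rightarrow> hilbert_univ) (\<pi> :: real \<Rightarrow> 'g \<Rightarrow> (nat \<Rightarrow> complex) \<Rightarrow> (nat \<Rightarrow> complex)).
           uncountable I \<and>
           (\<forall>t\<in>I. irreducible_rep G (H t) (\<pi> t) \<and> \<not> finite_dimensional (H t) \<and>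
                  traceable_rep G (H t) (\<pi> t)) \<and>
           (\<forall>t\<in>I. \<forall>t'\<in>I. t' \<noteq> t \<longrightarrow> \<not> weakly_equivalent G (H t) (\<pi> t) (H t') (\<pi> t'))"
proof -
 obtain W :: "nat set" and F r act d where W: "tree_action W F r G act" "inj_on d W" "d ` W \<subseteq> V"
  "!!g n. [|g \<in> carrier G; n \<in> W|] ==> d (act g n) = \<phi> g (d n)"
  using countable_subtree_action[OF assms(1-4)] by metis
 interpret T: tree_action W F r G act by (rule W(1))
 have K: "act k b = b \<longleftrightarrow> \<phi> k (d b) = d b" if "k \<in> carrier G" "b \<in> W" for k b
  using W(2,4) that T.act_V by (metis inj_onD)
 have "\<exists>S. gapped_tree_action W F r G act S"
 proof (rule ccontr)
  assume no: "\<nexists>S. gapped_tree_action W F r G act S"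
  have ai: "\<exists>f\<in>square_summable W. \<forall>s\<in>S. hnorm (ell2 W) (T.perm_op s f \<ominus>\<^bsub>ell2 W\<^esub> f) < \<epsilon> * hnorm (ell2 W) f"
   if S: "finite S" "S \<subseteq> carrier G" "S ~= {}" "!!s. s \<in> S ==> inv\<^bsub>G\<^esub> s \<in> S" "\<epsilon> > 0" for S and \<epsilon> :: real
  proof -
   have "\<not> (\<exists>\<epsilon>>0. \<forall>f\<in>square_summable W. \<exists>s\<in>S.
     \<epsilon> * hnorm (ell2 W) f <= hnorm (ell2 W) (T.perm_op s f \<ominus>\<^bsub>ell2 W\<^esub> f))"
    using no S W(1) unfolding gapped_tree_action_def gapped_tree_action_axioms_def by blast
   thus ?thesis using S(5) by (meson not_le)
  qed
  obtain \<mu> where mu: "mean W \<mu>" "!!g f. [|g \<in> carrier G; f \<in> bfun W|] ==> \<mu> (\<lambda>v. f (act g v)) = \<mu> f"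
   using T.invariant_mean[OF ai] by blast
  from assms(5) show False
  proof
   assume a: "\<not> amenable G (discrete_topology (carrier G)) \<and> (\<forall>v\<in>V. finite (stabilizer G \<phi> v))"
   have "finite {k \<in> carrier G. act k b = b}" if b: "b \<in> W" for b
   proof -
    have "{k \<in> carrier G. act k b = b} = stabilizer G \<phi> (d b)" using K b by (auto simp: stabilizer_def)
    thus ?thesis using a W(3) b by auto
   qed
   thus False using T.amenable_of_finite_stabilizers[OF mu] a by blast
  next
   assume a: "locally_finite_graph V E \<and> (let C = graph_aut_topology V E closure_of (\<phi> ` carrier G)
      in \<not> amenable (graph_aut V E\<lparr>carrier := C\<rparr>) (subtopology (graph_aut_topology V E) C))"
   have E: "E \<subseteq> V \<times> V" using assms(3) by (simp add: tree_graph_def simple_graph_def)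
   have "finite ((\<lambda>k. \<phi> k y) ` {k \<in> carrier G. act k b = b})" if b: "b \<in> W" and y: "y \<in> V" for b y
   proof -
    have dV: "d b \<in> V" using W(3) b by blast
    obtain n where n: "(d b, y) \<in> E ^^ n"
     using assms(3) dV y unfolding tree_graph_def graph_connected_def rtrancl_power by blast
    have step: "(\<phi> k u, \<phi> k w) \<in> E ^^ n" if "(u, w) \<in> E ^^ n" "k \<in> carrier G" for k u w n
     using that
    proof (induction n arbitrary: w)
     case (Suc n)
     then obtain x where x: "(u, x) \<in> E ^^ n" "(x, w) \<in> E" by auto
     have "\<phi> k \<in> carrier (graph_aut V E)" using assms(4) Suc.prems by (auto simp: hom_def)
     hence "(\<phi> k x, \<phi> k w) \<in> E" using x(2) E by (auto simp: graph_aut_def)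
     thus ?case using Suc.IH[OF x(1) Suc.prems(2)] by auto
    qed simp
    have "(\<lambda>k. \<phi> k y) ` {k \<in> carrier G. act k b = b} \<subseteq> {w. (d b, w) \<in> E ^^ n}"
     using step[OF n] K[OF _ b] by force
    thus ?thesis by (rule finite_subset[OF _ finite_sphere[OF conjunct1[OF a] E dV]])
   qed
   hence "amenable (graph_aut V E\<lparr>carrier := graph_aut_topology V E closure_of (\<phi> ` carrier G)\<rparr>)
     (subtopology (graph_aut_topology V E) (graph_aut_topology V E closure_of (\<phi> ` carrier G)))"
    using T.amenable_of_locally_finite[OF mu assms(4)] by blast
   thus False using a by (simp add: Let_def)
  qed
 qed
 then obtain S where S: "gapped_tree_action W F r G act S" by blast
 note S' = gapped_tree_action.S[OF S]
 obtain \<rho> where rho: "\<rho> < 1" "!!t. [|\<rho> < t; 0 < t; t < 1|] ==> \<exists>(H :: hilbert_univ) \<pi>.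
   traceable_rep G H \<pi> \<and> \<not> finite_dimensional H \<and> opnorm H (group_algebra_rep H \<pi> (lazy_walk G S)) = t"
  using gapped_tree_action_traceable_family[OF S] by blast
 define I where "I = {max \<rho> 0<..<1}"
 define P where "P t p \<longleftrightarrow> traceable_rep G (fst p) (snd p) \<and> \<not> finite_dimensional (fst p)
   \<and> opnorm (fst p) (group_algebra_rep (fst p) (snd p) (lazy_walk G S)) = t"
  for t and p :: "hilbert_univ \<times> ('g => (nat => complex) => (nat => complex))"
 have "\<forall>t\<in>I. \<exists>p. P t p"
 proof
  fix t assume "t \<in> I"
  then obtain H :: hilbert_univ and \<pi> where "P t (H, \<pi>)" using rho(2)[of t] by (auto simp: I_def P_def)
  thus "\<exists>p. P t p" ..
 qed
 from bchoice[OF this] obtain p where p: "\<forall>t\<in>I. P t (p t)" by blast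
 define H where "H t = fst (p t)" for t
 define \<pi> where "\<pi> t = snd (p t)" for t
 have H: "!!t. t \<in> I ==> traceable_rep G (H t) (\<pi> t)" "!!t. t \<in> I ==> \<not> finite_dimensional (H t)"
  "!!t. t \<in> I ==> opnorm (H t) (group_algebra_rep (H t) (\<pi> t) (lazy_walk G S)) = t"
  using p unfolding P_def H_def \<pi>_def by blast+
 have irr: "irreducible_rep G (H t) (\<pi> t)" if "t \<in> I" for t using H(1)[OF that] by (simp add: traceable_rep_def)
 have lw: "lazy_walk G S \<in> group_algebra G"
  by (rule group_algebraI[of "insert \<one>\<^bsub>G\<^esub> S"]) (use S' in \<open>auto simp: lazy_walk_def\<close>)
 have we: "\<not> weakly_equivalent G (H t) (\<pi> t) (H t') (\<pi> t')" if "t \<in> I" "t' \<in> I" "t' ~= t" for t t'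
  using not_weakly_equivalentI[OF assms(1) _ _ lw, of "H t" "\<pi> t" "H t'" "\<pi> t'"] irr[OF that(1)] irr[OF that(2)]
   H(3)[OF that(1)] H(3)[OF that(2)] that(3) by (simp add: irreducible_rep_def)
 have "uncountable I" using rho(1) by (simp add: I_def uncountable_open_interval)
 thus ?thesis using irr H(1,2) we by (intro exI[of _ I] exI[of _ H] exI[of _ \<pi>] conjI ballI impI) simp_all
qed

end
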